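(* Let $\mathbb{K}$ be a field of characteristic zero, $V$ a $\mathbb{K}$-vector space of finite dimension $n\ge2$, $\mathfrak{L}$ a Lie subalgebra of $\mathfrak{gl}_{\mathbb{K}}(V)$, and $\mathcal{K}$ a $\mathbb{Z}$-graded ideal of $\mathfrak{f}(V)$ with $\mathfrak{f}_{[\mu+1]}(V)\subseteq\mathcal{K}\subseteq\mathfrak{f}_{[2]}(V)$ for some integer $\mu\ge1$. Let $\mathfrak{m}=\mathfrak{m}(\mathcal{K})=\mathfrak{f}(V)/\mathcal{K}=\sum_{p=1}^{\mu}\mathfrak{g}_{-p}$, $\mathfrak{n}=\sum_{p\ge2}\mathfrak{g}_{-p}$, and let $\mathfrak{g}(\mathcal{K},\mathfrak{L})=\sum_{p\in\mathbb{Z}}\mathfrak{g}_p(\mathcal{K},\mathfrak{L})$ be the maximal effective prolongation of type $\mathfrak{L}$ of $\mathfrak{m}$. Set $$\mathfrak{a}=(\mathfrak{m}/\mathfrak{n})\oplus\sum_{p\ge0}\mathfrak{a}_p,\qquad \mathfrak{a}_p=\{\xi\in\mathfrak{g}_p(\mathcal{K},\mathfrak{L})\mid[\xi,\mathfrak{n}]=\{0\}\},$$ with the Lie algebra structure of the quotient $(\mathfrak{m}\oplus\sum_{p\ge0}\mathfrak{a}_p)/\mathfrak{n}$, and $$\mathfrak{a}_0(\mathcal{K},\mathfrak{L})=\{A\in\mathfrak{L}\mid T_A(\mathfrak{f}_{[2]}(V))\subseteq\mathcal{K}\}.$$ Then $\mathfrak{a}$ is the maximal effective prolongation of type $\mathfrak{a}_0(\mathcal{K},\mathfrak{L})$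 of the abelian Lie algebra $\mathfrak{m}(\mathfrak{f}_{[2]}(V))=\mathfrak{f}(V)/\mathfrak{f}_{[2]}(V)\simeq V$, and the following are equivalent: (i) $\mathfrak{g}(\mathcal{K},\mathfrak{L})$ is finite dimensional; (ii) $\mathfrak{g}(\mathfrak{f}_{[2]}(V),\mathfrak{a}_0(\mathcal{K},\mathfrak{L}))$, the maximal effective prolongation of type $\mathfrak{a}_0(\mathcal{K},\mathfrak{L})$ of the abelian Lie algebra $V$ (placed in degree $-1$), is finite dimensional.
   Context: $\mathfrak{f}(V)=\sum_{p\ge1}\mathfrak{f}_{-p}(V)$ is the free Lie $\mathbb{K}$-algebra generated by $V$, graded so that $\mathfrak{f}_{-1}(V)=V$; $\mathfrak{f}_{[q]}(V)=\sum_{p\ge q}\mathfrak{f}_{-p}(V)$. For $A\in\mathfrak{gl}_{\mathbb{K}}(V)$, $T_A$ is the unique degree-$0$ derivation of $\mathfrak{f}(V)$ extending $A$. A $\mathbb{Z}$-graded Lie algebra $\mathfrak{m}=\sum_{p\ge1}\mathfrak{g}_{-p}$ is fundamental (an FGLA) if $\mathfrak{g}_{-1}$ is finite dimensional and generates $\mathfrak{m}$. A $\mathbb{Z}$-graded Lie algebra $\mathfrak{g}=\sum_{p\in\mathbb{Z}}\mathfrak{g}_p$ is an effective prolongation of the FGLA $\mathfrak{m}$ if $\sum_{p<0}\mathfrak{g}_p=\mathfrak{m}$ and $\{X\in\sum_{p\ge0}\mathfrak{g}_p\mid[X,\mathfrak{g}_{-1}]=\{0\}\}=\{0\}$. It is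 of type $\mathfrak{L}\subseteq\mathfrak{gl}_{\mathbb{K}}(\mathfrak{g}_{-1})$ if for each $A\in\mathfrak{g}_0$ the map $v\mapsto[A,v]$ on $\mathfrak{g}_{-1}$ belongs to $\mathfrak{L}$. The maximal effective prolongation of type $\mathfrak{L}$ of $\mathfrak{m}$ is the one into which every effective prolongation of type $\mathfrak{L}$ of $\mathfrak{m}$ embeds by an injective graded Lie algebra homomorphism that is the identity on $\mathfrak{m}$; it exists and is unique up to isomorphism, and is denoted $\mathfrak{g}(\mathcal{K},\mathfrak{L})$ when $\mathfrak{m}=\mathfrak{m}(\mathcal{K})$. *)

theory Defs
  imports "HOL-Algebra.QuotRing" "Jordan_Normal_Form.Missing_VectorSpace"
begin

section \<open>Lie algebras\<close>

definition char_zero :: "('k, 'r) ring_scheme \<Rightarrow> bool" where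
  "char_zero K \<longleftrightarrow> (\<forall>n::nat. 0 < n \<longrightarrow> [n] \<cdot>\<^bsub>K\<^esub> \<one>\<^bsub>K\<^esub> \<noteq> \<zero>\<^bsub>K\<^esub>)"

text \<open>The Lie bracket is the multiplication of the underlying record; the component
  \<^const>\<open>one\<close> plays no role.\<close>

locale lie_algebra = vectorspace K L for K and L (structure) +
  assumes bracket_closed:
      "\<lbrakk>x \<in> carrier L; y \<in> carrier L\<rbrakk> \<Longrightarrow> x \<otimes> y \<in> carrier L"
    and bracket_add_left:
      "\<lbrakk>x \<in> carrier L; y \<in> carrier L; z \<in> carrier L\<rbrakk> \<Longrightarrow> (x \<oplus> y) \<otimes> z = x \<otimes> z \<oplus> y \<otimes> z"
    and bracket_add_right:
      "\<lbrakk>x \<in> carrier L; y \<in> carrier L; z \<in> carrier L\<rbrakk> \<Longrightarrow> x \<otimes> (y \<oplus> z) = x \<otimes> y \<oplus> x \<otimes> z"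
    and bracket_smult_left:
      "\<lbrakk>c \<in> carrier K; x \<in> carrier L; y \<in> carrier L\<rbrakk> \<Longrightarrow> (c \<odot> x) \<otimes> y = c \<odot> (x \<otimes> y)"
    and bracket_smult_right:
      "\<lbrakk>c \<in> carrier K; x \<in> carrier L; y \<in> carrier L\<rbrakk> \<Longrightarrow> x \<otimes> (c \<odot> y) = c \<odot> (x \<otimes> y)"
    and bracket_self: "x \<in> carrier L \<Longrightarrow> x \<otimes> x = \<zero>"
    and jacobi:
      "\<lbrakk>x \<in> carrier L; y \<in> carrier L; z \<in> carrier L\<rbrakk> \<Longrightarrow>
        x \<otimes> (y \<otimes> z) \<oplus> y \<otimes> (z \<otimes> x) \<oplus> z \<otimes> (x \<otimes> y) = \<zero>"

definition abelian_lie :: "('k, 'a, 's) module_scheme \<Rightarrow> bool" where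
  "abelian_lie L \<longleftrightarrow> (\<forall>x\<in>carrier L. \<forall>y\<in>carrier L. x \<otimes>\<^bsub>L\<^esub> y = \<zero>\<^bsub>L\<^esub>)"

definition lie_subalgebra ::
    "('k, 'r) ring_scheme \<Rightarrow> 'a set \<Rightarrow> ('k, 'a, 's) module_scheme \<Rightarrow> bool" where
  "lie_subalgebra K S L \<longleftrightarrow> subspace K S L \<and> (\<forall>x\<in>S. \<forall>y\<in>S. x \<otimes>\<^bsub>L\<^esub> y \<in> S)"

definition lie_ideal ::
    "('k, 'r) ring_scheme \<Rightarrow> 'a set \<Rightarrow> ('k, 'a, 's) module_scheme \<Rightarrow> bool" where
  "lie_ideal K I L \<longleftrightarrow> subspace K I L \<and> (\<forall>x\<in>carrier L. \<forall>y\<in>I. x \<otimes>\<^bsub>L\<^esub> y \<in> I)"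

definition lie_hom ::
    "('k, 'r) ring_scheme \<Rightarrow> ('k, 'a, 's) module_scheme \<Rightarrow> ('k, 'b, 't) module_scheme
      \<Rightarrow> ('a \<Rightarrow> 'b) set" where
  "lie_hom K L M = {\<phi> \<in> module_hom K L M.
     \<forall>x\<in>carrier L. \<forall>y\<in>carrier L. \<phi> (x \<otimes>\<^bsub>L\<^esub> y) = \<phi> x \<otimes>\<^bsub>M\<^esub> \<phi> y}"

definition lie_derivation ::
    "('k, 'r) ring_scheme \<Rightarrow> ('k, 'a, 's) module_scheme \<Rightarrow> ('a \<Rightarrow> 'a) \<Rightarrow> bool" where
  "lie_derivation K L D \<longleftrightarrow> D \<in> module_hom K L L \<and>
     (\<forall>x\<in>carrier L. \<forall>y\<in>carrier L. D (x \<otimes>\<^bsub>L\<^esub> y) = D x \<otimes>\<^bsub>L\<^esub> y \<oplus>\<^bsub>L\<^esub> x \<otimes>\<^bsub>L\<^esub> D y)"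

definition gl :: "('k, 'r) ring_scheme \<Rightarrow> ('k, 'v, 's) module_scheme \<Rightarrow> ('k, 'v \<Rightarrow> 'v) module" where
  "gl K V =
    \<lparr>carrier = module_hom K V V \<inter> extensional (carrier V),
     mult = (\<lambda>A B. \<lambda>v\<in>carrier V. A (B v) \<ominus>\<^bsub>V\<^esub> B (A v)),
     one = (\<lambda>v\<in>carrier V. v),
     zero = (\<lambda>v\<in>carrier V. \<zero>\<^bsub>V\<^esub>),
     add = (\<lambda>A B. \<lambda>v\<in>carrier V. A v \<oplus>\<^bsub>V\<^esub> B v),
     smult = (\<lambda>c A. \<lambda>v\<in>carrier V. c \<odot>\<^bsub>V\<^esub> A v)\<rparr>"

text \<open>The quotient by an ideal: \<^const>\<open>FactRing\<close> together with the induced scalar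
  multiplication.\<close>

definition lie_quot :: "('k, 'a, 's) module_scheme \<Rightarrow> 'a set \<Rightarrow> ('k, 'a set) module" where
  "lie_quot L I =
    \<lparr>carrier = a_rcosets\<^bsub>L\<^esub> I, mult = rcoset_mult L I, one = I +>\<^bsub>L\<^esub> \<one>\<^bsub>L\<^esub>,
     zero = I, add = set_add L, smult = (\<lambda>c X. \<Union>x\<in>X. I +>\<^bsub>L\<^esub> (c \<odot>\<^bsub>L\<^esub> x))\<rparr>"


section \<open>Gradings\<close>

definition graded_lie_algebra ::
    "('k, 'r) ring_scheme \<Rightarrow> ('k, 'a, 's) module_scheme \<Rightarrow> (int \<Rightarrow> 'a set) \<Rightarrow> bool" where
  "graded_lie_algebra K L G \<longleftrightarrow> lie_algebra K L \<and>
     (\<forall>p. subspace K (G p) L) \<and>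
     (\<forall>x\<in>carrier L. \<exists>!c. (\<forall>p. c p \<in> G p) \<and> finite {p. c p \<noteq> \<zero>\<^bsub>L\<^esub>} \<and>
        x = (\<Oplus>\<^bsub>L\<^esub>p\<in>{p. c p \<noteq> \<zero>\<^bsub>L\<^esub>}. c p)) \<and>
     (\<forall>p q. \<forall>x\<in>G p. \<forall>y\<in>G q. x \<otimes>\<^bsub>L\<^esub> y \<in> G (p + q))"

text \<open>The subspace \<open>\<Sum>\<^bsub>p\<in>P\<^esub> G p\<close>.\<close>

definition graded_sum ::
    "('k, 'a, 's) module_scheme \<Rightarrow> (int \<Rightarrow> 'a set) \<Rightarrow> int set \<Rightarrow> 'a set" where
  "graded_sum L G P = {\<Oplus>\<^bsub>L\<^esub>p\<in>F. c p | F c. finite F \<and> F \<subseteq> P \<and> (\<forall>p\<in>F. c p \<in> G p)}"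

definition graded_ideal ::
    "('k, 'r) ring_scheme \<Rightarrow> 'a set \<Rightarrow> ('k, 'a, 's) module_scheme \<Rightarrow> (int \<Rightarrow> 'a set) \<Rightarrow> bool" where
  "graded_ideal K I L G \<longleftrightarrow> lie_ideal K I L \<and> I = graded_sum L (\<lambda>p. I \<inter> G p) UNIV"

definition quot_grading ::
    "('k, 'a, 's) module_scheme \<Rightarrow> 'a set \<Rightarrow> (int \<Rightarrow> 'a set) \<Rightarrow> int \<Rightarrow> 'a set set" where
  "quot_grading L I G p = (\<lambda>x. I +>\<^bsub>L\<^esub> x) ` G p"

definition fgla ::
    "('k, 'r) ring_scheme \<Rightarrow> ('k, 'a, 's) module_scheme \<Rightarrow> (int \<Rightarrow> 'a set) \<Rightarrow> bool" where
  "fgla K m M \<longleftrightarrow> graded_lie_algebra K m M \<and> (\<forall>p\<ge>0. M p = {\<zero>\<^bsub>m\<^esub>}) \<and>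
     vectorspace.fin_dim K (m\<lparr>carrier := M (-1)\<rparr>) \<and>
     (\<forall>S. lie_subalgebra K S m \<and> M (-1) \<subseteq> S \<longrightarrow> S = carrier m)"


section \<open>Prolongations\<close>

text \<open>A prolongation \<open>g\<close> of \<open>m\<close> comes with the map \<open>\<iota>\<close> that identifies \<open>m\<close> with
  \<open>\<Sum>\<^bsub>p<0\<^esub> G p\<close>; types prevent \<open>m\<close> from being literally a subset of \<open>g\<close>.\<close>

definition effective_prolongation ::
    "('k, 'r) ring_scheme \<Rightarrow> ('k, 'm) module \<Rightarrow> (int \<Rightarrow> 'm set)
      \<Rightarrow> ('k, 'g) module \<Rightarrow> (int \<Rightarrow> 'g set) \<Rightarrow> ('m \<Rightarrow> 'g) \<Rightarrow> bool" where
  "effective_prolongation K m M g G \<iota> \<longleftrightarrow>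
     fgla K m M \<and> graded_lie_algebra K g G \<and>
     \<iota> \<in> lie_hom K m g \<and> inj_on \<iota> (carrier m) \<and> (\<forall>p<0. \<iota> ` M p = G p) \<and>
     {X \<in> graded_sum g G {0..}. \<forall>v\<in>G (-1). X \<otimes>\<^bsub>g\<^esub> v = \<zero>\<^bsub>g\<^esub>} = {\<zero>\<^bsub>g\<^esub>}"

text \<open>Here \<open>\<L>\<close> is a set of endomorphisms of \<open>M (-1)\<close>.\<close>

definition prolongation_of_type ::
    "('m \<Rightarrow> 'm) set \<Rightarrow> (int \<Rightarrow> 'm set) \<Rightarrow> ('k, 'g) module \<Rightarrow> (int \<Rightarrow> 'g set) \<Rightarrow> ('m \<Rightarrow> 'g) \<Rightarrow> bool" where
  "prolongation_of_type \<L> M g G \<iota> \<longleftrightarrow>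
     (\<forall>X\<in>G 0. \<exists>A\<in>\<L>. \<forall>v\<in>M (-1). X \<otimes>\<^bsub>g\<^esub> \<iota> v = \<iota> (A v))"

text \<open>Maximality is tested against the effective prolongations whose elements belong to a given
  type. For the type \<^typ>\<open>nat \<Rightarrow> 'k\<close>, where \<open>carrier K \<subseteq> (UNIV :: 'k set)\<close>, this is the same as
  maximality among all effective prolongations: if \<open>g\<close> is an effective prolongation then, for
  \<open>p \<ge> 0\<close>, bracketing with \<open>G (-1)\<close> embeds \<open>G p\<close> into \<open>Hom (G (-1), G (p - 1))\<close>, and \<open>m\<close> is
  finitely generated; so all \<open>G p\<close> are finite dimensional, \<open>g\<close> has countable dimension, and it is
  isomorphic to a Lie algebra whose elements are finitely supported sequences of scalars.\<close>

definition maximal_effective_prolongation ::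
    "'t itself \<Rightarrow> ('k, 'r) ring_scheme \<Rightarrow> ('k, 'm) module \<Rightarrow> (int \<Rightarrow> 'm set) \<Rightarrow> ('m \<Rightarrow> 'm) set
      \<Rightarrow> ('k, 'g) module \<Rightarrow> (int \<Rightarrow> 'g set) \<Rightarrow> ('m \<Rightarrow> 'g) \<Rightarrow> bool" where
  "maximal_effective_prolongation T K m M \<L> g G \<iota> \<longleftrightarrow>
     effective_prolongation K m M g G \<iota> \<and> prolongation_of_type \<L> M g G \<iota> \<and>
     (\<forall>(h :: ('k, 't) module) H \<kappa>.
        effective_prolongation K m M h H \<kappa> \<and> prolongation_of_type \<L> M h H \<kappa> \<longrightarrow>
        (\<exists>\<phi>\<in>lie_hom K h g. inj_on \<phi> (carrier h) \<and> (\<forall>p. \<phi> ` H p \<subseteq> G p) \<and>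
           (\<forall>x\<in>carrier m. \<phi> (\<kappa> x) = \<iota> x)))"


section \<open>The free Lie algebra on a vector space\<close>

text \<open>Formal Lie polynomials in the vectors of \<open>V\<close>, modulo the smallest congruence that enforces
  the laws of a Lie algebra and the linearity of \<^term>\<open>Gen\<close>.\<close>

datatype ('k, 'v) lie_term =
    Gen 'v
  | Zero
  | Plus "('k, 'v) lie_term" "('k, 'v) lie_term"
  | Scale 'k "('k, 'v) lie_term"
  | Br "('k, 'v) lie_term" "('k, 'v) lie_term"

inductive_set lie_terms ::
    "('k, 'r) ring_scheme \<Rightarrow> ('k, 'v, 's) module_scheme \<Rightarrow> ('k, 'v) lie_term set"
  for K and V where
  Gen: "v \<in> carrier V \<Longrightarrow> Gen v \<in> lie_terms K V"
| Zero: "Zero \<in> lie_terms K V"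
| Plus: "\<lbrakk>s \<in> lie_terms K V; t \<in> lie_terms K V\<rbrakk> \<Longrightarrow> Plus s t \<in> lie_terms K V"
| Scale: "\<lbrakk>c \<in> carrier K; t \<in> lie_terms K V\<rbrakk> \<Longrightarrow> Scale c t \<in> lie_terms K V"
| Br: "\<lbrakk>s \<in> lie_terms K V; t \<in> lie_terms K V\<rbrakk> \<Longrightarrow> Br s t \<in> lie_terms K V"

inductive lie_cong ::
    "('k, 'r) ring_scheme \<Rightarrow> ('k, 'v, 's) module_scheme
      \<Rightarrow> ('k, 'v) lie_term \<Rightarrow> ('k, 'v) lie_term \<Rightarrow> bool"
  for K and V where
  refl: "t \<in> lie_terms K V \<Longrightarrow> lie_cong K V t t"
| sym: "lie_cong K V s t \<Longrightarrow> lie_cong K V t s"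
| trans: "\<lbrakk>lie_cong K V s t; lie_cong K V t u\<rbrakk> \<Longrightarrow> lie_cong K V s u"
| Plus: "\<lbrakk>lie_cong K V s s'; lie_cong K V t t'\<rbrakk> \<Longrightarrow> lie_cong K V (Plus s t) (Plus s' t')"
| Scale: "\<lbrakk>c \<in> carrier K; lie_cong K V t t'\<rbrakk> \<Longrightarrow> lie_cong K V (Scale c t) (Scale c t')"
| Br: "\<lbrakk>lie_cong K V s s'; lie_cong K V t t'\<rbrakk> \<Longrightarrow> lie_cong K V (Br s t) (Br s' t')"
| add_assoc: "\<lbrakk>s \<in> lie_terms K V; t \<in> lie_terms K V; u \<in> lie_terms K V\<rbrakk> \<Longrightarrow>
    lie_cong K V (Plus (Plus s t) u) (Plus s (Plus t u))"
| add_commute: "\<lbrakk>s \<in> lie_terms K V; t \<in> lie_terms K V\<rbrakk> \<Longrightarrow>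
    lie_cong K V (Plus s t) (Plus t s)"
| add_zero: "t \<in> lie_terms K V \<Longrightarrow> lie_cong K V (Plus Zero t) t"
| add_minus: "t \<in> lie_terms K V \<Longrightarrow> lie_cong K V (Plus (Scale (\<ominus>\<^bsub>K\<^esub> \<one>\<^bsub>K\<^esub>) t) t) Zero"
| scale_add_left: "\<lbrakk>a \<in> carrier K; b \<in> carrier K; t \<in> lie_terms K V\<rbrakk> \<Longrightarrow>
    lie_cong K V (Scale (a \<oplus>\<^bsub>K\<^esub> b) t) (Plus (Scale a t) (Scale b t))"
| scale_add_right: "\<lbrakk>a \<in> carrier K; s \<in> lie_terms K V; t \<in> lie_terms K V\<rbrakk> \<Longrightarrow>
    lie_cong K V (Scale a (Plus s t)) (Plus (Scale a s) (Scale a t))"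
| scale_scale: "\<lbrakk>a \<in> carrier K; b \<in> carrier K; t \<in> lie_terms K V\<rbrakk> \<Longrightarrow>
    lie_cong K V (Scale (a \<otimes>\<^bsub>K\<^esub> b) t) (Scale a (Scale b t))"
| scale_one: "t \<in> lie_terms K V \<Longrightarrow> lie_cong K V (Scale \<one>\<^bsub>K\<^esub> t) t"
| br_add_left: "\<lbrakk>s \<in> lie_terms K V; t \<in> lie_terms K V; u \<in> lie_terms K V\<rbrakk> \<Longrightarrow>
    lie_cong K V (Br (Plus s t) u) (Plus (Br s u) (Br t u))"
| br_add_right: "\<lbrakk>s \<in> lie_terms K V; t \<in> lie_terms K V; u \<in> lie_terms K V\<rbrakk> \<Longrightarrow>
    lie_cong K V (Br s (Plus t u)) (Plus (Br s t) (Br s u))"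
| br_scale_left: "\<lbrakk>a \<in> carrier K; s \<in> lie_terms K V; t \<in> lie_terms K V\<rbrakk> \<Longrightarrow>
    lie_cong K V (Br (Scale a s) t) (Scale a (Br s t))"
| br_scale_right: "\<lbrakk>a \<in> carrier K; s \<in> lie_terms K V; t \<in> lie_terms K V\<rbrakk> \<Longrightarrow>
    lie_cong K V (Br s (Scale a t)) (Scale a (Br s t))"
| br_self: "t \<in> lie_terms K V \<Longrightarrow> lie_cong K V (Br t t) Zero"
| br_jacobi: "\<lbrakk>s \<in> lie_terms K V; t \<in> lie_terms K V; u \<in> lie_terms K V\<rbrakk> \<Longrightarrow>
    lie_cong K V (Plus (Plus (Br s (Br t u)) (Br t (Br u s))) (Br u (Br s t))) Zero"
| gen_add: "\<lbrakk>v \<in> carrier V; w \<in> carrier V\<rbrakk> \<Longrightarrow>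
    lie_cong K V (Gen (v \<oplus>\<^bsub>V\<^esub> w)) (Plus (Gen v) (Gen w))"
| gen_smult: "\<lbrakk>a \<in> carrier K; v \<in> carrier V\<rbrakk> \<Longrightarrow>
    lie_cong K V (Gen (a \<odot>\<^bsub>V\<^esub> v)) (Scale a (Gen v))"

definition lie_class ::
    "('k, 'r) ring_scheme \<Rightarrow> ('k, 'v, 's) module_scheme \<Rightarrow> ('k, 'v) lie_term
      \<Rightarrow> ('k, 'v) lie_term set" where
  "lie_class K V t = {s. lie_cong K V t s}"

definition free_lie ::
    "('k, 'r) ring_scheme \<Rightarrow> ('k, 'v, 's) module_scheme \<Rightarrow> ('k, ('k, 'v) lie_term set) module" where
  "free_lie K V =
    \<lparr>carrier = lie_class K V ` lie_terms K V,
     mult = (\<lambda>X Y. \<Union>s\<in>X. \<Union>t\<in>Y. lie_class K V (Br s t)),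
     one = lie_class K V Zero,
     zero = lie_class K V Zero,
     add = (\<lambda>X Y. \<Union>s\<in>X. \<Union>t\<in>Y. lie_class K V (Plus s t)),
     smult = (\<lambda>c X. \<Union>t\<in>X. lie_class K V (Scale c t))\<rparr>"

definition free_gen ::
    "('k, 'r) ring_scheme \<Rightarrow> ('k, 'v, 's) module_scheme \<Rightarrow> 'v \<Rightarrow> ('k, 'v) lie_term set" where
  "free_gen K V v = lie_class K V (Gen v)"

context vectorspace
begin

lemma lie_cong_terms: "lie_cong K V s t \<Longrightarrow> s \<in> lie_terms K V \<and> t \<in> lie_terms K V"
  by (induction rule: lie_cong.induct) (auto intro!: lie_terms.intros)

lemma lie_class_eq: "lie_cong K V s t \<Longrightarrow> lie_class K V s = lie_class K V t"
  unfolding lie_class_def by (auto intro: lie_cong.sym lie_cong.trans)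

lemma lie_class_eqD: "\<lbrakk>lie_class K V s = lie_class K V t; t \<in> lie_terms K V\<rbrakk> \<Longrightarrow> lie_cong K V s t"
  unfolding lie_class_def by (auto intro: lie_cong.refl)

lemma in_lie_class: "s \<in> lie_class K V t \<longleftrightarrow> lie_cong K V t s"
  unfolding lie_class_def by simp

lemma free_lie_mult:
  assumes "s \<in> lie_terms K V" "t \<in> lie_terms K V"
  shows "lie_class K V s \<otimes>\<^bsub>free_lie K V\<^esub> lie_class K V t = lie_class K V (Br s t)"
proof -
  have "lie_class K V (Br s' t') = lie_class K V (Br s t)"
    if "s' \<in> lie_class K V s" "t' \<in> lie_class K V t" for s' t'
    using that by (intro lie_class_eq[symmetric] lie_cong.Br) (simp_all add: in_lie_class)
  moreover have "s \<in> lie_class K V s" "t \<in> lie_class K V t"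
    using assms by (auto simp: in_lie_class intro: lie_cong.refl)
  ultimately show ?thesis unfolding free_lie_def monoid.simps ring.simps module.simps partial_object.simps by blast
qed

lemma free_lie_add:
  assumes "s \<in> lie_terms K V" "t \<in> lie_terms K V"
  shows "lie_class K V s \<oplus>\<^bsub>free_lie K V\<^esub> lie_class K V t = lie_class K V (Plus s t)"
proof -
  have "lie_class K V (Plus s' t') = lie_class K V (Plus s t)"
    if "s' \<in> lie_class K V s" "t' \<in> lie_class K V t" for s' t'
    using that by (intro lie_class_eq[symmetric] lie_cong.Plus) (simp_all add: in_lie_class)
  moreover have "s \<in> lie_class K V s" "t \<in> lie_class K V t"
    using assms by (auto simp: in_lie_class intro: lie_cong.refl)
  ultimately show ?thesis unfolding free_lie_def monoid.simps ring.simps module.simps partial_object.simps by blast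
qed

lemma free_lie_smult:
  assumes "c \<in> carrier K" "t \<in> lie_terms K V"
  shows "c \<odot>\<^bsub>free_lie K V\<^esub> lie_class K V t = lie_class K V (Scale c t)"
proof -
  have "lie_class K V (Scale c t') = lie_class K V (Scale c t)"
    if "t' \<in> lie_class K V t" for t'
    using that assms by (intro lie_class_eq[symmetric] lie_cong.Scale) (simp_all add: in_lie_class)
  moreover have "t \<in> lie_class K V t"
    using assms by (auto simp: in_lie_class intro: lie_cong.refl)
  ultimately show ?thesis unfolding free_lie_def monoid.simps ring.simps module.simps partial_object.simps by blast
qed

lemma free_lie_zero: "\<zero>\<^bsub>free_lie K V\<^esub> = lie_class K V Zero"
  by (simp add: free_lie_def)

lemma free_lie_carrier: "carrier (free_lie K V) = lie_class K V ` lie_terms K V"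
  by (simp add: free_lie_def)

lemmas free_lie_ops = free_lie_mult free_lie_add free_lie_smult free_lie_zero free_lie_carrier

lemma lie_algebra_free_lie: "lie_algebra K (free_lie K V)"
proof -
  note [simp] = free_lie_ops lie_terms.intros
  note eq = lie_class_eq
  note laws = lie_cong.scale_add_left lie_cong.scale_add_right lie_cong.scale_scale
    lie_cong.scale_one lie_cong.br_add_left lie_cong.br_add_right lie_cong.br_scale_left
    lie_cong.br_scale_right lie_cong.br_self lie_cong.br_jacobi
  have "abelian_group (free_lie K V)"
  proof (rule abelian_groupI, goal_cases)
    case (3 x y z) then show ?case by clarsimp (intro eq lie_cong.add_assoc)
  next
    case (4 x y) then show ?case by clarsimp (intro eq lie_cong.add_commute)
  next
    case (5 x) then show ?case by clarsimp (intro eq lie_cong.add_zero)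
  next
    case (6 x)
    then obtain t where t: "t \<in> lie_terms K V" "x = lie_class K V t" by auto
    show ?case
      using t by (intro bexI[of _ "lie_class K V (Scale (\<ominus>\<^bsub>K\<^esub> \<one>\<^bsub>K\<^esub>) t)"])
        (simp_all add: eq lie_cong.add_minus)
  qed auto
  then have "module K (free_lie K V)"
    by (intro moduleI R.is_cring; clarsimp?; (intro eq)?; (simp add: laws)?)
  then have "vectorspace K (free_lie K V)"
    by (intro vectorspace.intro field_axioms)
  then show ?thesis
    by (intro lie_algebra.intro lie_algebra_axioms.intro; clarsimp?; (intro eq)?;
        (simp add: laws)?)
qed

lemma free_gen_hom: "free_gen K V \<in> module_hom K V (free_lie K V)"
  by (simp add: module_hom_def free_gen_def free_lie_ops lie_terms.intros Pi_iff
      lie_class_eq[OF lie_cong.gen_add] lie_class_eq[OF lie_cong.gen_smult])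

end

text \<open>The universal property of the free Lie algebra.\<close>

primrec lie_eval :: "('k, 'a, 's) module_scheme \<Rightarrow> ('v \<Rightarrow> 'a) \<Rightarrow> ('k, 'v) lie_term \<Rightarrow> 'a" where
  "lie_eval L f (Gen v) = f v"
| "lie_eval L f Zero = \<zero>\<^bsub>L\<^esub>"
| "lie_eval L f (Plus s t) = lie_eval L f s \<oplus>\<^bsub>L\<^esub> lie_eval L f t"
| "lie_eval L f (Scale c t) = c \<odot>\<^bsub>L\<^esub> lie_eval L f t"
| "lie_eval L f (Br s t) = lie_eval L f s \<otimes>\<^bsub>L\<^esub> lie_eval L f t"

theorem free_lie_universal:
  assumes V: "vectorspace K V" and L: "lie_algebra K L" and f: "f \<in> module_hom K V L"
  shows "\<exists>!\<phi>. \<phi> \<in> lie_hom K (free_lie K V) L \<inter> extensional (carrier (free_lie K V)) \<and>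
    (\<forall>v\<in>carrier V. \<phi> (free_gen K V v) = f v)"
proof -
  interpret V: vectorspace K V by fact
  interpret L: lie_algebra K L by fact
  note ops = V.free_lie_ops
  let ?F = "free_lie K V" and ?e = "lie_eval L f"
  have closed: "?e t \<in> carrier L" if "t \<in> lie_terms K V" for t
    using that f by (induction) (auto simp: module_hom_def L.bracket_closed)
  have cong: "?e s = ?e t" if "lie_cong K V s t" for s t
    using that
  proof induction
    case (add_minus t) then show ?case
      by (simp add: closed L.smult_minus_1 L.l_neg)
  next
    case (add_assoc s t u) then show ?case by (simp add: closed L.a_assoc)
  next
    case (add_commute s t) then show ?case by (simp add: closed L.a_comm)
  next
    case (br_jacobi s t u) then show ?case by (simp add: closed L.jacobi)
  next
    case (gen_add v w) then show ?case using f by (simp add: module_hom_add)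
  next
    case (gen_smult a v) then show ?case using f by (simp add: module_hom_smult)
  qed (simp_all add: closed L.smult_l_distr L.smult_r_distr L.smult_assoc1
      L.bracket_add_left L.bracket_add_right L.bracket_smult_left L.bracket_smult_right
      L.bracket_self)
  define \<psi> where "\<psi> = (\<lambda>X\<in>carrier ?F. ?e (SOME t. t \<in> X))"
  have \<psi>: "\<psi> (lie_class K V t) = ?e t" if t: "t \<in> lie_terms K V" for t
  proof -
    have "t \<in> lie_class K V t" using t by (simp add: V.in_lie_class lie_cong.refl)
    then have "(SOME s. s \<in> lie_class K V t) \<in> lie_class K V t" by (rule someI)
    then have "?e t = ?e (SOME s. s \<in> lie_class K V t)" by (intro cong) (simp add: V.in_lie_class)
    then show ?thesis using t by (simp add: \<psi>_def ops)
  qed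
  show ?thesis
  proof (rule ex1I[of _ \<psi>], goal_cases)
    case 1
    have "\<psi> \<in> lie_hom K ?F L"
      by (auto simp: lie_hom_def module_hom_def ops \<psi> closed lie_terms.intros)
    moreover have "\<psi> \<in> extensional (carrier ?F)" by (simp add: \<psi>_def)
    ultimately show ?case by (simp add: free_gen_def \<psi> lie_terms.intros)
  next
    case (2 \<phi>)
    then have hom: "\<phi> \<in> lie_hom K ?F L" and gen: "\<And>v. v \<in> carrier V \<Longrightarrow> \<phi> (free_gen K V v) = f v"
      and ext: "\<phi> \<in> extensional (carrier ?F)" by auto
    interpret F: lie_algebra K ?F by (rule V.lie_algebra_free_lie)
    have add: "\<phi> (X \<oplus>\<^bsub>?F\<^esub> Y) = \<phi> X \<oplus>\<^bsub>L\<^esub> \<phi> Y" if "X \<in> carrier ?F" "Y \<in> carrier ?F" for X Y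
      using hom that by (auto simp: lie_hom_def module_hom_def)
    have smult: "\<phi> (c \<odot>\<^bsub>?F\<^esub> X) = c \<odot>\<^bsub>L\<^esub> \<phi> X" if "c \<in> carrier K" "X \<in> carrier ?F" for c X
      using hom that by (auto simp: lie_hom_def module_hom_def)
    have mult: "\<phi> (X \<otimes>\<^bsub>?F\<^esub> Y) = \<phi> X \<otimes>\<^bsub>L\<^esub> \<phi> Y" if "X \<in> carrier ?F" "Y \<in> carrier ?F" for X Y
      using hom that by (auto simp: lie_hom_def)
    have ran: "\<phi> X \<in> carrier L" if "X \<in> carrier ?F" for X
      using hom that by (auto simp: lie_hom_def module_hom_def)
    have zero: "\<phi> \<zero>\<^bsub>?F\<^esub> = \<zero>\<^bsub>L\<^esub>"
      using smult[of "\<zero>\<^bsub>K\<^esub>" "\<zero>\<^bsub>?F\<^esub>"] ran[of "\<zero>\<^bsub>?F\<^esub>"] by simp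
    have "\<phi> (lie_class K V t) = ?e t" if "t \<in> lie_terms K V" for t
      using that
    proof induction
      case (Gen v) then show ?case using gen by (simp add: free_gen_def)
    next
      case Zero then show ?case using zero by (simp add: ops)
    next
      case (Plus s t)
      then show ?case using add[of "lie_class K V s" "lie_class K V t"] by (simp add: ops)
    next
      case (Scale c t)
      then show ?case using smult[of c "lie_class K V t"] by (simp add: ops)
    next
      case (Br s t)
      then show ?case using mult[of "lie_class K V s" "lie_class K V t"] by (simp add: ops)
    qed
    moreover have "\<psi> \<in> extensional (carrier ?F)" by (simp add: \<psi>_def)
    ultimately show ?case
      by (intro extensionalityI[OF ext, of \<psi>]) (auto simp: ops \<psi>)
  qed
qed

text \<open>\<^const>\<open>Zero\<close> is homogeneous of every degree, and only elements congruent to it arise in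
  degrees \<open>p \<ge> 0\<close>.\<close>

inductive homogeneous :: "int \<Rightarrow> ('k, 'v) lie_term \<Rightarrow> bool" where
  Gen: "homogeneous (-1) (Gen v)"
| Zero: "homogeneous p Zero"
| Plus: "\<lbrakk>homogeneous p s; homogeneous p t\<rbrakk> \<Longrightarrow> homogeneous p (Plus s t)"
| Scale: "homogeneous p t \<Longrightarrow> homogeneous p (Scale c t)"
| Br: "\<lbrakk>homogeneous p s; homogeneous q t\<rbrakk> \<Longrightarrow> homogeneous (p + q) (Br s t)"

definition free_lie_deg ::
    "('k, 'r) ring_scheme \<Rightarrow> ('k, 'v, 's) module_scheme \<Rightarrow> int \<Rightarrow> ('k, 'v) lie_term set set" where
  "free_lie_deg K V p = lie_class K V ` {t \<in> lie_terms K V. homogeneous p t}"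

text \<open>\<open>\<Sum>\<^bsub>p\<ge>q\<^esub> \<ff>\<^bsub>-p\<^esub>(V)\<close>\<close>

definition free_lie_from ::
    "('k, 'r) ring_scheme \<Rightarrow> ('k, 'v, 's) module_scheme \<Rightarrow> int \<Rightarrow> ('k, 'v) lie_term set set" where
  "free_lie_from K V q = graded_sum (free_lie K V) (free_lie_deg K V) {..- q}"

text \<open>The derivation \<open>T\<^sub>A\<close>; the value outside the carrier is fixed to make it unique.\<close>

definition free_derivation ::
    "('k, 'r) ring_scheme \<Rightarrow> ('k, 'v, 's) module_scheme \<Rightarrow> ('v \<Rightarrow> 'v)
      \<Rightarrow> ('k, 'v) lie_term set \<Rightarrow> ('k, 'v) lie_term set" where
  "free_derivation K V A = (THE D. D \<in> extensional (carrier (free_lie K V)) \<and>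
     lie_derivation K (free_lie K V) D \<and>
     (\<forall>p. D ` free_lie_deg K V p \<subseteq> free_lie_deg K V p) \<and>
     (\<forall>v\<in>carrier V. D (free_gen K V v) = free_gen K V (A v)))"


section \<open>The quotients \<open>\<mm>(\<K>)\<close> and the algebra \<open>\<aa>\<close>\<close>

abbreviation quot_lie ::
    "('k, 'r) ring_scheme \<Rightarrow> ('k, 'v, 's) module_scheme \<Rightarrow> ('k, 'v) lie_term set set
      \<Rightarrow> ('k, ('k, 'v) lie_term set set) module" where
  "quot_lie K V \<K> \<equiv> lie_quot (free_lie K V) \<K>"

abbreviation quot_lie_deg ::
    "('k, 'r) ring_scheme \<Rightarrow> ('k, 'v, 's) module_scheme \<Rightarrow> ('k, 'v) lie_term set set
      \<Rightarrow> int \<Rightarrow> ('k, 'v) lie_term set set set" where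
  "quot_lie_deg K V \<K> \<equiv> quot_grading (free_lie K V) \<K> (free_lie_deg K V)"

text \<open>The identification of \<open>V\<close> with the component of degree \<open>-1\<close> of \<open>\<mm>(\<K>)\<close>, and the induced
  identification of subsets of \<open>\<gg>\<ll>(V)\<close> with subsets of \<open>\<gg>\<ll>(\<gg>\<^bsub>-1\<^esub>)\<close>.\<close>

definition quot_gen ::
    "('k, 'r) ring_scheme \<Rightarrow> ('k, 'v, 's) module_scheme \<Rightarrow> ('k, 'v) lie_term set set
      \<Rightarrow> 'v \<Rightarrow> ('k, 'v) lie_term set set" where
  "quot_gen K V \<K> v = \<K> +>\<^bsub>free_lie K V\<^esub> free_gen K V v"

definition transport_gl ::
    "('k, 'v, 's) module_scheme \<Rightarrow> ('v \<Rightarrow> 'm) \<Rightarrow> ('v \<Rightarrow> 'v) set \<Rightarrow> ('m \<Rightarrow> 'm) set" where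
  "transport_gl V e \<L> =
     {B \<in> extensional (e ` carrier V). \<exists>A\<in>\<L>. \<forall>v\<in>carrier V. B (e v) = e (A v)}"

text \<open>Up to the choice of the representative, \<open>(g, G, \<iota>)\<close> is \<open>\<gg>(\<K>, \<L>)\<close>.\<close>

definition is_prolongation ::
    "'t itself \<Rightarrow> ('k, 'r) ring_scheme \<Rightarrow> ('k, 'v, 's) module_scheme
      \<Rightarrow> ('k, 'v) lie_term set set \<Rightarrow> ('v \<Rightarrow> 'v) set
      \<Rightarrow> ('k, 'g) module \<Rightarrow> (int \<Rightarrow> 'g set) \<Rightarrow> (('k, 'v) lie_term set set \<Rightarrow> 'g) \<Rightarrow> bool" where
  "is_prolongation T K V \<K> \<L> g G \<iota> \<longleftrightarrow>
     maximal_effective_prolongation T K (quot_lie K V \<K>) (quot_lie_deg K V \<K>)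
       (transport_gl V (quot_gen K V \<K>) \<L>) g G \<iota>"

definition a0 ::
    "('k, 'r) ring_scheme \<Rightarrow> ('k, 'v, 's) module_scheme \<Rightarrow> ('k, 'v) lie_term set set
      \<Rightarrow> ('v \<Rightarrow> 'v) set \<Rightarrow> ('v \<Rightarrow> 'v) set" where
  "a0 K V \<K> \<L> = {A \<in> \<L>. free_derivation K V A ` free_lie_from K V 2 \<subseteq> \<K>}"

definition n_part :: "('k, 'g) module \<Rightarrow> (int \<Rightarrow> 'g set) \<Rightarrow> 'g set" where
  "n_part g G = graded_sum g G {..-2}"

text \<open>The homogeneous components of \<open>\<mm> \<oplus> \<Sum>\<^bsub>p\<ge>0\<^esub> \<aa>\<^sub>p\<close> as a subspace of \<open>g\<close>.\<close>

definition pre_a_deg :: "('k, 'g) module \<Rightarrow> (int \<Rightarrow> 'g set) \<Rightarrow> int \<Rightarrow> 'g set" where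
  "pre_a_deg g G p =
     (if p < 0 then G p else {\<xi> \<in> G p. \<forall>y\<in>n_part g G. \<xi> \<otimes>\<^bsub>g\<^esub> y = \<zero>\<^bsub>g\<^esub>})"

definition pre_a :: "('k, 'g) module \<Rightarrow> (int \<Rightarrow> 'g set) \<Rightarrow> ('k, 'g) module" where
  "pre_a g G = g\<lparr>carrier := graded_sum g (pre_a_deg g G) UNIV\<rparr>"

definition a_lie :: "('k, 'g) module \<Rightarrow> (int \<Rightarrow> 'g set) \<Rightarrow> ('k, 'g set) module" where
  "a_lie g G = lie_quot (pre_a g G) (n_part g G)"

definition a_deg :: "('k, 'g) module \<Rightarrow> (int \<Rightarrow> 'g set) \<Rightarrow> int \<Rightarrow> 'g set set" where
  "a_deg g G = quot_grading (pre_a g G) (n_part g G) (pre_a_deg g G)"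

text \<open>The canonical map \<open>\<ff>(V)/\<ff>\<^bsub>[2]\<^esub>(V) \<rightarrow> \<mm>/\<nn> \<subseteq> \<aa>\<close>, sending the class of \<open>x\<close> to the class of
  \<open>\<iota> (x + \<K>)\<close>. All the cosets in the union coincide.\<close>

definition a_incl ::
    "('k, 'r) ring_scheme \<Rightarrow> ('k, 'v, 's) module_scheme \<Rightarrow> ('k, 'v) lie_term set set
      \<Rightarrow> ('k, 'g) module \<Rightarrow> (int \<Rightarrow> 'g set) \<Rightarrow> (('k, 'v) lie_term set set \<Rightarrow> 'g)
      \<Rightarrow> ('k, 'v) lie_term set set \<Rightarrow> 'g set" where
  "a_incl K V \<K> g G \<iota> X =
     (\<Union>x\<in>X. n_part g G +>\<^bsub>pre_a g G\<^esub> \<iota> (\<K> +>\<^bsub>free_lie K V\<^esub> x))"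

end

(*
  An element A of degree 0 that annihilates n acts on m_{-1} as a derivation of m that vanishes on n;
  these are exactly the A in L with T_A(f_[2]) contained in K.  Conversely, if h is a prolongation of
  the abelian algebra V of type a_0, then n + h, with the elements of h of degree >= 0 acting trivially
  on n, is an effective prolongation of m of type L, so it embeds in g, and h embeds in a.

  For the finite dimensionality, suppose that a_p = 0 for large p.  Let C_r be the annihilator in g of
  all elements of degree < -r; in degree p >= 0, C_1 is a_p, and C_mu = g.  Passing from
  C_{r-1} to C_r, drop the conditions [x, z] = 0 one by one, for the finitely many brackets z = [v, y]
  that span degree -r.  On the space W obtained by dropping the condition for z, the operator Z = ad z
  is injective in large degrees and commutes with X = ad v and Y = ad y, and Z = YX - XY.  The
  dimensions of W_p are then periodic for large p, so Z is invertible there, and the traces of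
  Z^{-1} Y X on the W_p show that a sum of dimensions is zero in K.  In characteristic zero, W_p = 0.
*)
theory Submission
  imports Defs "HOL-Library.Countable"
begin

section \<open>Linear algebra of subspaces inside a fixed carrier\<close>

section \<open>Subspaces and homomorphisms\<close>

text \<open>The hard direction is (ii) to (i): after a condition [x, z] = 0 is dropped, nothing
  bounds the degrees of W directly. What remains is that Z is injective in large degrees, because a
  kernel element satisfies the dropped condition again. A map that lowers the degree by s + 1 and is
  injective makes dimensions non-increasing along residue classes, which is where periodicity comes
  from. With Z invertible, Z^{-1} Y X = 1 + Z^{-1} X Y, a graded form of the fact that the identity
  is not a commutator in characteristic zero: the two traces belong to different degrees, so they do
  not cancel at once but only after running through s periods of length s + 1.

  Two further obstacles shape the text. Degree -1 is abelian in h but not in m, so n + h is no Lie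
  algebra until the brackets of m are put back by a correction term, and its Jacobi identity then
  uses the defining condition of a_0. And maximality is tested only on one type of elements, so
  prolongations have to be shown small enough to be transported into it.\<close>

context vectorspace
begin

lemma subspaceI:
  assumes "W \<subseteq> carrier V" "\<zero>\<^bsub>V\<^esub> \<in> W"
    and "\<And>x y. \<lbrakk>x \<in> W; y \<in> W\<rbrakk> \<Longrightarrow> x \<oplus>\<^bsub>V\<^esub> y \<in> W"
    and "\<And>c x. \<lbrakk>c \<in> carrier K; x \<in> W\<rbrakk> \<Longrightarrow> c \<odot>\<^bsub>V\<^esub> x \<in> W"
  shows "subspace K W V"
  by (intro subspace.intro submodule.intro vectorspace_axioms module_axioms) (use assms in auto)

lemma subspace_carrier: "\<lbrakk>subspace K W V; x \<in> W\<rbrakk> \<Longrightarrow> x \<in> carrier V"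
  by (auto simp: subspace_def submodule_def)

lemma subspace_zero: "subspace K W V \<Longrightarrow> \<zero>\<^bsub>V\<^esub> \<in> W"
  by (auto simp: subspace_def submodule_def)

lemma subspace_add: "\<lbrakk>subspace K W V; x \<in> W; y \<in> W\<rbrakk> \<Longrightarrow> x \<oplus>\<^bsub>V\<^esub> y \<in> W"
  by (auto simp: subspace_def submodule_def)

lemma subspace_smult: "\<lbrakk>subspace K W V; c \<in> carrier K; x \<in> W\<rbrakk> \<Longrightarrow> c \<odot>\<^bsub>V\<^esub> x \<in> W"
  by (auto simp: subspace_def submodule_def)

lemma subspace_neg: "\<lbrakk>subspace K W V; x \<in> W\<rbrakk> \<Longrightarrow> \<ominus>\<^bsub>V\<^esub> x \<in> W"
  using subspace_smult[of W "\<ominus>\<^bsub>K\<^esub> \<one>\<^bsub>K\<^esub>" x] by (simp add: smult_minus_1 subspace_carrier)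

lemma subspace_minus: "\<lbrakk>subspace K W V; x \<in> W; y \<in> W\<rbrakk> \<Longrightarrow> x \<ominus>\<^bsub>V\<^esub> y \<in> W"
  by (simp add: a_minus_def subspace_add subspace_neg)

lemma subspace_finsum:
  "\<lbrakk>subspace K W V; \<And>i. i \<in> A \<Longrightarrow> f i \<in> W\<rbrakk> \<Longrightarrow> (\<Oplus>\<^bsub>V\<^esub>i\<in>A. f i) \<in> W"
proof (induction A rule: infinite_finite_induct)
  case (infinite A) then show ?case by (simp add: subspace_zero M.finsum_infinite)
next
  case empty then show ?case by (simp add: subspace_zero)
next
  case (insert a A)
  then have "f a \<in> carrier V" "f \<in> A \<rightarrow> carrier V" by (auto intro: subspace_carrier)
  then show ?case using insert by (simp add: M.finsum_insert subspace_add)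
qed

lemma minus_zero_vector [simp]: "\<ominus>\<^bsub>V\<^esub> \<zero>\<^bsub>V\<^esub> = \<zero>\<^bsub>V\<^esub>"
  by (rule M.minus_equality) simp_all

lemma subspace_zero_singleton: "subspace K {\<zero>\<^bsub>V\<^esub>} V"
  by (rule subspaceI) auto

lemma subspace_carrier_self: "subspace K (carrier V) V"
  by (rule subspaceI) auto

lemmas v_zero_closed = M.zero_closed
lemmas v_finsum_insert = M.finsum_insert
lemmas v_finsum_infinite = M.finsum_infinite

end

lemma linear_mapI: "\<lbrakk>vectorspace K L; vectorspace K N; f \<in> module_hom K L N\<rbrakk> \<Longrightarrow> linear_map K L N f"
  by (simp add: linear_map_def mod_hom_def mod_hom_axioms_def vectorspace_def)

context linear_map
begin

lemma map_finsum: "c \<in> A \<rightarrow> carrier V \<Longrightarrow> T (\<Oplus>\<^bsub>V\<^esub>i\<in>A. c i) = (\<Oplus>\<^bsub>W\<^esub>i\<in>A. T (c i))"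
proof (induction A rule: infinite_finite_induct)
  case (insert a A)
  then have "c \<in> A \<rightarrow> carrier V" "c a \<in> carrier V" by auto
  then show ?case using insert
    by (simp add: V.v_finsum_insert W.v_finsum_insert Pi_iff)
qed (simp_all add: V.v_finsum_infinite W.v_finsum_infinite)

lemma inj_on_iff: "inj_on T (carrier V) \<longleftrightarrow> (\<forall>x\<in>carrier V. T x = \<zero>\<^bsub>W\<^esub> \<longrightarrow> x = \<zero>\<^bsub>V\<^esub>)"
proof
  assume "inj_on T (carrier V)"
  then show "\<forall>x\<in>carrier V. T x = \<zero>\<^bsub>W\<^esub> \<longrightarrow> x = \<zero>\<^bsub>V\<^esub>"
    by (metis V.v_zero_closed T0_is_0 inj_onD)
next
  assume *: "\<forall>x\<in>carrier V. T x = \<zero>\<^bsub>W\<^esub> \<longrightarrow> x = \<zero>\<^bsub>V\<^esub>"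
  show "inj_on T (carrier V)"
  proof (rule inj_onI)
    fix x y assume xy: "x \<in> carrier V" "y \<in> carrier V" "T x = T y"
    then have "T (x \<ominus>\<^bsub>V\<^esub> y) = \<zero>\<^bsub>W\<^esub>" by (simp add: T_minus T_im)
    then have "x \<ominus>\<^bsub>V\<^esub> y = \<zero>\<^bsub>V\<^esub>" using * xy by simp
    then show "x = y" using xy by simp
  qed
qed

lemma image_subspace: "subspace K S V \<Longrightarrow> subspace K (T ` S) W"
proof (rule W.subspaceI, goal_cases)
  case 1 then show ?case by (auto simp: V.subspace_carrier T_im)
next
  case 2 then show ?case using V.subspace_zero[of S] T0_is_0 by (metis imageI)
next
  case (3 x y)
  then obtain a b where "a \<in> S" "b \<in> S" "x = T a" "y = T b" by auto
  then have "x \<oplus>\<^bsub>W\<^esub> y = T (a \<oplus>\<^bsub>V\<^esub> b)" "a \<oplus>\<^bsub>V\<^esub> b \<in> S"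
    using 3 V.subspace_carrier V.subspace_add by (auto simp: T_add)
  then show ?case by simp
next
  case (4 c x)
  then obtain a where "a \<in> S" "x = T a" by auto
  then have "c \<odot>\<^bsub>W\<^esub> x = T (c \<odot>\<^bsub>V\<^esub> a)" "c \<odot>\<^bsub>V\<^esub> a \<in> S"
    using 4 V.subspace_carrier V.subspace_smult by (auto simp: T_smult)
  then show ?case by simp
qed

lemma vimage_subspace: "subspace K S W \<Longrightarrow> subspace K {x \<in> carrier V. T x \<in> S} V"
  by (rule V.subspaceI) (auto simp: W.subspace_zero W.subspace_add W.subspace_smult)

end

section \<open>Brackets, and transfer of the axioms along a surjection\<close>

section \<open>Lie algebras and their homomorphic images\<close>

context lie_algebra
begin

lemmas vs = vectorspace_axioms

lemma zero_bracket [simp]: "x \<in> carrier L \<Longrightarrow> \<zero> \<otimes> x = \<zero>"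
  using bracket_smult_left[of "\<zero>\<^bsub>K\<^esub>" "\<zero>" x] by (simp add: bracket_closed)

lemma bracket_zero [simp]: "x \<in> carrier L \<Longrightarrow> x \<otimes> \<zero> = \<zero>"
  using bracket_smult_right[of "\<zero>\<^bsub>K\<^esub>" x "\<zero>"] by (simp add: bracket_closed)

lemma bracket_neg_left: "\<lbrakk>x \<in> carrier L; y \<in> carrier L\<rbrakk> \<Longrightarrow> (\<ominus> x) \<otimes> y = \<ominus> (x \<otimes> y)"
  using bracket_smult_left[of "\<ominus>\<^bsub>K\<^esub> \<one>\<^bsub>K\<^esub>" x y] by (simp add: smult_minus_1 bracket_closed)

lemma bracket_neg_right: "\<lbrakk>x \<in> carrier L; y \<in> carrier L\<rbrakk> \<Longrightarrow> x \<otimes> (\<ominus> y) = \<ominus> (x \<otimes> y)"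
  using bracket_smult_right[of "\<ominus>\<^bsub>K\<^esub> \<one>\<^bsub>K\<^esub>" x y] by (simp add: smult_minus_1 bracket_closed)

lemma bracket_antisym:
  assumes "x \<in> carrier L" "y \<in> carrier L" shows "x \<otimes> y = \<ominus> (y \<otimes> x)"
proof -
  have "(x \<oplus> y) \<otimes> (x \<oplus> y) = \<zero>" using assms by (simp add: bracket_self)
  moreover have "(x \<oplus> y) \<otimes> (x \<oplus> y) = x \<otimes> y \<oplus> y \<otimes> x"
    using assms
    by (simp add: bracket_add_left bracket_add_right bracket_closed bracket_self[of x]
        bracket_self[of y] M.a_comm)
  ultimately have "x \<otimes> y \<oplus> y \<otimes> x = \<zero>" by simp
  then show ?thesis using assms by (metis bracket_closed M.minus_equality)
qed

lemma jacobi_left: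
  assumes "x \<in> carrier L" "y \<in> carrier L" "z \<in> carrier L"
  shows "x \<otimes> (y \<otimes> z) = (x \<otimes> y) \<otimes> z \<oplus> y \<otimes> (x \<otimes> z)"
proof -
  let ?a = "x \<otimes> (y \<otimes> z)" and ?b = "y \<otimes> (z \<otimes> x)" and ?c = "z \<otimes> (x \<otimes> y)"
  have c: "?a \<in> carrier L" "?b \<in> carrier L" "?c \<in> carrier L" using assms by (auto intro: bracket_closed)
  have "?a \<oplus> (?b \<oplus> ?c) = \<zero>" using jacobi[OF assms] c by (simp add: M.a_assoc)
  then have "?a = \<ominus> (?b \<oplus> ?c)" using c by (metis M.minus_equality M.add.m_comm M.a_closed M.minus_minus)
  then have a: "?a = (\<ominus> ?b) \<oplus> (\<ominus> ?c)" using c by (simp add: M.minus_add)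
  have "y \<otimes> (x \<otimes> z) = \<ominus> ?b" 
    using assms by (simp add: bracket_antisym[of x z] bracket_neg_right bracket_closed)
  moreover have "(x \<otimes> y) \<otimes> z = \<ominus> ?c" using assms by (intro bracket_antisym bracket_closed)
  ultimately show ?thesis using a c by (simp add: M.a_comm)
qed

text \<open>Bracketing with z on the right is a derivation as well. The annihilator argument acts by
  right brackets, which is why this form is wanted.\<close>

lemma jacobi_right:
  assumes "x \<in> carrier L" "y \<in> carrier L" "z \<in> carrier L"
  shows "(x \<otimes> y) \<otimes> z = (x \<otimes> z) \<otimes> y \<oplus> x \<otimes> (y \<otimes> z)"
proof -
  have c: "x \<otimes> (y \<otimes> z) \<in> carrier L" "(x \<otimes> y) \<otimes> z \<in> carrier L" "y \<otimes> (x \<otimes> z) \<in> carrier L"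
    using assms by (auto intro: bracket_closed)
  have "(x \<otimes> z) \<otimes> y = \<ominus> (y \<otimes> (x \<otimes> z))" using assms by (intro bracket_antisym bracket_closed)
  moreover have "\<ominus> b \<oplus> (a \<oplus> b) = a" if "a \<in> carrier L" "b \<in> carrier L" for a b
    using that by (simp add: M.a_comm[of a b] M.r_neg1)
  ultimately show ?thesis using jacobi_left[OF assms] c by simp
qed

lemma subalgebra:
  assumes S: "subspace K S L" and br: "\<And>x y. \<lbrakk>x \<in> S; y \<in> S\<rbrakk> \<Longrightarrow> x \<otimes> y \<in> S"
  shows "lie_algebra K (L\<lparr>carrier := S\<rparr>)"
proof -
  interpret S: vectorspace K "L\<lparr>carrier := S\<rparr>" by (rule subspace_is_vs[OF S])
  note c = subspace_carrier[OF S]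
  show ?thesis
    by (unfold_locales)
      (simp_all add: br c bracket_add_left bracket_add_right bracket_smult_left
         bracket_smult_right bracket_self jacobi)
qed

end

text \<open>Of \<open>N\<close> only a map onto its carrier that respects the operations is known;
  all laws are pulled back along \<open>f\<close>. Quotients by ideals and transport along an
  injection are both instances.\<close>

locale lie_surjection = lie_algebra K L
  for K :: "('k, 'r) ring_scheme" and L :: "('k, 'a, 's) module_scheme" (structure) +
  fixes N :: "('k, 'b, 't) module_scheme" and f :: "'a \<Rightarrow> 'b"
  assumes onto: "f ` carrier L = carrier N"
    and map_zero: "f \<zero> = \<zero>\<^bsub>N\<^esub>"
    and map_add: "\<lbrakk>x \<in> carrier L; y \<in> carrier L\<rbrakk> \<Longrightarrow> f (x \<oplus> y) = f x \<oplus>\<^bsub>N\<^esub> f y"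
    and map_smult: "\<lbrakk>c \<in> carrier K; x \<in> carrier L\<rbrakk> \<Longrightarrow> f (c \<odot> x) = c \<odot>\<^bsub>N\<^esub> f x"
    and map_mult: "\<lbrakk>x \<in> carrier L; y \<in> carrier L\<rbrakk> \<Longrightarrow> f (x \<otimes> y) = f x \<otimes>\<^bsub>N\<^esub> f y"
begin

lemma image_closed: "x \<in> carrier L \<Longrightarrow> f x \<in> carrier N"
  using onto by auto

lemma image_cases: assumes "z \<in> carrier N" obtains x where "x \<in> carrier L" "z = f x"
  using assms onto by auto

lemmas map_rev = map_zero[symmetric] map_add[symmetric] map_smult[symmetric] map_mult[symmetric]

lemma lie_algebra_image: "lie_algebra K N"
proof -
  have "abelian_group N"
  proof (rule abelian_groupI, goal_cases)
    case (1 x y) then show ?case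
      by (elim image_cases) (simp add: map_rev image_closed)
  next
    case 2 then show ?case by (simp add: map_rev image_closed)
  next
    case (3 x y z) then show ?case
      by (elim image_cases) (simp add: map_rev M.a_assoc)
  next
    case (4 x y) then show ?case
      by (elim image_cases) (simp add: map_rev M.a_comm)
  next
    case (5 x) then show ?case
      by (elim image_cases) (simp add: map_rev)
  next
    case (6 x)
    then obtain y where y: "y \<in> carrier L" "x = f y" by (elim image_cases)
    then have "f (\<ominus> y) \<oplus>\<^bsub>N\<^esub> x = \<zero>\<^bsub>N\<^esub>" by (simp add: map_rev M.l_neg)
    then show ?case using y by (auto intro: image_closed)
  qed
  then have "module K N"
  proof (intro moduleI R.is_cring, goal_cases)
    case 1 then show ?case .
  next
    case (2 a x) then show ?case by (elim image_cases) (simp add: map_rev image_closed)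
  next
    case (3 a b x) then show ?case by (elim image_cases) (simp add: map_rev smult_l_distr)
  next
    case (4 a x y) then show ?case by (elim image_cases) (simp add: map_rev smult_r_distr)
  next
    case (5 a b x) then show ?case by (elim image_cases) (simp add: map_rev smult_assoc1)
  next
    case (6 x) then show ?case by (elim image_cases) (simp add: map_rev)
  qed
  then have "vectorspace K N" by (intro vectorspace.intro field_axioms)
  then show ?thesis
  proof (intro lie_algebra.intro lie_algebra_axioms.intro, goal_cases)
    case 1 then show ?case .
  next
    case (2 x y) then show ?case by (elim image_cases) (simp add: map_rev image_closed bracket_closed)
  next
    case (3 x y z) then show ?case
      by (elim image_cases) (simp add: map_rev bracket_closed bracket_add_left)
  next
    case (4 x y z) then show ?case
      by (elim image_cases) (simp add: map_rev bracket_closed bracket_add_right)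
  next
    case (5 c x y) then show ?case
      by (elim image_cases) (simp add: map_rev bracket_closed bracket_smult_left)
  next
    case (6 c x y) then show ?case
      by (elim image_cases) (simp add: map_rev bracket_closed bracket_smult_right)
  next
    case (7 x) then show ?case by (elim image_cases) (simp add: map_rev bracket_self)
  next
    case (8 x y z) then show ?case
      by (elim image_cases) (simp add: map_rev bracket_closed jacobi)
  qed
qed

lemma hom: "f \<in> lie_hom K L N"
  by (auto simp: lie_hom_def module_hom_def image_closed map_add map_smult map_mult)

sublocale N: lie_algebra K N by (rule lie_algebra_image)

sublocale map: linear_map K L N f
  by (rule linear_mapI) (use hom in \<open>auto simp: lie_hom_def vectorspace_axioms N.vectorspace_axioms\<close>)

end

section \<open>Gradings, components and graded images\<close>

section \<open>Graded Lie algebras\<close>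

locale graded_lie = lie_algebra K L
  for K :: "('k, 'r) ring_scheme" and L :: "('k, 'a, 's) module_scheme" (structure) +
  fixes G :: "int \<Rightarrow> 'a set"
  assumes graded: "graded_lie_algebra K L G"
begin

definition component where
  "component p x = (THE c. (\<forall>p. c p \<in> G p) \<and> finite {p. c p \<noteq> \<zero>} \<and>
     x = (\<Oplus>p\<in>{p. c p \<noteq> \<zero>}. c p)) p"

lemma G_subspace: "subspace K (G p) L"
  using graded by (auto simp: graded_lie_algebra_def)

lemma G_closed: "x \<in> G p \<Longrightarrow> x \<in> carrier L"
  by (rule subspace_carrier[OF G_subspace])

lemma G_zero [simp]: "\<zero> \<in> G p"
  by (rule subspace_zero[OF G_subspace])

lemma G_bracket: "\<lbrakk>x \<in> G p; y \<in> G q; r = p + q\<rbrakk> \<Longrightarrow> x \<otimes> y \<in> G r"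
  using graded by (auto simp: graded_lie_algebra_def)

lemma component_ex1:
  "x \<in> carrier L \<Longrightarrow> \<exists>!c. (\<forall>p. c p \<in> G p) \<and> finite {p. c p \<noteq> \<zero>} \<and> x = (\<Oplus>p\<in>{p. c p \<noteq> \<zero>}. c p)"
  using graded by (auto simp: graded_lie_algebra_def)

lemma component_spec:
  assumes "x \<in> carrier L"
  shows component_in: "component p x \<in> G p"
    and component_finite: "finite {p. component p x \<noteq> \<zero>}"
    and component_sum: "x = (\<Oplus>p\<in>{p. component p x \<noteq> \<zero>}. component p x)"
  using theI'[OF component_ex1[OF assms]] unfolding component_def by auto

lemma component_closed [simp]: "x \<in> carrier L \<Longrightarrow> component p x \<in> carrier L"
  using G_closed component_in by blast

text \<open>Uniqueness of the decomposition in the form that is applied: zero terms are allowed in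
  \<open>F\<close>, and \<open>c\<close> is constrained only on \<open>F\<close>. Linearity of
  components follows by comparing sums over a common index set.\<close>

lemma component_eqI:
  assumes F: "finite F" and c: "\<And>p. p \<in> F \<Longrightarrow> c p \<in> G p" and x: "x = (\<Oplus>p\<in>F. c p)"
  shows "component p x = (if p \<in> F then c p else \<zero>)"
proof -
  let ?d = "\<lambda>p. if p \<in> F then c p else \<zero>"
  have cL: "c \<in> F \<rightarrow> carrier L" using c G_closed by blast
  then have xL: "x \<in> carrier L" unfolding x by (rule M.finsum_closed)
  have sub: "{p. ?d p \<noteq> \<zero>} \<subseteq> F" by auto
  have "(\<Oplus>p\<in>{p. ?d p \<noteq> \<zero>}. ?d p) = (\<Oplus>p\<in>F. c p)"
    by (rule M.add.finprod_mono_neutral_cong_left[OF F sub]) (use cL in \<open>auto split: if_splits\<close>)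
  then have "(\<forall>p. ?d p \<in> G p) \<and> finite {p. ?d p \<noteq> \<zero>} \<and> x = (\<Oplus>p\<in>{p. ?d p \<noteq> \<zero>}. ?d p)"
    using x c sub F by (simp add: finite_subset)
  from the1_equality[OF component_ex1[OF xL], of ?d] this show ?thesis unfolding component_def by simp
qed

lemma component_sum':
  assumes x: "x \<in> carrier L" and F: "finite F" "{p. component p x \<noteq> \<zero>} \<subseteq> F"
  shows "x = (\<Oplus>p\<in>F. component p x)"
proof -
  have "(\<Oplus>p\<in>{p. component p x \<noteq> \<zero>}. component p x) = (\<Oplus>p\<in>F. component p x)"
    by (rule M.add.finprod_mono_neutral_cong_left[OF F]) (use x in auto)
  then show ?thesis using component_sum[OF x] by simp
qed

lemma component_same: "x \<in> G p \<Longrightarrow> component p x = x"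
  using component_eqI[of "{p}" "\<lambda>_. x" x p] by (simp add: G_closed)

lemma component_other: "\<lbrakk>x \<in> G q; p \<noteq> q\<rbrakk> \<Longrightarrow> component p x = \<zero>"
  using component_eqI[of "{q}" "\<lambda>_. x" x p] by (simp add: G_closed)

lemma component_zero [simp]: "component p \<zero> = \<zero>"
  by (rule component_same) simp

lemma component_add:
  assumes "x \<in> carrier L" "y \<in> carrier L"
  shows "component p (x \<oplus> y) = component p x \<oplus> component p y"
proof -
  let ?F = "{p. component p x \<noteq> \<zero>} \<union> {p. component p y \<noteq> \<zero>}"
  have F: "finite ?F" using assms by (simp add: component_finite)
  have "x \<oplus> y = (\<Oplus>p\<in>?F. component p x) \<oplus> (\<Oplus>p\<in>?F. component p y)"
    using component_sum'[OF assms(1) F] component_sum'[OF assms(2) F] by auto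
  also have "\<dots> = (\<Oplus>p\<in>?F. component p x \<oplus> component p y)"
    by (rule M.finsum_addf[symmetric]) (use assms in auto)
  finally have "component p (x \<oplus> y) = (if p \<in> ?F then component p x \<oplus> component p y else \<zero>)"
    by (intro component_eqI F) (auto intro: subspace_add[OF G_subspace] component_in assms)
  then show ?thesis by auto
qed

lemma component_smult:
  assumes "c \<in> carrier K" "x \<in> carrier L"
  shows "component p (c \<odot> x) = c \<odot> component p x"
proof -
  let ?F = "{p. component p x \<noteq> \<zero>}"
  have F: "finite ?F" using assms by (simp add: component_finite)
  have "c \<odot> x = c \<odot> (\<Oplus>p\<in>?F. component p x)"
    using component_sum[OF assms(2)] by simp
  also have "\<dots> = (\<Oplus>p\<in>?F. c \<odot> component p x)"
    by (rule finsum_smult) (use assms in auto)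
  finally have "component p (c \<odot> x) = (if p \<in> ?F then c \<odot> component p x else \<zero>)"
    by (intro component_eqI F) (auto intro: subspace_smult[OF G_subspace] component_in assms)
  then show ?thesis using assms by auto
qed

lemma component_neg: "x \<in> carrier L \<Longrightarrow> component p (\<ominus> x) = \<ominus> component p x"
  using component_smult[of "\<ominus>\<^bsub>K\<^esub> \<one>\<^bsub>K\<^esub>" x p] by (simp add: smult_minus_1)

lemma component_minus:
  "\<lbrakk>x \<in> carrier L; y \<in> carrier L\<rbrakk> \<Longrightarrow> component p (x \<ominus> y) = component p x \<ominus> component p y"
  by (simp add: a_minus_def component_add component_neg)

lemma eq_zero_if_components: "\<lbrakk>x \<in> carrier L; \<And>p. component p x = \<zero>\<rbrakk> \<Longrightarrow> x = \<zero>"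
  using component_sum[of x] by simp

lemma graded_induct [consumes 1, case_names homogeneous add]:
  assumes x: "x \<in> carrier L"
    and hom: "\<And>p x. x \<in> G p \<Longrightarrow> P x"
    and add: "\<And>x y. \<lbrakk>x \<in> carrier L; y \<in> carrier L; P x; P y\<rbrakk> \<Longrightarrow> P (x \<oplus> y)"
  shows "P x"
proof -
  have "P (\<Oplus>p\<in>F. component p x)" if "finite F" for F
    using that
  proof induction
    case empty then show ?case using hom[OF G_zero] by simp
  next
    case (insert p F)
    then show ?case using x by (simp add: M.finsum_insert Pi_iff add hom[OF component_in] M.finsum_closed)
  qed
  from this[OF component_finite[OF x]] show ?thesis using component_sum[OF x] by simp
qed

lemma mem_graded_sum_iff:
  assumes H: "\<And>p. p \<in> P \<Longrightarrow> H p \<subseteq> G p" and z: "\<And>p. p \<in> P \<Longrightarrow> \<zero> \<in> H p"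
  shows "x \<in> graded_sum L H P \<longleftrightarrow>
    x \<in> carrier L \<and> (\<forall>p\<in>P. component p x \<in> H p) \<and> (\<forall>p. p \<notin> P \<longrightarrow> component p x = \<zero>)"
proof
  assume "x \<in> graded_sum L H P"
  then obtain F c where F: "finite F" "F \<subseteq> P" "\<And>p. p \<in> F \<Longrightarrow> c p \<in> H p" "x = (\<Oplus>p\<in>F. c p)"
    by (auto simp: graded_sum_def)
  then have "component p x = (if p \<in> F then c p else \<zero>)" for p
    using H by (intro component_eqI) auto
  moreover have "x \<in> carrier L"
    unfolding F(4) by (rule M.finsum_closed) (use F H G_closed in blast)
  ultimately show "x \<in> carrier L \<and> (\<forall>p\<in>P. component p x \<in> H p) \<and> (\<forall>p. p \<notin> P \<longrightarrow> component p x = \<zero>)"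
    using F z by auto
next
  assume x: "x \<in> carrier L \<and> (\<forall>p\<in>P. component p x \<in> H p) \<and> (\<forall>p. p \<notin> P \<longrightarrow> component p x = \<zero>)"
  then have "finite {p. component p x \<noteq> \<zero>}" "{p. component p x \<noteq> \<zero>} \<subseteq> P"
    "\<forall>p\<in>{p. component p x \<noteq> \<zero>}. component p x \<in> H p" "x = (\<Oplus>p\<in>{p. component p x \<noteq> \<zero>}. component p x)"
    by (auto intro: component_finite component_sum)
  then show "x \<in> graded_sum L H P" unfolding graded_sum_def by blast
qed

lemma graded_sum_iff:
  "x \<in> graded_sum L G P \<longleftrightarrow> x \<in> carrier L \<and> (\<forall>p. p \<notin> P \<longrightarrow> component p x = \<zero>)"
  by (subst mem_graded_sum_iff) (auto intro: component_in)

lemma G_subset_graded_sum: "p \<in> P \<Longrightarrow> G p \<subseteq> graded_sum L G P"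
  by (metis component_other G_closed graded_sum_iff subsetI)

lemma subspace_graded_sum: "subspace K (graded_sum L G P) L"
  by (rule subspaceI) (auto simp: graded_sum_iff component_add component_smult)

end

text \<open>Additive projections \<open>cp p\<close> stand in for existence and uniqueness of
  decompositions. They read off the terms of any decomposition, whence uniqueness; and an element
  differs from the sum of its projections by something that every projection kills, whence
  existence.\<close>

lemma graded_lie_algebraI:
  fixes cp :: "int \<Rightarrow> 'a \<Rightarrow> 'a"
  assumes L: "lie_algebra K L"
    and sub: "\<And>p. subspace K (G p) L"
    and br: "\<And>p q x y. \<lbrakk>x \<in> G p; y \<in> G q\<rbrakk> \<Longrightarrow> x \<otimes>\<^bsub>L\<^esub> y \<in> G (p + q)"
    and cp: "\<And>p x. x \<in> carrier L \<Longrightarrow> cp p x \<in> G p"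
    and finite_supp: "\<And>x. x \<in> carrier L \<Longrightarrow> finite {p. cp p x \<noteq> \<zero>\<^bsub>L\<^esub>}"
    and add: "\<And>p x y. \<lbrakk>x \<in> carrier L; y \<in> carrier L\<rbrakk> \<Longrightarrow> cp p (x \<oplus>\<^bsub>L\<^esub> y) = cp p x \<oplus>\<^bsub>L\<^esub> cp p y"
    and same: "\<And>p x. x \<in> G p \<Longrightarrow> cp p x = x"
    and other: "\<And>p q x. \<lbrakk>x \<in> G q; p \<noteq> q\<rbrakk> \<Longrightarrow> cp p x = \<zero>\<^bsub>L\<^esub>"
    and sep: "\<And>x. \<lbrakk>x \<in> carrier L; \<And>p. cp p x = \<zero>\<^bsub>L\<^esub>\<rbrakk> \<Longrightarrow> x = \<zero>\<^bsub>L\<^esub>"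
  shows "graded_lie_algebra K L G"
proof -
  interpret lie_algebra K L by fact
  have Gc: "x \<in> carrier L" if "x \<in> G p" for x p by (rule subspace_carrier[OF sub that])
  have cpc: "cp p x \<in> carrier L" if "x \<in> carrier L" for p x using cp[OF that] Gc by blast
  have cp0: "cp p \<zero>\<^bsub>L\<^esub> = \<zero>\<^bsub>L\<^esub>" for p by (rule same) (rule subspace_zero[OF sub])
  have cp_sum: "cp q (\<Oplus>\<^bsub>L\<^esub>p\<in>F. c p) = (if q \<in> F then c q else \<zero>\<^bsub>L\<^esub>)"
    if "finite F" "\<forall>p. c p \<in> G p" for F c q
    using that
  proof (induction F)
    case empty then show ?case by (simp add: cp0)
  next
    case (insert p F)
    have "c \<in> F \<rightarrow> carrier L" "c p \<in> carrier L" "c q \<in> carrier L" using insert.prems Gc by auto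
    moreover have "cp q (c p) = (if q = p then c p else \<zero>\<^bsub>L\<^esub>)"
      using insert.prems by (auto intro: same other)
    ultimately show ?case using insert by (auto simp: M.finsum_insert add M.finsum_closed)
  qed
  have cp_minus: "cp p (x \<ominus>\<^bsub>L\<^esub> y) = \<zero>\<^bsub>L\<^esub>"
    if "x \<in> carrier L" "y \<in> carrier L" "cp p x = cp p y" for p x y
  proof -
    have "cp p (x \<ominus>\<^bsub>L\<^esub> y) \<oplus>\<^bsub>L\<^esub> cp p y = cp p y"
      using that add[of "x \<ominus>\<^bsub>L\<^esub> y" y p] by (simp add: a_minus_def M.a_assoc M.l_neg)
    then show ?thesis using that cpc by simp
  qed
  have "\<exists>!c. (\<forall>p. c p \<in> G p) \<and> finite {p. c p \<noteq> \<zero>\<^bsub>L\<^esub>} \<and> x = (\<Oplus>\<^bsub>L\<^esub>p\<in>{p. c p \<noteq> \<zero>\<^bsub>L\<^esub>}. c p)"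
    if x: "x \<in> carrier L" for x
  proof (rule ex1I[of _ "\<lambda>p. cp p x"], goal_cases)
    case 1
    let ?y = "\<Oplus>\<^bsub>L\<^esub>p\<in>{p. cp p x \<noteq> \<zero>\<^bsub>L\<^esub>}. cp p x"
    have y: "?y \<in> carrier L" using cpc x by (intro M.finsum_closed) auto
    have "x \<ominus>\<^bsub>L\<^esub> ?y = \<zero>\<^bsub>L\<^esub>"
      by (rule sep) (use x y cp finite_supp in \<open>auto intro!: cp_minus simp: cp_sum\<close>)
    then have "x = ?y" using x y by simp
    then show ?case using cp finite_supp x by simp
  next
    case (2 c)
    have "cp q x = (if q \<in> {p. c p \<noteq> \<zero>\<^bsub>L\<^esub>} then c q else \<zero>\<^bsub>L\<^esub>)" for q
      using cp_sum[of "{p. c p \<noteq> \<zero>\<^bsub>L\<^esub>}" c q] 2 by simp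
    then show ?case by (auto simp: fun_eq_iff)
  qed
  then show ?thesis using L sub br by (auto simp: graded_lie_algebra_def)
qed

lemma graded_lieI: "graded_lie_algebra K L G \<Longrightarrow> graded_lie K L G"
  by (simp add: graded_lie_def graded_lie_axioms_def graded_lie_algebra_def)

text \<open>An image inherits a grading when the kernel is a graded subspace;
  \<open>ker_graded\<close> says this through components.\<close>

locale graded_lie_surjection = graded_lie K L G + lie_surjection K L N f
  for K :: "('k, 'r) ring_scheme" and L :: "('k, 'a, 's) module_scheme" (structure)
    and G and N :: "('k, 'b, 't) module_scheme" and f +
  assumes ker_graded: "\<lbrakk>x \<in> carrier L; f x = \<zero>\<^bsub>N\<^esub>\<rbrakk> \<Longrightarrow> f (component p x) = \<zero>\<^bsub>N\<^esub>"
begin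

definition image_component where "image_component p z = f (component p (inv_into (carrier L) f z))"

text \<open>The preimage picked in the definition does not matter: two preimages differ by a kernel
  element, whose components stay in the kernel.\<close>

lemma image_component:
  assumes "x \<in> carrier L" shows "image_component p (f x) = f (component p x)"
proof -
  let ?y = "inv_into (carrier L) f (f x)"
  have y: "?y \<in> carrier L" "f ?y = f x" using assms by (auto intro: inv_into_into f_inv_into_f)
  then have "f (?y \<ominus> x) = \<zero>\<^bsub>N\<^esub>" using assms by (simp add: map.T_minus image_closed)
  then have "f (component p (?y \<ominus> x)) = \<zero>\<^bsub>N\<^esub>" using assms y by (intro ker_graded) auto
  then have "f (component p ?y) \<ominus>\<^bsub>N\<^esub> f (component p x) = \<zero>\<^bsub>N\<^esub>"
    using assms y by (simp add: component_minus map.T_minus)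
  then show ?thesis using assms y by (simp add: image_component_def image_closed)
qed

lemma graded_image: "graded_lie_algebra K N (\<lambda>p. f ` G p)"
proof (rule graded_lie_algebraI[where cp = image_component], goal_cases)
  case 1 then show ?case by (rule lie_algebra_image)
next
  case (2 p) then show ?case by (rule map.image_subspace[OF G_subspace])
next
  case (3 p q x y) then show ?case
    by (auto simp: map_mult[symmetric] G_closed intro: G_bracket)
next
  case (4 p x) then show ?case by (elim image_cases) (auto simp: image_component component_in)
next
  case (5 x)
  then obtain y where y: "y \<in> carrier L" "x = f y" by (elim image_cases)
  then have "{p. image_component p x \<noteq> \<zero>\<^bsub>N\<^esub>} \<subseteq> {p. component p y \<noteq> \<zero>}"
    by (auto simp: image_component map_zero)
  then show ?case using component_finite[OF y(1)] finite_subset by blast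
next
  case (6 p x y)
  then obtain a b where ab: "a \<in> carrier L" "b \<in> carrier L" "x = f a" "y = f b"
    by (elim image_cases) blast
  then have "image_component p (f (a \<oplus> b)) = f (component p a) \<oplus>\<^bsub>N\<^esub> f (component p b)"
    by (subst image_component) (simp_all add: component_add map_add)
  then show ?case using ab by (simp add: image_component map_add)
next
  case (7 p x) then show ?case by (auto simp: image_component G_closed component_same)
next
  case (8 p q x) then show ?case by (auto simp: image_component G_closed component_other map_zero)
next
  case (9 x)
  then obtain y where y: "y \<in> carrier L" "x = f y" by (elim image_cases)
  then have "f (component p y) = \<zero>\<^bsub>N\<^esub>" for p using 9 by (simp add: image_component)
  then have "f (\<Oplus>p\<in>{p. component p y \<noteq> \<zero>}. component p y) = \<zero>\<^bsub>N\<^esub>"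
    using y by (subst map.map_finsum) (auto intro: N.M.finsum_all0)
  then show ?case using component_sum[OF y(1)] y by simp
qed

end

section \<open>Quotients by ideals\<close>

context lie_algebra
begin

text \<open>Scalar multiples and brackets of cosets are unions over representatives, so the point is
  that all cosets in such a union coincide. Once the coset map is a \<open>lie_surjection\<close>,
  the laws of the quotient come for free.\<close>

lemma lie_quot_surjection:
  assumes I: "lie_ideal K I L"
  shows "lie_surjection K L (lie_quot L I) (\<lambda>x. I +> x)"
    and coset_eq_iff: "\<And>x y. \<lbrakk>x \<in> carrier L; y \<in> carrier L\<rbrakk> \<Longrightarrow> I +> x = I +> y \<longleftrightarrow> x \<ominus> y \<in> I"
    and mem_coset_iff: "\<And>x y. \<lbrakk>x \<in> carrier L; y \<in> carrier L\<rbrakk> \<Longrightarrow> y \<in> I +> x \<longleftrightarrow> y \<ominus> x \<in> I"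
    and coset_subset: "\<And>x. x \<in> carrier L \<Longrightarrow> I +> x \<subseteq> carrier L"
proof -
  have sub: "subspace K I L" and br: "\<And>x y. \<lbrakk>x \<in> carrier L; y \<in> I\<rbrakk> \<Longrightarrow> x \<otimes> y \<in> I"
    using I by (auto simp: lie_ideal_def)
  note Ic = subspace_carrier[OF sub]
  have br': "y \<otimes> x \<in> I" if "x \<in> carrier L" "y \<in> I" for x y
    using bracket_antisym[of y x] br[OF that] that Ic subspace_neg[OF sub] by metis
  have coset: "I +> x = {i \<oplus> x | i. i \<in> I}" for x by (auto simp: a_r_coset_def')
  show mem: "y \<in> I +> x \<longleftrightarrow> y \<ominus> x \<in> I" if "x \<in> carrier L" "y \<in> carrier L" for x y
  proof
    assume "y \<in> I +> x"
    then obtain i where "i \<in> I" "y = i \<oplus> x" by (auto simp: coset)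
    then show "y \<ominus> x \<in> I" using that Ic by (simp add: a_minus_def M.a_assoc M.r_neg)
  next
    assume "y \<ominus> x \<in> I"
    moreover have "y = (y \<ominus> x) \<oplus> x" using that by (simp add: a_minus_def M.a_assoc M.l_neg)
    ultimately show "y \<in> I +> x" unfolding coset by blast
  qed
  show subs: "I +> x \<subseteq> carrier L" if "x \<in> carrier L" for x using that Ic by (auto simp: coset)
  have self: "x \<in> I +> x" if "x \<in> carrier L" for x
    using mem[OF that that] that by (simp add: a_minus_def M.r_neg subspace_zero[OF sub])
  have sw: "y \<ominus> x \<in> I" if "x \<ominus> y \<in> I" "x \<in> carrier L" "y \<in> carrier L" for x y
    using subspace_neg[OF sub that(1)] that by (simp add: a_minus_def M.minus_add M.a_comm)
  have tr: "x \<ominus> z \<in> I" if "x \<ominus> y \<in> I" "y \<ominus> z \<in> I" "x \<in> carrier L" "y \<in> carrier L" "z \<in> carrier L" for x y z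
  proof -
    have "x \<ominus> z = (x \<ominus> y) \<oplus> (y \<ominus> z)"
      using that by (simp add: a_minus_def M.a_assoc M.r_neg1)
    then show ?thesis using subspace_add[OF sub] that by simp
  qed
  show eq: "I +> x = I +> y \<longleftrightarrow> x \<ominus> y \<in> I" if "x \<in> carrier L" "y \<in> carrier L" for x y
  proof
    assume "I +> x = I +> y" then show "x \<ominus> y \<in> I" using self that mem by blast
  next
    assume *: "x \<ominus> y \<in> I"
    have "z \<in> I +> x \<longleftrightarrow> z \<in> I +> y" if z: "z \<in> carrier L" for z
      unfolding mem[OF \<open>x \<in> carrier L\<close> z] mem[OF \<open>y \<in> carrier L\<close> z]
      using tr[OF _ * z \<open>x \<in> carrier L\<close> \<open>y \<in> carrier L\<close>] tr[OF _ sw[OF *] z \<open>y \<in> carrier L\<close>] \<open>x \<in> carrier L\<close>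
        \<open>y \<in> carrier L\<close> by blast
    then show "I +> x = I +> y" using subs that by blast
  qed
  have UN: "(\<Union>a\<in>I +> x. \<Union>b\<in>I +> y. I +> h a b) = I +> h x y"
    if "x \<in> carrier L" "y \<in> carrier L"
      "\<And>a b. \<lbrakk>a \<in> I +> x; b \<in> I +> y\<rbrakk> \<Longrightarrow> I +> h a b = I +> h x y" for x y h
    using self that by blast
  let ?Q = "lie_quot L I"
  have add: "(I +> x) \<oplus>\<^bsub>?Q\<^esub> (I +> y) = I +> (x \<oplus> y)" if "x \<in> carrier L" "y \<in> carrier L" for x y
  proof -
    have "(I +> x) \<oplus>\<^bsub>?Q\<^esub> (I +> y) = {a \<oplus> b | a b. a \<in> I +> x \<and> b \<in> I +> y}"
      by (auto simp: lie_quot_def set_add_def')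
    also have "\<dots> = I +> (x \<oplus> y)"
    proof (intro subset_antisym subsetI)
      fix z assume "z \<in> {a \<oplus> b | a b. a \<in> I +> x \<and> b \<in> I +> y}"
      then obtain i j where ij: "i \<in> I" "j \<in> I" "z = (i \<oplus> x) \<oplus> (j \<oplus> y)" by (auto simp: coset)
      then have "z = (i \<oplus> j) \<oplus> (x \<oplus> y)" using that Ic by (simp add: M.a_ac)
      then show "z \<in> I +> (x \<oplus> y)" using ij subspace_add[OF sub] unfolding coset by blast
    next
      fix z assume "z \<in> I +> (x \<oplus> y)"
      then obtain i where "i \<in> I" "z = i \<oplus> (x \<oplus> y)" by (auto simp: coset)
      then have "z = (i \<oplus> x) \<oplus> y" "i \<oplus> x \<in> I +> x" using that Ic by (auto simp: M.a_assoc coset)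
      then show "z \<in> {a \<oplus> b | a b. a \<in> I +> x \<and> b \<in> I +> y}" using self[OF that(2)] by blast
    qed
    finally show ?thesis .
  qed
  show "lie_surjection K L ?Q (\<lambda>x. I +> x)"
  proof (unfold_locales, goal_cases)
    case 1 then show ?case by (auto simp: lie_quot_def A_RCOSETS_def')
  next
    case 2
    have "I +> \<zero> = I" unfolding coset using Ic by force
    then show ?case by (simp add: lie_quot_def)
  next
    case (3 x y) then show ?case by (rule add[symmetric])
  next
    case (4 c x)
    have "(\<Union>a\<in>I +> x. I +> (c \<odot> a)) = I +> (c \<odot> x)"
    proof -
      have "I +> (c \<odot> a) = I +> (c \<odot> x)" if "a \<in> I +> x" for a
      proof -
        have a: "a \<in> carrier L" "a \<ominus> x \<in> I" using that subs 4 mem by auto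
        then have "c \<odot> a \<ominus> c \<odot> x = c \<odot> (a \<ominus> x)" using 4 by (simp add: a_minus_def smult_r_distr smult_r_minus)
        then show ?thesis using a 4 subspace_smult[OF sub] by (simp add: eq)
      qed
      then show ?thesis using self[OF 4(2)] by blast
    qed
    then show ?case by (simp add: lie_quot_def)
  next
    case (5 x y)
    have "(\<Union>a\<in>I +> x. \<Union>b\<in>I +> y. I +> (a \<otimes> b)) = I +> (x \<otimes> y)"
    proof (rule UN[OF 5])
      fix a b assume ab: "a \<in> I +> x" "b \<in> I +> y"
      then have c: "a \<in> carrier L" "b \<in> carrier L" "a \<ominus> x \<in> I" "b \<ominus> y \<in> I" using subs 5 mem by auto
      \<comment> \<open>The difference of a \<otimes> b and x \<otimes> y is split by changing one
        factor at a time.\<close>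
      have "a \<otimes> b \<ominus> x \<otimes> b = (a \<ominus> x) \<otimes> b" "x \<otimes> b \<ominus> x \<otimes> y = x \<otimes> (b \<ominus> y)"
        using 5 c by (simp_all add: a_minus_def bracket_add_left bracket_add_right bracket_neg_left
            bracket_neg_right bracket_closed)
      then have "a \<otimes> b \<ominus> x \<otimes> b \<in> I" "x \<otimes> b \<ominus> x \<otimes> y \<in> I" using br br' c 5 by auto
      then have "a \<otimes> b \<ominus> x \<otimes> y \<in> I" using tr c 5 by (meson bracket_closed)
      then show "I +> (a \<otimes> b) = I +> (x \<otimes> y)" using eq c 5 bracket_closed by simp
    qed
    then show ?case by (simp add: lie_quot_def rcoset_mult_def)
  qed
qed

end

section \<open>Dimension counting by functionals and traces\<close>

section \<open>Functionals, dual bases and traces\<close>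

context vectorspace
begin

definition functional :: "('c \<Rightarrow> 'a) \<Rightarrow> bool" where
  "functional \<phi> \<longleftrightarrow> (\<forall>x\<in>carrier V. \<phi> x \<in> carrier K) \<and>
     (\<forall>x\<in>carrier V. \<forall>y\<in>carrier V. \<phi> (x \<oplus>\<^bsub>V\<^esub> y) = \<phi> x \<oplus>\<^bsub>K\<^esub> \<phi> y) \<and>
     (\<forall>c\<in>carrier K. \<forall>x\<in>carrier V. \<phi> (c \<odot>\<^bsub>V\<^esub> x) = c \<otimes>\<^bsub>K\<^esub> \<phi> x)"

text \<open>Finite dimension of W expressed by finitely many linear functionals on all of
  \<open>V\<close>. No basis of W is chosen, so the property passes to subsets and pulls back along
  injective linear maps.\<close>

definition separated :: "'c set \<Rightarrow> bool" where
  "separated W \<longleftrightarrow> (\<exists>\<Phi>. finite \<Phi> \<and> (\<forall>\<phi>\<in>\<Phi>. functional \<phi>) \<and>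
     (\<forall>x\<in>W. (\<forall>\<phi>\<in>\<Phi>. \<phi> x = \<zero>\<^bsub>K\<^esub>) \<longrightarrow> x = \<zero>\<^bsub>V\<^esub>))"

text \<open>The functionals \<open>\<epsilon> i\<close> live on all of \<open>V\<close>, not only on
  W, so that no functional ever has to be extended from a subspace.\<close>

definition dual_basis :: "'c set \<Rightarrow> nat \<Rightarrow> (nat \<Rightarrow> 'c) \<Rightarrow> (nat \<Rightarrow> 'c \<Rightarrow> 'a) \<Rightarrow> bool" where
  "dual_basis W n e \<epsilon> \<longleftrightarrow> (\<forall>i<n. e i \<in> W \<and> functional (\<epsilon> i)) \<and>
     (\<forall>i<n. \<forall>j<n. \<epsilon> i (e j) = (if i = j then \<one>\<^bsub>K\<^esub> else \<zero>\<^bsub>K\<^esub>)) \<and>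
     (\<forall>x\<in>W. x = (\<Oplus>\<^bsub>V\<^esub>i\<in>{..<n}. \<epsilon> i x \<odot>\<^bsub>V\<^esub> e i))"

definition lin_on :: "'c set \<Rightarrow> 'c set \<Rightarrow> ('c \<Rightarrow> 'c) \<Rightarrow> bool" where
  "lin_on W U f \<longleftrightarrow> (\<forall>x\<in>W. f x \<in> U) \<and>
     (\<forall>x\<in>W. \<forall>y\<in>W. f (x \<oplus>\<^bsub>V\<^esub> y) = f x \<oplus>\<^bsub>V\<^esub> f y) \<and>
     (\<forall>c\<in>carrier K. \<forall>x\<in>W. f (c \<odot>\<^bsub>V\<^esub> x) = c \<odot>\<^bsub>V\<^esub> f x)"

text \<open>The basis is a parameter; independence of it is the case of \<open>trace_commute\<close>
  in which one of the two maps is the identity of W.\<close>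

definition trace :: "nat \<Rightarrow> (nat \<Rightarrow> 'c) \<Rightarrow> (nat \<Rightarrow> 'c \<Rightarrow> 'a) \<Rightarrow> ('c \<Rightarrow> 'c) \<Rightarrow> 'a" where
  "trace n e \<epsilon> f = (\<Oplus>\<^bsub>K\<^esub>i\<in>{..<n}. \<epsilon> i (f (e i)))"

lemma functional_closed: "\<lbrakk>functional \<phi>; x \<in> carrier V\<rbrakk> \<Longrightarrow> \<phi> x \<in> carrier K"
  and functional_add:
    "\<lbrakk>functional \<phi>; x \<in> carrier V; y \<in> carrier V\<rbrakk> \<Longrightarrow> \<phi> (x \<oplus>\<^bsub>V\<^esub> y) = \<phi> x \<oplus>\<^bsub>K\<^esub> \<phi> y"
  and functional_smult:
    "\<lbrakk>functional \<phi>; c \<in> carrier K; x \<in> carrier V\<rbrakk> \<Longrightarrow> \<phi> (c \<odot>\<^bsub>V\<^esub> x) = c \<otimes>\<^bsub>K\<^esub> \<phi> x"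
  by (auto simp: functional_def)

lemma functional_zero: "functional \<phi> \<Longrightarrow> \<phi> \<zero>\<^bsub>V\<^esub> = \<zero>\<^bsub>K\<^esub>"
  using functional_smult[of \<phi> "\<zero>\<^bsub>K\<^esub>" "\<zero>\<^bsub>V\<^esub>"] by (simp add: functional_closed)

lemma functional_minus:
  assumes "functional \<phi>" "x \<in> carrier V" "y \<in> carrier V"
  shows "\<phi> (x \<ominus>\<^bsub>V\<^esub> y) = \<phi> x \<ominus>\<^bsub>K\<^esub> \<phi> y"
proof -
  have "\<phi> (\<ominus>\<^bsub>V\<^esub> y) = \<phi> ((\<ominus>\<^bsub>K\<^esub> \<one>\<^bsub>K\<^esub>) \<odot>\<^bsub>V\<^esub> y)" using assms by (simp add: smult_minus_1)
  also have "\<dots> = \<ominus>\<^bsub>K\<^esub> \<phi> y" using assms by (simp add: functional_smult functional_closed R.l_minus)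
  finally show ?thesis using assms by (simp add: a_minus_def functional_add)
qed

lemma functional_finsum:
  "\<lbrakk>finite A; functional \<phi>; a \<in> A \<rightarrow> carrier V\<rbrakk> \<Longrightarrow> \<phi> (\<Oplus>\<^bsub>V\<^esub>i\<in>A. a i) = (\<Oplus>\<^bsub>K\<^esub>i\<in>A. \<phi> (a i))"
proof (induction A rule: finite_induct)
  case empty then show ?case by (simp add: functional_zero)
next
  case (insert x A)
  then have "a \<in> A \<rightarrow> carrier V" "a x \<in> carrier V" "(\<lambda>i. \<phi> (a i)) \<in> A \<rightarrow> carrier K"
    by (auto intro: functional_closed)
  then show ?case using insert
    by (simp add: M.finsum_insert R.finsum_insert functional_add functional_closed M.finsum_closed)
qed

lemma functional_compose:
  assumes "functional \<phi>" "\<And>x. x \<in> carrier V \<Longrightarrow> f x \<in> carrier V"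
    "\<And>x y. \<lbrakk>x \<in> carrier V; y \<in> carrier V\<rbrakk> \<Longrightarrow> f (x \<oplus>\<^bsub>V\<^esub> y) = f x \<oplus>\<^bsub>V\<^esub> f y"
    "\<And>c x. \<lbrakk>c \<in> carrier K; x \<in> carrier V\<rbrakk> \<Longrightarrow> f (c \<odot>\<^bsub>V\<^esub> x) = c \<odot>\<^bsub>V\<^esub> f x"
  shows "functional (\<lambda>x. \<phi> (f x))"
  unfolding functional_def using assms by (simp add: functional_closed functional_add functional_smult)

lemma lin_onD:
  assumes "lin_on W U f"
  shows "x \<in> W \<Longrightarrow> f x \<in> U"
    and "\<lbrakk>x \<in> W; y \<in> W\<rbrakk> \<Longrightarrow> f (x \<oplus>\<^bsub>V\<^esub> y) = f x \<oplus>\<^bsub>V\<^esub> f y"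
    and "\<lbrakk>c \<in> carrier K; x \<in> W\<rbrakk> \<Longrightarrow> f (c \<odot>\<^bsub>V\<^esub> x) = c \<odot>\<^bsub>V\<^esub> f x"
  using assms by (auto simp: lin_on_def)

lemma lin_on_comp: "\<lbrakk>lin_on W U f; lin_on U S h\<rbrakk> \<Longrightarrow> lin_on W S (\<lambda>x. h (f x))"
  by (auto simp: lin_on_def)

lemma lin_on_zero:
  assumes "lin_on W U f" "subspace K W V" "subspace K U V" shows "f \<zero>\<^bsub>V\<^esub> = \<zero>\<^bsub>V\<^esub>"
proof -
  have z: "\<zero>\<^bsub>V\<^esub> \<in> W" by (rule subspace_zero[OF assms(2)])
  then have "f (\<zero>\<^bsub>K\<^esub> \<odot>\<^bsub>V\<^esub> \<zero>\<^bsub>V\<^esub>) = \<zero>\<^bsub>K\<^esub> \<odot>\<^bsub>V\<^esub> f \<zero>\<^bsub>V\<^esub>" by (intro lin_onD[OF assms(1)]) auto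
  then show ?thesis using z lin_onD(1)[OF assms(1)] subspace_carrier[OF assms(3)] by simp
qed

lemma lin_on_finsum:
  assumes f: "lin_on W U f" and W: "subspace K W V" and U: "subspace K U V"
  shows "\<lbrakk>finite A; a \<in> A \<rightarrow> W\<rbrakk> \<Longrightarrow> f (\<Oplus>\<^bsub>V\<^esub>i\<in>A. a i) = (\<Oplus>\<^bsub>V\<^esub>i\<in>A. f (a i))"
proof (induction A rule: finite_induct)
  case empty then show ?case by (simp add: lin_on_zero[OF f W U])
next
  case (insert x A)
  note Wc = subspace_carrier[OF W] and Uc = subspace_carrier[OF U]
  have "a \<in> A \<rightarrow> carrier V" "a x \<in> carrier V" "(\<lambda>i. f (a i)) \<in> A \<rightarrow> carrier V" "f (a x) \<in> carrier V"
    "(\<Oplus>\<^bsub>V\<^esub>i\<in>A. a i) \<in> W" "a x \<in> W"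
    using insert.prems lin_onD(1)[OF f] Wc Uc by (auto intro!: subspace_finsum[OF W])
  then show ?case using insert by (simp add: M.finsum_insert lin_onD(2)[OF f])
qed

lemma lin_on_kernel_trivial:
  assumes f: "lin_on W U f" and W: "subspace K W V" and U: "subspace K U V"
    and ker: "\<And>x. \<lbrakk>x \<in> W; f x = \<zero>\<^bsub>V\<^esub>\<rbrakk> \<Longrightarrow> x = \<zero>\<^bsub>V\<^esub>"
  shows "inj_on f W"
proof (rule inj_onI)
  fix x y assume xy: "x \<in> W" "y \<in> W" "f x = f y"
  note Wc = subspace_carrier[OF W] and Uc = subspace_carrier[OF U]
  have "f (x \<ominus>\<^bsub>V\<^esub> y) \<oplus>\<^bsub>V\<^esub> f y = f y"
    using xy lin_onD(2)[OF f, of "x \<ominus>\<^bsub>V\<^esub> y" y] Wc subspace_minus[OF W]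
    by (simp add: a_minus_def M.a_assoc M.l_neg)
  then have "f (x \<ominus>\<^bsub>V\<^esub> y) = \<zero>\<^bsub>V\<^esub>" using xy subspace_minus[OF W] lin_onD(1)[OF f] Uc by simp
  then have "x \<ominus>\<^bsub>V\<^esub> y = \<zero>\<^bsub>V\<^esub>" using xy ker subspace_minus[OF W] by blast
  then show "x = y" using xy Wc by simp
qed

lemma lin_on_inv:
  assumes f: "lin_on W U f" and W: "subspace K W V" and inj: "inj_on f W" and im: "f ` W = U"
  shows "lin_on U W (inv_into W f)"
proof -
  have inv: "inv_into W f (f x) = x" if "x \<in> W" for x using that inj by (rule inv_into_f_f[rotated])
  show ?thesis unfolding lin_on_def im[symmetric]
    using inv subspace_add[OF W] subspace_smult[OF W]
    by (auto simp: lin_onD(2,3)[OF f, symmetric])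
qed

lemma dual_basisD:
  assumes "dual_basis W n e \<epsilon>"
  shows "i < n \<Longrightarrow> e i \<in> W" "i < n \<Longrightarrow> functional (\<epsilon> i)"
    "\<lbrakk>i < n; j < n\<rbrakk> \<Longrightarrow> \<epsilon> i (e j) = (if i = j then \<one>\<^bsub>K\<^esub> else \<zero>\<^bsub>K\<^esub>)"
    "x \<in> W \<Longrightarrow> x = (\<Oplus>\<^bsub>V\<^esub>i\<in>{..<n}. \<epsilon> i x \<odot>\<^bsub>V\<^esub> e i)"
  using assms unfolding dual_basis_def by blast+

lemma dual_basis_exists:
  assumes "finite \<Phi>" "\<forall>\<phi>\<in>\<Phi>. functional \<phi>" "subspace K W V"
    "\<forall>x\<in>W. (\<forall>\<phi>\<in>\<Phi>. \<phi> x = \<zero>\<^bsub>K\<^esub>) \<longrightarrow> x = \<zero>\<^bsub>V\<^esub>"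
  shows "\<exists>n e \<epsilon>. dual_basis W n e \<epsilon>"
  using assms
proof (induction \<Phi> arbitrary: W rule: finite_induct)
  case empty
  then have "dual_basis W 0 (\<lambda>_. \<zero>\<^bsub>V\<^esub>) (\<lambda>_ _. \<zero>\<^bsub>K\<^esub>)" by (auto simp: dual_basis_def)
  then show ?case by blast
next
  case (insert \<phi> \<Phi>)
  note W = insert.prems(2)
  note Wc = subspace_carrier[OF W]
  have \<phi>: "functional \<phi>" using insert.prems by simp
  show ?case
  proof (cases "\<forall>x\<in>W. \<phi> x = \<zero>\<^bsub>K\<^esub>")
    case True then show ?thesis using insert by auto
  next
    case False
    then obtain w0 where w0: "w0 \<in> W" "\<phi> w0 \<noteq> \<zero>\<^bsub>K\<^esub>" by blast
    define w where "w = inv\<^bsub>K\<^esub> (\<phi> w0) \<odot>\<^bsub>V\<^esub> w0"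
    have u: "\<phi> w0 \<in> Units K" using w0 Wc functional_closed[OF \<phi>] field_Units by blast
    have w: "w \<in> W" "\<phi> w = \<one>\<^bsub>K\<^esub>"
      using w0 Wc u by (auto simp: w_def functional_smult[OF \<phi>] R.Units_l_inv subspace_smult[OF W])
    have wc: "w \<in> carrier V" using w Wc by blast
    let ?W = "{x \<in> W. \<phi> x = \<zero>\<^bsub>K\<^esub>}"
    have sub: "subspace K ?W V"
      by (rule subspaceI) (use Wc in \<open>auto simp: functional_zero[OF \<phi>] subspace_zero[OF W]
        subspace_add[OF W] subspace_smult[OF W] functional_add[OF \<phi>] functional_smult[OF \<phi>]\<close>)
    obtain n e \<epsilon> where db: "dual_basis ?W n e \<epsilon>"
      using insert.IH[OF _ sub] insert.prems by auto
    \<comment> \<open>Projection of W onto the kernel of \<phi> along w. Composed with \<pi>, the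
      old functionals vanish at w, as the extended dual basis requires.\<close>
    define \<pi> where "\<pi> x = x \<ominus>\<^bsub>V\<^esub> \<phi> x \<odot>\<^bsub>V\<^esub> w" for x
    note \<phi>c = functional_closed[OF \<phi>]
    have \<pi>: "\<pi> x \<in> ?W" if x: "x \<in> W" for x
    proof -
      have "\<phi> (\<pi> x) = \<phi> x \<ominus>\<^bsub>K\<^esub> \<phi> x"
        unfolding \<pi>_def using x w(2) Wc wc \<phi>c
        by (simp add: functional_minus[OF \<phi>] functional_smult[OF \<phi>])
      then have "\<phi> (\<pi> x) = \<zero>\<^bsub>K\<^esub>" using \<phi>c[OF Wc[OF x]] by (simp add: R.r_neg a_minus_def)
      moreover have "\<pi> x \<in> W"
        unfolding \<pi>_def using x w(1) Wc \<phi>c by (intro subspace_minus[OF W] subspace_smult[OF W]) auto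
      ultimately show ?thesis by simp
    qed
    have \<pi>c: "\<pi> x \<in> carrier V" if "x \<in> carrier V" for x using that wc \<phi>c by (simp add: \<pi>_def)
    have \<pi>fun: "functional (\<lambda>x. \<epsilon> i (\<pi> x))" if "i < n" for i
    proof (rule functional_compose[OF dual_basisD(2)[OF db that] \<pi>c])
      fix x y assume "x \<in> carrier V" "y \<in> carrier V"
      then show "\<pi> (x \<oplus>\<^bsub>V\<^esub> y) = \<pi> x \<oplus>\<^bsub>V\<^esub> \<pi> y"
        using wc \<phi>c by (simp add: \<pi>_def functional_add[OF \<phi>] smult_l_distr a_minus_def M.minus_add M.a_ac)
    next
      fix c x assume "c \<in> carrier K" "x \<in> carrier V"
      then show "\<pi> (c \<odot>\<^bsub>V\<^esub> x) = c \<odot>\<^bsub>V\<^esub> \<pi> x"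
        using wc \<phi>c by (simp add: \<pi>_def functional_smult[OF \<phi>] smult_r_distr a_minus_def smult_assoc1 smult_r_minus)
    qed
    let ?e = "e(n := w)" and ?\<epsilon> = "\<lambda>i. if i = n then \<phi> else (\<lambda>x. \<epsilon> i (\<pi> x))"
    have \<pi>e: "\<pi> x = x" if "x \<in> ?W" for x
      using that Wc wc by (simp add: \<pi>_def a_minus_def)
    have \<pi>w: "\<pi> w = \<zero>\<^bsub>V\<^esub>" using w wc by (simp add: \<pi>_def a_minus_def M.r_neg)
    have "dual_basis W (Suc n) ?e ?\<epsilon>"
      unfolding dual_basis_def
    proof (intro conjI allI impI ballI)
      fix i assume "i < Suc n"
      then show "?e i \<in> W" using dual_basisD(1)[OF db, of i] w by auto
      show "functional (?\<epsilon> i)" using \<phi> \<pi>fun \<open>i < Suc n\<close> by auto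
      fix j assume "j < Suc n"
      show "?\<epsilon> i (?e j) = (if i = j then \<one>\<^bsub>K\<^esub> else \<zero>\<^bsub>K\<^esub>)"
        using \<open>i < Suc n\<close> \<open>j < Suc n\<close> w dual_basisD[OF db] \<pi>w functional_zero \<pi>e[of "e j"]
        by (auto simp: less_Suc_eq)
    next
      fix x assume x: "x \<in> W"
      have ec: "\<And>i. i < n \<Longrightarrow> e i \<in> carrier V" using dual_basisD(1)[OF db] Wc by blast
      have tc: "\<And>i. i < n \<Longrightarrow> \<epsilon> i (\<pi> x) \<in> carrier K"
        using functional_closed[OF dual_basisD(2)[OF db]] \<pi>c x Wc by blast
      have eq: "\<pi> x = (\<Oplus>\<^bsub>V\<^esub>i\<in>{..<n}. \<epsilon> i (\<pi> x) \<odot>\<^bsub>V\<^esub> e i)" by (rule dual_basisD(4)[OF db \<pi>[OF x]])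
      have "x = \<phi> x \<odot>\<^bsub>V\<^esub> w \<oplus>\<^bsub>V\<^esub> \<pi> x"
        using x Wc wc \<phi>c by (simp add: \<pi>_def a_minus_def M.r_neg2 M.a_ac M.r_neg1 M.r_neg M.l_neg)
      also have "\<dots> = \<phi> x \<odot>\<^bsub>V\<^esub> w \<oplus>\<^bsub>V\<^esub> (\<Oplus>\<^bsub>V\<^esub>i\<in>{..<n}. ?\<epsilon> i x \<odot>\<^bsub>V\<^esub> ?e i)"
      proof -
        have "(\<Oplus>\<^bsub>V\<^esub>i\<in>{..<n}. ?\<epsilon> i x \<odot>\<^bsub>V\<^esub> ?e i) = (\<Oplus>\<^bsub>V\<^esub>i\<in>{..<n}. \<epsilon> i (\<pi> x) \<odot>\<^bsub>V\<^esub> e i)"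
          by (rule M.finsum_cong') (use ec tc in auto)
        then show ?thesis using eq by simp
      qed
      also have "\<dots> = (\<Oplus>\<^bsub>V\<^esub>i\<in>{..<Suc n}. ?\<epsilon> i x \<odot>\<^bsub>V\<^esub> ?e i)"
        unfolding lessThan_Suc
        by (subst M.finsum_insert) (use ec tc wc \<phi>c x Wc in auto)
      finally show "x = (\<Oplus>\<^bsub>V\<^esub>i\<in>{..<Suc n}. ?\<epsilon> i x \<odot>\<^bsub>V\<^esub> ?e i)" .
    qed
    then show ?thesis by blast
  qed
qed

lemma separated_dual_basis:
  assumes "separated W" "subspace K W V"
  obtains n e \<epsilon> where "dual_basis W n e \<epsilon>"
proof -
  obtain \<Phi> where "finite \<Phi>" "\<forall>\<phi>\<in>\<Phi>. functional \<phi>"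
    "\<forall>x\<in>W. (\<forall>\<phi>\<in>\<Phi>. \<phi> x = \<zero>\<^bsub>K\<^esub>) \<longrightarrow> x = \<zero>\<^bsub>V\<^esub>"
    using assms(1) unfolding separated_def by auto
  from dual_basis_exists[OF this(1,2) assms(2) this(3)] that show ?thesis by auto
qed

lemma separated_subset: "\<lbrakk>separated W; U \<subseteq> W\<rbrakk> \<Longrightarrow> separated U"
  unfolding separated_def by blast

lemma dual_basis_separated: 
  assumes "dual_basis W n e \<epsilon>" "W \<subseteq> carrier V" shows "separated W"
proof -
  have "x = \<zero>\<^bsub>V\<^esub>" if x: "x \<in> W" "\<forall>\<phi>\<in>\<epsilon> ` {..<n}. \<phi> x = \<zero>\<^bsub>K\<^esub>" for x
  proof -
    have "(\<Oplus>\<^bsub>V\<^esub>i\<in>{..<n}. \<epsilon> i x \<odot>\<^bsub>V\<^esub> e i) = \<zero>\<^bsub>V\<^esub>"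
    proof (rule M.finsum_all0)
      fix i assume "i \<in> {..<n}"
      then have "e i \<in> carrier V" "\<epsilon> i x = \<zero>\<^bsub>K\<^esub>" using x(2) dual_basisD(1)[OF assms(1)] assms(2) by auto
      then show "\<epsilon> i x \<odot>\<^bsub>V\<^esub> e i = \<zero>\<^bsub>V\<^esub>" by simp
    qed
    then show ?thesis using dual_basisD(4)[OF assms(1) x(1)] by simp
  qed
  then show ?thesis unfolding separated_def
    by (intro exI[of _ "\<epsilon> ` {..<n}"]) (use dual_basisD(2)[OF assms(1)] in auto)
qed

lemma finsum_swap:
  assumes "finite A" "finite B" "\<And>i j. \<lbrakk>i \<in> A; j \<in> B\<rbrakk> \<Longrightarrow> a i j \<in> carrier K"
  shows "(\<Oplus>\<^bsub>K\<^esub>i\<in>A. \<Oplus>\<^bsub>K\<^esub>j\<in>B. a i j) = (\<Oplus>\<^bsub>K\<^esub>j\<in>B. \<Oplus>\<^bsub>K\<^esub>i\<in>A. a i j)"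
  using assms(1,3)
proof (induction A rule: finite_induct)
  case empty
  then show ?case by simp
next
  case (insert x A)
  have "(\<Oplus>\<^bsub>K\<^esub>i\<in>insert x A. \<Oplus>\<^bsub>K\<^esub>j\<in>B. a i j) = (\<Oplus>\<^bsub>K\<^esub>j\<in>B. a x j) \<oplus>\<^bsub>K\<^esub> (\<Oplus>\<^bsub>K\<^esub>j\<in>B. \<Oplus>\<^bsub>K\<^esub>i\<in>A. a i j)"
    using insert by (subst R.finsum_insert) (auto intro!: R.finsum_closed)
  also have "\<dots> = (\<Oplus>\<^bsub>K\<^esub>j\<in>B. a x j \<oplus>\<^bsub>K\<^esub> (\<Oplus>\<^bsub>K\<^esub>i\<in>A. a i j))"
    by (rule R.finsum_addf[symmetric]) (use insert in \<open>auto intro!: R.finsum_closed\<close>)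
  also have "\<dots> = (\<Oplus>\<^bsub>K\<^esub>j\<in>B. \<Oplus>\<^bsub>K\<^esub>i\<in>insert x A. a i j)"
    by (rule R.finsum_cong') (use insert in \<open>auto intro!: R.finsum_closed\<close>)
  finally show ?case .
qed

lemma trace_expand:
  assumes W: "subspace K W V" and U: "subspace K U V"
    and e: "dual_basis W n e \<epsilon>" and d: "dual_basis U m d \<delta>"
    and f: "lin_on W U f" and h: "lin_on U W h"
  shows "trace n e \<epsilon> (\<lambda>x. h (f x)) =
    (\<Oplus>\<^bsub>K\<^esub>i\<in>{..<n}. \<Oplus>\<^bsub>K\<^esub>j\<in>{..<m}. \<epsilon> i (h (d j)) \<otimes>\<^bsub>K\<^esub> \<delta> j (f (e i)))"
proof -
  note Wc = subspace_carrier[OF W] and Uc = subspace_carrier[OF U]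
  note ed = dual_basisD[OF e] and dd = dual_basisD[OF d]
  have c: "\<delta> j (f (e i)) \<in> carrier K" "\<epsilon> i (h (d j)) \<in> carrier K" if "i < n" "j < m" for i j
    using that ed(1) dd(1) Wc Uc lin_onD(1)[OF f] lin_onD(1)[OF h]
    by (auto intro!: functional_closed[OF ed(2)] functional_closed[OF dd(2)])
  have "\<epsilon> i (h (f (e i))) = (\<Oplus>\<^bsub>K\<^esub>j\<in>{..<m}. \<epsilon> i (h (d j)) \<otimes>\<^bsub>K\<^esub> \<delta> j (f (e i)))" if i: "i < n" for i
  proof -
    let ?u = "\<lambda>j. \<delta> j (f (e i)) \<odot>\<^bsub>V\<^esub> d j"
    have fe: "f (e i) \<in> U" using ed(1) i lin_onD(1)[OF f] by blast
    have uU: "?u \<in> {..<m} \<rightarrow> U" using c i dd(1) subspace_smult[OF U] by auto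
    have "h (f (e i)) = h (\<Oplus>\<^bsub>V\<^esub>j\<in>{..<m}. ?u j)"
      by (rule arg_cong[where f = h]) (rule dd(4)[OF fe])
    also have "\<dots> = (\<Oplus>\<^bsub>V\<^esub>j\<in>{..<m}. h (?u j))"
      by (rule lin_on_finsum[OF h U W _ uU]) simp
    finally have "\<epsilon> i (h (f (e i))) = \<epsilon> i (\<Oplus>\<^bsub>V\<^esub>j\<in>{..<m}. h (?u j))" by simp
    also have "\<dots> = (\<Oplus>\<^bsub>K\<^esub>j\<in>{..<m}. \<epsilon> i (h (?u j)))"
      by (rule functional_finsum[OF _ ed(2)[OF i]]) (use uU lin_onD(1)[OF h] Wc in auto)
    also have "\<dots> = (\<Oplus>\<^bsub>K\<^esub>j\<in>{..<m}. \<epsilon> i (h (d j)) \<otimes>\<^bsub>K\<^esub> \<delta> j (f (e i)))"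
    proof (rule R.finsum_cong')
      show "(\<lambda>j. \<epsilon> i (h (d j)) \<otimes>\<^bsub>K\<^esub> \<delta> j (f (e i))) \<in> {..<m} \<rightarrow> carrier K" using c i by auto
      fix j assume "j \<in> {..<m}"
      then show "\<epsilon> i (h (?u j)) = \<epsilon> i (h (d j)) \<otimes>\<^bsub>K\<^esub> \<delta> j (f (e i))"
        using c i dd(1) lin_onD(1)[OF h] Wc
        by (simp add: lin_onD(3)[OF h] functional_smult[OF ed(2)[OF i]] R.m_comm)
    qed simp
    finally show ?thesis .
  qed
  then show ?thesis unfolding trace_def
    by (intro R.finsum_cong') (use c in \<open>auto intro!: R.finsum_closed\<close>)
qed

text \<open>The double sum of \<open>trace_expand\<close> becomes its mirror image when the order of
  summation and the two factors are exchanged. W and U may be different spaces, which lets traces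
  compare dimensions.\<close>

lemma trace_commute:
  assumes W: "subspace K W V" and U: "subspace K U V"
    and e: "dual_basis W n e \<epsilon>" and d: "dual_basis U m d \<delta>"
    and f: "lin_on W U f" and h: "lin_on U W h"
  shows "trace n e \<epsilon> (\<lambda>x. h (f x)) = trace m d \<delta> (\<lambda>x. f (h x))"
proof -
  note Wc = subspace_carrier[OF W] and Uc = subspace_carrier[OF U]
  note ed = dual_basisD[OF e] and dd = dual_basisD[OF d]
  have c: "\<delta> j (f (e i)) \<in> carrier K" "\<epsilon> i (h (d j)) \<in> carrier K" if "i < n" "j < m" for i j
    using that ed(1) dd(1) Wc Uc lin_onD(1)[OF f] lin_onD(1)[OF h]
    by (auto intro!: functional_closed[OF ed(2)] functional_closed[OF dd(2)])
  have "trace n e \<epsilon> (\<lambda>x. h (f x)) =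
      (\<Oplus>\<^bsub>K\<^esub>j\<in>{..<m}. \<Oplus>\<^bsub>K\<^esub>i\<in>{..<n}. \<epsilon> i (h (d j)) \<otimes>\<^bsub>K\<^esub> \<delta> j (f (e i)))"
    unfolding trace_expand[OF assms] by (rule finsum_swap) (use c in auto)
  also have "\<dots> = (\<Oplus>\<^bsub>K\<^esub>j\<in>{..<m}. \<Oplus>\<^bsub>K\<^esub>i\<in>{..<n}. \<delta> j (f (e i)) \<otimes>\<^bsub>K\<^esub> \<epsilon> i (h (d j)))"
    by (intro R.finsum_cong') (use c in \<open>auto intro!: R.finsum_closed R.finsum_cong' simp: R.m_comm\<close>)
  also have "\<dots> = trace m d \<delta> (\<lambda>x. f (h x))"
    by (rule trace_expand[OF U W d e h f, symmetric])
  finally show ?thesis .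
qed

lemma trace_cong:
  assumes "dual_basis W n e \<epsilon>" "\<And>x. x \<in> W \<Longrightarrow> f x = h x" "\<And>x. x \<in> W \<Longrightarrow> h x \<in> carrier V"
  shows "trace n e \<epsilon> f = trace n e \<epsilon> h"
  unfolding trace_def
  by (rule R.finsum_cong')
    (use assms(2,3) dual_basisD(1)[OF assms(1)] functional_closed[OF dual_basisD(2)[OF assms(1)]] in auto)

lemma trace_closed:
  assumes "dual_basis W n e \<epsilon>" "\<And>x. x \<in> W \<Longrightarrow> f x \<in> carrier V"
  shows "trace n e \<epsilon> f \<in> carrier K"
  unfolding trace_def
  by (rule R.finsum_closed)
    (use assms(2) dual_basisD(1)[OF assms(1)] functional_closed[OF dual_basisD(2)[OF assms(1)]] in auto)

lemma trace_add:
  assumes "dual_basis W n e \<epsilon>" "\<And>x. x \<in> W \<Longrightarrow> f x \<in> carrier V" "\<And>x. x \<in> W \<Longrightarrow> h x \<in> carrier V"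
  shows "trace n e \<epsilon> (\<lambda>x. f x \<oplus>\<^bsub>V\<^esub> h x) = trace n e \<epsilon> f \<oplus>\<^bsub>K\<^esub> trace n e \<epsilon> h"
proof -
  note d = dual_basisD[OF assms(1)]
  have "trace n e \<epsilon> (\<lambda>x. f x \<oplus>\<^bsub>V\<^esub> h x) = (\<Oplus>\<^bsub>K\<^esub>i\<in>{..<n}. \<epsilon> i (f (e i)) \<oplus>\<^bsub>K\<^esub> \<epsilon> i (h (e i)))"
    unfolding trace_def
    by (rule R.finsum_cong')
     (use assms d(1) functional_closed[OF d(2)] functional_add[OF d(2)] in auto)
  then show ?thesis unfolding trace_def
    by (simp add: R.finsum_addf assms d functional_closed Pi_iff)
qed

lemma trace_id:
  assumes "dual_basis W n e \<epsilon>" shows "trace n e \<epsilon> (\<lambda>x. x) = [n] \<cdot>\<^bsub>K\<^esub> \<one>\<^bsub>K\<^esub>"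
proof -
  have "trace n e \<epsilon> (\<lambda>x. x) = (\<Oplus>\<^bsub>K\<^esub>i\<in>{..<n}. \<one>\<^bsub>K\<^esub>)"
    unfolding trace_def by (rule R.finsum_cong') (use dual_basisD(3)[OF assms] in auto)
  also have "\<dots> = [n] \<cdot>\<^bsub>K\<^esub> \<one>\<^bsub>K\<^esub>"
    by (subst R.add.finprod_const) auto
  finally show ?thesis .
qed

text \<open>The trace of the identity gives a dimension only as an element of \<open>K\<close>;
  characteristic zero recovers the natural number.\<close>

lemma char_zero_cancel:
  assumes "char_zero K" "[a] \<cdot>\<^bsub>K\<^esub> \<one>\<^bsub>K\<^esub> = [b] \<cdot>\<^bsub>K\<^esub> \<one>\<^bsub>K\<^esub>" shows "(a::nat) = b"
proof -
  have "\<not> a < b" if "[a] \<cdot>\<^bsub>K\<^esub> \<one>\<^bsub>K\<^esub> = [b] \<cdot>\<^bsub>K\<^esub> \<one>\<^bsub>K\<^esub>" for a b :: nat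
  proof
    assume "a < b"
    then have "([a] \<cdot>\<^bsub>K\<^esub> \<one>\<^bsub>K\<^esub>) \<oplus>\<^bsub>K\<^esub> ([(b - a)] \<cdot>\<^bsub>K\<^esub> \<one>\<^bsub>K\<^esub>) = [b] \<cdot>\<^bsub>K\<^esub> \<one>\<^bsub>K\<^esub>"
      by (subst R.add.nat_pow_mult) auto
    then have "[(b - a)] \<cdot>\<^bsub>K\<^esub> \<one>\<^bsub>K\<^esub> = \<zero>\<^bsub>K\<^esub>" using that by simp
    then show False using assms(1) \<open>a < b\<close> by (simp add: char_zero_def)
  qed
  from this[of a b] this[of b a] assms(2) show ?thesis by auto
qed

text \<open>The projection \<pi> onto W and its complement q = 1 - \<pi> split U into W and the
  kernel \<open>?C\<close> of \<pi> in U. Their traces on U are n and k and add up to the trace m of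
  the identity. Thus m = n + k, and k = 0 forces q to vanish on U.\<close>

lemma dual_basis_size_add:
  assumes ch: "char_zero K" and U: "subspace K U V" and W: "subspace K W V" and WU: "W \<subseteq> U"
    and dU: "dual_basis U m d \<delta>" and dW: "dual_basis W n e \<epsilon>"
  shows "n \<le> m \<and> (n = m \<longrightarrow> W = U)"
proof -
  note Wc = subspace_carrier[OF W] and Uc = subspace_carrier[OF U]
  note ed = dual_basisD[OF dW]
  define \<pi> where "\<pi> x = (\<Oplus>\<^bsub>V\<^esub>i\<in>{..<n}. \<epsilon> i x \<odot>\<^bsub>V\<^esub> e i)" for x
  have tW: "\<epsilon> i x \<odot>\<^bsub>V\<^esub> e i \<in> W" if "i < n" "x \<in> carrier V" for i x
    using that ed(1) functional_closed[OF ed(2)] subspace_smult[OF W] by blast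
  have \<pi>W: "\<pi> x \<in> W" if "x \<in> carrier V" for x
    unfolding \<pi>_def by (rule subspace_finsum[OF W]) (use tW that in auto)
  have \<pi>id: "\<pi> x = x" if "x \<in> W" for x unfolding \<pi>_def using ed(4)[OF that] by simp
  have \<pi>add: "\<pi> (x \<oplus>\<^bsub>V\<^esub> y) = \<pi> x \<oplus>\<^bsub>V\<^esub> \<pi> y" if "x \<in> carrier V" "y \<in> carrier V" for x y
  proof -
    have "\<pi> x \<oplus>\<^bsub>V\<^esub> \<pi> y = (\<Oplus>\<^bsub>V\<^esub>i\<in>{..<n}. \<epsilon> i x \<odot>\<^bsub>V\<^esub> e i \<oplus>\<^bsub>V\<^esub> \<epsilon> i y \<odot>\<^bsub>V\<^esub> e i)"
      unfolding \<pi>_def by (rule M.finsum_addf[symmetric]) (use that tW Wc in auto)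
    also have "\<dots> = \<pi> (x \<oplus>\<^bsub>V\<^esub> y)" unfolding \<pi>_def
    proof (rule M.finsum_cong')
      fix i assume "i \<in> {..<n}"
      then show "\<epsilon> i x \<odot>\<^bsub>V\<^esub> e i \<oplus>\<^bsub>V\<^esub> \<epsilon> i y \<odot>\<^bsub>V\<^esub> e i = \<epsilon> i (x \<oplus>\<^bsub>V\<^esub> y) \<odot>\<^bsub>V\<^esub> e i"
        using that ed(1) Wc by (simp add: functional_add[OF ed(2)] functional_closed[OF ed(2)] smult_l_distr)
    qed (use that tW Wc in auto)
    finally show ?thesis by simp
  qed
  have \<pi>smult: "\<pi> (c \<odot>\<^bsub>V\<^esub> x) = c \<odot>\<^bsub>V\<^esub> \<pi> x" if "c \<in> carrier K" "x \<in> carrier V" for c x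
  proof -
    have "c \<odot>\<^bsub>V\<^esub> \<pi> x = (\<Oplus>\<^bsub>V\<^esub>i\<in>{..<n}. c \<odot>\<^bsub>V\<^esub> (\<epsilon> i x \<odot>\<^bsub>V\<^esub> e i))"
      unfolding \<pi>_def by (rule finsum_smult) (use that tW Wc in auto)
    also have "\<dots> = \<pi> (c \<odot>\<^bsub>V\<^esub> x)" unfolding \<pi>_def
    proof (rule M.finsum_cong')
      fix i assume "i \<in> {..<n}"
      then show "c \<odot>\<^bsub>V\<^esub> (\<epsilon> i x \<odot>\<^bsub>V\<^esub> e i) = \<epsilon> i (c \<odot>\<^bsub>V\<^esub> x) \<odot>\<^bsub>V\<^esub> e i"
        using that ed(1) Wc by (simp add: functional_smult[OF ed(2)] functional_closed[OF ed(2)] smult_assoc1)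
    qed (use that tW Wc in auto)
    finally show ?thesis by simp
  qed
  let ?C = "{x \<in> U. \<pi> x = \<zero>\<^bsub>V\<^esub>}"
  have \<pi>0: "\<pi> \<zero>\<^bsub>V\<^esub> = \<zero>\<^bsub>V\<^esub>" using \<pi>id subspace_zero[OF W] by blast
  have C: "subspace K ?C V"
    by (rule subspaceI) (use Uc in \<open>auto simp: subspace_zero[OF U] \<pi>0 subspace_add[OF U] subspace_smult[OF U] \<pi>add \<pi>smult\<close>)
  have "separated U" using dual_basis_separated[OF dU] Uc by blast
  then have "separated ?C" by (rule separated_subset) auto
  then obtain k b \<beta> where dC: "dual_basis ?C k b \<beta>" using C by (rule separated_dual_basis)
  define q where "q x = x \<ominus>\<^bsub>V\<^esub> \<pi> x" for x
  have \<pi>c: "\<pi> x \<in> carrier V" if "x \<in> carrier V" for x using \<pi>W Wc that by blast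
  have \<pi>m: "\<pi> (x \<ominus>\<^bsub>V\<^esub> y) = \<pi> x \<ominus>\<^bsub>V\<^esub> \<pi> y" if "x \<in> carrier V" "y \<in> carrier V" for x y
  proof -
    have "\<pi> (x \<ominus>\<^bsub>V\<^esub> y) \<oplus>\<^bsub>V\<^esub> \<pi> y = \<pi> x"
      using that \<pi>add[of "x \<ominus>\<^bsub>V\<^esub> y" y] by (simp add: a_minus_def M.a_assoc M.l_neg)
    then show ?thesis using that \<pi>c[of x] \<pi>c[of y] \<pi>c[of "x \<ominus>\<^bsub>V\<^esub> y"]
      by (metis M.add.inv_solve_right M.minus_closed a_minus_def)
  qed
  have lin\<pi>: "lin_on U W \<pi>" unfolding lin_on_def using \<pi>W \<pi>add \<pi>smult Uc by blast
  have linj: "lin_on W U (\<lambda>x. x)" unfolding lin_on_def using WU by auto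
  have linC: "lin_on ?C U (\<lambda>x. x)" unfolding lin_on_def by auto
  have linq: "lin_on U ?C q"
    unfolding lin_on_def
  proof (intro conjI ballI)
    fix x assume x: "x \<in> U"
    then have "\<pi> (q x) = \<zero>\<^bsub>V\<^esub>"
      using Uc \<pi>W[of x] \<pi>c[of x] by (simp add: q_def \<pi>m \<pi>id)
    moreover have "q x \<in> U" using x \<pi>W[of x] Uc[of x] WU unfolding q_def by (blast intro: subspace_minus[OF U])
    ultimately show "q x \<in> ?C" by simp
    fix y assume y: "y \<in> U"
    show "q (x \<oplus>\<^bsub>V\<^esub> y) = q x \<oplus>\<^bsub>V\<^esub> q y"
      using x y Uc \<pi>c by (simp add: q_def \<pi>add a_minus_def M.minus_add M.a_ac)
  next
    fix c x assume "c \<in> carrier K" "x \<in> U"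
    then show "q (c \<odot>\<^bsub>V\<^esub> x) = c \<odot>\<^bsub>V\<^esub> q x"
      using Uc \<pi>c by (simp add: q_def \<pi>smult a_minus_def smult_r_distr smult_r_minus)
  qed
  have "[n] \<cdot>\<^bsub>K\<^esub> \<one>\<^bsub>K\<^esub> = trace n e \<epsilon> (\<lambda>x. \<pi> x)"
    unfolding trace_id[OF dW, symmetric] by (rule trace_cong[OF dW]) (use \<pi>id \<pi>c Wc in auto)
  also have "\<dots> = trace m d \<delta> (\<lambda>x. \<pi> x)"
    by (rule trace_commute[OF W U dW dU linj lin\<pi>])
  finally have 1: "[n] \<cdot>\<^bsub>K\<^esub> \<one>\<^bsub>K\<^esub> = trace m d \<delta> \<pi>" .
  have "[k] \<cdot>\<^bsub>K\<^esub> \<one>\<^bsub>K\<^esub> = trace k b \<beta> (\<lambda>x. q x)"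
    unfolding trace_id[OF dC, symmetric]
    by (rule trace_cong[OF dC]) (use Uc in \<open>auto simp: q_def a_minus_def\<close>)
  also have "\<dots> = trace m d \<delta> (\<lambda>x. q x)"
    by (rule trace_commute[OF C U dC dU linC linq])
  finally have 2: "[k] \<cdot>\<^bsub>K\<^esub> \<one>\<^bsub>K\<^esub> = trace m d \<delta> q" .
  have qc: "q x \<in> carrier V" if "x \<in> U" for x using that Uc \<pi>c by (simp add: q_def)
  have "[m] \<cdot>\<^bsub>K\<^esub> \<one>\<^bsub>K\<^esub> = trace m d \<delta> (\<lambda>x. \<pi> x \<oplus>\<^bsub>V\<^esub> q x)"
    unfolding trace_id[OF dU, symmetric]
    by (rule trace_cong[OF dU]) (use Uc \<pi>c in \<open>auto simp: q_def a_minus_def M.a_ac M.r_neg2 M.r_neg1 M.r_neg\<close>)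
  also have "\<dots> = ([n] \<cdot>\<^bsub>K\<^esub> \<one>\<^bsub>K\<^esub>) \<oplus>\<^bsub>K\<^esub> ([k] \<cdot>\<^bsub>K\<^esub> \<one>\<^bsub>K\<^esub>)"
    unfolding 1 2 by (rule trace_add[OF dU]) (use Uc \<pi>c qc in auto)
  also have "\<dots> = [(n + k)] \<cdot>\<^bsub>K\<^esub> \<one>\<^bsub>K\<^esub>" by (simp add: R.add.nat_pow_mult)
  finally have mk: "m = n + k" using char_zero_cancel[OF ch] by blast
  moreover have "W = U" if "k = 0"
  proof -
    have "q x = \<zero>\<^bsub>V\<^esub>" if "x \<in> U" for x
      using lin_onD(1)[OF linq that] dual_basisD(4)[OF dC, of "q x"] \<open>k = 0\<close> by simp
    then have "x = \<pi> x" if "x \<in> U" for x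
      using that Uc \<pi>c by (simp add: q_def)
    then show ?thesis using WU \<pi>W Uc by (metis subsetI subset_antisym)
  qed
  ultimately show ?thesis by auto
qed

text \<open>On its image f has an inverse, and cyclicity of the trace gives the image as many basis
  vectors as W. What remains is a comparison of the image with U.\<close>

lemma injective_dual_basis_size:
  assumes ch: "char_zero K" and W: "subspace K W V" and U: "subspace K U V"
    and f: "lin_on W U f" and inj: "inj_on f W"
    and dW: "dual_basis W n e \<epsilon>" and dU: "dual_basis U m d \<delta>"
  shows "n \<le> m \<and> (n = m \<longrightarrow> f ` W = U)"
proof -
  note Wc = subspace_carrier[OF W] and Uc = subspace_carrier[OF U]
  have fU: "f ` W \<subseteq> U" using lin_onD(1)[OF f] by blast
  have im: "subspace K (f ` W) V"
  proof (rule subspaceI)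
    show "f ` W \<subseteq> carrier V" using fU Uc by blast
    show "\<zero>\<^bsub>V\<^esub> \<in> f ` W" using lin_on_zero[OF f W U] subspace_zero[OF W] by (metis imageI)
  qed (auto simp: lin_onD(2,3)[OF f, symmetric] subspace_add[OF W] subspace_smult[OF W])
  have f': "lin_on W (f ` W) f" using f by (auto simp: lin_on_def)
  have "separated U" using dual_basis_separated[OF dU] Uc by blast
  then have "separated (f ` W)" using fU by (rule separated_subset)
  then obtain k b \<beta> where dI: "dual_basis (f ` W) k b \<beta>" using im by (rule separated_dual_basis)
  note inv = lin_on_inv[OF f' W inj HOL.refl]
  have "[n] \<cdot>\<^bsub>K\<^esub> \<one>\<^bsub>K\<^esub> = trace n e \<epsilon> (\<lambda>x. inv_into W f (f x))"
    unfolding trace_id[OF dW, symmetric] by (rule trace_cong[OF dW]) (use inj Wc in auto)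
  also have "\<dots> = trace k b \<beta> (\<lambda>x. f (inv_into W f x))"
    by (rule trace_commute[OF W im dW dI f' inv])
  also have "\<dots> = [k] \<cdot>\<^bsub>K\<^esub> \<one>\<^bsub>K\<^esub>"
    unfolding trace_id[OF dI, symmetric] by (rule trace_cong[OF dI]) (use fU Uc in \<open>auto simp: f_inv_into_f\<close>)
  finally have "n = k" by (rule char_zero_cancel[OF ch])
  then show ?thesis using dual_basis_size_add[OF ch U im fU dU dI] by simp
qed

text \<open>Coordinates with respect to a finite basis separate the vectors; conversely, the vectors
  of a dual basis span.\<close>

lemma fin_dim_iff_separated: "fin_dim \<longleftrightarrow> separated (carrier V)"
proof
  assume "separated (carrier V)"
  then obtain n e \<epsilon> where db: "dual_basis (carrier V) n e \<epsilon>"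
    using subspace_carrier_self by (rule separated_dual_basis)
  note d = dual_basisD[OF db]
  let ?S = "e ` {..<n}"
  have S: "?S \<subseteq> carrier V" "finite ?S" using d(1) by auto
  have "x \<in> span ?S" if x: "x \<in> carrier V" for x
  proof -
    have "(\<Oplus>\<^bsub>V\<^esub>i\<in>{..<n}. \<epsilon> i x \<odot>\<^bsub>V\<^esub> e i) \<in> span ?S"
    proof (rule subspace_finsum[OF span_is_subspace[OF S(1)]])
      fix i assume i: "i \<in> {..<n}"
      then have "e i \<in> span ?S" using span_mem[OF S(1)] by blast
      then show "\<epsilon> i x \<odot>\<^bsub>V\<^esub> e i \<in> span ?S"
        using i functional_closed[OF d(2)] x by (intro subspace_smult[OF span_is_subspace[OF S(1)]]) auto
    qed
    then show ?thesis using d(4)[OF x] by simp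
  qed
  then have "span ?S = carrier V" using S by auto
  then show fin_dim unfolding fin_dim_def using S by blast
next
  assume fin_dim
  then obtain B where B: "finite B" "basis B" using finite_basis_exists by blast
  then have BV: "B \<subseteq> carrier V" by (simp add: basis_def)
  have ex1: "\<exists>!a. a \<in> B \<rightarrow>\<^sub>E carrier K \<and> lincomb a B = v" if "v \<in> carrier V" for v
    using basis_criterion[OF B(1) BV] B(2) that by blast
  define co where "co v = (THE a. a \<in> B \<rightarrow>\<^sub>E carrier K \<and> lincomb a B = v)" for v
  have co: "co v \<in> B \<rightarrow>\<^sub>E carrier K" "lincomb (co v) B = v" if "v \<in> carrier V" for v
    using theI'[OF ex1[OF that]] by (auto simp: co_def)
  have coI: "co v = a" if "a \<in> B \<rightarrow>\<^sub>E carrier K" "lincomb a B = v" "v \<in> carrier V" for a v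
    unfolding co_def using the1_equality[OF ex1[OF that(3)], of a] that by blast
  have "functional (\<lambda>v. co v b)" if b: "b \<in> B" for b
    unfolding functional_def
  proof (intro conjI ballI)
    fix x assume x: "x \<in> carrier V"
    show "co x b \<in> carrier K" using co(1)[OF x] b by auto
    fix y assume y: "y \<in> carrier V"
    have c: "co x \<in> B \<rightarrow> carrier K" "co y \<in> B \<rightarrow> carrier K" using co(1) x y by (auto simp: PiE_def)
    have "lincomb (\<lambda>v\<in>B. co x v \<oplus>\<^bsub>K\<^esub> co y v) B = lincomb (\<lambda>v. co x v \<oplus>\<^bsub>K\<^esub> co y v) B"
      by (rule lincomb_cong) (use BV c in auto)
    also have "\<dots> = x \<oplus>\<^bsub>V\<^esub> y" using lincomb_sum[OF B(1) BV c] co(2) x y by simp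
    finally have "co (x \<oplus>\<^bsub>V\<^esub> y) = (\<lambda>v\<in>B. co x v \<oplus>\<^bsub>K\<^esub> co y v)"
      by (intro coI) (use c x y in auto)
    then show "co (x \<oplus>\<^bsub>V\<^esub> y) b = co x b \<oplus>\<^bsub>K\<^esub> co y b" using b by simp
  next
    fix r x assume r: "r \<in> carrier K" and x: "x \<in> carrier V"
    have c: "co x \<in> B \<rightarrow> carrier K" using co(1) x by (auto simp: PiE_def)
    have "lincomb (\<lambda>v\<in>B. r \<otimes>\<^bsub>K\<^esub> co x v) B = lincomb (\<lambda>v. r \<otimes>\<^bsub>K\<^esub> co x v) B"
      by (rule lincomb_cong) (use BV c r in auto)
    also have "\<dots> = r \<odot>\<^bsub>V\<^esub> x" using lincomb_smult[OF BV c r] co(2) x by simp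
    finally have "co (r \<odot>\<^bsub>V\<^esub> x) = (\<lambda>v\<in>B. r \<otimes>\<^bsub>K\<^esub> co x v)"
      by (intro coI) (use c x r in auto)
    then show "co (r \<odot>\<^bsub>V\<^esub> x) b = r \<otimes>\<^bsub>K\<^esub> co x b" using b by simp
  qed
  moreover have "x = \<zero>\<^bsub>V\<^esub>" if x: "x \<in> carrier V" "\<forall>b\<in>B. co x b = \<zero>\<^bsub>K\<^esub>" for x
  proof -
    have "lincomb (co x) B = \<zero>\<^bsub>V\<^esub>" unfolding lincomb_def by (rule M.finsum_all0) (use x BV in auto)
    then show ?thesis using co(2)[OF x(1)] by simp
  qed
  ultimately show "separated (carrier V)" unfolding separated_def
    by (intro exI[of _ "(\<lambda>b v. co v b) ` B"]) (use B in auto)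
qed

end

section \<open>The trace obstruction for graded commutators\<close>

section \<open>Commutators of graded operators\<close>

text \<open>A sum over a window of r consecutive values changes by d (p + 1) - d (p + 1 - r) when
  the window moves up by one, so it is non-increasing from N on. A non-increasing sequence of
  natural numbers is finally constant, and from then on the incoming and the outgoing value
  agree.\<close>

lemma eventually_periodic:
  fixes d :: "int \<Rightarrow> nat"
  assumes "\<And>p. p \<ge> N \<Longrightarrow> d p \<le> d (p - int r)"
  shows "\<exists>M\<ge>N. \<forall>p\<ge>M. d p = d (p - int r)"
proof -
  define S where "S p = (\<Sum>j<r. d (p - int j))" for p
  have step: "S (p + 1) + d (p + 1 - int r) = S p + d (p + 1)" for p
  proof -
    have "S (p + 1) + d (p + 1 - int r) = (\<Sum>j<Suc r. d (p + 1 - int j))"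
      by (simp add: S_def)
    also have "\<dots> = d (p + 1) + (\<Sum>j<r. d (p + 1 - int (Suc j)))"
      by (subst sum.lessThan_Suc_shift) simp
    finally show ?thesis by (simp add: S_def)
  qed
  define s where "s n = S (N + int n)" for n
  have dec: "s (Suc n) \<le> s n" for n
    using step[of "N + int n"] assms[of "N + int n + 1"] by (simp add: s_def algebra_simps)
  obtain n0 where n0: "\<And>n. s n0 \<le> s n"
    using arg_min_nat_lemma[of "\<lambda>_. True" _ s] by blast
  have const: "s n = s n0" if "n \<ge> n0" for n
    using n0[of n] lift_Suc_antimono_le[of s, OF dec that] by simp
  have "d p = d (p - int r)" if p: "p \<ge> N + int n0 + 1" for p
  proof -
    define n where "n = nat (p - 1 - N)"
    have n: "N + int n = p - 1" "n \<ge> n0" using p by (auto simp: n_def)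
    have "s (Suc n) = s n" using const[of n] const[of "Suc n"] n by simp
    moreover have "N + int (Suc n) = p" using n by simp
    ultimately have "S p = S (p - 1)" using n by (simp only: s_def)
    then show ?thesis using step[of "p - 1"] by simp
  qed
  then show ?thesis by (intro exI[of _ "N + int n0 + 1"]) auto
qed

context vectorspace
begin

text \<open>If \<open>Z\<close> is invertible, then \<open>t p = tr (Z\<^sup>-\<^sup>1 Y X | W p)\<close> satisfies
  \<open>dim (W p) = t p - t (p - s)\<close> and is periodic in \<open>p\<close>, so sums of dimensions vanish.\<close>

lemma commutator_vanishing:
  fixes W :: "int \<Rightarrow> 'c set" and s :: nat
  assumes ch: "char_zero K" and sub: "\<And>p. subspace K (W p) V" and sep: "\<And>p. separated (W p)"
    and X: "\<And>p. lin_on (W p) (W (p - 1)) X"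
    and Y: "\<And>p. lin_on (W p) (W (p - int s)) Y"
    and Z: "\<And>p. lin_on (W p) (W (p - int (Suc s))) Z"
    and com: "\<And>p x. x \<in> W p \<Longrightarrow> Y (X x) = Z x \<oplus>\<^bsub>V\<^esub> X (Y x)"
    and ZX: "\<And>p x. x \<in> W p \<Longrightarrow> Z (X x) = X (Z x)"
    and ZY: "\<And>p x. x \<in> W p \<Longrightarrow> Z (Y x) = Y (Z x)"
    and inj: "\<And>p x. \<lbrakk>p \<ge> N; x \<in> W p; Z x = \<zero>\<^bsub>V\<^esub>\<rbrakk> \<Longrightarrow> x = \<zero>\<^bsub>V\<^esub>"
  shows "\<exists>M. \<forall>p\<ge>M. W p = {\<zero>\<^bsub>V\<^esub>}"
proof -
  let ?r = "int (Suc s)"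
  note Wc = subspace_carrier[OF sub]
  have "\<forall>p. \<exists>n e \<epsilon>. dual_basis (W p) n e \<epsilon>"
    using separated_dual_basis[OF sep sub] by metis
  then obtain d E D where db: "\<And>p. dual_basis (W p) (d p) (E p) (D p)" by metis
  have injZ: "inj_on Z (W p)" if "p \<ge> N" for p
    by (rule lin_on_kernel_trivial[OF Z sub sub]) (use inj that in auto)
  note size = injective_dual_basis_size[OF ch sub sub Z injZ db db]
  \<comment> \<open>Injectivity alone gives \<open>d p \<le> d (p - ?r)\<close>; equality for large
    p is what makes \<open>Z\<close> onto.\<close>
  obtain M where M: "M \<ge> N" "\<And>p. p \<ge> M \<Longrightarrow> d p = d (p - ?r)"
    using eventually_periodic[of N d "Suc s"] size by blast
  have im: "Z ` W p = W (p - ?r)" if "p \<ge> M" for p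
    using size[of p] M that by auto
  define Zi where "Zi p = inv_into (W p) Z" for p
  have linZi: "lin_on (W (p - ?r)) (W p) (Zi p)" if "p \<ge> M" for p
    unfolding Zi_def by (rule lin_on_inv[OF Z sub injZ im]) (use that M in auto)
  have ZiZ: "Zi p (Z x) = x" if "p \<ge> M" "x \<in> W p" for p x
    unfolding Zi_def using that M injZ by simp
  \<comment> \<open>What commutes with \<open>Z\<close> commutes with its inverses.
    \<open>Zi\<close> is indexed by the degree of its target, so the index shifts by the degree of
    A.\<close>
  have commute: "A (Zi p y) = Zi (p - int a) (A y)"
    if A: "\<And>p. lin_on (W p) (W (p - int a)) A" and ZA: "\<And>p x. x \<in> W p \<Longrightarrow> Z (A x) = A (Z x)"
      and p: "p - int a \<ge> M" and y: "y \<in> W (p - ?r)" for A a p y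
  proof -
    from p have "p \<ge> M" by simp
    then obtain x where x: "x \<in> W p" "y = Z x" using im y by blast
    then have "Zi (p - int a) (A y) = Zi (p - int a) (Z (A x))" using ZA by simp
    also have "\<dots> = A x" using ZiZ p x lin_onD(1)[OF A] by blast
    finally show ?thesis using ZiZ x \<open>p \<ge> M\<close> by simp
  qed
  have X1: "\<And>p. lin_on (W p) (W (p - int 1)) X" using X by simp
  have YX: "lin_on (W p) (W (p - ?r)) (\<lambda>x. Y (X x))" for p
    using lin_on_comp[OF X Y, of p] by (simp add: algebra_simps)
  have XY: "lin_on (W p) (W (p - ?r)) (\<lambda>x. X (Y x))" for p
    using lin_on_comp[OF Y X, of p] by (simp add: algebra_simps)
  define T where "T p = trace (d p) (E p) (D p) (\<lambda>x. Zi p (Y (X x)))" for p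
  have Tc: "T p \<in> carrier K" if "p \<ge> M" for p
    unfolding T_def by (rule trace_closed[OF db])
      (use lin_onD(1)[OF lin_on_comp[OF YX linZi[OF that]]] Wc in auto)
  \<comment> \<open>Moving \<open>Zi p\<close> to the other end of the trace replaces the space W p
    by W (p - ?r); commuting it back past X and Y restores the operator there.\<close>
  have periodic: "T p = T (p - ?r)" if p: "p - ?r \<ge> M" for p
  proof -
    have pM: "p \<ge> M" using p by simp
    have "T p = trace (d (p - ?r)) (E (p - ?r)) (D (p - ?r)) (\<lambda>x. Y (X (Zi p x)))"
      unfolding T_def by (rule trace_commute[OF sub sub db db YX linZi[OF pM]])
    also have "\<dots> = T (p - ?r)" unfolding T_def
    proof (rule trace_cong[OF db])
      fix x assume x: "x \<in> W (p - ?r)"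
      have "X x \<in> W (p - 1 - ?r)" using lin_onD(1)[OF X x] by (simp add: algebra_simps)
      then have "Y (Zi (p - 1) (X x)) = Zi (p - 1 - int s) (Y (X x))"
        by (intro commute[OF Y ZY]) (use p in auto)
      moreover have "X (Zi p x) = Zi (p - 1) (X x)"
        using commute[OF X1 ZX _ x] p by simp
      ultimately show "Y (X (Zi p x)) = Zi (p - ?r) (Y (X x))" by (simp add: algebra_simps)
      show "Zi (p - ?r) (Y (X x)) \<in> carrier V"
        using lin_onD(1)[OF lin_on_comp[OF YX linZi[OF p]] x] Wc by blast
    qed
    finally show ?thesis .
  qed
  \<comment> \<open>Since YX = Z + XY, the operator under the trace is 1 + Z^{-1} X Y. The trace of
    the second term is moved to W (p - s), where it becomes \<open>T (p - int s)\<close>.\<close>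
  have step: "T p = ([d p] \<cdot>\<^bsub>K\<^esub> \<one>\<^bsub>K\<^esub>) \<oplus>\<^bsub>K\<^esub> T (p - int s)" if p: "p - int s \<ge> M" for p
  proof -
    have pM: "p \<ge> M" using p by simp
    have XZ: "lin_on (W (p - int s)) (W p) (\<lambda>x. Zi p (X x))"
      using lin_on_comp[OF X[of "p - int s"], of "W p" "Zi p"] linZi[OF pM] by (simp add: algebra_simps)
    have "trace (d p) (E p) (D p) (\<lambda>x. Zi p (X (Y x))) =
        trace (d (p - int s)) (E (p - int s)) (D (p - int s)) (\<lambda>x. Y (Zi p (X x)))"
      by (rule trace_commute[OF sub sub db db Y XZ])
    also have "\<dots> = T (p - int s)" unfolding T_def
    proof (rule trace_cong[OF db])
      fix x assume x: "x \<in> W (p - int s)"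
      have "X x \<in> W (p - ?r)" using lin_onD(1)[OF X x] by (simp add: algebra_simps)
      then show "Y (Zi p (X x)) = Zi (p - int s) (Y (X x))"
        by (intro commute[OF Y ZY]) (use p in auto)
      show "Zi (p - int s) (Y (X x)) \<in> carrier V"
        using lin_onD(1)[OF lin_on_comp[OF YX linZi[OF p]] x] Wc by blast
    qed
    finally have 1: "trace (d p) (E p) (D p) (\<lambda>x. Zi p (X (Y x))) = T (p - int s)" .
    have cl: "Zi p (X (Y x)) \<in> W p" if "x \<in> W p" for x
      using lin_onD(1)[OF lin_on_comp[OF XY linZi[OF pM]] that] .
    have "T p = trace (d p) (E p) (D p) (\<lambda>x. x \<oplus>\<^bsub>V\<^esub> Zi p (X (Y x)))"
      unfolding T_def
    proof (rule trace_cong[OF db])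
      fix x assume x: "x \<in> W p"
      have "Z x \<in> W (p - ?r)" "X (Y x) \<in> W (p - ?r)" using lin_onD(1)[OF Z x] lin_onD(1)[OF XY x] .
      then have "Zi p (Z x \<oplus>\<^bsub>V\<^esub> X (Y x)) = Zi p (Z x) \<oplus>\<^bsub>V\<^esub> Zi p (X (Y x))"
        by (rule lin_onD(2)[OF linZi[OF pM]])
      then show "Zi p (Y (X x)) = x \<oplus>\<^bsub>V\<^esub> Zi p (X (Y x))" using com[OF x] ZiZ[OF pM x] by simp
      show "x \<oplus>\<^bsub>V\<^esub> Zi p (X (Y x)) \<in> carrier V" using x cl[OF x] Wc by blast
    qed
    also have "\<dots> = trace (d p) (E p) (D p) (\<lambda>x. x) \<oplus>\<^bsub>K\<^esub> trace (d p) (E p) (D p) (\<lambda>x. Zi p (X (Y x)))"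
      by (rule trace_add[OF db]) (use cl Wc in auto)
    finally show ?thesis unfolding 1 trace_id[OF db] .
  qed
  have steps: "p - int (k * s) \<ge> M \<Longrightarrow>
      T p = ([(\<Sum>j<k. d (p - int (j * s)))] \<cdot>\<^bsub>K\<^esub> \<one>\<^bsub>K\<^esub>) \<oplus>\<^bsub>K\<^esub> T (p - int (k * s))" for p k
  proof (induction k)
    case 0 then show ?case using Tc[of p] by simp
  next
    case (Suc k)
    let ?q = "p - int (k * s)"
    have q: "?q - int s = p - int (Suc k * s)" by (simp add: algebra_simps)
    have qM: "?q - int s \<ge> M" using Suc.prems unfolding q .
    have "T p = ([(\<Sum>j<k. d (p - int (j * s)))] \<cdot>\<^bsub>K\<^esub> \<one>\<^bsub>K\<^esub>) \<oplus>\<^bsub>K\<^esub>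
        (([d ?q] \<cdot>\<^bsub>K\<^esub> \<one>\<^bsub>K\<^esub>) \<oplus>\<^bsub>K\<^esub> T (?q - int s))"
      using Suc.IH qM step[OF qM] by simp
    also have "\<dots> = (([(\<Sum>j<k. d (p - int (j * s)))] \<cdot>\<^bsub>K\<^esub> \<one>\<^bsub>K\<^esub>) \<oplus>\<^bsub>K\<^esub>
        ([d ?q] \<cdot>\<^bsub>K\<^esub> \<one>\<^bsub>K\<^esub>)) \<oplus>\<^bsub>K\<^esub> T (?q - int s)"
      using Tc[OF qM] by (simp add: R.a_assoc)
    finally show ?case unfolding q by (simp add: R.add.nat_pow_mult)
  qed
  have periods: "p - int (k * Suc s) \<ge> M \<Longrightarrow> T p = T (p - int (k * Suc s))" for p k
  proof (induction k)
    case (Suc k)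
    let ?q = "p - int (k * Suc s)"
    have q: "?q - ?r = p - int (Suc k * Suc s)" by (simp add: algebra_simps)
    show ?case using Suc.IH periodic[of ?q] Suc.prems unfolding q[symmetric] by simp
  qed simp
  \<comment> \<open>Descending s + 1 times by s and s times by s + 1 leads to the same degree. Both
    descents express \<open>T p\<close>, so the s + 1 dimensions met on the first one add up to zero
    in \<open>K\<close>, and d p is one of them.\<close>
  have "W p = {\<zero>\<^bsub>V\<^esub>}" if p: "p \<ge> M + int (s * Suc s)" for p
  proof -
    let ?n = "\<Sum>j<Suc s. d (p - int (j * s))"
    have pM: "p - int (s * Suc s) \<ge> M" using p by linarith
    have "T p = ([?n] \<cdot>\<^bsub>K\<^esub> \<one>\<^bsub>K\<^esub>) \<oplus>\<^bsub>K\<^esub> T p"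
      using steps[of p "Suc s"] periods[OF pM] pM by (simp only: mult.commute[of "Suc s" s])
    moreover have "T p \<in> carrier K" using Tc[of p] pM by simp
    ultimately have "[?n] \<cdot>\<^bsub>K\<^esub> \<one>\<^bsub>K\<^esub> = [(0::nat)] \<cdot>\<^bsub>K\<^esub> \<one>\<^bsub>K\<^esub>"
      by (metis R.add.nat_pow_0 R.add.nat_pow_closed R.add.r_cancel_one' R.one_closed)
    then have "?n = 0" by (rule char_zero_cancel[OF ch])
    then have "d p = 0" by (simp add: sum.lessThan_Suc_shift del: sum.lessThan_Suc)
    then have "x = \<zero>\<^bsub>V\<^esub>" if "x \<in> W p" for x using dual_basisD(4)[OF db that] by simp
    then show ?thesis using subspace_zero[OF sub] by blast
  qed
  then show ?thesis by blast
qed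

end

section \<open>Finite-dimensional degrees, and annihilators of the lower degrees\<close>

context graded_lie
begin

lemma functional_component: "functional \<phi> \<Longrightarrow> functional (\<lambda>x. \<phi> (component p x))"
  by (rule functional_compose) (auto simp: component_add component_smult)

lemma functional_bracket: "\<lbrakk>functional \<phi>; v \<in> carrier L\<rbrakk> \<Longrightarrow> functional (\<lambda>x. \<phi> (x \<otimes> v))"
  by (rule functional_compose) (auto simp: bracket_add_left bracket_smult_left bracket_closed)

text \<open>The components of a finite spanning set occupy finitely many degrees. Conversely,
  separating functionals of the finitely many nonzero degrees are composed with the component
  maps.\<close>

lemma fin_dim_iff: "fin_dim \<longleftrightarrow> (\<forall>p. separated (G p)) \<and> finite {p. G p \<noteq> {\<zero>}}"
proof
  assume "fin_dim"
  then have "separated (carrier L)" by (simp add: fin_dim_iff_separated)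
  then have "\<forall>p. separated (G p)" using separated_subset G_closed by blast
  moreover obtain B where B: "finite B" "B \<subseteq> carrier L" "span B = carrier L"
    using \<open>fin_dim\<close> unfolding fin_dim_def by blast
  let ?P = "\<Union>b\<in>B. {p. component p b \<noteq> \<zero>}"
  have fin: "finite ?P" using B component_finite by blast
  have "B \<subseteq> graded_sum L G ?P" using B by (auto simp: graded_sum_iff)
  then have "span B \<subseteq> graded_sum L G ?P"
    by (rule span_is_subset) (rule is_module, rule subspace_graded_sum)
  then have "x = \<zero>" if "x \<in> G p" "p \<notin> ?P" for x p
    using that B(3) component_same[OF that(1)] G_closed[OF that(1)] by (auto simp: graded_sum_iff)
  then have "{p. G p \<noteq> {\<zero>}} \<subseteq> ?P" using G_zero by blast
  then have "finite {p. G p \<noteq> {\<zero>}}" using fin finite_subset by blast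
  ultimately show "(\<forall>p. separated (G p)) \<and> finite {p. G p \<noteq> {\<zero>}}" by blast
next
  assume *: "(\<forall>p. separated (G p)) \<and> finite {p. G p \<noteq> {\<zero>}}"
  then obtain \<Phi> where \<Phi>: "\<And>p. finite (\<Phi> p)" "\<And>p \<phi>. \<phi> \<in> \<Phi> p \<Longrightarrow> functional \<phi>"
    "\<And>p x. x \<in> G p \<Longrightarrow> (\<forall>\<phi>\<in>\<Phi> p. \<phi> x = \<zero>\<^bsub>K\<^esub>) \<Longrightarrow> x = \<zero>"
    unfolding separated_def by metis
  let ?P = "{p. G p \<noteq> {\<zero>}}" and ?\<Psi> = "\<lambda>p. (\<lambda>\<phi> x. \<phi> (component p x)) ` \<Phi> p"
  have "separated (carrier L)" unfolding separated_def
  proof (intro exI conjI)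
    show "finite (\<Union>(?\<Psi> ` ?P))" using \<Phi>(1) * by blast
    show "\<forall>\<phi>\<in>\<Union>(?\<Psi> ` ?P). functional \<phi>"
    proof
      fix \<psi> assume "\<psi> \<in> \<Union>(?\<Psi> ` ?P)"
      then obtain p \<phi> where "\<phi> \<in> \<Phi> p" "\<psi> = (\<lambda>x. \<phi> (component p x))" by blast
      then show "functional \<psi>" using functional_component[OF \<Phi>(2)] by simp
    qed
    show "\<forall>x\<in>carrier L. (\<forall>\<phi>\<in>\<Union>(?\<Psi> ` ?P). \<phi> x = \<zero>\<^bsub>K\<^esub>) \<longrightarrow> x = \<zero>"
    proof (intro ballI impI)
      fix x assume x: "x \<in> carrier L" "\<forall>\<phi>\<in>\<Union>(?\<Psi> ` ?P). \<phi> x = \<zero>\<^bsub>K\<^esub>"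
      show "x = \<zero>"
      proof (rule eq_zero_if_components[OF x(1)])
        fix p show "component p x = \<zero>"
        proof (cases "p \<in> ?P")
          case True
          then have "\<forall>\<phi>\<in>\<Phi> p. \<phi> (component p x) = \<zero>\<^bsub>K\<^esub>" using x(2) by auto
          then show ?thesis using \<Phi>(3) component_in[OF x(1)] by blast
        next
          case False then show ?thesis using component_in[OF x(1), of p] by auto
        qed
      qed
    qed
  qed
  then show "fin_dim" by (simp add: fin_dim_iff_separated)
qed

lemma annihilator_subspace: "x \<in> carrier L \<Longrightarrow> subspace K {z \<in> carrier L. x \<otimes> z = \<zero>} L"
  by (rule subspaceI) (auto simp: bracket_add_right bracket_smult_right)

lemma annihilates_span:
  assumes "x \<in> carrier L" "B \<subseteq> carrier L" "\<And>b. b \<in> B \<Longrightarrow> x \<otimes> b = \<zero>" "z \<in> span B"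
  shows "x \<otimes> z = \<zero>"
proof -
  have "B \<subseteq> {z \<in> carrier L. x \<otimes> z = \<zero>}" using assms by auto
  then have "span B \<subseteq> {z \<in> carrier L. x \<otimes> z = \<zero>}"
    by (rule span_is_subset) (rule is_module, rule annihilator_subspace[OF assms(1)])
  then show ?thesis using assms(4) by blast
qed

text \<open>By effectivity, an element of degree p + 1 is determined by its brackets with the finite
  set \<open>B\<close>, which lie in degree p. Functionals for degree p thus yield finitely many for
  degree p + 1.\<close>

lemma separated_effective:
  assumes sep: "separated (G (-1))"
    and B: "finite B" "B \<subseteq> G (-1)" "G (-1) \<subseteq> span B"
    and eff: "\<And>p x. \<lbrakk>p \<ge> 0; x \<in> G p; \<forall>v\<in>G (-1). x \<otimes> v = \<zero>\<rbrakk> \<Longrightarrow> x = \<zero>"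
  shows "p \<ge> -1 \<Longrightarrow> separated (G p)"
proof (induction p rule: int_ge_induct)
  case base then show ?case by (rule sep)
next
  case (step p)
  have Bc: "B \<subseteq> carrier L" using B(2) G_closed by blast
  obtain \<Phi> where \<Phi>: "finite \<Phi>" "\<forall>\<phi>\<in>\<Phi>. functional \<phi>"
    "\<forall>x\<in>G p. (\<forall>\<phi>\<in>\<Phi>. \<phi> x = \<zero>\<^bsub>K\<^esub>) \<longrightarrow> x = \<zero>"
    using step.IH unfolding separated_def by auto
  let ?\<Psi> = "(\<lambda>(\<phi>, v) x. \<phi> (x \<otimes> v)) ` (\<Phi> \<times> B)"
  have "x = \<zero>" if x: "x \<in> G (p + 1)" "\<forall>\<psi>\<in>?\<Psi>. \<psi> x = \<zero>\<^bsub>K\<^esub>" for x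
  proof (rule eff[OF _ x(1)])
    have "x \<otimes> b = \<zero>" if b: "b \<in> B" for b
    proof -
      have "x \<otimes> b \<in> G p" using x(1) b B(2) by (auto intro: G_bracket)
      moreover have "\<forall>\<phi>\<in>\<Phi>. \<phi> (x \<otimes> b) = \<zero>\<^bsub>K\<^esub>" using x(2) b by force
      ultimately show ?thesis using \<Phi>(3) by blast
    qed
    then show "\<forall>v\<in>G (-1). x \<otimes> v = \<zero>" using annihilates_span[OF G_closed[OF x(1)] Bc] B(3) by blast
  qed (use step in simp)
  then show ?case unfolding separated_def
    by (intro exI[of _ ?\<Psi>]) (use \<Phi> B Bc in \<open>auto intro!: functional_bracket\<close>)
qed

text \<open>Interpolates between two consecutive annihilators: \<open>A = {}\<close> asks for
  annihilation of the degrees below - r only, while an \<open>A\<close> that spans degree - r adds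
  that degree to them.\<close>

definition annihilator :: "int \<Rightarrow> 'a set \<Rightarrow> int \<Rightarrow> 'a set" where
  "annihilator r A p = {x \<in> G p. (\<forall>q\<le>-r-1. \<forall>y\<in>G q. x \<otimes> y = \<zero>) \<and> (\<forall>a\<in>A. x \<otimes> a = \<zero>)}"

text \<open>On the annihilator of everything below the degree of \<open>z = [v, y]\<close>, the operator \<open>ad z\<close> is
  the commutator of \<open>ad v\<close> and \<open>ad y\<close> and commutes with both.\<close>

lemma annihilator_vanishes_step:
  assumes ch: "char_zero K" and sep: "\<And>p. separated (G p)" and s: "s \<ge> 1"
    and A: "A \<subseteq> G (- int s - 1)" and v: "v \<in> G (-1)" and y: "y \<in> G (- int s)"
    and van: "\<And>p. p \<ge> N \<Longrightarrow> annihilator (int s + 1) (insert (v \<otimes> y) A) p = {\<zero>}"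
  shows "\<exists>M. \<forall>p\<ge>M. annihilator (int s + 1) A p = {\<zero>}"
proof (rule commutator_vanishing[OF ch, where s = s and N = N])
  let ?W = "annihilator (int s + 1) A" and ?b = "v \<otimes> y"
  have b: "?b \<in> G (- int s - 1)" using v y by (rule G_bracket) simp
  note c = G_closed[OF v] G_closed[OF y] G_closed[OF b]
  have WG: "x \<in> G p" if "x \<in> ?W p" for x p using that by (simp add: annihilator_def)
  have W1: "x \<otimes> u = \<zero>" if "x \<in> ?W p" "u \<in> G q" "q \<le> - int s - 2" for x p u q
  proof -
    have "q \<le> - (int s + 1) - 1" using that(3) by simp
    then show ?thesis using that(1,2) unfolding annihilator_def by blast
  qed
  have W2: "x \<otimes> a = \<zero>" if "x \<in> ?W p" "a \<in> A" for x p a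
    using that by (auto simp: annihilator_def)
  fix p
  show "subspace K (?W p) L"
    by (rule subspaceI)
      (use A in \<open>auto simp: annihilator_def G_closed bracket_add_left bracket_smult_left subset_eq
        intro: subspace_add[OF G_subspace] subspace_smult[OF G_subspace]\<close>)
  show "separated (?W p)" by (rule separated_subset[OF sep]) (use WG in blast)
  have shift: "lin_on (?W p) (?W (p - k)) (\<lambda>x. x \<otimes> w)" if w: "w \<in> G (- k)" "k \<ge> 1" for k w p
  proof -
    have "x \<otimes> w \<in> ?W (p - k)" if x: "x \<in> ?W p" for x
    proof -
      \<comment> \<open>Leibniz rule: x \<otimes> u is zero by assumption, and w \<otimes> u has
        degree at most - s - 2, where x annihilates everything.\<close>
      have vanish: "(x \<otimes> w) \<otimes> u = \<zero>" if u: "u \<in> G q" "q \<le> - int s - 1" "x \<otimes> u = \<zero>" for u q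
      proof -
        have "(x \<otimes> w) \<otimes> u = (x \<otimes> u) \<otimes> w \<oplus> x \<otimes> (w \<otimes> u)"
          using G_closed[OF WG[OF x]] G_closed[OF w(1)] G_closed[OF u(1)] by (rule jacobi_right)
        moreover have "x \<otimes> (w \<otimes> u) = \<zero>" 
          by (rule W1[OF x G_bracket[OF w(1) u(1) HOL.refl]]) (use w u in simp)
        ultimately show ?thesis using u w by (simp add: G_closed)
      qed
      have "(x \<otimes> w) \<otimes> u = \<zero>" if "u \<in> G q" "q \<le> - int s - 2" for u q
        by (rule vanish[OF that(1)]) (use W1[OF x that] that in auto)
      moreover have "(x \<otimes> w) \<otimes> a = \<zero>" if "a \<in> A" for a
        by (rule vanish[of a "- int s - 1"]) (use W2[OF x that] that A in auto)
      moreover have "x \<otimes> w \<in> G (p - k)" using WG[OF x] w(1) by (rule G_bracket) simp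
      ultimately show ?thesis by (auto simp: annihilator_def)
    qed
    then show ?thesis unfolding lin_on_def
      using w by (auto simp: bracket_add_left bracket_smult_left G_closed[OF WG] G_closed)
  qed
  show "lin_on (?W p) (?W (p - 1)) (\<lambda>x. x \<otimes> v)" by (rule shift) (use v in auto)
  show "lin_on (?W p) (?W (p - int s)) (\<lambda>x. x \<otimes> y)" by (rule shift) (use y s in auto)
  show "lin_on (?W p) (?W (p - int (Suc s))) (\<lambda>x. x \<otimes> ?b)" 
  proof -
    have "?b \<in> G (- (1 + int s))" using v y by (rule G_bracket) simp
    then show ?thesis unfolding of_nat_Suc by (rule shift) simp
  qed
  fix x assume x: "x \<in> ?W p"
  note xc = G_closed[OF WG[OF x]]
  show "(x \<otimes> v) \<otimes> y = x \<otimes> ?b \<oplus> (x \<otimes> y) \<otimes> v"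
    using jacobi_right[OF xc c(1,2)] xc c by (simp add: M.a_comm bracket_closed)
  have com: "(x \<otimes> w) \<otimes> ?b = (x \<otimes> ?b) \<otimes> w" if w: "w \<in> G (-k)" "k \<ge> 1" for k w
  proof -
    have "x \<otimes> (w \<otimes> ?b) = \<zero>"
      by (rule W1[OF x G_bracket[OF w(1) b HOL.refl]]) (use w in simp)
    then show ?thesis using jacobi_right[OF xc G_closed[OF w(1)] c(3)] xc c G_closed[OF w(1)]
      by (simp add: bracket_closed)
  qed
  show "(x \<otimes> v) \<otimes> ?b = (x \<otimes> ?b) \<otimes> v" by (rule com[of v 1]) (use v in auto)
  show "(x \<otimes> y) \<otimes> ?b = (x \<otimes> ?b) \<otimes> y" by (rule com[of y "int s"]) (use y s in auto)
  assume "p \<ge> N" "x \<otimes> ?b = \<zero>"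
  \<comment> \<open>A kernel element of \<open>ad ?b\<close> satisfies the condition that was
    dropped, so it lies in the smaller annihilator, which is zero by \<open>van\<close>.\<close>
  then have "x \<in> annihilator (int s + 1) (insert ?b A) p" using x by (simp add: annihilator_def)
  then show "x = \<zero>" using van[OF \<open>p \<ge> N\<close>] by blast
qed

text \<open>A consists of brackets v \<otimes> y rather than arbitrary vectors of their degree,
  since each removal has to present the dropped vector through the commutator of \<open>ad v\<close>
  and \<open>ad y\<close>.\<close>

lemma annihilator_vanishes_induct:
  assumes ch: "char_zero K" and sep: "\<And>p. separated (G p)" and s: "s \<ge> 1"
    and "finite A" "A \<subseteq> {v \<otimes> y | v y. v \<in> G (-1) \<and> y \<in> G (- int s)}"
    and "\<exists>N. \<forall>p\<ge>N. annihilator (int s + 1) A p = {\<zero>}"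
  shows "\<exists>N. \<forall>p\<ge>N. annihilator (int s + 1) {} p = {\<zero>}"
  using assms(4-)
proof (induction A rule: finite_induct)
  case empty then show ?case by blast
next
  case (insert b A)
  obtain v y where vy: "v \<in> G (-1)" "y \<in> G (- int s)" "b = v \<otimes> y" using insert.prems by blast
  obtain N where "\<And>p. p \<ge> N \<Longrightarrow> annihilator (int s + 1) (insert (v \<otimes> y) A) p = {\<zero>}"
    using insert.prems vy by blast
  moreover have "A \<subseteq> G (- int s - 1)" using insert.prems by (auto intro!: G_bracket)
  ultimately have "\<exists>M. \<forall>p\<ge>M. annihilator (int s + 1) A p = {\<zero>}"
    using annihilator_vanishes_step[OF ch sep s _ vy(1,2)] by blast
  then show ?case using insert by blast
qed

lemma vanishing_of_abelian_part:
  assumes ch: "char_zero K" and sep: "\<And>p. separated (G p)"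
    and bot: "\<And>p. p < - \<mu> \<Longrightarrow> G p = {\<zero>}"
    and gen: "\<And>s::nat. s \<ge> 1 \<Longrightarrow> \<exists>B. finite B \<and> B \<subseteq> {v \<otimes> y | v y. v \<in> G (-1) \<and> y \<in> G (- int s)} \<and>
      G (- int s - 1) \<subseteq> span B"
    and base: "\<exists>N. \<forall>p\<ge>N. annihilator 1 {} p = {\<zero>}"
  shows "\<exists>N. \<forall>p\<ge>N. G p = {\<zero>}"
proof -
  have "\<exists>N. \<forall>p\<ge>N. annihilator (int (Suc n)) {} p = {\<zero>}" for n
  proof (induction n)
    case 0 then show ?case using base by simp
  next
    case (Suc n)
    let ?s = "Suc n"
    obtain B where B: "finite B" "B \<subseteq> {v \<otimes> y | v y. v \<in> G (-1) \<and> y \<in> G (- int ?s)}"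
      "G (- int ?s - 1) \<subseteq> span B" using gen[of ?s] by auto
    have BG: "B \<subseteq> G (- int ?s - 1)" using B(2) by (auto intro!: G_bracket)
    have Bc: "B \<subseteq> carrier L" using BG G_closed by blast
    \<comment> \<open>\<open>B\<close> spans degree - ?s - 1, so annihilating \<open>B\<close> adds
      this whole degree to the ones below it.\<close>
    have "annihilator (int ?s + 1) B p \<subseteq> annihilator (int ?s) {} p" for p
    proof
      fix x assume x: "x \<in> annihilator (int ?s + 1) B p"
      then have xG: "x \<in> G p" by (simp add: annihilator_def)
      have "x \<otimes> y = \<zero>" if "y \<in> G q" "q \<le> - int ?s - 1" for y q
      proof (cases "q = - int ?s - 1")
        case True
        then show ?thesis using that B(3) x annihilates_span[OF G_closed[OF xG] Bc]
          by (auto simp: annihilator_def)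
      next
        case False
        then have "q \<le> - (int ?s + 1) - 1" using that(2) by simp
        then show ?thesis using x that(1) unfolding annihilator_def by blast
      qed
      then show "x \<in> annihilator (int ?s) {} p" using xG by (simp add: annihilator_def)
    qed
    moreover have "\<zero> \<in> annihilator (int ?s + 1) B p" for p
      using Bc by (auto simp: annihilator_def G_closed)
    ultimately have "\<exists>N. \<forall>p\<ge>N. annihilator (int ?s + 1) B p = {\<zero>}" using Suc by blast
    from annihilator_vanishes_induct[OF ch sep _ B(1,2) this] show ?case
      by (simp add: algebra_simps)
  qed
  \<comment> \<open>At this index the annihilated degrees lie below - \<mu> and are zero, so the
    annihilator is all of G p.\<close>
  from this[of "nat \<mu>"] obtain N where N: "\<And>p. p \<ge> N \<Longrightarrow> annihilator (int (Suc (nat \<mu>))) {} p = {\<zero>}"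
    by blast
  have "annihilator (int (Suc (nat \<mu>))) {} p = G p" for p
    using bot by (auto simp: annihilator_def G_closed)
  then show ?thesis using N by blast
qed

end

section \<open>Size bounds that bring prolongations into the test type of maximality\<close>

section \<open>Cardinality bounds\<close>

text \<open>Sequences of scalars form the type on which maximality is tested. A bare injection of
  sets is enough, because the Lie algebra structure can be carried along it.\<close>

definition seq_embeddable :: "'k itself \<Rightarrow> 'a set \<Rightarrow> bool" where
  "seq_embeddable T A \<longleftrightarrow> (\<exists>f :: 'a \<Rightarrow> nat \<Rightarrow> 'k. inj_on f A)"

lemma seq_embeddable_subset: "\<lbrakk>seq_embeddable T B; A \<subseteq> B\<rbrakk> \<Longrightarrow> seq_embeddable T A"
  unfolding seq_embeddable_def using inj_on_subset by blast

lemma seq_embeddable_image: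
  assumes "seq_embeddable (T :: 'k itself) A" shows "seq_embeddable T (f ` A)"
proof -
  obtain h :: "_ \<Rightarrow> nat \<Rightarrow> 'k" where h: "inj_on h A"
    using assms unfolding seq_embeddable_def by blast
  have "inj_on (h \<circ> inv_into A f) (f ` A)"
    by (rule comp_inj_on[OF inj_on_inv_into[OF subset_refl] inj_on_subset[OF h]])
      (auto intro: inv_into_into)
  then show ?thesis unfolding seq_embeddable_def by blast
qed

text \<open>Countably many sequences are interleaved into one by the pairing of natural numbers, so
  a separating countable family of maps into small sets suffices.\<close>

lemma seq_embeddable_family:
  fixes F :: "'i::countable \<Rightarrow> 'a \<Rightarrow> 'b"
  assumes B: "\<And>i. seq_embeddable T (B i)" and F: "\<And>i x. x \<in> A \<Longrightarrow> F i x \<in> B i"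
    and sep: "\<And>x y. \<lbrakk>x \<in> A; y \<in> A; \<And>i. F i x = F i y\<rbrakk> \<Longrightarrow> x = y"
  shows "seq_embeddable (T :: 'k itself) A"
proof -
  obtain f :: "'i \<Rightarrow> 'b \<Rightarrow> nat \<Rightarrow> 'k" where f: "\<And>i. inj_on (f i) (B i)"
    using B unfolding seq_embeddable_def by metis
  define h where "h x n = f (from_nat (fst (prod_decode n))) (F (from_nat (fst (prod_decode n))) x)
    (snd (prod_decode n))" for x n
  have "inj_on h A"
  proof (rule inj_onI)
    fix x y assume xy: "x \<in> A" "y \<in> A" "h x = h y"
    have "F i x = F i y" for i
    proof (rule inj_onD[OF f])
      show "f i (F i x) = f i (F i y)"
      proof
        fix n
        show "f i (F i x) n = f i (F i y) n"
          using fun_cong[OF xy(3), of "prod_encode (to_nat i, n)"] by (simp add: h_def)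
      qed
    qed (use F xy in auto)
    then show "x = y" using sep xy by blast
  qed
  then show ?thesis unfolding seq_embeddable_def by blast
qed

text \<open>The label of the node of a term that is reached by a path of left and right turns.\<close>

primrec term_code :: "('v \<Rightarrow> nat \<Rightarrow> 'k) \<Rightarrow> (nat \<Rightarrow> nat \<Rightarrow> 'k) \<Rightarrow> ('k, 'v) lie_term \<Rightarrow>
    bool list \<Rightarrow> nat \<Rightarrow> 'k" where
  "term_code g c (Gen v) = case_list (c 0) (\<lambda>b p. g v)"
| "term_code g c Zero = case_list (c 1) (\<lambda>b p. c 1)"
| "term_code g c (Plus s t) =
    case_list (c 2) (\<lambda>b p. if b then term_code g c s p else term_code g c t p)"
| "term_code g c (Scale a t) =
    case_list (c 3) (\<lambda>b p. if b then term_code g c t p else (\<lambda>_. a))"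
| "term_code g c (Br s t) =
    case_list (c 4) (\<lambda>b p. if b then term_code g c s p else term_code g c t p)"

text \<open>The label at the empty path identifies the constructor because c is injective, and the
  paths below it return the codes of the subterms. A scalar is stored as a constant sequence, a
  generator through g.\<close>

lemma term_code_inj:
  assumes g: "inj_on g (carrier V)" and c: "inj c"
  shows "\<lbrakk>s \<in> lie_terms K V; t \<in> lie_terms K V; term_code g c s = term_code g c t\<rbrakk> \<Longrightarrow> s = t"
proof (induction arbitrary: t rule: lie_terms.induct)
  case (Gen v)
  have "term_code g c t [] = c 0" using fun_cong[OF Gen(3), of "[]"] by simp
  then obtain w where w: "t = Gen w" using injD[OF c] by (cases t) fastforce+
  then have "w \<in> carrier V" using Gen(2) by (auto elim: lie_terms.cases)
  then show ?case using fun_cong[OF Gen(3), of "[True]"] w Gen(1) inj_onD[OF g] by simp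
next
  case Zero
  have "term_code g c t [] = c 1" using fun_cong[OF Zero(2), of "[]"] by simp
  then show ?case using injD[OF c] by (cases t) fastforce+
next
  case (Plus s1 s2)
  have "term_code g c t [] = c 2" using fun_cong[OF Plus.prems(2), of "[]"] by simp
  then obtain t1 t2 where t: "t = Plus t1 t2" using injD[OF c] by (cases t) fastforce+
  have "t1 \<in> lie_terms K V" "t2 \<in> lie_terms K V"
    using Plus.prems(1) unfolding t by (auto elim: lie_terms.cases)
  moreover have "term_code g c s1 = term_code g c t1"
  proof
    fix p show "term_code g c s1 p = term_code g c t1 p"
      using fun_cong[OF Plus.prems(2), of "True # p"] unfolding t by simp
  qed
  moreover have "term_code g c s2 = term_code g c t2"
  proof
    fix p show "term_code g c s2 p = term_code g c t2 p"
      using fun_cong[OF Plus.prems(2), of "False # p"] unfolding t by simp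
  qed
  ultimately show ?case using Plus.IH t by simp
next
  case (Scale a s1)
  have "term_code g c t [] = c 3" using fun_cong[OF Scale.prems(2), of "[]"] by simp
  then obtain b t1 where t: "t = Scale b t1" using injD[OF c] by (cases t) fastforce+
  have "t1 \<in> lie_terms K V"
    using Scale.prems(1) unfolding t by (auto elim: lie_terms.cases)
  moreover have "term_code g c s1 = term_code g c t1"
  proof
    fix p show "term_code g c s1 p = term_code g c t1 p"
      using fun_cong[OF Scale.prems(2), of "True # p"] unfolding t by simp
  qed
  moreover have "a = b"
    using fun_cong[OF fun_cong[OF Scale.prems(2), of "[False]"], of 0] unfolding t by simp
  ultimately show ?case using Scale.IH t by simp
next
  case (Br s1 s2)
  have "term_code g c t [] = c 4" using fun_cong[OF Br.prems(2), of "[]"] by simp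
  then obtain t1 t2 where t: "t = Br t1 t2" using injD[OF c] by (cases t) fastforce+
  have "t1 \<in> lie_terms K V" "t2 \<in> lie_terms K V"
    using Br.prems(1) unfolding t by (auto elim: lie_terms.cases)
  moreover have "term_code g c s1 = term_code g c t1"
  proof
    fix p show "term_code g c s1 p = term_code g c t1 p"
      using fun_cong[OF Br.prems(2), of "True # p"] unfolding t by simp
  qed
  moreover have "term_code g c s2 = term_code g c t2"
  proof
    fix p show "term_code g c s2 p = term_code g c t2 p"
      using fun_cong[OF Br.prems(2), of "False # p"] unfolding t by simp
  qed
  ultimately show ?case using Br.IH t by simp
qed

lemma seq_embeddable_lie_terms:
  fixes K :: "('k, 'r) ring_scheme"
  assumes V: "seq_embeddable TYPE('k) (carrier V)" and K: "field K"
  shows "seq_embeddable TYPE('k) (lie_terms K V)"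
proof -
  obtain g :: "_ \<Rightarrow> nat \<Rightarrow> 'k" where g: "inj_on g (carrier V)"
    using V unfolding seq_embeddable_def by blast
  \<comment> \<open>Unit sequences are pairwise distinct labels over any field, as 1 differs from
    0.\<close>
  define c :: "nat \<Rightarrow> nat \<Rightarrow> 'k" where "c i = (\<lambda>n. if n = i then \<one>\<^bsub>K\<^esub> else \<zero>\<^bsub>K\<^esub>)" for i
  have ne: "\<one>\<^bsub>K\<^esub> \<noteq> \<zero>\<^bsub>K\<^esub>" using K by (simp add: field_def domain_def domain_axioms_def)
  have "inj c"
  proof (rule injI)
    fix i j assume "c i = c j"
    then have "c i i = c j i" by simp
    then show "i = j" using ne by (simp add: c_def split: if_splits)
  qed
  show ?thesis
  proof (rule seq_embeddable_family[where F = "\<lambda>p t. term_code g c t p" and B = "\<lambda>_. UNIV"])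
    show "seq_embeddable TYPE('k) (UNIV :: (nat \<Rightarrow> 'k) set)"
      unfolding seq_embeddable_def by (intro exI[of _ "\<lambda>x. x"]) simp
  next
    fix s t assume "s \<in> lie_terms K V" "t \<in> lie_terms K V" "\<And>p. term_code g c s p = term_code g c t p"
    then show "s = t" using term_code_inj[OF g \<open>inj c\<close>] by (meson ext)
  qed simp
qed

lemma (in vectorspace) seq_embeddable_fin_dim:
  assumes "fin_dim" shows "seq_embeddable TYPE('a) (carrier V)"
proof -
  have "separated (carrier V)" using assms by (simp add: fin_dim_iff_separated)
  then obtain n e \<epsilon> where db: "dual_basis (carrier V) n e \<epsilon>"
    using subspace_carrier_self by (rule separated_dual_basis)
  have "inj_on (\<lambda>x i. if i < n then \<epsilon> i x else \<zero>\<^bsub>K\<^esub>) (carrier V)"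
  proof (rule inj_onI)
    fix x y assume xy: "x \<in> carrier V" "y \<in> carrier V"
      and eq: "(\<lambda>i. if i < n then \<epsilon> i x else \<zero>\<^bsub>K\<^esub>) = (\<lambda>i. if i < n then \<epsilon> i y else \<zero>\<^bsub>K\<^esub>)"
    have "\<epsilon> i x = \<epsilon> i y" if "i < n" for i using fun_cong[OF eq, of i] that by simp
    then have "(\<Oplus>\<^bsub>V\<^esub>i\<in>{..<n}. \<epsilon> i x \<odot>\<^bsub>V\<^esub> e i) = (\<Oplus>\<^bsub>V\<^esub>i\<in>{..<n}. \<epsilon> i y \<odot>\<^bsub>V\<^esub> e i)"
      using dual_basisD(1,2)[OF db] xy functional_closed by (intro M.finsum_cong') auto
    then show "x = y" using dual_basisD(4)[OF db] xy by metis
  qed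
  then show ?thesis unfolding seq_embeddable_def by blast
qed

text \<open>Brackets with the finite set \<open>B\<close> embed degree p + 1 into a power of degree
  p, and components embed the whole algebra into a countable product of degrees. The bound thus
  spreads upwards from the negative part.\<close>

lemma (in graded_lie) seq_embeddable_effective:
  assumes neg: "\<And>p. p < 0 \<Longrightarrow> seq_embeddable T (G p)"
    and B: "finite B" "B \<subseteq> G (-1)" "G (-1) \<subseteq> span B"
    and eff: "\<And>p x. \<lbrakk>p \<ge> 0; x \<in> G p; \<forall>v\<in>G (-1). x \<otimes> v = \<zero>\<rbrakk> \<Longrightarrow> x = \<zero>"
  shows "seq_embeddable T (carrier L)"
proof -
  obtain bs where bs: "set bs = B" using B(1) finite_list by blast
  have Bc: "B \<subseteq> carrier L" using B(2) G_closed by blast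
  have pos: "seq_embeddable T (G p)" if "p \<ge> -1" for p
    using that
  proof (induction p rule: int_ge_induct)
    case base then show ?case by (simp add: neg)
  next
    case (step p)
    show ?case
    proof (rule seq_embeddable_family[where F = "\<lambda>i x. if i < length bs then x \<otimes> (bs ! i) else \<zero>"
          and B = "\<lambda>_ :: nat. G p"])
      show "seq_embeddable T (G p)" by (rule step.IH)
      show "(if i < length bs then x \<otimes> (bs ! i) else \<zero>) \<in> G p" if "x \<in> G (p + 1)" for i x
        using that B(2) bs nth_mem[of i bs] by (auto intro!: G_bracket[of x "p + 1" "bs ! i" "-1"])
      fix x y assume xy: "x \<in> G (p + 1)" "y \<in> G (p + 1)"
        and eq: "\<And>i. (if i < length bs then x \<otimes> (bs ! i) else \<zero>) = (if i < length bs then y \<otimes> (bs ! i) else \<zero>)"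
      note c = G_closed[OF xy(1)] G_closed[OF xy(2)]
      have d: "x \<ominus> y \<in> G (p + 1)" using xy by (rule subspace_minus[OF G_subspace])
      have "(x \<ominus> y) \<otimes> b = \<zero>" if b: "b \<in> B" for b
      proof -
        obtain i where "i < length bs" "b = bs ! i" using b bs by (metis in_set_conv_nth)
        then have "x \<otimes> b = y \<otimes> b" using eq[of i] by simp
        then show ?thesis using c b Bc
          by (simp add: a_minus_def bracket_add_left bracket_neg_left bracket_closed subset_eq M.r_neg)
      qed
      then have "\<forall>v\<in>G (-1). (x \<ominus> y) \<otimes> v = \<zero>"
        using annihilates_span[OF G_closed[OF d] Bc] B(3) by blast
      then have "x \<ominus> y = \<zero>" using eff[OF _ d] step by simp
      then show "x = y" using c by simp
    qed
  qed
  show ?thesis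
  proof (rule seq_embeddable_family[where F = component and B = G])
    show "seq_embeddable T (G p)" for p by (cases "p < 0") (auto intro: neg pos)
    show "component p x \<in> G p" if "x \<in> carrier L" for p x using that by (rule component_in)
    fix x y assume xy: "x \<in> carrier L" "y \<in> carrier L" "\<And>p. component p x = component p y"
    have "x \<ominus> y = \<zero>"
    proof (rule eq_zero_if_components)
      fix p show "component p (x \<ominus> y) = \<zero>"
        using xy(1,2) xy(3)[of p] by (simp add: component_minus)
    qed (use xy in simp)
    then show "x = y" using xy by simp
  qed
qed

section \<open>Effective prolongations and their transport\<close>

section \<open>Effective prolongations\<close>

lemma (in linear_map) image_span_subset:
  assumes "B \<subseteq> carrier V" shows "T ` V.module.span B \<subseteq> W.module.span (T ` B)"
proof -
  have TB: "T ` B \<subseteq> carrier W" using assms T_im by blast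
  let ?S = "{x \<in> carrier V. T x \<in> W.module.span (T ` B)}"
  have "B \<subseteq> ?S" using assms W.span_mem[OF TB] by auto
  then have "V.module.span B \<subseteq> ?S"
    by (rule V.module.span_is_subset) (rule V.is_module, rule vimage_subspace, rule W.span_is_subspace[OF TB])
  then show ?thesis by blast
qed

lemma lie_hom_linear_map:
  "\<lbrakk>lie_algebra K L; lie_algebra K N; f \<in> lie_hom K L N\<rbrakk> \<Longrightarrow> linear_map K L N f"
  by (rule linear_mapI) (auto simp: lie_algebra_def lie_hom_def)

lemma lie_hom_bracket:
  "\<lbrakk>f \<in> lie_hom K L N; x \<in> carrier L; y \<in> carrier L\<rbrakk> \<Longrightarrow> f (x \<otimes>\<^bsub>L\<^esub> y) = f x \<otimes>\<^bsub>N\<^esub> f y"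
  by (auto simp: lie_hom_def)

lemma lie_hom_compose:
  "\<lbrakk>f \<in> lie_hom K L N; h \<in> lie_hom K N P\<rbrakk> \<Longrightarrow> (\<lambda>x. h (f x)) \<in> lie_hom K L P"
  by (auto simp: lie_hom_def module_hom_def Pi_iff)

context graded_lie
begin

text \<open>Right-nested brackets of n + 1 elements of \<open>B\<close>; hence the degree - n - 1
  when \<open>B\<close> lies in degree -1.\<close>

primrec brackets :: "'a set \<Rightarrow> nat \<Rightarrow> 'a set" where
  "brackets B 0 = B"
| "brackets B (Suc n) = (\<lambda>(v, y). v \<otimes> y) ` (B \<times> brackets B n)"

lemma brackets_finite: "finite B \<Longrightarrow> finite (brackets B n)"
  by (induction n) auto

lemma brackets_degree: "B \<subseteq> G (-1) \<Longrightarrow> brackets B n \<subseteq> G (- int n - 1)"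
proof (induction n)
  case (Suc n) then show ?case by (auto intro!: G_bracket)
qed simp

text \<open>The span of all right-nested brackets is a subalgebra that contains degree -1, hence
  everything. Each nested bracket is homogeneous, so an element of one degree involves only those of
  the matching length.\<close>

lemma generated_component_span:
  assumes B: "finite B" "B \<subseteq> G (-1)" "G (-1) \<subseteq> span B"
    and gen: "\<And>S. \<lbrakk>lie_subalgebra K S L; G (-1) \<subseteq> S\<rbrakk> \<Longrightarrow> S = carrier L"
  shows "G (- int n - 1) \<subseteq> span (brackets B n)"
proof -
  have bc: "brackets B n \<subseteq> carrier L" for n using brackets_degree[OF B(2)] G_closed by blast
  have sp: "subspace K (span (brackets B n)) L" for n by (rule span_is_subspace[OF bc])
  note spc = subspace_carrier[OF sp]
  have span_bracket: "x \<otimes> z \<in> S" if z: "z \<in> span A" and S: "subspace K S L"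
    and A: "A \<subseteq> carrier L" and x: "x \<in> carrier L" and a: "\<And>a. a \<in> A \<Longrightarrow> x \<otimes> a \<in> S" for x z A S
  proof -
    have "A \<subseteq> {z \<in> carrier L. x \<otimes> z \<in> S}" using a A by blast
    moreover have "subspace K {z \<in> carrier L. x \<otimes> z \<in> S} L"
      by (rule subspaceI) (auto simp: bracket_add_right bracket_smult_right x
          subspace_zero[OF S] subspace_add[OF S] subspace_smult[OF S])
    ultimately have "span A \<subseteq> {z \<in> carrier L. x \<otimes> z \<in> S}" by (intro span_is_subset is_module)
    then show ?thesis using z by blast
  qed
  \<comment> \<open>Induction on the length of the left factor: [[v, y], c] = [v, [y, c]] - [y,
    [v, c]], where y is shorter than b.\<close>
  have bb: "b \<otimes> c \<in> span (brackets B (Suc (i + j)))" if "b \<in> brackets B i" "c \<in> brackets B j" for b c i j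
    using that
  proof (induction i arbitrary: b c j)
    case 0
    then have "b \<otimes> c \<in> brackets B (Suc j)" by force
    then show ?case using span_mem[OF bc] by (metis add_0)
  next
    case (Suc i)
    then obtain v y where vy: "v \<in> B" "y \<in> brackets B i" "b = v \<otimes> y" by auto
    have c: "v \<in> carrier L" "y \<in> carrier L" "c \<in> carrier L" using vy Suc.prems bc[of 0] bc by auto
    have "v \<otimes> (y \<otimes> c) \<in> span (brackets B (Suc (Suc (i + j))))"
    proof (rule span_bracket[OF Suc.IH[OF vy(2) Suc.prems(2)] sp bc c(1)])
      fix a assume "a \<in> brackets B (Suc (i + j))"
      then have "v \<otimes> a \<in> brackets B (Suc (Suc (i + j)))" using vy(1) by force
      then show "v \<otimes> a \<in> span (brackets B (Suc (Suc (i + j))))" using span_mem[OF bc] by blast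
    qed
    moreover have "v \<otimes> c \<in> brackets B (Suc j)" using vy(1) Suc.prems(2) by force
    then have "y \<otimes> (v \<otimes> c) \<in> span (brackets B (Suc (i + Suc j)))" by (rule Suc.IH[OF vy(2)])
    moreover have "b \<otimes> c = v \<otimes> (y \<otimes> c) \<ominus> y \<otimes> (v \<otimes> c)"
      unfolding vy(3) using jacobi_left[OF c] c
      by (simp add: a_minus_def M.a_assoc bracket_closed M.r_neg)
    ultimately show ?case using subspace_minus[OF sp] by (simp del: brackets.simps)
  qed
  let ?U = "\<Union>n. brackets B n"
  have Uc: "?U \<subseteq> carrier L" using bc by blast
  have U: "subspace K (span ?U) L" by (rule span_is_subspace[OF Uc])
  have bU: "b \<otimes> z \<in> span ?U" if b: "b \<in> brackets B i" and z: "z \<in> span ?U" for b z i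
  proof (rule span_bracket[OF z U Uc])
    show "b \<in> carrier L" using b bc by blast
    fix a assume "a \<in> ?U"
    then obtain j where "a \<in> brackets B j" by blast
    then show "b \<otimes> a \<in> span ?U" using bb[OF b] span_is_monotone[of "brackets B _" ?U] by blast
  qed
  have "x \<otimes> z \<in> span ?U" if x: "x \<in> span ?U" and z: "z \<in> span ?U" for x z
  proof -
    note c = subspace_carrier[OF U x] subspace_carrier[OF U z]
    have "z \<otimes> x \<in> span ?U"
    proof (rule span_bracket[OF x U Uc c(2)])
      fix a assume "a \<in> ?U"
      then obtain j where a: "a \<in> brackets B j" by blast
      then have "z \<otimes> a = \<ominus> (a \<otimes> z)" using c bc by (intro bracket_antisym) auto
      then show "z \<otimes> a \<in> span ?U" using bU[OF a z] subspace_neg[OF U] by simp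
    qed
    then show ?thesis using bracket_antisym[OF c] subspace_neg[OF U] by simp
  qed
  moreover have "G (-1) \<subseteq> span ?U"
    using B(3) span_is_monotone[of B ?U] UN_upper[of 0 UNIV "brackets B"] by auto
  ultimately have full: "span ?U = carrier L" using U by (intro gen) (auto simp: lie_subalgebra_def)
  \<comment> \<open>The elements whose components lie in the matching spans form a subspace
    \<open>?T\<close>; it contains all nested brackets, so it is everything.\<close>
  let ?H = "\<lambda>p. if p < 0 then span (brackets B (nat (- p - 1))) else {\<zero>}"
  let ?T = "{x \<in> carrier L. \<forall>p. component p x \<in> ?H p}"
  have H: "subspace K (?H p) L" for p using sp subspace_zero_singleton by simp
  have T: "subspace K ?T L"
    by (rule subspaceI) (use H in \<open>auto simp: component_add component_smult
      subspace_zero[OF H] subspace_add[OF H] subspace_smult[OF H] simp del: if_split\<close>)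
  have "?U \<subseteq> ?T"
  proof
    fix x assume "x \<in> ?U"
    then obtain k where k: "x \<in> brackets B k" by blast
    then have xG: "x \<in> G (- int k - 1)" using brackets_degree[OF B(2)] by blast
    have "component p x \<in> ?H p" for p
    proof (cases "p = - int k - 1")
      case True
      then show ?thesis using component_same[OF xG] span_mem[OF bc k] by simp
    next
      case False
      then show ?thesis using component_other[OF xG] subspace_zero[OF H] by simp
    qed
    then show "x \<in> ?T" using G_closed[OF xG] by blast
  qed
  then have "span ?U \<subseteq> ?T" by (rule span_is_subset) (rule is_module[OF T])
  then have *: "component p x \<in> ?H p" if "x \<in> carrier L" for x p using full that by blast
  show ?thesis
  proof
    fix x assume x: "x \<in> G (- int n - 1)"
    from *[OF G_closed[OF x], of "- int n - 1"] show "x \<in> span (brackets B n)"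
      using component_same[OF x] by simp
  qed
qed

end

locale effective =
  fixes K :: "('k, 'r) ring_scheme" and m :: "('k, 'm) module" and M and
    g :: "('k, 'g) module" and G and \<iota>
  assumes eff: "effective_prolongation K m M g G \<iota>"
begin

lemma fgla_m: "fgla K m M" and graded_m: "graded_lie_algebra K m M"
  and graded_g: "graded_lie_algebra K g G" and hom: "\<iota> \<in> lie_hom K m g"
  and inj: "inj_on \<iota> (carrier m)" and image: "p < 0 \<Longrightarrow> \<iota> ` M p = G p"
  and M_nonneg: "p \<ge> 0 \<Longrightarrow> M p = {\<zero>\<^bsub>m\<^esub>}"
  and M_fin_dim: "vectorspace.fin_dim K (m\<lparr>carrier := M (-1)\<rparr>)"
  and generated: "\<lbrakk>lie_subalgebra K S m; M (-1) \<subseteq> S\<rbrakk> \<Longrightarrow> S = carrier m"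
  using eff by (auto simp: effective_prolongation_def fgla_def)

sublocale m: graded_lie K m M by (rule graded_lieI[OF graded_m])
sublocale g: graded_lie K g G by (rule graded_lieI[OF graded_g])
sublocale \<iota>: linear_map K m g \<iota>
  by (rule lie_hom_linear_map[OF m.lie_algebra_axioms g.lie_algebra_axioms hom])

lemma \<iota>_bracket: "\<lbrakk>x \<in> carrier m; y \<in> carrier m\<rbrakk> \<Longrightarrow> \<iota> (x \<otimes>\<^bsub>m\<^esub> y) = \<iota> x \<otimes>\<^bsub>g\<^esub> \<iota> y"
  using hom by (rule lie_hom_bracket)

lemma \<iota>_zeroD: "\<lbrakk>x \<in> carrier m; \<iota> x = \<zero>\<^bsub>g\<^esub>\<rbrakk> \<Longrightarrow> x = \<zero>\<^bsub>m\<^esub>"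
  using iffD1[OF \<iota>.inj_on_iff inj] by simp

lemma effectivity_sum:
  assumes "x \<in> graded_sum g G {0..}" "\<forall>v\<in>G (-1). x \<otimes>\<^bsub>g\<^esub> v = \<zero>\<^bsub>g\<^esub>" shows "x = \<zero>\<^bsub>g\<^esub>"
  using eff assms unfolding effective_prolongation_def by blast

lemma effectivity:
  assumes "p \<ge> 0" "x \<in> G p" "\<forall>v\<in>G (-1). x \<otimes>\<^bsub>g\<^esub> v = \<zero>\<^bsub>g\<^esub>" shows "x = \<zero>\<^bsub>g\<^esub>"
  by (rule effectivity_sum) (use assms g.G_subset_graded_sum[of p "{0..}"] in auto)

lemma finite_spanning:
  obtains B where "finite B" "B \<subseteq> M (-1)" "M (-1) \<subseteq> m.span B"
proof -
  let ?M = "m\<lparr>carrier := M (-1)\<rparr>"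
  interpret M1: vectorspace K ?M by (rule m.subspace_is_vs[OF m.G_subspace])
  obtain B where B: "finite B" "B \<subseteq> M (-1)" "M1.span B = M (-1)"
    using M_fin_dim unfolding M1.fin_dim_def by auto
  have "M1.span B = m.span B"
    by (rule m.span_li_not_depend(1)) (use B m.is_module[OF m.G_subspace] in auto)
  then show thesis using B that by blast
qed

lemma finite_spanning_image:
  assumes B: "B \<subseteq> M (-1)" "M (-1) \<subseteq> m.span B"
  shows "\<iota> ` B \<subseteq> G (-1)" "G (-1) \<subseteq> g.span (\<iota> ` B)"
proof -
  show "\<iota> ` B \<subseteq> G (-1)" using B(1) image[of "-1"] by auto
  have "\<iota> ` M (-1) \<subseteq> \<iota> ` m.span B" using B(2) by blast
  also have "\<dots> \<subseteq> g.span (\<iota> ` B)" by (rule \<iota>.image_span_subset) (use B(1) m.G_closed in blast)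
  finally show "G (-1) \<subseteq> g.span (\<iota> ` B)" using image[of "-1"] by simp
qed

lemma seq_embeddable_prolongation:
  assumes "seq_embeddable T (carrier m)" shows "seq_embeddable T (carrier g)"
proof -
  obtain B where B: "finite B" "B \<subseteq> M (-1)" "M (-1) \<subseteq> m.span B" by (rule finite_spanning)
  show ?thesis
  proof (rule g.seq_embeddable_effective[OF _ _ finite_spanning_image[OF B(2,3)]])
    fix p :: int assume p: "p < 0"
    have "seq_embeddable T (\<iota> ` M p)"
      by (rule seq_embeddable_image, rule seq_embeddable_subset[OF assms]) (use m.G_closed in blast)
    then show "seq_embeddable T (G p)" using image[OF p] by simp
  qed (use B effectivity in auto)
qed

text \<open>An injective f has trivial kernel, so the grading passes to the image; components
  correspond under f, and effectivity is inherited through them.\<close>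

lemma image_effective:
  assumes sur: "lie_surjection K g N f" and f: "inj_on f (carrier g)"
  shows "effective_prolongation K m M N (\<lambda>p. f ` G p) (\<lambda>x. f (\<iota> x))"
proof -
  interpret s: lie_surjection K g N f by fact
  have z: "x = \<zero>\<^bsub>g\<^esub>" if "x \<in> carrier g" "f x = \<zero>\<^bsub>N\<^esub>" for x
    using iffD1[OF s.map.inj_on_iff f] that by simp
  interpret s: graded_lie_surjection K g G N f
  proof unfold_locales
    fix x p assume "x \<in> carrier g" "f x = \<zero>\<^bsub>N\<^esub>"
    then have "x = \<zero>\<^bsub>g\<^esub>" by (rule z)
    then show "f (g.component p x) = \<zero>\<^bsub>N\<^esub>" by (simp add: s.map_zero)
  qed
  have grN: "graded_lie_algebra K N (\<lambda>p. f ` G p)" by (rule s.graded_image)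
  interpret N: graded_lie K N "\<lambda>p. f ` G p" by (rule graded_lieI[OF grN])
  have comp: "N.component p (f x) = f (g.component p x)" if x: "x \<in> carrier g" for p x
  proof -
    have *: "N.component p (f x) = f (g.component p x)" for p
      using x
    proof (induction rule: g.graded_induct)
      case (homogeneous q x)
      then have "f x \<in> f ` G q" by simp
      then show ?case
        using N.component_same N.component_other g.component_same[OF homogeneous]
          g.component_other[OF homogeneous] s.map_zero by (cases "p = q") metis+
    next
      case (add x y)
      then show ?case using s.image_closed
        by (simp add: s.map_add N.component_add g.component_add)
    qed
    then show ?thesis .
  qed
  have "X = \<zero>\<^bsub>N\<^esub>" if X: "X \<in> graded_sum N (\<lambda>p. f ` G p) {0..}"
    "\<forall>v\<in>f ` G (-1). X \<otimes>\<^bsub>N\<^esub> v = \<zero>\<^bsub>N\<^esub>" for X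
  proof -
    have "X \<in> carrier N" using X(1) by (simp add: N.graded_sum_iff)
    then obtain x where x: "x \<in> carrier g" "X = f x" by (elim s.image_cases)
    have "g.component p x = \<zero>\<^bsub>g\<^esub>" if "p \<notin> {0..}" for p
      by (rule z) (use X(1) x that in \<open>auto simp: N.graded_sum_iff comp\<close>)
    then have "x \<in> graded_sum g G {0..}" using x by (simp add: g.graded_sum_iff)
    moreover have "\<forall>v\<in>G (-1). x \<otimes>\<^bsub>g\<^esub> v = \<zero>\<^bsub>g\<^esub>"
    proof
      fix v assume v: "v \<in> G (-1)"
      then have "f (x \<otimes>\<^bsub>g\<^esub> v) = \<zero>\<^bsub>N\<^esub>" using X(2) x g.G_closed by (auto simp: s.map_mult)
      then show "x \<otimes>\<^bsub>g\<^esub> v = \<zero>\<^bsub>g\<^esub>" using x v g.G_closed by (intro z g.bracket_closed) auto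
    qed
    ultimately have "x = \<zero>\<^bsub>g\<^esub>" by (rule effectivity_sum)
    then show ?thesis using x s.map_zero by simp
  qed
  moreover have "\<zero>\<^bsub>N\<^esub> \<in> graded_sum N (\<lambda>p. f ` G p) {0..}" by (simp add: N.graded_sum_iff)
  moreover have "\<zero>\<^bsub>N\<^esub> \<otimes>\<^bsub>N\<^esub> v = \<zero>\<^bsub>N\<^esub>" if "v \<in> f ` G (-1)" for v
    using lie_algebra.zero_bracket[OF s.lie_algebra_image] N.G_closed that by blast
  moreover have "(\<lambda>x. f (\<iota> x)) \<in> lie_hom K m N" by (rule lie_hom_compose[OF hom s.hom])
  moreover have "inj_on (\<lambda>x. f (\<iota> x)) (carrier m)"
    by (rule inj_onI) (metis inj_onD[OF inj] inj_onD[OF f] \<iota>.T_im)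
  moreover have "(\<lambda>x. f (\<iota> x)) ` M p = f ` G p" if "p < 0" for p
    using image[OF that] by (metis image_image)
  ultimately show ?thesis
    unfolding effective_prolongation_def using fgla_m grN by blast
qed

end

definition transport :: "('k, 'a) module \<Rightarrow> ('a \<Rightarrow> 'b) \<Rightarrow> ('k, 'b) module" where
  "transport L f = (let i = inv_into (carrier L) f in
    \<lparr>carrier = f ` carrier L, mult = (\<lambda>x y. f (i x \<otimes>\<^bsub>L\<^esub> i y)), one = f \<zero>\<^bsub>L\<^esub>, zero = f \<zero>\<^bsub>L\<^esub>,
     add = (\<lambda>x y. f (i x \<oplus>\<^bsub>L\<^esub> i y)), smult = (\<lambda>c x. f (c \<odot>\<^bsub>L\<^esub> i x))\<rparr>)"

lemma lie_surjection_transport: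
  assumes "lie_algebra K L" "inj_on f (carrier L)"
  shows "lie_surjection K L (transport L f) f"
proof -
  interpret lie_algebra K L by fact
  show ?thesis
    by unfold_locales (use assms(2) in \<open>simp_all add: transport_def Let_def\<close>)
qed

text \<open>Maximality among the prolongations with elements in \<open>nat \<Rightarrow> 'k\<close> extends to all
  types, since every effective prolongation can be transported there.\<close>

lemma maximal_embedding:
  fixes K :: "('k, 'r) ring_scheme" and h :: "('k, 't) module"
  assumes max: "maximal_effective_prolongation TYPE(nat \<Rightarrow> 'k) K m M \<L> g G \<iota>"
    and h: "effective_prolongation K m M h H \<kappa>" and type: "prolongation_of_type \<L> M h H \<kappa>"
    and emb: "seq_embeddable TYPE('k) (carrier m)"
  obtains \<phi> where "\<phi> \<in> lie_hom K h g" "inj_on \<phi> (carrier h)" "\<And>p. \<phi> ` H p \<subseteq> G p"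
    "\<And>x. x \<in> carrier m \<Longrightarrow> \<phi> (\<kappa> x) = \<iota> x"
proof -
  interpret h: effective K m M h H \<kappa> by (rule effective.intro[OF h])
  obtain f :: "'t \<Rightarrow> nat \<Rightarrow> 'k" where f: "inj_on f (carrier h)"
    using h.seq_embeddable_prolongation[OF emb] unfolding seq_embeddable_def by blast
  let ?N = "transport h f"
  have sur: "lie_surjection K h ?N f"
    by (rule lie_surjection_transport[OF h.g.lie_algebra_axioms f])
  interpret s: lie_surjection K h ?N f by (rule sur)
  have "effective_prolongation K m M ?N (\<lambda>p. f ` H p) (\<lambda>x. f (\<kappa> x))"
    by (rule h.image_effective[OF sur f])
  moreover have "prolongation_of_type \<L> M ?N (\<lambda>p. f ` H p) (\<lambda>x. f (\<kappa> x))"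
    unfolding prolongation_of_type_def
  proof
    fix X assume "X \<in> f ` H 0"
    then obtain x where x: "x \<in> H 0" "X = f x" by blast
    then obtain A where A: "A \<in> \<L>" "\<forall>v\<in>M (-1). x \<otimes>\<^bsub>h\<^esub> \<kappa> v = \<kappa> (A v)"
      using type unfolding prolongation_of_type_def by blast
    then have "\<forall>v\<in>M (-1). X \<otimes>\<^bsub>?N\<^esub> f (\<kappa> v) = f (\<kappa> (A v))"
      using x h.g.G_closed h.m.G_closed h.\<iota>.T_im by (metis s.map_mult)
    then show "\<exists>A\<in>\<L>. \<forall>v\<in>M (-1). X \<otimes>\<^bsub>?N\<^esub> f (\<kappa> v) = f (\<kappa> (A v))" using A(1) by blast
  qed
  ultimately obtain \<phi> where \<phi>: "\<phi> \<in> lie_hom K ?N g" "inj_on \<phi> (carrier ?N)"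
    "\<forall>p. \<phi> ` f ` H p \<subseteq> G p" "\<forall>x\<in>carrier m. \<phi> (f (\<kappa> x)) = \<iota> x"
    using max unfolding maximal_effective_prolongation_def by blast
  show thesis
  proof (rule that[of "\<lambda>x. \<phi> (f x)"])
    show "(\<lambda>x. \<phi> (f x)) \<in> lie_hom K h g" by (rule lie_hom_compose[OF s.hom \<phi>(1)])
    show "inj_on (\<lambda>x. \<phi> (f x)) (carrier h)"
    proof (rule inj_onI)
      fix x y assume xy: "x \<in> carrier h" "y \<in> carrier h" "\<phi> (f x) = \<phi> (f y)"
      then have "f x = f y" using inj_onD[OF \<phi>(2)] s.image_closed by blast
      then show "x = y" using inj_onD[OF f] xy by blast
    qed
  qed (use \<phi> in auto)
qed

section \<open>The Lie algebra n + h built from a prolongation of the abelian algebra V\<close>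

section \<open>Extending a prolongation of the abelian quotient\<close>

context graded_lie
begin

lemma bracket_in_lower_part:
  assumes neg: "\<And>p. p \<ge> 0 \<Longrightarrow> G p = {\<zero>}" and x: "x \<in> carrier L" and y: "y \<in> carrier L"
  shows "x \<otimes> y \<in> graded_sum L G {..-2}"
  using x
proof (induction rule: graded_induct)
  case (homogeneous p x)
  note x = homogeneous
  show ?case using y
  proof (induction rule: graded_induct)
    case (homogeneous q y)
    show ?case
    proof (cases "p \<ge> 0 \<or> q \<ge> 0")
      case True
      then have "x = \<zero> \<or> y = \<zero>" using neg x homogeneous by blast
      then have "x \<otimes> y = \<zero>" using G_closed[OF x] G_closed[OF homogeneous] by auto
      then show ?thesis by (simp add: graded_sum_iff)
    next
      case False
      then have "p + q \<in> {..-2}" by auto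
      then show ?thesis using G_bracket[OF x homogeneous HOL.refl] G_subset_graded_sum by blast
    qed
  next
    case (add y z)
    then show ?case
      by (simp add: G_closed[OF x] bracket_add_right subspace_add[OF subspace_graded_sum])
  qed
next
  case (add x z)
  then show ?case by (simp add: y bracket_add_left subspace_add[OF subspace_graded_sum])
qed

end

text \<open>Two copies of V: \<open>e\<close> in degree -1 of \<open>m\<close> and \<open>k\<close>
  in degree -1 of \<open>h\<close>. The assumptions \<open>A_derivation\<close> and
  \<open>A_lower\<close> are the condition that T_A maps f_[2](V) into the ideal, read inside
  \<open>m\<close>, as \<open>derivation_condition\<close> shows. They allow the elements of
  \<open>h\<close> of degree \<ge> 0 to act by zero on the lower part of \<open>m\<close>.\<close>

locale abelian_extension = V: vectorspace K V + m: graded_lie K m M + h: graded_lie K h H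
  for K :: "('k, 'r) ring_scheme" and V :: "('k, 'v) module" and m :: "('k, 'm) module" and M
    and h :: "('k, 'h) module" and H +
  fixes e k and \<A> :: "('v \<Rightarrow> 'v) set"
  assumes fgla: "fgla K m M"
    and e_hom: "e \<in> module_hom K V m" and e_inj: "inj_on e (carrier V)" and e_onto: "e ` carrier V = M (-1)"
    and k_hom: "k \<in> module_hom K V h" and k_inj: "inj_on k (carrier V)" and k_onto: "k ` carrier V = H (-1)"
    and k_commute: "\<lbrakk>v \<in> carrier V; w \<in> carrier V\<rbrakk> \<Longrightarrow> k v \<otimes>\<^bsub>h\<^esub> k w = \<zero>\<^bsub>h\<^esub>"
    and H_bot: "p \<le> -2 \<Longrightarrow> H p = {\<zero>\<^bsub>h\<^esub>}"
    and h_eff: "\<lbrakk>x \<in> graded_sum h H {0..}; \<forall>v\<in>H (-1). x \<otimes>\<^bsub>h\<^esub> v = \<zero>\<^bsub>h\<^esub>\<rbrakk> \<Longrightarrow> x = \<zero>\<^bsub>h\<^esub>"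
    and h_type: "X \<in> H 0 \<Longrightarrow> \<exists>A\<in>\<A>. \<forall>v\<in>carrier V. X \<otimes>\<^bsub>h\<^esub> k v = k (A v)"
    and A_closed: "\<lbrakk>A \<in> \<A>; v \<in> carrier V\<rbrakk> \<Longrightarrow> A v \<in> carrier V"
    and A_derivation: "\<lbrakk>A \<in> \<A>; v \<in> carrier V; w \<in> carrier V\<rbrakk> \<Longrightarrow>
      e (A v) \<otimes>\<^bsub>m\<^esub> e w \<oplus>\<^bsub>m\<^esub> e v \<otimes>\<^bsub>m\<^esub> e (A w) = \<zero>\<^bsub>m\<^esub>"
    and A_lower: "\<lbrakk>A \<in> \<A>; v \<in> carrier V; y \<in> graded_sum m M {..-2}\<rbrakk> \<Longrightarrow> e (A v) \<otimes>\<^bsub>m\<^esub> y = \<zero>\<^bsub>m\<^esub>"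
begin

sublocale e: linear_map K V m e
  by (rule linear_mapI) (use e_hom m.vs V.vectorspace_axioms in auto)
sublocale k: linear_map K V h k
  by (rule linear_mapI) (use k_hom h.vs V.vectorspace_axioms in auto)

lemma e_in: "v \<in> carrier V \<Longrightarrow> e v \<in> M (-1)"
  using e_onto by blast

lemma k_in: "v \<in> carrier V \<Longrightarrow> k v \<in> H (-1)"
  using k_onto by blast

abbreviation n where "n \<equiv> graded_sum m M {..-2}"

lemma M_nonneg: "p \<ge> 0 \<Longrightarrow> M p = {\<zero>\<^bsub>m\<^esub>}"
  using fgla by (simp add: fgla_def)

lemma n_subspace: "subspace K n m"
  by (rule m.subspace_graded_sum)

lemma n_closed: "y \<in> n \<Longrightarrow> y \<in> carrier m"
  by (simp add: m.graded_sum_iff)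

lemma bracket_n: "\<lbrakk>u \<in> carrier m; w \<in> carrier m\<rbrakk> \<Longrightarrow> u \<otimes>\<^bsub>m\<^esub> w \<in> n"
  by (rule m.bracket_in_lower_part[OF M_nonneg])

definition \<nu> where "\<nu> x = inv_into (carrier V) k (h.component (-1) x)"
definition \<alpha> where "\<alpha> x = e (\<nu> x)"
text \<open>The choice is harmless: \<open>k\<close> is injective on V, so the action of the degree
  0 component determines the values of A on V.\<close>

definition op_of where "op_of x = (SOME A. A \<in> \<A> \<and> (\<forall>v\<in>carrier V. h.component 0 x \<otimes>\<^bsub>h\<^esub> k v = k (A v)))"

lemma \<nu>_closed: "x \<in> carrier h \<Longrightarrow> \<nu> x \<in> carrier V"
  unfolding \<nu>_def by (rule inv_into_into) (simp add: k_onto h.component_in)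

lemma k_\<nu>: "x \<in> carrier h \<Longrightarrow> k (\<nu> x) = h.component (-1) x"
  unfolding \<nu>_def by (rule f_inv_into_f) (simp add: k_onto h.component_in)

lemma \<nu>_eqI: "\<lbrakk>v \<in> carrier V; k v = h.component (-1) x\<rbrakk> \<Longrightarrow> \<nu> x = v"
  unfolding \<nu>_def using inv_into_f_f[OF k_inj] by metis

lemma \<nu>_add: "\<lbrakk>x \<in> carrier h; y \<in> carrier h\<rbrakk> \<Longrightarrow> \<nu> (x \<oplus>\<^bsub>h\<^esub> y) = \<nu> x \<oplus>\<^bsub>V\<^esub> \<nu> y"
  by (rule \<nu>_eqI) (simp_all add: \<nu>_closed k_\<nu> h.component_add)

lemma \<nu>_smult: "\<lbrakk>c \<in> carrier K; x \<in> carrier h\<rbrakk> \<Longrightarrow> \<nu> (c \<odot>\<^bsub>h\<^esub> x) = c \<odot>\<^bsub>V\<^esub> \<nu> x"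
  by (rule \<nu>_eqI) (simp_all add: \<nu>_closed k_\<nu> h.component_smult)

lemma \<nu>_k: "v \<in> carrier V \<Longrightarrow> \<nu> (k v) = v"
  by (intro \<nu>_eqI) (simp_all add: h.component_same k_in)

lemma \<nu>_zero: "h.component (-1) x = \<zero>\<^bsub>h\<^esub> \<Longrightarrow> \<nu> x = \<zero>\<^bsub>V\<^esub>"
  by (rule \<nu>_eqI) simp_all

lemma \<alpha>_in: "x \<in> carrier h \<Longrightarrow> \<alpha> x \<in> M (-1)"
  unfolding \<alpha>_def using \<nu>_closed e_onto by blast

lemma \<alpha>_closed [simp]: "x \<in> carrier h \<Longrightarrow> \<alpha> x \<in> carrier m"
  using \<alpha>_in m.G_closed by blast

lemma \<alpha>_add: "\<lbrakk>x \<in> carrier h; y \<in> carrier h\<rbrakk> \<Longrightarrow> \<alpha> (x \<oplus>\<^bsub>h\<^esub> y) = \<alpha> x \<oplus>\<^bsub>m\<^esub> \<alpha> y"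
  by (simp add: \<alpha>_def \<nu>_add \<nu>_closed)

lemma \<alpha>_smult: "\<lbrakk>c \<in> carrier K; x \<in> carrier h\<rbrakk> \<Longrightarrow> \<alpha> (c \<odot>\<^bsub>h\<^esub> x) = c \<odot>\<^bsub>m\<^esub> \<alpha> x"
  by (simp add: \<alpha>_def \<nu>_smult \<nu>_closed)

lemma \<alpha>_k: "v \<in> carrier V \<Longrightarrow> \<alpha> (k v) = e v"
  by (simp add: \<alpha>_def \<nu>_k)

lemma \<alpha>_zero: "h.component (-1) x = \<zero>\<^bsub>h\<^esub> \<Longrightarrow> \<alpha> x = \<zero>\<^bsub>m\<^esub>"
  by (simp add: \<alpha>_def \<nu>_zero)

lemma \<alpha>_zero' [simp]: "\<alpha> \<zero>\<^bsub>h\<^esub> = \<zero>\<^bsub>m\<^esub>"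
  by (simp add: \<alpha>_zero)

lemma \<alpha>_other: "\<lbrakk>x \<in> H p; p \<noteq> -1\<rbrakk> \<Longrightarrow> \<alpha> x = \<zero>\<^bsub>m\<^esub>"
  by (simp add: \<alpha>_zero h.component_other)

lemma op_of:
  assumes "x \<in> carrier h"
  shows "op_of x \<in> \<A>" "v \<in> carrier V \<Longrightarrow> h.component 0 x \<otimes>\<^bsub>h\<^esub> k v = k (op_of x v)"
proof -
  have "\<exists>A. A \<in> \<A> \<and> (\<forall>v\<in>carrier V. h.component 0 x \<otimes>\<^bsub>h\<^esub> k v = k (A v))"
    using h_type[OF h.component_in[OF assms]] by blast
  from someI_ex[OF this] show "op_of x \<in> \<A>" "v \<in> carrier V \<Longrightarrow> h.component 0 x \<otimes>\<^bsub>h\<^esub> k v = k (op_of x v)"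
    unfolding op_of_def by blast+
qed

text \<open>As \<open>h\<close> has nothing below degree -1, the degrees 0 and -1 are the only pair
  that can add up to -1.\<close>

lemma component_bracket:
  assumes x: "x \<in> carrier h" and y: "y \<in> carrier h"
  shows "h.component (-1) (x \<otimes>\<^bsub>h\<^esub> y) =
    h.component 0 x \<otimes>\<^bsub>h\<^esub> h.component (-1) y \<oplus>\<^bsub>h\<^esub> h.component (-1) x \<otimes>\<^bsub>h\<^esub> h.component 0 y"
  using x
proof (induction rule: h.graded_induct)
  case (homogeneous p x)
  note x = homogeneous and xc = h.G_closed[OF homogeneous]
  show ?case using y
  proof (induction rule: h.graded_induct)
    case (homogeneous q y)
    note yc = h.G_closed[OF homogeneous] and xy = h.G_bracket[OF x homogeneous HOL.refl]
    note same = h.component_same[OF x] h.component_same[OF homogeneous] h.component_same[OF xy]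
    note other = h.component_other[OF x] h.component_other[OF homogeneous] h.component_other[OF xy]
    consider "p \<le> -2" | "q \<le> -2" | "p = 0" "q = -1" | "p = -1" "q = 0" | "p + q \<noteq> -1" "p \<noteq> 0 \<or> q \<noteq> -1" "p \<noteq> -1 \<or> q \<noteq> 0"
      by linarith
    then show ?case
    proof cases
      case 1
      then have "x = \<zero>\<^bsub>h\<^esub>" using H_bot x by blast
      then show ?thesis using yc by simp
    next
      case 2
      then have "y = \<zero>\<^bsub>h\<^esub>" using H_bot homogeneous by blast
      then show ?thesis using xc by simp
    next
      case 3
      then have "h.component (-1) x = \<zero>\<^bsub>h\<^esub>" "h.component 0 y = \<zero>\<^bsub>h\<^esub>" using other by auto
      then show ?thesis using 3 same xc yc by (simp add: h.bracket_closed)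
    next
      case 4
      then have "h.component 0 x = \<zero>\<^bsub>h\<^esub>" "h.component (-1) y = \<zero>\<^bsub>h\<^esub>" using other by auto
      then show ?thesis using 4 same xc yc by (simp add: h.bracket_closed)
    next
      case 5
      have "h.component 0 x = \<zero>\<^bsub>h\<^esub> \<or> h.component (-1) y = \<zero>\<^bsub>h\<^esub>"
        "h.component (-1) x = \<zero>\<^bsub>h\<^esub> \<or> h.component 0 y = \<zero>\<^bsub>h\<^esub>" using other 5 by metis+
      moreover have "h.component (-1) (x \<otimes>\<^bsub>h\<^esub> y) = \<zero>\<^bsub>h\<^esub>" using 5 other by metis
      ultimately show ?thesis using xc yc by auto
    qed
  next
    case (add y z)
    then show ?case using xc
      by (simp add: h.bracket_add_right h.bracket_closed h.component_add h.M.a_ac)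
  qed
next
  case (add x z)
  then show ?case using y
    by (simp add: h.bracket_add_left h.bracket_closed h.component_add h.M.a_ac)
qed

lemma \<alpha>_bracket:
  assumes x: "x \<in> carrier h" and y: "y \<in> carrier h"
  shows "\<alpha> (x \<otimes>\<^bsub>h\<^esub> y) = e (op_of x (\<nu> y)) \<ominus>\<^bsub>m\<^esub> e (op_of y (\<nu> x))"
proof -
  note c = A_closed[OF op_of(1)[OF x] \<nu>_closed[OF y]] A_closed[OF op_of(1)[OF y] \<nu>_closed[OF x]]
  have "h.component (-1) x \<otimes>\<^bsub>h\<^esub> h.component 0 y = \<ominus>\<^bsub>h\<^esub> k (op_of y (\<nu> x))"
    using h.bracket_antisym[of "h.component (-1) x" "h.component 0 y"] op_of(2)[OF y \<nu>_closed[OF x]] x y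
    by (simp add: k_\<nu>)
  then have "k (op_of x (\<nu> y) \<ominus>\<^bsub>V\<^esub> op_of y (\<nu> x)) = h.component (-1) (x \<otimes>\<^bsub>h\<^esub> y)"
    using component_bracket[OF x y] op_of(2)[OF x \<nu>_closed[OF y]] c y
    by (simp add: k_\<nu> k.T_minus a_minus_def)
  then have "\<nu> (x \<otimes>\<^bsub>h\<^esub> y) = op_of x (\<nu> y) \<ominus>\<^bsub>V\<^esub> op_of y (\<nu> x)"
    using c by (intro \<nu>_eqI) simp_all
  then show ?thesis using c by (simp add: \<alpha>_def e.T_minus)
qed

definition S where "S x y z = e (\<nu> x) \<otimes>\<^bsub>m\<^esub> e (op_of y (\<nu> z))"

lemma S_closed: "\<lbrakk>x \<in> carrier h; y \<in> carrier h; z \<in> carrier h\<rbrakk> \<Longrightarrow> S x y z \<in> carrier m"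
  by (simp add: S_def m.bracket_closed \<nu>_closed A_closed op_of)

text \<open>Written with \<open>S\<close>, the cyclic sum of these brackets telescopes; this is what the Jacobi
  identity needs beyond the one in \<open>m\<close>.\<close>

lemma bracket_\<alpha>_bracket:
  assumes u: "u \<in> n" and x: "x \<in> carrier h" and y: "y \<in> carrier h" and z: "z \<in> carrier h"
  shows "(u \<oplus>\<^bsub>m\<^esub> \<alpha> x) \<otimes>\<^bsub>m\<^esub> \<alpha> (y \<otimes>\<^bsub>h\<^esub> z) = S x y z \<ominus>\<^bsub>m\<^esub> S y z x"
proof -
  note uc = n_closed[OF u]
  have c: "e (op_of a (\<nu> b)) \<in> carrier m" if "a \<in> carrier h" "b \<in> carrier h" for a b
    using that by (simp add: \<nu>_closed A_closed op_of)
  \<comment> \<open>\<open>A_lower\<close> removes the part u of the left factor, so only vectors of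
    degree -1 interact.\<close>
  have n0: "u \<otimes>\<^bsub>m\<^esub> e (op_of a (\<nu> b)) = \<zero>\<^bsub>m\<^esub>" if "a \<in> carrier h" "b \<in> carrier h" for a b
    using m.bracket_antisym[OF uc c[OF that]] A_lower[OF op_of(1)[OF that(1)] \<nu>_closed[OF that(2)] u] by simp
  have \<alpha>e: "e (\<nu> x) = \<alpha> x" by (simp add: \<alpha>_def)
  have "\<alpha> x \<otimes>\<^bsub>m\<^esub> e (op_of z (\<nu> y)) = S y z x"
  proof -
    \<comment> \<open>\<open>A_derivation\<close> moves the operator of z from y to x at the price
      of a sign, which antisymmetry absorbs.\<close>
    have eq: "e (op_of z (\<nu> x)) \<otimes>\<^bsub>m\<^esub> e (\<nu> y) \<oplus>\<^bsub>m\<^esub> e (\<nu> x) \<otimes>\<^bsub>m\<^esub> e (op_of z (\<nu> y)) = \<zero>\<^bsub>m\<^esub>"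
      by (rule A_derivation[OF op_of(1)[OF z]]) (use x y \<nu>_closed in auto)
    have "e (op_of z (\<nu> x)) \<otimes>\<^bsub>m\<^esub> e (\<nu> y) = \<ominus>\<^bsub>m\<^esub> S y z x"
      unfolding S_def by (rule m.bracket_antisym) (use c[OF z x] y \<nu>_closed in auto)
    then have "\<ominus>\<^bsub>m\<^esub> S y z x \<oplus>\<^bsub>m\<^esub> \<alpha> x \<otimes>\<^bsub>m\<^esub> e (op_of z (\<nu> y)) = \<zero>\<^bsub>m\<^esub>" using eq \<alpha>e by simp
    then show ?thesis using c[OF z y] S_closed[OF y z x] x
      by (metis m.M.a_comm m.M.add.inv_closed m.M.minus_equality m.M.minus_minus m.bracket_closed \<alpha>_closed)
  qed
  then show ?thesis using c uc x y z n0
    by (simp add: \<alpha>_bracket m.bracket_add_left m.bracket_add_right m.bracket_neg_right a_minus_def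
        m.bracket_closed S_def \<alpha>e \<nu>_closed)
qed

text \<open>The sum \<open>\<nn> \<oplus> h\<close> in which the part of \<open>h\<close> of degree \<open>\<ge> 0\<close> annihilates \<open>\<nn>\<close>. The vector \<open>\<alpha> x\<close>
  is the component of \<open>x\<close> of degree \<open>-1\<close>, moved to \<open>m\<close>; it restores the brackets of \<open>m\<close> that are
  lost in \<open>h\<close>, where elements of degree \<open>-1\<close> commute.\<close>

definition ext :: "('k, 'm \<times> 'h) module" where
  "ext = \<lparr>carrier = n \<times> carrier h,
    mult = (\<lambda>P Q. ((fst P \<oplus>\<^bsub>m\<^esub> \<alpha> (snd P)) \<otimes>\<^bsub>m\<^esub> (fst Q \<oplus>\<^bsub>m\<^esub> \<alpha> (snd Q)), snd P \<otimes>\<^bsub>h\<^esub> snd Q)),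
    one = (\<zero>\<^bsub>m\<^esub>, \<zero>\<^bsub>h\<^esub>), zero = (\<zero>\<^bsub>m\<^esub>, \<zero>\<^bsub>h\<^esub>),
    add = (\<lambda>P Q. (fst P \<oplus>\<^bsub>m\<^esub> fst Q, snd P \<oplus>\<^bsub>h\<^esub> snd Q)),
    smult = (\<lambda>c P. (c \<odot>\<^bsub>m\<^esub> fst P, c \<odot>\<^bsub>h\<^esub> snd P))\<rparr>"

lemma ext_simps:
  "carrier ext = n \<times> carrier h"
  "(y, x) \<otimes>\<^bsub>ext\<^esub> (y', x') = ((y \<oplus>\<^bsub>m\<^esub> \<alpha> x) \<otimes>\<^bsub>m\<^esub> (y' \<oplus>\<^bsub>m\<^esub> \<alpha> x'), x \<otimes>\<^bsub>h\<^esub> x')"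
  "(y, x) \<oplus>\<^bsub>ext\<^esub> (y', x') = (y \<oplus>\<^bsub>m\<^esub> y', x \<oplus>\<^bsub>h\<^esub> x')"
  "c \<odot>\<^bsub>ext\<^esub> (y, x) = (c \<odot>\<^bsub>m\<^esub> y, c \<odot>\<^bsub>h\<^esub> x)"
  "\<zero>\<^bsub>ext\<^esub> = (\<zero>\<^bsub>m\<^esub>, \<zero>\<^bsub>h\<^esub>)"
  by (simp_all add: ext_def)

lemma vectorspace_ext: "vectorspace K ext"
proof -
  note n_simps = m.subspace_zero[OF n_subspace] m.subspace_add[OF n_subspace]
    m.subspace_smult[OF n_subspace]
  have "abelian_group ext"
  proof (rule abelian_groupI, goal_cases)
    case (6 x)
    then obtain y z where yz: "x = (y, z)" "y \<in> n" "z \<in> carrier h" by (auto simp: ext_simps)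
    then have "(\<ominus>\<^bsub>m\<^esub> y, \<ominus>\<^bsub>h\<^esub> z) \<in> carrier ext"
      by (simp add: ext_simps m.subspace_neg[OF n_subspace])
    then show ?case using yz n_closed
      by (intro bexI[of _ "(\<ominus>\<^bsub>m\<^esub> y, \<ominus>\<^bsub>h\<^esub> z)"]) (auto simp: ext_simps m.M.l_neg h.M.l_neg)
  qed (auto simp: ext_simps n_simps n_closed m.M.a_ac h.M.a_ac)
  then have "module K ext"
    by (intro moduleI V.R.is_cring)
      (auto simp: ext_simps n_simps n_closed m.smult_l_distr m.smult_r_distr m.smult_assoc1
        h.smult_l_distr h.smult_r_distr h.smult_assoc1)
  then show ?thesis by (intro vectorspace.intro V.field_axioms)
qed

lemma ext_closed: "\<lbrakk>P \<in> carrier ext; Q \<in> carrier ext\<rbrakk> \<Longrightarrow> P \<otimes>\<^bsub>ext\<^esub> Q \<in> carrier ext"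
  by (auto simp: ext_simps n_closed h.bracket_closed intro!: bracket_n)

lemma ext_jacobi:
  assumes "P \<in> carrier ext" "Q \<in> carrier ext" "R \<in> carrier ext"
  shows "P \<otimes>\<^bsub>ext\<^esub> (Q \<otimes>\<^bsub>ext\<^esub> R) \<oplus>\<^bsub>ext\<^esub> Q \<otimes>\<^bsub>ext\<^esub> (R \<otimes>\<^bsub>ext\<^esub> P) \<oplus>\<^bsub>ext\<^esub> R \<otimes>\<^bsub>ext\<^esub> (P \<otimes>\<^bsub>ext\<^esub> Q) = \<zero>\<^bsub>ext\<^esub>"
proof -
  obtain y1 x1 y2 x2 y3 x3 where eq: "P = (y1, x1)" "Q = (y2, x2)" "R = (y3, x3)"
    and y: "y1 \<in> n" "y2 \<in> n" "y3 \<in> n" and x: "x1 \<in> carrier h" "x2 \<in> carrier h" "x3 \<in> carrier h"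
    using assms by (auto simp: ext_simps)
  note yc = y[THEN n_closed]
  let ?u1 = "y1 \<oplus>\<^bsub>m\<^esub> \<alpha> x1" and ?u2 = "y2 \<oplus>\<^bsub>m\<^esub> \<alpha> x2" and ?u3 = "y3 \<oplus>\<^bsub>m\<^esub> \<alpha> x3"
  have u: "?u1 \<in> carrier m" "?u2 \<in> carrier m" "?u3 \<in> carrier m" using yc x by simp_all
  let ?J1 = "?u1 \<otimes>\<^bsub>m\<^esub> (?u2 \<otimes>\<^bsub>m\<^esub> ?u3)" and ?J2 = "?u2 \<otimes>\<^bsub>m\<^esub> (?u3 \<otimes>\<^bsub>m\<^esub> ?u1)" and ?J3 = "?u3 \<otimes>\<^bsub>m\<^esub> (?u1 \<otimes>\<^bsub>m\<^esub> ?u2)"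
  let ?a = "S x1 x2 x3" and ?b = "S x2 x3 x1" and ?c = "S x3 x1 x2"
  have c: "?J1 \<in> carrier m" "?J2 \<in> carrier m" "?J3 \<in> carrier m" "?a \<in> carrier m" "?b \<in> carrier m" "?c \<in> carrier m"
    using u x by (auto intro: m.bracket_closed S_closed)
  \<comment> \<open>In the first component each double bracket is the one of \<open>m\<close> for
    the vectors \<open>?u1\<close>, \<open>?u2\<close>, \<open>?u3\<close>, plus a correction from
    \<alpha> of a bracket in \<open>h\<close>. The corrections are the differences around the cycle
    \<open>?a\<close>, \<open>?b\<close>, \<open>?c\<close>.\<close>
  have t: "?u1 \<otimes>\<^bsub>m\<^esub> (?u2 \<otimes>\<^bsub>m\<^esub> ?u3 \<oplus>\<^bsub>m\<^esub> \<alpha> (x2 \<otimes>\<^bsub>h\<^esub> x3)) = ?J1 \<oplus>\<^bsub>m\<^esub> (?a \<ominus>\<^bsub>m\<^esub> ?b)"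
    "?u2 \<otimes>\<^bsub>m\<^esub> (?u3 \<otimes>\<^bsub>m\<^esub> ?u1 \<oplus>\<^bsub>m\<^esub> \<alpha> (x3 \<otimes>\<^bsub>h\<^esub> x1)) = ?J2 \<oplus>\<^bsub>m\<^esub> (?b \<ominus>\<^bsub>m\<^esub> ?c)"
    "?u3 \<otimes>\<^bsub>m\<^esub> (?u1 \<otimes>\<^bsub>m\<^esub> ?u2 \<oplus>\<^bsub>m\<^esub> \<alpha> (x1 \<otimes>\<^bsub>h\<^esub> x2)) = ?J3 \<oplus>\<^bsub>m\<^esub> (?c \<ominus>\<^bsub>m\<^esub> ?a)"
    using u x bracket_\<alpha>_bracket[OF y(1) x(1,2,3)] bracket_\<alpha>_bracket[OF y(2) x(2,3,1)]
      bracket_\<alpha>_bracket[OF y(3) x(3,1,2)]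
    by (simp_all add: m.bracket_add_right m.bracket_closed h.bracket_closed del: m.M.a_closed)
  have "(?J1 \<oplus>\<^bsub>m\<^esub> (?a \<ominus>\<^bsub>m\<^esub> ?b)) \<oplus>\<^bsub>m\<^esub> (?J2 \<oplus>\<^bsub>m\<^esub> (?b \<ominus>\<^bsub>m\<^esub> ?c)) \<oplus>\<^bsub>m\<^esub> (?J3 \<oplus>\<^bsub>m\<^esub> (?c \<ominus>\<^bsub>m\<^esub> ?a))
      = (?J1 \<oplus>\<^bsub>m\<^esub> ?J2 \<oplus>\<^bsub>m\<^esub> ?J3) \<oplus>\<^bsub>m\<^esub> ((?a \<ominus>\<^bsub>m\<^esub> ?b) \<oplus>\<^bsub>m\<^esub> (?b \<ominus>\<^bsub>m\<^esub> ?c) \<oplus>\<^bsub>m\<^esub> (?c \<ominus>\<^bsub>m\<^esub> ?a))"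
    using c by (simp add: m.M.a_ac)
  also have "?J1 \<oplus>\<^bsub>m\<^esub> ?J2 \<oplus>\<^bsub>m\<^esub> ?J3 = \<zero>\<^bsub>m\<^esub>" by (rule m.jacobi[OF u])
  also have "(?a \<ominus>\<^bsub>m\<^esub> ?b) \<oplus>\<^bsub>m\<^esub> (?b \<ominus>\<^bsub>m\<^esub> ?c) \<oplus>\<^bsub>m\<^esub> (?c \<ominus>\<^bsub>m\<^esub> ?a) = \<zero>\<^bsub>m\<^esub>"
    using c by (simp add: a_minus_def m.M.a_assoc m.M.r_neg1 m.M.r_neg m.M.r_neg2 m.M.l_neg)
  finally have sum: "(?J1 \<oplus>\<^bsub>m\<^esub> (?a \<ominus>\<^bsub>m\<^esub> ?b)) \<oplus>\<^bsub>m\<^esub> (?J2 \<oplus>\<^bsub>m\<^esub> (?b \<ominus>\<^bsub>m\<^esub> ?c)) \<oplus>\<^bsub>m\<^esub> (?J3 \<oplus>\<^bsub>m\<^esub> (?c \<ominus>\<^bsub>m\<^esub> ?a)) = \<zero>\<^bsub>m\<^esub>"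
    by simp
  show ?thesis unfolding eq ext_simps t sum by (simp add: h.jacobi[OF x])
qed

lemma lie_algebra_ext: "lie_algebra K ext"
proof (rule lie_algebra.intro[OF vectorspace_ext], unfold_locales, goal_cases)
  case (1 x y) then show ?case by (rule ext_closed)
next
  case (2 x y z)
  then show ?case
    by (auto simp: ext_simps n_closed \<alpha>_add m.bracket_add_left m.bracket_add_right m.bracket_closed m.M.a_ac
        h.bracket_add_left)
next
  case (3 x y z)
  then show ?case
    by (auto simp: ext_simps n_closed \<alpha>_add m.bracket_add_left m.bracket_add_right m.bracket_closed m.M.a_ac
        h.bracket_add_right)
next
  case (4 c x y)
  then show ?case
    by (auto simp: ext_simps n_closed \<alpha>_smult m.smult_r_distr[symmetric] m.bracket_smult_left h.bracket_smult_left)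
next
  case (5 c x y)
  then show ?case
    by (auto simp: ext_simps n_closed \<alpha>_smult m.smult_r_distr[symmetric] m.bracket_smult_right h.bracket_smult_right)
next
  case (6 x) then show ?case by (auto simp: ext_simps n_closed m.bracket_self h.bracket_self)
next
  case (7 x y z) then show ?case by (rule ext_jacobi)
qed

sublocale x: lie_algebra K ext by (rule lie_algebra_ext)

text \<open>The copy of V in degree -1 is kept in \<open>h\<close> alone, so \<open>m\<close>
  contributes only in degrees at most -2, where \<open>h\<close> is zero.\<close>

definition ext_deg where "ext_deg p = (if p \<le> -2 then M p else {\<zero>\<^bsub>m\<^esub>}) \<times> H p"

lemma ext_deg_iff: "(y, x) \<in> ext_deg p \<longleftrightarrow> x \<in> H p \<and> y \<in> M p \<and> (p > -2 \<longrightarrow> y = \<zero>\<^bsub>m\<^esub>)"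
  by (auto simp: ext_deg_def)

lemma ext_deg_closed: "P \<in> ext_deg p \<Longrightarrow> P \<in> carrier ext"
  by (cases P) (auto simp: ext_deg_iff ext_simps h.G_closed m.G_closed m.graded_sum_iff m.component_other)

lemma ext_deg_sum: "(y, x) \<in> ext_deg p \<Longrightarrow> y \<oplus>\<^bsub>m\<^esub> \<alpha> x \<in> M p"
proof -
  assume yx: "(y, x) \<in> ext_deg p"
  then have c: "y \<in> carrier m" "x \<in> carrier h" by (auto simp: ext_deg_iff h.G_closed m.G_closed)
  show ?thesis
  proof (cases "p = -1")
    case True
    then show ?thesis using yx \<alpha>_in[OF c(2)] c by (simp add: ext_deg_iff)
  next
    case False
    then show ?thesis using yx c \<alpha>_other[of x p] by (simp add: ext_deg_iff)
  qed
qed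

lemma graded_ext: "graded_lie_algebra K ext ext_deg"
proof (rule graded_lie_algebraI[where cp = "\<lambda>p P. (m.component p (fst P), h.component p (snd P))"], goal_cases)
  case 1 then show ?case by (rule lie_algebra_ext)
next
  case (2 p)
  show ?case
  proof (rule x.subspaceI)
    show "ext_deg p \<subseteq> carrier ext" using ext_deg_closed by blast
  qed (auto simp: ext_simps ext_deg_iff m.subspace_add[OF m.G_subspace] h.subspace_add[OF h.G_subspace]
      m.subspace_smult[OF m.G_subspace] h.subspace_smult[OF h.G_subspace])
next
  case (3 p q P Q)
  obtain y x y' x' where eq: "P = (y, x)" "Q = (y', x')" by (cases P, cases Q) auto
  note d = 3[unfolded eq]
  have c: "x \<otimes>\<^bsub>h\<^esub> x' \<in> H (p + q)" using d by (auto simp: ext_deg_iff intro: h.G_bracket)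
  have u: "(y \<oplus>\<^bsub>m\<^esub> \<alpha> x) \<otimes>\<^bsub>m\<^esub> (y' \<oplus>\<^bsub>m\<^esub> \<alpha> x') \<in> M (p + q)"
    by (rule m.G_bracket[OF ext_deg_sum[OF d(1)] ext_deg_sum[OF d(2)]]) simp
  \<comment> \<open>A sum p + q > -2 forces p \<ge> 0 or q \<ge> 0, and in such a degree the part y
    \<oplus> \<alpha> x in \<open>m\<close> vanishes.\<close>
  moreover have "(y \<oplus>\<^bsub>m\<^esub> \<alpha> x) \<otimes>\<^bsub>m\<^esub> (y' \<oplus>\<^bsub>m\<^esub> \<alpha> x') = \<zero>\<^bsub>m\<^esub>" if "p + q > -2"
  proof -
    note s = ext_deg_sum[OF d(1)] ext_deg_sum[OF d(2)]
    from that have "p \<ge> 0 \<or> q \<ge> 0" by linarith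
    then have "y \<oplus>\<^bsub>m\<^esub> \<alpha> x = \<zero>\<^bsub>m\<^esub> \<or> y' \<oplus>\<^bsub>m\<^esub> \<alpha> x' = \<zero>\<^bsub>m\<^esub>" using s M_nonneg by blast
    then show ?thesis using m.G_closed[OF s(1)] m.G_closed[OF s(2)] by auto
  qed
  ultimately show ?case using c unfolding eq by (simp add: ext_simps ext_deg_iff)
next
  case (4 x p)
  then show ?case by (auto simp: ext_simps ext_deg_iff m.component_in h.component_in m.graded_sum_iff)
next
  case (5 x)
  then have c: "fst x \<in> carrier m" "snd x \<in> carrier h" by (auto simp: ext_simps n_closed)
  have "{p. (m.component p (fst x), h.component p (snd x)) \<noteq> \<zero>\<^bsub>ext\<^esub>} \<subseteq>
      {p. m.component p (fst x) \<noteq> \<zero>\<^bsub>m\<^esub>} \<union> {p. h.component p (snd x) \<noteq> \<zero>\<^bsub>h\<^esub>}"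
    by (auto simp: ext_simps)
  then show ?case using m.component_finite[OF c(1)] h.component_finite[OF c(2)] finite_subset by blast
next
  case (6 x y p)
  then show ?case by (auto simp: ext_simps m.component_add h.component_add n_closed)
next
  case (7 p x)
  then show ?case by (cases x) (auto simp: ext_deg_iff m.component_same h.component_same)
next
  case (8 p q x)
  then show ?case by (cases x) (auto simp: ext_deg_iff ext_simps m.component_other h.component_other)
next
  case (9 x)
  then show ?case
    by (cases x) (auto simp: ext_simps n_closed intro: m.eq_zero_if_components h.eq_zero_if_components)
qed

sublocale x: graded_lie K ext ext_deg by (rule graded_lieI[OF graded_ext])

definition \<eta> where "\<eta> w = inv_into (carrier V) e (m.component (-1) w)"
text \<open>Degree -1 of \<open>m\<close> is moved to \<open>h\<close> through V. The bracket of
  \<open>ext\<close> adds \<alpha> of the second component back to the first, and thereby recovers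
  the bracket of \<open>m\<close>.\<close>

definition ext_incl where "ext_incl w = (w \<ominus>\<^bsub>m\<^esub> m.component (-1) w, k (\<eta> w))"

lemma \<eta>_closed: "w \<in> carrier m \<Longrightarrow> \<eta> w \<in> carrier V"
  unfolding \<eta>_def by (rule inv_into_into) (simp add: e_onto m.component_in)

lemma e_\<eta>: "w \<in> carrier m \<Longrightarrow> e (\<eta> w) = m.component (-1) w"
  unfolding \<eta>_def by (rule f_inv_into_f) (simp add: e_onto m.component_in)

lemma \<eta>_eqI: "\<lbrakk>v \<in> carrier V; e v = m.component (-1) w\<rbrakk> \<Longrightarrow> \<eta> w = v"
  unfolding \<eta>_def using inv_into_f_f[OF e_inj] by metis

lemma \<eta>_e: "v \<in> carrier V \<Longrightarrow> \<eta> (e v) = v"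
  by (intro \<eta>_eqI) (simp_all add: m.component_same e_in)

lemma \<eta>_zero: "m.component (-1) w = \<zero>\<^bsub>m\<^esub> \<Longrightarrow> \<eta> w = \<zero>\<^bsub>V\<^esub>"
  by (rule \<eta>_eqI) simp_all

lemma ext_incl_n: "y \<in> n \<Longrightarrow> ext_incl y = (y, \<zero>\<^bsub>h\<^esub>)"
  by (simp add: ext_incl_def m.graded_sum_iff \<eta>_zero a_minus_def)

lemma ext_incl_e: "v \<in> carrier V \<Longrightarrow> ext_incl (e v) = (\<zero>\<^bsub>m\<^esub>, k v)"
  by (simp add: m.component_same e_in ext_incl_def \<eta>_e a_minus_def m.M.r_neg)

lemma lower_remainder: "w \<in> carrier m \<Longrightarrow> w \<ominus>\<^bsub>m\<^esub> m.component (-1) w \<in> n"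
proof -
  assume w: "w \<in> carrier m"
  have "m.component p (w \<ominus>\<^bsub>m\<^esub> m.component (-1) w) = \<zero>\<^bsub>m\<^esub>" if "p \<notin> {..-2}" for p
  proof (cases "p = -1")
    case True
    then show ?thesis using w by (simp add: m.component_minus m.component_same[OF m.component_in])
  next
    case False
    then have "m.component p w = \<zero>\<^bsub>m\<^esub>" using m.component_in[OF w, of p] M_nonneg[of p] that by auto
    then show ?thesis using w False
      by (simp add: m.component_minus m.component_other[OF m.component_in[OF w]])
  qed
  then show ?thesis using w by (simp add: m.graded_sum_iff)
qed

lemma ext_incl_closed: "w \<in> carrier m \<Longrightarrow> ext_incl w \<in> carrier ext"
  using lower_remainder \<eta>_closed by (simp add: ext_incl_def ext_simps)

lemma ext_incl_hom: "ext_incl \<in> lie_hom K m ext"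
proof -
  have add: "ext_incl (x \<oplus>\<^bsub>m\<^esub> y) = ext_incl x \<oplus>\<^bsub>ext\<^esub> ext_incl y" if "x \<in> carrier m" "y \<in> carrier m" for x y
  proof -
    have "\<eta> (x \<oplus>\<^bsub>m\<^esub> y) = \<eta> x \<oplus>\<^bsub>V\<^esub> \<eta> y"
      by (rule \<eta>_eqI) (use that in \<open>simp_all add: \<eta>_closed e_\<eta> m.component_add\<close>)
    then show ?thesis using that
      by (simp add: ext_incl_def ext_simps m.component_add \<eta>_closed a_minus_def m.M.minus_add m.M.a_ac)
  qed
  have smult: "ext_incl (c \<odot>\<^bsub>m\<^esub> x) = c \<odot>\<^bsub>ext\<^esub> ext_incl x" if "c \<in> carrier K" "x \<in> carrier m" for c x
  proof -
    have "\<eta> (c \<odot>\<^bsub>m\<^esub> x) = c \<odot>\<^bsub>V\<^esub> \<eta> x"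
      by (rule \<eta>_eqI) (use that in \<open>simp_all add: \<eta>_closed e_\<eta> m.component_smult\<close>)
    then show ?thesis using that
      by (simp add: ext_incl_def ext_simps m.component_smult \<eta>_closed a_minus_def m.smult_r_distr m.smult_r_minus)
  qed
  have u: "fst (ext_incl x) \<oplus>\<^bsub>m\<^esub> \<alpha> (snd (ext_incl x)) = x" if "x \<in> carrier m" for x
    using that by (simp add: ext_incl_def \<alpha>_k \<eta>_closed e_\<eta> a_minus_def m.M.a_assoc m.M.l_neg)
  have mult: "ext_incl (x \<otimes>\<^bsub>m\<^esub> y) = ext_incl x \<otimes>\<^bsub>ext\<^esub> ext_incl y" if "x \<in> carrier m" "y \<in> carrier m" for x y
  proof -
    have "snd (ext_incl x) \<otimes>\<^bsub>h\<^esub> snd (ext_incl y) = \<zero>\<^bsub>h\<^esub>"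
      using that by (simp add: ext_incl_def k_commute \<eta>_closed)
    then have "ext_incl x \<otimes>\<^bsub>ext\<^esub> ext_incl y = (x \<otimes>\<^bsub>m\<^esub> y, \<zero>\<^bsub>h\<^esub>)"
      unfolding ext_def monoid.simps using u that by simp
    then show ?thesis using ext_incl_n[OF bracket_n[OF that]] by simp
  qed
  show ?thesis using add smult mult ext_incl_closed by (auto simp: lie_hom_def module_hom_def)
qed

lemma ext_incl_image:
  assumes "p < 0" shows "ext_incl ` M p = ext_deg p"
proof (cases "p = -1")
  case True
  have "ext_incl ` M (-1) = (\<lambda>v. (\<zero>\<^bsub>m\<^esub>, k v)) ` carrier V"
    unfolding e_onto[symmetric] image_image by (rule image_cong) (simp_all add: ext_incl_e)
  also have "\<dots> = ext_deg (-1)" unfolding ext_deg_def k_onto[symmetric] by auto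
  finally show ?thesis using True by simp
next
  case False
  then have p: "p \<le> -2" using assms by simp
  then have "M p \<subseteq> n" by (intro m.G_subset_graded_sum) simp
  then have "ext_incl ` M p = (\<lambda>y. (y, \<zero>\<^bsub>h\<^esub>)) ` M p" by (intro image_cong) (auto simp: ext_incl_n)
  also have "\<dots> = ext_deg p" using p H_bot[OF p] by (auto simp: ext_deg_def)
  finally show ?thesis .
qed

lemma ext_incl_inj: "inj_on ext_incl (carrier m)"
proof -
  interpret i: linear_map K m ext ext_incl
    by (rule lie_hom_linear_map[OF m.lie_algebra_axioms lie_algebra_ext ext_incl_hom])
  show ?thesis unfolding i.inj_on_iff
  proof (intro ballI impI)
    fix w assume w: "w \<in> carrier m" "ext_incl w = \<zero>\<^bsub>ext\<^esub>"
    then have "k (\<eta> w) = \<zero>\<^bsub>h\<^esub>" "w \<ominus>\<^bsub>m\<^esub> m.component (-1) w = \<zero>\<^bsub>m\<^esub>" by (auto simp: ext_incl_def ext_simps)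
    then have "\<eta> w = \<zero>\<^bsub>V\<^esub>" "w = m.component (-1) w"
      using iffD1[OF k.inj_on_iff k_inj] \<eta>_closed[OF w(1)] w(1) by auto
    then show "w = \<zero>\<^bsub>m\<^esub>" using e_\<eta>[OF w(1)] by simp
  qed
qed

text \<open>In degrees \<ge> 0 only \<open>h\<close> is left, and the second component of a bracket
  with degree -1 is the bracket of \<open>h\<close>; effectivity is inherited from there.\<close>

lemma effective_ext: "effective_prolongation K m M ext ext_deg ext_incl"
proof -
  have "X = \<zero>\<^bsub>ext\<^esub>" if X: "X \<in> graded_sum ext ext_deg {0..}"
    and 0: "\<forall>v\<in>ext_deg (-1). X \<otimes>\<^bsub>ext\<^esub> v = \<zero>\<^bsub>ext\<^esub>" for X
  proof -
    obtain y x where eq: "X = (y, x)" by (cases X) auto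
    have sub: "ext_deg p \<subseteq> {\<zero>\<^bsub>m\<^esub>} \<times> graded_sum h H {0..}" if "p \<ge> 0" for p
      using that h.G_subset_graded_sum[of p "{0..}" ] by (auto simp: ext_deg_def)
    have Y: "subspace K ({\<zero>\<^bsub>m\<^esub>} \<times> graded_sum h H {0..}) ext"
      by (rule x.subspaceI)
        (auto simp: ext_simps h.graded_sum_iff m.graded_sum_iff h.component_add h.component_smult)
    have "X \<in> {\<zero>\<^bsub>m\<^esub>} \<times> graded_sum h H {0..}"
    proof -
      obtain F c where F: "finite F" "F \<subseteq> {0..}" "\<forall>p\<in>F. c p \<in> ext_deg p" "X = (\<Oplus>\<^bsub>ext\<^esub>p\<in>F. c p)"
        using X unfolding graded_sum_def by blast
      show ?thesis unfolding F(4) by (rule x.subspace_finsum[OF Y]) (use F sub in fastforce)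
    qed
    then have y: "y = \<zero>\<^bsub>m\<^esub>" and x: "x \<in> graded_sum h H {0..}" by (auto simp: eq)
    have "x \<otimes>\<^bsub>h\<^esub> v = \<zero>\<^bsub>h\<^esub>" if v: "v \<in> H (-1)" for v
    proof -
      have "(\<zero>\<^bsub>m\<^esub>, v) \<in> ext_deg (-1)" using v by (simp add: ext_deg_iff)
      then have "X \<otimes>\<^bsub>ext\<^esub> (\<zero>\<^bsub>m\<^esub>, v) = \<zero>\<^bsub>ext\<^esub>" using 0 by blast
      then show ?thesis by (simp add: eq ext_simps)
    qed
    then have "x = \<zero>\<^bsub>h\<^esub>" using h_eff[OF x] by blast
    then show ?thesis by (simp add: eq y ext_simps)
  qed
  moreover have "\<zero>\<^bsub>ext\<^esub> \<in> graded_sum ext ext_deg {0..}"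
    by (simp add: x.graded_sum_iff)
  moreover have "\<zero>\<^bsub>ext\<^esub> \<otimes>\<^bsub>ext\<^esub> v = \<zero>\<^bsub>ext\<^esub>" if "v \<in> ext_deg (-1)" for v
    using ext_deg_closed[OF that] by simp
  ultimately show ?thesis unfolding effective_prolongation_def
    using fgla graded_ext ext_incl_hom ext_incl_inj ext_incl_image by blast
qed

lemma ext_type:
  assumes "X \<in> ext_deg 0" shows "\<exists>A\<in>\<A>. \<forall>v\<in>carrier V. X \<otimes>\<^bsub>ext\<^esub> ext_incl (e v) = ext_incl (e (A v))"
proof -
  obtain x where X: "X = (\<zero>\<^bsub>m\<^esub>, x)" "x \<in> H 0" using assms by (cases X) (auto simp: ext_deg_iff)
  obtain A where A: "A \<in> \<A>" "\<forall>v\<in>carrier V. x \<otimes>\<^bsub>h\<^esub> k v = k (A v)" using h_type[OF X(2)] by blast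
  have "X \<otimes>\<^bsub>ext\<^esub> ext_incl (e v) = ext_incl (e (A v))" if v: "v \<in> carrier V" for v
    using v A X A_closed[OF A(1) v] \<alpha>_other[OF X(2)] by (simp add: ext_incl_e ext_simps \<alpha>_k)
  then show ?thesis using A(1) by blast
qed

end

section \<open>Linear part, degrees and derivations of the free Lie algebra\<close>

section \<open>The free Lie algebra\<close>

text \<open>On terms, the homomorphism to V, regarded as an abelian Lie algebra, that extends the
  identity of V.\<close>

primrec linear_part :: "('k, 'v, 's) module_scheme \<Rightarrow> ('k, 'v) lie_term \<Rightarrow> 'v" where
  "linear_part V (Gen v) = v"
| "linear_part V Zero = \<zero>\<^bsub>V\<^esub>"
| "linear_part V (Plus s t) = linear_part V s \<oplus>\<^bsub>V\<^esub> linear_part V t"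
| "linear_part V (Scale c t) = c \<odot>\<^bsub>V\<^esub> linear_part V t"
| "linear_part V (Br s t) = \<zero>\<^bsub>V\<^esub>"

text \<open>T_A on representatives. The values are classes, and the untouched factor of a bracket
  enters through its class, so compatibility with the congruence can be checked by the laws of a Lie
  algebra.\<close>

primrec term_derivation :: "('k, 'r) ring_scheme \<Rightarrow> ('k, 'v, 's) module_scheme \<Rightarrow> ('v \<Rightarrow> 'v)
    \<Rightarrow> ('k, 'v) lie_term \<Rightarrow> ('k, 'v) lie_term set" where
  "term_derivation K V A (Gen v) = free_gen K V (A v)"
| "term_derivation K V A Zero = \<zero>\<^bsub>free_lie K V\<^esub>"
| "term_derivation K V A (Plus s t) =
    term_derivation K V A s \<oplus>\<^bsub>free_lie K V\<^esub> term_derivation K V A t"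
| "term_derivation K V A (Scale c t) = c \<odot>\<^bsub>free_lie K V\<^esub> term_derivation K V A t"
| "term_derivation K V A (Br s t) =
    term_derivation K V A s \<otimes>\<^bsub>free_lie K V\<^esub> lie_class K V t \<oplus>\<^bsub>free_lie K V\<^esub>
    lie_class K V s \<otimes>\<^bsub>free_lie K V\<^esub> term_derivation K V A t"

text \<open>Independence of the summands is not assumed, so this applies to the degrees of the free
  Lie algebra and of its quotients without knowing that their sum is direct.\<close>

lemma (in vectorspace) subspace_graded_sum_general:
  assumes G: "\<And>p. subspace K (G p) V"
  shows "subspace K (graded_sum V G P) V"
proof -
  note Gc = subspace_carrier[OF G]
  show ?thesis
  proof (rule subspaceI, goal_cases)
    case 1
    show ?case
    proof
      fix x assume "x \<in> graded_sum V G P"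
      then obtain F c where "\<forall>p\<in>F. c p \<in> G p" "x = (\<Oplus>\<^bsub>V\<^esub>p\<in>F. c p)"
        by (auto simp: graded_sum_def)
      then show "x \<in> carrier V" using Gc by (auto intro!: M.finsum_closed)
    qed
  next
    case 2
    have "\<zero>\<^bsub>V\<^esub> = (\<Oplus>\<^bsub>V\<^esub>p\<in>({}::int set). \<zero>\<^bsub>V\<^esub>)" by simp
    then show ?case unfolding graded_sum_def by (intro CollectI exI[of _ "{}"] exI[of _ "\<lambda>_. \<zero>\<^bsub>V\<^esub>"]) auto
  next
    case (3 x y)
    then obtain F c F' c' where F: "finite F" "F \<subseteq> P" "\<forall>p\<in>F. c p \<in> G p" "x = (\<Oplus>\<^bsub>V\<^esub>p\<in>F. c p)"
      and F': "finite F'" "F' \<subseteq> P" "\<forall>p\<in>F'. c' p \<in> G p" "y = (\<Oplus>\<^bsub>V\<^esub>p\<in>F'. c' p)"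
      unfolding graded_sum_def by blast
    \<comment> \<open>Both families are extended by zero to the union of the index sets.\<close>
    let ?c = "\<lambda>p. if p \<in> F then c p else \<zero>\<^bsub>V\<^esub>" and ?c' = "\<lambda>p. if p \<in> F' then c' p else \<zero>\<^bsub>V\<^esub>"
    have c: "?c p \<in> G p" "?c' p \<in> G p" for p using F(3) F'(3) subspace_zero[OF G] by auto
    have cc: "?c \<in> A \<rightarrow> carrier V" "?c' \<in> A \<rightarrow> carrier V" for A using Gc[OF c(1)] Gc[OF c(2)] by auto
    have x: "x = (\<Oplus>\<^bsub>V\<^esub>p\<in>F \<union> F'. ?c p)"
      unfolding F(4) by (rule M.add.finprod_mono_neutral_cong_left) (use F(1) F'(1) cc in auto)
    have y: "y = (\<Oplus>\<^bsub>V\<^esub>p\<in>F \<union> F'. ?c' p)"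
      unfolding F'(4) by (rule M.add.finprod_mono_neutral_cong_left) (use F(1) F'(1) cc in auto)
    have "x \<oplus>\<^bsub>V\<^esub> y = (\<Oplus>\<^bsub>V\<^esub>p\<in>F \<union> F'. ?c p \<oplus>\<^bsub>V\<^esub> ?c' p)"
      unfolding x y by (rule M.finsum_addf[symmetric]) (rule cc)+
    moreover have "?c p \<oplus>\<^bsub>V\<^esub> ?c' p \<in> G p" for p using c by (rule subspace_add[OF G])
    moreover have "finite (F \<union> F')" "F \<union> F' \<subseteq> P" using F(1,2) F'(1,2) by auto
    ultimately show ?case unfolding graded_sum_def by blast
  next
    case (4 a x)
    then obtain F c where F: "finite F" "F \<subseteq> P" "\<forall>p\<in>F. c p \<in> G p" "x = (\<Oplus>\<^bsub>V\<^esub>p\<in>F. c p)"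
      unfolding graded_sum_def by blast
    have "a \<odot>\<^bsub>V\<^esub> x = (\<Oplus>\<^bsub>V\<^esub>p\<in>F. a \<odot>\<^bsub>V\<^esub> c p)"
      unfolding F(4) by (rule finsum_smult) (use 4 F Gc in auto)
    moreover have "\<forall>p\<in>F. a \<odot>\<^bsub>V\<^esub> c p \<in> G p" using F(3) 4(1) subspace_smult[OF G] by blast
    ultimately show ?case unfolding graded_sum_def using F(1,2) by blast
  qed
qed

lemma (in vectorspace) graded_sum_subset:
  assumes W: "subspace K W V" and G: "\<And>p. p \<in> P \<Longrightarrow> G p \<subseteq> W"
  shows "graded_sum V G P \<subseteq> W"
proof
  fix x assume "x \<in> graded_sum V G P"
  then obtain F c where F: "F \<subseteq> P" "\<forall>p\<in>F. c p \<in> G p" "x = (\<Oplus>\<^bsub>V\<^esub>p\<in>F. c p)"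
    unfolding graded_sum_def by blast
  show "x \<in> W" unfolding F(3) by (rule subspace_finsum[OF W]) (use F G in blast)
qed

lemma (in vectorspace) subset_graded_sum:
  assumes G: "G p \<subseteq> carrier V" and p: "p \<in> P" shows "G p \<subseteq> graded_sum V G P"
proof
  fix x assume x: "x \<in> G p"
  then have "x = (\<Oplus>\<^bsub>V\<^esub>q\<in>{p}. x)" using G by auto
  then show "x \<in> graded_sum V G P" unfolding graded_sum_def
    by (intro CollectI exI[of _ "{p}"] exI[of _ "\<lambda>_. x"]) (use x p in auto)
qed

locale free_lie_on = vectorspace K V
  for K :: "('k, 'r) ring_scheme" and V :: "('k, 'v) module"
begin

abbreviation F where "F \<equiv> free_lie K V"
abbreviation F2 where "F2 \<equiv> free_lie_from K V 2"
abbreviation D where "D \<equiv> free_lie_deg K V"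
abbreviation cl where "cl \<equiv> lie_class K V"

sublocale F: lie_algebra K F by (rule lie_algebra_free_lie)

lemmas ops = free_lie_mult free_lie_add free_lie_smult free_lie_zero
lemmas ops_rev = ops[symmetric]

lemma cl_closed: "t \<in> lie_terms K V \<Longrightarrow> cl t \<in> carrier F"
  by (simp add: free_lie_carrier)

lemma F_cases: assumes "X \<in> carrier F" obtains t where "t \<in> lie_terms K V" "X = cl t"
  using assms by (auto simp: free_lie_carrier)

lemma free_induct [consumes 1, case_names Gen Zero Plus Scale Br]:
  assumes "X \<in> carrier F"
    and "\<And>v. v \<in> carrier V \<Longrightarrow> P (free_gen K V v)" and "P \<zero>\<^bsub>F\<^esub>"
    and "\<And>X Y. \<lbrakk>X \<in> carrier F; Y \<in> carrier F; P X; P Y\<rbrakk> \<Longrightarrow> P (X \<oplus>\<^bsub>F\<^esub> Y)"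
    and "\<And>c X. \<lbrakk>c \<in> carrier K; X \<in> carrier F; P X\<rbrakk> \<Longrightarrow> P (c \<odot>\<^bsub>F\<^esub> X)"
    and "\<And>X Y. \<lbrakk>X \<in> carrier F; Y \<in> carrier F; P X; P Y\<rbrakk> \<Longrightarrow> P (X \<otimes>\<^bsub>F\<^esub> Y)"
  shows "P X"
proof -
  obtain t where t: "t \<in> lie_terms K V" "X = cl t" using assms(1) by (rule F_cases)
  have "P (cl t)" using t(1)
  proof induction
    case (Gen v) then show ?case using assms(2) by (simp add: free_gen_def)
  next
    case Zero then show ?case using assms(3) by (simp add: ops)
  next
    case (Plus s t) then show ?case using assms(4)[of "cl s" "cl t"] by (simp add: ops cl_closed)
  next
    case (Scale c t) then show ?case using assms(5)[of c "cl t"] by (simp add: ops cl_closed)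
  next
    case (Br s t) then show ?case using assms(6)[of "cl s" "cl t"] by (simp add: ops cl_closed)
  qed
  then show ?thesis using t by simp
qed

lemma cong_some: "t \<in> lie_terms K V \<Longrightarrow> lie_cong K V t (SOME s. s \<in> cl t)"
proof -
  assume "t \<in> lie_terms K V"
  then have "t \<in> cl t" by (simp add: in_lie_class lie_cong.refl)
  then have "(SOME s. s \<in> cl t) \<in> cl t" by (rule someI)
  then show ?thesis by (simp add: in_lie_class)
qed

lemma gen_closed: "v \<in> carrier V \<Longrightarrow> free_gen K V v \<in> carrier F"
  by (simp add: free_gen_def cl_closed lie_terms.Gen)

sublocale gen: linear_map K V F "free_gen K V"
  by (rule linear_mapI[OF vectorspace_axioms F.vs free_gen_hom])

lemma linear_part_closed: "t \<in> lie_terms K V \<Longrightarrow> linear_part V t \<in> carrier V"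
  by (induction rule: lie_terms.induct) auto

lemma linear_part_cong: "lie_cong K V s t \<Longrightarrow> linear_part V s = linear_part V t"
proof (induction rule: lie_cong.induct)
  case (add_minus t)
  then show ?case by (simp add: linear_part_closed smult_minus_1 M.l_neg)
qed (simp_all add: linear_part_closed M.a_ac smult_l_distr smult_r_distr smult_assoc1)

text \<open>Independent of the representative because \<open>linear_part\<close> is invariant under
  the congruence. It is the projection to V with kernel f_[2](V).\<close>

definition \<rho> where "\<rho> X = linear_part V (SOME t. t \<in> X)"

lemma \<rho>_cl: "t \<in> lie_terms K V \<Longrightarrow> \<rho> (cl t) = linear_part V t"
  unfolding \<rho>_def using linear_part_cong[OF cong_some] by simp

lemma \<rho>_closed: "X \<in> carrier F \<Longrightarrow> \<rho> X \<in> carrier V"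
  by (elim F_cases) (simp add: \<rho>_cl linear_part_closed)

lemma \<rho>_add: "\<lbrakk>X \<in> carrier F; Y \<in> carrier F\<rbrakk> \<Longrightarrow> \<rho> (X \<oplus>\<^bsub>F\<^esub> Y) = \<rho> X \<oplus>\<^bsub>V\<^esub> \<rho> Y"
  by (elim F_cases) (simp add: ops \<rho>_cl lie_terms.intros)

lemma \<rho>_smult: "\<lbrakk>c \<in> carrier K; X \<in> carrier F\<rbrakk> \<Longrightarrow> \<rho> (c \<odot>\<^bsub>F\<^esub> X) = c \<odot>\<^bsub>V\<^esub> \<rho> X"
  by (elim F_cases) (simp add: ops \<rho>_cl lie_terms.intros)

lemma \<rho>_bracket: "\<lbrakk>X \<in> carrier F; Y \<in> carrier F\<rbrakk> \<Longrightarrow> \<rho> (X \<otimes>\<^bsub>F\<^esub> Y) = \<zero>\<^bsub>V\<^esub>"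
  by (elim F_cases) (simp add: ops \<rho>_cl lie_terms.intros)

lemma \<rho>_gen: "v \<in> carrier V \<Longrightarrow> \<rho> (free_gen K V v) = v"
  by (simp add: free_gen_def \<rho>_cl lie_terms.intros)

sublocale \<rho>: linear_map K F V \<rho>
  by (rule linear_mapI[OF F.vs vectorspace_axioms])
    (auto simp: module_hom_def \<rho>_closed \<rho>_add \<rho>_smult)

lemma D_subspace: "subspace K (D p) F"
proof (rule F.subspaceI, goal_cases)
  case 1 then show ?case by (auto simp: free_lie_deg_def cl_closed)
next
  case 2 then show ?case by (auto simp: free_lie_deg_def ops intro: homogeneous.Zero lie_terms.Zero)
next
  case (3 x y)
  then obtain s t where "s \<in> lie_terms K V" "homogeneous p s" "t \<in> lie_terms K V" "homogeneous p t"
    "x = cl s" "y = cl t" by (auto simp: free_lie_deg_def)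
  then show ?case unfolding free_lie_deg_def
    by (intro image_eqI[of _ _ "Plus s t"]) (auto simp: ops intro: homogeneous.intros lie_terms.intros)
next
  case (4 c x)
  then obtain t where "t \<in> lie_terms K V" "homogeneous p t" "x = cl t" by (auto simp: free_lie_deg_def)
  then show ?case using 4 unfolding free_lie_deg_def
    by (intro image_eqI[of _ _ "Scale c t"]) (auto simp: ops intro: homogeneous.intros lie_terms.intros)
qed

lemma D_closed: "X \<in> D p \<Longrightarrow> X \<in> carrier F"
  by (rule F.subspace_carrier[OF D_subspace])

lemma D_bracket: "\<lbrakk>X \<in> D p; Y \<in> D q\<rbrakk> \<Longrightarrow> X \<otimes>\<^bsub>F\<^esub> Y \<in> D (p + q)"
proof -
  assume "X \<in> D p" "Y \<in> D q"
  then obtain s t where "s \<in> lie_terms K V" "homogeneous p s" "t \<in> lie_terms K V" "homogeneous q t"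
    "X = cl s" "Y = cl t" by (auto simp: free_lie_deg_def)
  then show ?thesis unfolding free_lie_deg_def
    by (intro image_eqI[of _ _ "Br s t"]) (auto simp: ops intro: homogeneous.intros lie_terms.intros)
qed

lemma gen_in_D: "v \<in> carrier V \<Longrightarrow> free_gen K V v \<in> D (-1)"
  unfolding free_lie_deg_def free_gen_def by (auto intro: homogeneous.Gen lie_terms.Gen)

text \<open>A bracket can have degree \<ge> -1 only if one factor has degree \<ge> 0, and that
  factor is zero by induction. Hence only linear combinations of generators survive in degree
  -1.\<close>

lemma homogeneous_class:
  "\<lbrakk>homogeneous p t; t \<in> lie_terms K V\<rbrakk> \<Longrightarrow>
    (p = -1 \<longrightarrow> cl t = free_gen K V (linear_part V t)) \<and> (p \<ge> 0 \<longrightarrow> cl t = \<zero>\<^bsub>F\<^esub>) \<and>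
    (p \<noteq> -1 \<longrightarrow> linear_part V t = \<zero>\<^bsub>V\<^esub>)"
proof (induction rule: homogeneous.induct)
  case (Gen v) then show ?case by (simp add: free_gen_def)
next
  case (Zero p) then show ?case by (simp add: ops_rev)
next
  case (Plus p s t)
  then have st: "s \<in> lie_terms K V" "t \<in> lie_terms K V" by (auto elim: lie_terms.cases)
  then show ?case using Plus.IH by (simp add: ops_rev linear_part_closed)
next
  case (Scale p t c)
  then have st: "t \<in> lie_terms K V" "c \<in> carrier K" by (auto elim: lie_terms.cases)
  then show ?case using Scale.IH by (simp add: ops_rev linear_part_closed)
next
  case (Br p s q t)
  then have st: "s \<in> lie_terms K V" "t \<in> lie_terms K V" by (auto elim: lie_terms.cases)
  have "cl (Br s t) = \<zero>\<^bsub>F\<^esub>" if "p + q \<ge> -1"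
  proof -
    have "p \<ge> 0 \<or> q \<ge> 0" using that by linarith
    then show ?thesis using Br.IH st cl_closed by (auto simp: ops(1)[symmetric])
  qed
  then show ?case by simp
qed

lemma D_minus_one: "D (-1) = free_gen K V ` carrier V"
proof
  show "D (-1) \<subseteq> free_gen K V ` carrier V"
    using homogeneous_class linear_part_closed by (auto simp: free_lie_deg_def)
  show "free_gen K V ` carrier V \<subseteq> D (-1)" using gen_in_D by blast
qed

lemma D_nonneg: "p \<ge> 0 \<Longrightarrow> D p = {\<zero>\<^bsub>F\<^esub>}"
  using homogeneous_class F.subspace_zero[OF D_subspace] by (auto simp: free_lie_deg_def)

lemma F2_subspace: "subspace K F2 F"
  unfolding free_lie_from_def by (rule F.subspace_graded_sum_general[OF D_subspace])

lemma F2_closed: "X \<in> F2 \<Longrightarrow> X \<in> carrier F"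
  by (rule F.subspace_carrier[OF F2_subspace])

lemma D_subset_F2: "p \<le> -2 \<Longrightarrow> D p \<subseteq> F2"
  unfolding free_lie_from_def by (rule F.subset_graded_sum) (auto intro: D_closed)

text \<open>The sum of the degrees \<le> -1 contains the generators and is closed under brackets, so
  it is everything; and two degrees \<le> -1 add up to a degree \<le> -2.\<close>

lemma bracket_in_F2:
  assumes X: "X \<in> carrier F" and Y: "Y \<in> carrier F" shows "X \<otimes>\<^bsub>F\<^esub> Y \<in> F2"
proof -
  let ?F1 = "graded_sum F D {..-1}"
  have F1: "subspace K ?F1 F" by (rule F.subspace_graded_sum_general[OF D_subspace])
  note F1c = F.subspace_carrier[OF F1]
  have F1F1: "X \<otimes>\<^bsub>F\<^esub> Y \<in> F2" if X: "X \<in> ?F1" and Y: "Y \<in> ?F1" for X Y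
  proof -
    note F2_simps = F.subspace_zero[OF F2_subspace] F.subspace_add[OF F2_subspace] F.subspace_smult[OF F2_subspace]
    have DD: "X \<otimes>\<^bsub>F\<^esub> Y \<in> F2" if "X \<in> D p" "Y \<in> D q" "p \<le> -1" "q \<le> -1" for X Y p q
      using D_bracket[OF that(1,2)] D_subset_F2[of "p + q"] that by auto
    have DF: "X \<otimes>\<^bsub>F\<^esub> Y \<in> F2" if X: "X \<in> D p" "p \<le> -1" for X p
    proof -
      have "subspace K {Z \<in> carrier F. X \<otimes>\<^bsub>F\<^esub> Z \<in> F2} F"
        by (rule F.subspaceI) (auto simp: F.bracket_add_right F.bracket_smult_right D_closed[OF X(1)] F2_simps)
      moreover have "D q \<subseteq> {Z \<in> carrier F. X \<otimes>\<^bsub>F\<^esub> Z \<in> F2}" if "q \<in> {..-1}" for q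
        using DD[OF X(1)] X(2) that D_closed by auto
      ultimately have "?F1 \<subseteq> {Z \<in> carrier F. X \<otimes>\<^bsub>F\<^esub> Z \<in> F2}" by (rule F.graded_sum_subset)
      then show ?thesis using Y by blast
    qed
    have "subspace K {Z \<in> carrier F. Z \<otimes>\<^bsub>F\<^esub> Y \<in> F2} F"
      by (rule F.subspaceI) (auto simp: F.bracket_add_left F.bracket_smult_left F1c[OF Y] F2_simps)
    moreover have "D q \<subseteq> {Z \<in> carrier F. Z \<otimes>\<^bsub>F\<^esub> Y \<in> F2}" if "q \<in> {..-1}" for q
      using DF that D_closed by auto
    ultimately have "?F1 \<subseteq> {Z \<in> carrier F. Z \<otimes>\<^bsub>F\<^esub> Y \<in> F2}" by (rule F.graded_sum_subset)
    then show ?thesis using X by blast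
  qed
  have D1: "D p \<subseteq> ?F1" if "p \<le> -1" for p by (rule F.subset_graded_sum) (use D_closed that in auto)
  have F21: "F2 \<subseteq> ?F1" unfolding free_lie_from_def
    by (rule F.graded_sum_subset[OF F1]) (use D1 in auto)
  have "X \<in> ?F1" if "X \<in> carrier F" for X
    using that
  proof (induction rule: free_induct)
    case (Gen v) then show ?case using gen_in_D D1 by blast
  next
    case Zero then show ?case by (rule F.subspace_zero[OF F1])
  next
    case (Plus X Y) then show ?case by (blast intro: F.subspace_add[OF F1])
  next
    case (Scale c X) then show ?case by (blast intro: F.subspace_smult[OF F1])
  next
    case (Br X Y) then show ?case using F1F1 F21 by blast
  qed
  then show ?thesis using F1F1 X Y by blast
qed

text \<open>The difference is linear in X, so only generators, where it is zero, and brackets, which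
  have no linear part and lie in \<open>F2\<close>, need an argument.\<close>

lemma F_decompose:
  assumes "X \<in> carrier F" shows "X \<ominus>\<^bsub>F\<^esub> free_gen K V (\<rho> X) \<in> F2"
  using assms
proof (induction rule: free_induct)
  case (Gen v)
  then show ?case using gen_closed F.subspace_zero[OF F2_subspace] by (simp add: \<rho>_gen a_minus_def F.M.r_neg)
next
  case Zero
  have "\<rho> \<zero>\<^bsub>F\<^esub> = \<zero>\<^bsub>V\<^esub>" "free_gen K V \<zero>\<^bsub>V\<^esub> = \<zero>\<^bsub>F\<^esub>" by simp_all
  then show ?case using F.subspace_zero[OF F2_subspace] by (simp add: a_minus_def)
next
  case (Plus X Y)
  note c = gen_closed[OF \<rho>_closed[OF Plus(1)]] gen_closed[OF \<rho>_closed[OF Plus(2)]]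
  have "(X \<oplus>\<^bsub>F\<^esub> Y) \<ominus>\<^bsub>F\<^esub> free_gen K V (\<rho> (X \<oplus>\<^bsub>F\<^esub> Y)) =
      (X \<ominus>\<^bsub>F\<^esub> free_gen K V (\<rho> X)) \<oplus>\<^bsub>F\<^esub> (Y \<ominus>\<^bsub>F\<^esub> free_gen K V (\<rho> Y))"
    using Plus(1,2) c by (simp add: \<rho>_closed a_minus_def F.M.minus_add F.M.a_ac)
  then show ?case using F.subspace_add[OF F2_subspace] Plus by simp
next
  case (Scale a X)
  have "(a \<odot>\<^bsub>F\<^esub> X) \<ominus>\<^bsub>F\<^esub> free_gen K V (\<rho> (a \<odot>\<^bsub>F\<^esub> X)) = a \<odot>\<^bsub>F\<^esub> (X \<ominus>\<^bsub>F\<^esub> free_gen K V (\<rho> X))"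
    using Scale(1,2) gen_closed[OF \<rho>_closed[OF Scale(2)]]
    by (simp add: \<rho>_closed a_minus_def F.smult_r_distr F.smult_r_minus)
  then show ?case using F.subspace_smult[OF F2_subspace] Scale by simp
next
  case (Br X Y)
  have "free_gen K V \<zero>\<^bsub>V\<^esub> = \<zero>\<^bsub>F\<^esub>" by simp
  then show ?case using Br bracket_in_F2 by (simp add: \<rho>_bracket a_minus_def F.bracket_closed)
qed

text \<open>If the linear part vanishes, \<open>F_decompose\<close> leaves X itself in
  \<open>F2\<close>; conversely, homogeneous terms of degree other than -1 have zero linear
  part.\<close>

lemma F2_iff: "X \<in> carrier F \<Longrightarrow> X \<in> F2 \<longleftrightarrow> \<rho> X = \<zero>\<^bsub>V\<^esub>"
proof
  assume X: "X \<in> carrier F" "\<rho> X = \<zero>\<^bsub>V\<^esub>"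
  have "free_gen K V \<zero>\<^bsub>V\<^esub> = \<zero>\<^bsub>F\<^esub>" by simp
  then show "X \<in> F2" using F_decompose[OF X(1)] X by (simp add: a_minus_def)
next
  assume X: "X \<in> F2"
  have "subspace K {X \<in> carrier F. \<rho> X \<in> {\<zero>\<^bsub>V\<^esub>}} F"
    by (rule \<rho>.vimage_subspace[OF subspace_zero_singleton])
  moreover have "D p \<subseteq> {X \<in> carrier F. \<rho> X \<in> {\<zero>\<^bsub>V\<^esub>}}" if "p \<in> {..-2}" for p
    using that homogeneous_class by (auto simp: free_lie_deg_def cl_closed \<rho>_cl)
  ultimately have "F2 \<subseteq> {X \<in> carrier F. \<rho> X \<in> {\<zero>\<^bsub>V\<^esub>}}"
    unfolding free_lie_from_def by (rule F.graded_sum_subset)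
  then show "\<rho> X = \<zero>\<^bsub>V\<^esub>" using X by blast
qed

lemma F2_ideal: "lie_ideal K F2 F"
  unfolding lie_ideal_def using F2_subspace bracket_in_F2 F2_closed by blast

subsection \<open>Derivations\<close>

context
  fixes A assumes A: "A \<in> module_hom K V V"
begin

interpretation A: linear_map K V V A
  by (rule linear_mapI[OF vectorspace_axioms vectorspace_axioms A])

abbreviation d where "d \<equiv> term_derivation K V A"

lemma d_closed: "t \<in> lie_terms K V \<Longrightarrow> d t \<in> carrier F"
  by (induction rule: lie_terms.induct) (auto simp: gen_closed cl_closed F.bracket_closed)

lemma d_cong: "lie_cong K V s t \<Longrightarrow> d s = d t"
proof (induction rule: lie_cong.induct)
  case (Br s s' t t')
  then show ?case by (simp add: lie_class_eq)
next
  case (add_minus t)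
  then show ?case by (simp add: d_closed F.smult_minus_1 F.M.l_neg)
next
  case (br_add_left s t u)
  then show ?case
    by (simp add: ops_rev d_closed cl_closed F.bracket_add_left F.bracket_add_right F.bracket_closed F.M.a_ac)
next
  case (br_add_right s t u)
  then show ?case
    by (simp add: ops_rev d_closed cl_closed F.bracket_add_left F.bracket_add_right F.bracket_closed F.M.a_ac)
next
  case (br_scale_left a s t)
  then show ?case
    by (simp add: ops_rev d_closed cl_closed F.bracket_smult_left F.bracket_smult_right F.bracket_closed F.smult_r_distr)
next
  case (br_scale_right a s t)
  then show ?case
    by (simp add: ops_rev d_closed cl_closed F.bracket_smult_left F.bracket_smult_right F.bracket_closed F.smult_r_distr)
next
  case (br_self t)
  then show ?case using F.bracket_antisym[OF d_closed[OF br_self] cl_closed[OF br_self]]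
    by (simp add: d_closed cl_closed F.bracket_closed F.M.l_neg)
next
  case (br_jacobi s t u)
  note c = br_jacobi[THEN d_closed] br_jacobi[THEN cl_closed]
  let ?s = "cl s" and ?t = "cl t" and ?u = "cl u"
  \<comment> \<open>The Leibniz rule turns the Jacobi sum into three Jacobi sums, each with one of
    the three entries differentiated.\<close>
  have "d (Plus (Plus (Br s (Br t u)) (Br t (Br u s))) (Br u (Br s t))) =
    (d s \<otimes>\<^bsub>F\<^esub> (?t \<otimes>\<^bsub>F\<^esub> ?u) \<oplus>\<^bsub>F\<^esub> ?t \<otimes>\<^bsub>F\<^esub> (?u \<otimes>\<^bsub>F\<^esub> d s) \<oplus>\<^bsub>F\<^esub> ?u \<otimes>\<^bsub>F\<^esub> (d s \<otimes>\<^bsub>F\<^esub> ?t)) \<oplus>\<^bsub>F\<^esub>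
    (?s \<otimes>\<^bsub>F\<^esub> (d t \<otimes>\<^bsub>F\<^esub> ?u) \<oplus>\<^bsub>F\<^esub> d t \<otimes>\<^bsub>F\<^esub> (?u \<otimes>\<^bsub>F\<^esub> ?s) \<oplus>\<^bsub>F\<^esub> ?u \<otimes>\<^bsub>F\<^esub> (?s \<otimes>\<^bsub>F\<^esub> d t)) \<oplus>\<^bsub>F\<^esub>
    (?s \<otimes>\<^bsub>F\<^esub> (?t \<otimes>\<^bsub>F\<^esub> d u) \<oplus>\<^bsub>F\<^esub> ?t \<otimes>\<^bsub>F\<^esub> (d u \<otimes>\<^bsub>F\<^esub> ?s) \<oplus>\<^bsub>F\<^esub> d u \<otimes>\<^bsub>F\<^esub> (?s \<otimes>\<^bsub>F\<^esub> ?t))"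
    using c br_jacobi
    by (simp add: free_lie_mult[symmetric] F.bracket_add_left F.bracket_add_right F.bracket_closed F.M.a_ac)
  also have "\<dots> = \<zero>\<^bsub>F\<^esub>" using c by (simp add: F.jacobi)
  finally show ?case by simp
qed (simp_all add: d_closed F.M.a_ac F.smult_l_distr F.smult_r_distr F.smult_assoc1 gen_closed)

lemma d_homogeneous: "\<lbrakk>homogeneous p t; t \<in> lie_terms K V\<rbrakk> \<Longrightarrow> d t \<in> D p"
proof (induction rule: homogeneous.induct)
  case (Gen v)
  then have "v \<in> carrier V" by (auto elim: lie_terms.cases)
  then show ?case by (simp add: gen_in_D)
next
  case (Zero p) then show ?case by (simp add: F.subspace_zero[OF D_subspace])
next
  case (Plus p s t)
  then have "s \<in> lie_terms K V" "t \<in> lie_terms K V" by (auto elim: lie_terms.cases)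
  then show ?case using Plus.IH by (simp add: F.subspace_add[OF D_subspace])
next
  case (Scale p t c)
  then have "t \<in> lie_terms K V" "c \<in> carrier K" by (auto elim: lie_terms.cases)
  then show ?case using Scale.IH by (simp add: F.subspace_smult[OF D_subspace])
next
  case (Br p s q t)
  then have st: "s \<in> lie_terms K V" "t \<in> lie_terms K V" by (auto elim: lie_terms.cases)
  then have "cl s \<in> D p" "cl t \<in> D q" using Br.hyps by (auto simp: free_lie_deg_def)
  then show ?case using Br.IH st by (simp add: F.subspace_add[OF D_subspace] D_bracket)
qed

text \<open>The description by \<open>THE\<close> is met by \<open>T\<close>, defined on
  representatives; two such derivations agree on generators and hence everywhere, by induction on
  Lie polynomials.\<close>

lemma free_derivation_props:
  shows "lie_derivation K F (free_derivation K V A)"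
    and "\<And>v. v \<in> carrier V \<Longrightarrow> free_derivation K V A (free_gen K V v) = free_gen K V (A v)"
proof -
  define T where "T = (\<lambda>X\<in>carrier F. d (SOME t. t \<in> X))"
  have T: "T (cl t) = d t" if "t \<in> lie_terms K V" for t
    unfolding T_def using d_cong[OF cong_some[OF that]] cl_closed[OF that] by simp
  have 1: "T \<in> extensional (carrier F)" by (simp add: T_def)
  have 2: "lie_derivation K F T"
    unfolding lie_derivation_def module_hom_def
  proof (intro conjI CollectI allI impI ballI Pi_I)
    fix X assume "X \<in> carrier F" then show "T X \<in> carrier F"
      by (elim F_cases) (simp add: T d_closed)
  next
    fix X Y assume "X \<in> carrier F \<and> Y \<in> carrier F"
    then show "T (X \<oplus>\<^bsub>F\<^esub> Y) = T X \<oplus>\<^bsub>F\<^esub> T Y"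
      by (auto elim!: F_cases simp: ops T lie_terms.intros)
  next
    fix c X assume "c \<in> carrier K \<and> X \<in> carrier F"
    then show "T (c \<odot>\<^bsub>F\<^esub> X) = c \<odot>\<^bsub>F\<^esub> T X"
      by (auto elim!: F_cases simp: ops T lie_terms.intros)
  next
    fix X Y assume "X \<in> carrier F" "Y \<in> carrier F"
    then show "T (X \<otimes>\<^bsub>F\<^esub> Y) = T X \<otimes>\<^bsub>F\<^esub> Y \<oplus>\<^bsub>F\<^esub> X \<otimes>\<^bsub>F\<^esub> T Y"
      by (auto elim!: F_cases simp: ops(1) T lie_terms.intros)
  qed
  have 3: "T ` D p \<subseteq> D p" for p using d_homogeneous T by (auto simp: free_lie_deg_def)
  have 4: "\<forall>v\<in>carrier V. T (free_gen K V v) = free_gen K V (A v)"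
    using T[OF lie_terms.Gen] by (simp add: free_gen_def)
  have "free_derivation K V A = T" unfolding free_derivation_def
  proof (rule the_equality, goal_cases)
    case 1 then show ?case using \<open>T \<in> extensional _\<close> 2 3 4 by blast
  next
    case (2 E)
    then have E: "E \<in> module_hom K F F" and Eb: "\<And>X Y. \<lbrakk>X \<in> carrier F; Y \<in> carrier F\<rbrakk> \<Longrightarrow>
        E (X \<otimes>\<^bsub>F\<^esub> Y) = E X \<otimes>\<^bsub>F\<^esub> Y \<oplus>\<^bsub>F\<^esub> X \<otimes>\<^bsub>F\<^esub> E Y"
      and Eg: "\<And>v. v \<in> carrier V \<Longrightarrow> E (free_gen K V v) = free_gen K V (A v)"
      by (auto simp: lie_derivation_def)
    from \<open>lie_derivation K F T\<close> have Th: "T \<in> module_hom K F F" and Tb: "\<And>X Y. \<lbrakk>X \<in> carrier F; Y \<in> carrier F\<rbrakk> \<Longrightarrow>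
        T (X \<otimes>\<^bsub>F\<^esub> Y) = T X \<otimes>\<^bsub>F\<^esub> Y \<oplus>\<^bsub>F\<^esub> X \<otimes>\<^bsub>F\<^esub> T Y" by (auto simp: lie_derivation_def)
    interpret E: linear_map K F F E by (rule linear_mapI[OF F.vs F.vs E])
    interpret T: linear_map K F F T by (rule linear_mapI[OF F.vs F.vs Th])
    have "E X = T X" if "X \<in> carrier F" for X using that
    proof (induction rule: free_induct)
      case (Gen v) then show ?case using Eg 4 by simp
    next
      case Zero show ?case using E.T0_is_0 T.T0_is_0 by simp
    next
      case (Plus X Y) then show ?case by (simp add: E.T_add T.T_add)
    next
      case (Scale c X) then show ?case by (simp add: E.T_smult T.T_smult)
    next
      case (Br X Y) then show ?case by (simp add: Eb Tb)
    qed
    then show ?case using 2 1 by (intro extensionalityI[of E "carrier F" T]) auto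
  qed
  then show "lie_derivation K F (free_derivation K V A)"
    and "\<And>v. v \<in> carrier V \<Longrightarrow> free_derivation K V A (free_gen K V v) = free_gen K V (A v)"
    using 2 4 by auto
qed

end

end

section \<open>The algebras m(K) as quotients of the free Lie algebra\<close>

section \<open>Quotients of the free Lie algebra\<close>

locale free_lie_quotient = free_lie_on K V
  for K :: "('k, 'r) ring_scheme" and V :: "('k, 'v) module" +
  fixes \<K>
  assumes ideal: "lie_ideal K \<K> (free_lie K V)" and sub_F2: "\<K> \<subseteq> free_lie_from K V 2"
begin

abbreviation m where "m \<equiv> quot_lie K V \<K>"
abbreviation M where "M \<equiv> quot_lie_deg K V \<K>"
abbreviation e where "e \<equiv> quot_gen K V \<K>"
definition \<pi> where "\<pi> X = \<K> +>\<^bsub>free_lie K V\<^esub> X"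

sublocale \<pi>: lie_surjection K F m \<pi>
  unfolding \<pi>_def[abs_def] by (rule F.lie_quot_surjection(1)[OF ideal])

lemma \<pi>_eq_iff: "\<lbrakk>X \<in> carrier F; Y \<in> carrier F\<rbrakk> \<Longrightarrow> \<pi> X = \<pi> Y \<longleftrightarrow> X \<ominus>\<^bsub>F\<^esub> Y \<in> \<K>"
  unfolding \<pi>_def by (rule F.lie_quot_surjection(2)[OF ideal])

lemma \<pi>_zero_iff: "X \<in> carrier F \<Longrightarrow> \<pi> X = \<zero>\<^bsub>m\<^esub> \<longleftrightarrow> X \<in> \<K>"
  using \<pi>_eq_iff[of X "\<zero>\<^bsub>F\<^esub>"] by (simp add: \<pi>.map_zero a_minus_def)

lemma \<pi>_closed: "X \<in> carrier F \<Longrightarrow> \<pi> X \<in> carrier m"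
  by (rule \<pi>.image_closed)

lemma e_eq: "e v = \<pi> (free_gen K V v)"
  by (simp add: quot_gen_def \<pi>_def)

lemma M_eq: "M p = \<pi> ` D p"
  by (simp add: quot_grading_def \<pi>_def)

lemma e_hom: "e \<in> module_hom K V m"
  by (auto simp: module_hom_def e_eq \<pi>_closed gen_closed)

sublocale e: linear_map K V m e
  by (rule linear_mapI[OF vectorspace_axioms \<pi>.N.vs e_hom])

text \<open>Since \<K> lies in \<open>F2\<close>, the kernel of \<rho>, it meets the linear elements
  only in zero.\<close>

lemma e_inj: "inj_on e (carrier V)"
  unfolding e.inj_on_iff
proof (intro ballI impI)
  fix v assume v: "v \<in> carrier V" "e v = \<zero>\<^bsub>m\<^esub>"
  then have "free_gen K V v \<in> F2" using \<pi>_zero_iff[OF gen_closed[OF v(1)]] sub_F2 by (auto simp: e_eq)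
  then show "v = \<zero>\<^bsub>V\<^esub>" using F2_iff[OF gen_closed[OF v(1)]] v by (simp add: \<rho>_gen)
qed

lemma e_onto: "e ` carrier V = M (-1)"
  by (simp add: M_eq D_minus_one image_image e_eq)

lemma M_nonneg: "p \<ge> 0 \<Longrightarrow> M p = {\<zero>\<^bsub>m\<^esub>}"
  by (simp add: M_eq D_nonneg \<pi>.map_zero)

lemma M_subspace: "subspace K (M p) m"
  unfolding M_eq by (rule \<pi>.map.image_subspace[OF D_subspace])

lemma M_below:
  assumes "free_lie_from K V (\<mu> + 1) \<subseteq> \<K>" "p < - \<mu>" shows "M p = {\<zero>\<^bsub>m\<^esub>}"
proof -
  have "D p \<subseteq> free_lie_from K V (\<mu> + 1)" unfolding free_lie_from_def
    by (rule F.subset_graded_sum) (use assms D_closed in auto)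
  then have "\<pi> X = \<zero>\<^bsub>m\<^esub>" if "X \<in> D p" for X
    using \<pi>_zero_iff[OF D_closed[OF that]] that assms by blast
  then show ?thesis unfolding M_eq using F.subspace_zero[OF D_subspace] by blast
qed

lemma \<pi>_F2: "\<pi> ` F2 = graded_sum m M {..-2}"
proof
  have "F2 \<subseteq> {X \<in> carrier F. \<pi> X \<in> graded_sum m M {..-2}}" unfolding free_lie_from_def
  proof (rule F.graded_sum_subset[OF \<pi>.map.vimage_subspace[OF \<pi>.N.subspace_graded_sum_general[OF M_subspace]]])
    fix p assume "p \<in> {..-(2::int)}"
    then have "M p \<subseteq> graded_sum m M {..-2}"
      by (intro \<pi>.N.subset_graded_sum) (use \<pi>.N.subspace_carrier[OF M_subspace] in auto)
    then show "D p \<subseteq> {X \<in> carrier F. \<pi> X \<in> graded_sum m M {..-2}}" using D_closed M_eq by auto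
  qed
  then show "\<pi> ` F2 \<subseteq> graded_sum m M {..-2}" by blast
  show "graded_sum m M {..-2} \<subseteq> \<pi> ` F2"
    by (rule \<pi>.N.graded_sum_subset[OF \<pi>.map.image_subspace[OF F2_subspace]])
      (use D_subset_F2 M_eq in auto)
qed

lemma seq_embeddable_quotient:
  assumes "fin_dim" shows "seq_embeddable TYPE('k) (carrier m)"
proof -
  have "seq_embeddable TYPE('k) (lie_terms K V)"
    by (rule seq_embeddable_lie_terms[OF seq_embeddable_fin_dim[OF assms] field_axioms])
  then have "seq_embeddable TYPE('k) (\<pi> ` cl ` lie_terms K V)" by (intro seq_embeddable_image)
  then show ?thesis using \<pi>.onto by (simp add: free_lie_carrier)
qed

text \<open>As \<open>e\<close> is a bijection from V to M (-1), the transported endomorphisms of M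
  (-1) can be replaced by the operators on V from which they come.\<close>

lemma type_iff:
  "prolongation_of_type (transport_gl V e \<L>) M g G \<iota> \<longleftrightarrow>
    (\<forall>X\<in>G 0. \<exists>A\<in>\<L>. \<forall>v\<in>carrier V. X \<otimes>\<^bsub>g\<^esub> \<iota> (e v) = \<iota> (e (A v)))"
proof
  assume *: "prolongation_of_type (transport_gl V e \<L>) M g G \<iota>"
  show "\<forall>X\<in>G 0. \<exists>A\<in>\<L>. \<forall>v\<in>carrier V. X \<otimes>\<^bsub>g\<^esub> \<iota> (e v) = \<iota> (e (A v))"
  proof
    fix X assume "X \<in> G 0"
    then obtain B where B: "B \<in> transport_gl V e \<L>" "\<forall>v\<in>M (-1). X \<otimes>\<^bsub>g\<^esub> \<iota> v = \<iota> (B v)"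
      using * unfolding prolongation_of_type_def by blast
    then obtain A where "A \<in> \<L>" "\<forall>v\<in>carrier V. B (e v) = e (A v)" unfolding transport_gl_def by blast
    then show "\<exists>A\<in>\<L>. \<forall>v\<in>carrier V. X \<otimes>\<^bsub>g\<^esub> \<iota> (e v) = \<iota> (e (A v))" using B(2) e_onto by (metis imageI)
  qed
next
  assume *: "\<forall>X\<in>G 0. \<exists>A\<in>\<L>. \<forall>v\<in>carrier V. X \<otimes>\<^bsub>g\<^esub> \<iota> (e v) = \<iota> (e (A v))"
  show "prolongation_of_type (transport_gl V e \<L>) M g G \<iota>"
    unfolding prolongation_of_type_def
  proof
    fix X assume "X \<in> G 0"
    then obtain A where A: "A \<in> \<L>" "\<forall>v\<in>carrier V. X \<otimes>\<^bsub>g\<^esub> \<iota> (e v) = \<iota> (e (A v))" using * by blast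
    let ?B = "\<lambda>u\<in>e ` carrier V. e (A (inv_into (carrier V) e u))"
    have B: "?B (e v) = e (A v)" if "v \<in> carrier V" for v using that e_inj by simp
    then have "?B \<in> transport_gl V e \<L>" unfolding transport_gl_def using A(1) by auto
    moreover have "\<forall>u\<in>M (-1). X \<otimes>\<^bsub>g\<^esub> \<iota> u = \<iota> (?B u)"
      unfolding e_onto[symmetric] using A(2) B by auto
    ultimately show "\<exists>B\<in>transport_gl V e \<L>. \<forall>v\<in>M (-1). X \<otimes>\<^bsub>g\<^esub> \<iota> v = \<iota> (B v)" by blast
  qed
qed

text \<open>Modulo \<K>, T_A sends [v, w] to the first expression, and [v, Y] with Y in f_[2](V) to
  [A v, Y], because T_A Y already lies in \<K>. Conversely, the two equations show by induction that
  T_A modulo \<K> sees only the linear part, which is zero on f_[2](V).\<close>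

lemma derivation_condition:
  assumes A: "A \<in> module_hom K V V"
  shows "free_derivation K V A ` F2 \<subseteq> \<K> \<longleftrightarrow>
    (\<forall>v\<in>carrier V. \<forall>w\<in>carrier V. e (A v) \<otimes>\<^bsub>m\<^esub> e w \<oplus>\<^bsub>m\<^esub> e v \<otimes>\<^bsub>m\<^esub> e (A w) = \<zero>\<^bsub>m\<^esub>) \<and>
    (\<forall>v\<in>carrier V. \<forall>y\<in>graded_sum m M {..-2}. e (A v) \<otimes>\<^bsub>m\<^esub> y = \<zero>\<^bsub>m\<^esub>)"
proof -
  let ?T = "free_derivation K V A"
  have Ac: "A v \<in> carrier V" if "v \<in> carrier V" for v using A that by (auto simp: module_hom_def)
  note T = free_derivation_props[OF A]
  have Th: "?T \<in> module_hom K F F" and Tb: "\<And>X Y. \<lbrakk>X \<in> carrier F; Y \<in> carrier F\<rbrakk> \<Longrightarrow>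
      ?T (X \<otimes>\<^bsub>F\<^esub> Y) = ?T X \<otimes>\<^bsub>F\<^esub> Y \<oplus>\<^bsub>F\<^esub> X \<otimes>\<^bsub>F\<^esub> ?T Y"
    using T(1) by (auto simp: lie_derivation_def)
  interpret T: linear_map K F F ?T by (rule linear_mapI[OF F.vs F.vs Th])
  note Tc = T.T_im
  have \<pi>T: "\<pi> (?T (X \<otimes>\<^bsub>F\<^esub> Y)) = \<pi> (?T X) \<otimes>\<^bsub>m\<^esub> \<pi> Y \<oplus>\<^bsub>m\<^esub> \<pi> X \<otimes>\<^bsub>m\<^esub> \<pi> (?T Y)"
    if "X \<in> carrier F" "Y \<in> carrier F" for X Y
    using that by (simp add: Tb Tc F.bracket_closed \<pi>.map_mult \<pi>.map_add)
  have Tgen: "\<pi> (?T (free_gen K V v)) = e (A v)" if "v \<in> carrier V" for v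
    using T(2)[OF that] by (simp add: e_eq)
  show ?thesis
  proof
    assume *: "?T ` F2 \<subseteq> \<K>"
    then have \<pi>0: "\<pi> (?T X) = \<zero>\<^bsub>m\<^esub>" if "X \<in> F2" for X
      using that \<pi>_zero_iff[OF Tc[OF F2_closed[OF that]]] by blast
    show "(\<forall>v\<in>carrier V. \<forall>w\<in>carrier V. e (A v) \<otimes>\<^bsub>m\<^esub> e w \<oplus>\<^bsub>m\<^esub> e v \<otimes>\<^bsub>m\<^esub> e (A w) = \<zero>\<^bsub>m\<^esub>) \<and>
      (\<forall>v\<in>carrier V. \<forall>y\<in>graded_sum m M {..-2}. e (A v) \<otimes>\<^bsub>m\<^esub> y = \<zero>\<^bsub>m\<^esub>)"
    proof (intro conjI ballI)
      fix v w assume vw: "v \<in> carrier V" "w \<in> carrier V"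
      note c = gen_closed[OF vw(1)] gen_closed[OF vw(2)]
      show "e (A v) \<otimes>\<^bsub>m\<^esub> e w \<oplus>\<^bsub>m\<^esub> e v \<otimes>\<^bsub>m\<^esub> e (A w) = \<zero>\<^bsub>m\<^esub>"
        using \<pi>T[OF c] \<pi>0[OF bracket_in_F2[OF c]] vw by (simp add: Tgen e_eq[symmetric])
    next
      fix v y assume v: "v \<in> carrier V" and "y \<in> graded_sum m M {..-2}"
      then obtain Y where Y: "Y \<in> F2" "y = \<pi> Y" using \<pi>_F2 by blast
      note c = gen_closed[OF v] F2_closed[OF Y(1)]
      have "e (A v) \<otimes>\<^bsub>m\<^esub> \<pi> Y \<oplus>\<^bsub>m\<^esub> e v \<otimes>\<^bsub>m\<^esub> \<zero>\<^bsub>m\<^esub> = \<zero>\<^bsub>m\<^esub>"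
        using \<pi>T[OF c] \<pi>0[OF bracket_in_F2[OF c]] \<pi>0[OF Y(1)] v by (simp add: Tgen e_eq[symmetric])
      then show "e (A v) \<otimes>\<^bsub>m\<^esub> y = \<zero>\<^bsub>m\<^esub>" using v Y(2) c Ac by (simp add: \<pi>.N.bracket_closed \<pi>_closed)
    qed
  next
    assume *: "(\<forall>v\<in>carrier V. \<forall>w\<in>carrier V. e (A v) \<otimes>\<^bsub>m\<^esub> e w \<oplus>\<^bsub>m\<^esub> e v \<otimes>\<^bsub>m\<^esub> e (A w) = \<zero>\<^bsub>m\<^esub>) \<and>
      (\<forall>v\<in>carrier V. \<forall>y\<in>graded_sum m M {..-2}. e (A v) \<otimes>\<^bsub>m\<^esub> y = \<zero>\<^bsub>m\<^esub>)"
    \<comment> \<open>By the second equation, bracketing with e (A v) sees only the linear part of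
      Y.\<close>
    have reduce: "e (A v) \<otimes>\<^bsub>m\<^esub> \<pi> Y = e (A v) \<otimes>\<^bsub>m\<^esub> e (\<rho> Y)" if v: "v \<in> carrier V" and Y: "Y \<in> carrier F" for v Y
    proof -
      let ?Z = "Y \<ominus>\<^bsub>F\<^esub> free_gen K V (\<rho> Y)"
      have g: "free_gen K V (\<rho> Y) \<in> carrier F" using Y by (simp add: gen_closed \<rho>_closed)
      have "\<pi> ?Z \<in> graded_sum m M {..-2}" using F_decompose[OF Y] \<pi>_F2 by blast
      then have 0: "e (A v) \<otimes>\<^bsub>m\<^esub> \<pi> ?Z = \<zero>\<^bsub>m\<^esub>" using * v by blast
      have Z: "\<pi> ?Z = \<pi> Y \<ominus>\<^bsub>m\<^esub> e (\<rho> Y)" using Y g by (simp add: e_eq \<pi>.map.T_minus)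
      have "e (A v) \<otimes>\<^bsub>m\<^esub> \<pi> Y \<ominus>\<^bsub>m\<^esub> e (A v) \<otimes>\<^bsub>m\<^esub> e (\<rho> Y) = \<zero>\<^bsub>m\<^esub>"
        using 0[unfolded Z] v Y Ac
        by (simp add: a_minus_def \<pi>.N.bracket_add_right \<pi>.N.bracket_neg_right \<pi>_closed \<rho>_closed)
      then show ?thesis using v Y Ac by (simp add: \<pi>.N.bracket_closed \<pi>_closed \<rho>_closed)
    qed
    have reduce': "\<pi> Y \<otimes>\<^bsub>m\<^esub> e (A v) = e (\<rho> Y) \<otimes>\<^bsub>m\<^esub> e (A v)" if v: "v \<in> carrier V" and Y: "Y \<in> carrier F" for v Y
      using reduce[OF that] \<pi>.N.bracket_antisym[of "\<pi> Y" "e (A v)"] \<pi>.N.bracket_antisym[of "e (\<rho> Y)" "e (A v)"]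
        Ac[OF v] \<pi>_closed[OF Y] \<rho>_closed[OF Y] by simp
    have "\<pi> (?T X) = e (A (\<rho> X))" if "X \<in> carrier F" for X using that
    proof (induction rule: free_induct)
      case (Gen v) then show ?case by (simp add: Tgen \<rho>_gen)
    next
      case Zero
      have "A \<zero>\<^bsub>V\<^esub> = \<zero>\<^bsub>V\<^esub>" "\<rho> \<zero>\<^bsub>F\<^esub> = \<zero>\<^bsub>V\<^esub>" 
        using linear_map.T0_is_0[OF linear_mapI[OF vectorspace_axioms vectorspace_axioms A]] by simp_all
      then show ?case by (simp add: \<pi>.map_zero)
    next
      case (Plus X Y)
      then have "A (\<rho> (X \<oplus>\<^bsub>F\<^esub> Y)) = A (\<rho> X) \<oplus>\<^bsub>V\<^esub> A (\<rho> Y)"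
        using A by (simp add: \<rho>_closed module_hom_def)
      then show ?case using Plus by (simp add: Tc \<rho>_closed Ac)
    next
      case (Scale c X)
      then have "A (\<rho> (c \<odot>\<^bsub>F\<^esub> X)) = c \<odot>\<^bsub>V\<^esub> A (\<rho> X)"
        using A by (simp add: \<rho>_closed module_hom_def)
      then show ?case using Scale by (simp add: Tc \<rho>_closed Ac)
    next
      \<comment> \<open>Both factors are reduced to their linear parts. There the first equation
        gives zero, which is also the value of e \<circ> A at the linear part of a bracket.\<close>
      case (Br X Y)
      have "\<pi> (?T (X \<otimes>\<^bsub>F\<^esub> Y)) = e (A (\<rho> X)) \<otimes>\<^bsub>m\<^esub> e (\<rho> Y) \<oplus>\<^bsub>m\<^esub> e (\<rho> X) \<otimes>\<^bsub>m\<^esub> e (A (\<rho> Y))"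
        using Br \<pi>T reduce reduce' \<rho>_closed by simp
      also have "\<dots> = \<zero>\<^bsub>m\<^esub>" using * Br \<rho>_closed by blast
      also have "\<zero>\<^bsub>m\<^esub> = e (A \<zero>\<^bsub>V\<^esub>)"
        using linear_map.T0_is_0[OF linear_mapI[OF vectorspace_axioms vectorspace_axioms A]] by simp
      finally show ?case using Br by (simp add: \<rho>_bracket)
    qed
    then have "\<pi> (?T X) = \<zero>\<^bsub>m\<^esub>" if "X \<in> F2" for X
      using that F2_iff[OF F2_closed[OF that]] F2_closed[OF that]
        linear_map.T0_is_0[OF linear_mapI[OF vectorspace_axioms vectorspace_axioms A]] by simp
    then show "?T ` F2 \<subseteq> \<K>" using \<pi>_zero_iff Tc F2_closed by blast
  qed
qed

end

section \<open>The algebra a as a graded quotient\<close>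

section \<open>The algebra of elements annihilating the lower part\<close>

locale quotient_prolongation = free_lie_quotient K V \<K>
    + ab: free_lie_quotient K V "free_lie_from K V 2"
    + p: effective K "quot_lie K V \<K>" "quot_lie_deg K V \<K>" g G \<iota>
  for K :: "('k, 'r) ring_scheme" and V :: "('k, 'v) module" and \<K>
    and g :: "('k, 'g) module" and G \<iota> +
  fixes \<L> :: "('v \<Rightarrow> 'v) set"
  assumes V_fin_dim: "fin_dim"
    and \<L>_hom: "A \<in> \<L> \<Longrightarrow> A \<in> module_hom K V V"
    and type: "X \<in> G 0 \<Longrightarrow> \<exists>A\<in>\<L>. \<forall>v\<in>carrier V. X \<otimes>\<^bsub>g\<^esub> \<iota> (e v) = \<iota> (e (A v))"
begin

abbreviation n where "n \<equiv> graded_sum m M {..-2}"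
abbreviation ng where "ng \<equiv> n_part g G"
abbreviation H where "H \<equiv> pre_a_deg g G"
abbreviation pre where "pre \<equiv> pre_a g G"
abbreviation q where "q x \<equiv> ng +>\<^bsub>pre\<^esub> x"
abbreviation \<aa> where "\<aa> \<equiv> a_lie g G"

lemma a0_iff: "A \<in> a0 K V \<K> \<L> \<longleftrightarrow> A \<in> \<L> \<and>
    (\<forall>v\<in>carrier V. \<forall>w\<in>carrier V. e (A v) \<otimes>\<^bsub>m\<^esub> e w \<oplus>\<^bsub>m\<^esub> e v \<otimes>\<^bsub>m\<^esub> e (A w) = \<zero>\<^bsub>m\<^esub>) \<and>
    (\<forall>v\<in>carrier V. \<forall>y\<in>n. e (A v) \<otimes>\<^bsub>m\<^esub> y = \<zero>\<^bsub>m\<^esub>)"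
proof (cases "A \<in> \<L>")
  case True then show ?thesis using derivation_condition[OF \<L>_hom[OF True]] by (simp add: a0_def)
qed (simp add: a0_def)

lemma a0_subset: "a0 K V \<K> \<L> \<subseteq> \<L>"
  by (auto simp: a0_def)

lemma \<L>_closed: "\<lbrakk>A \<in> \<L>; v \<in> carrier V\<rbrakk> \<Longrightarrow> A v \<in> carrier V"
  using module_hom_closed[OF \<L>_hom] by blast

lemma n_closed: "y \<in> n \<Longrightarrow> y \<in> carrier m"
  by (simp add: p.m.graded_sum_iff)

lemma bracket_n: "\<lbrakk>u \<in> carrier m; w \<in> carrier m\<rbrakk> \<Longrightarrow> u \<otimes>\<^bsub>m\<^esub> w \<in> n"
  by (rule p.m.bracket_in_lower_part[OF p.M_nonneg])

lemma ng_subspace: "subspace K ng g"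
  unfolding n_part_def by (rule p.g.subspace_graded_sum)

lemma ng_closed: "z \<in> ng \<Longrightarrow> z \<in> carrier g"
  by (simp add: n_part_def p.g.graded_sum_iff)

lemma \<iota>_n: "\<iota> ` n = ng"
proof
  have "n \<subseteq> {y \<in> carrier m. \<iota> y \<in> ng}"
  proof (rule \<pi>.N.graded_sum_subset[OF p.\<iota>.vimage_subspace[OF ng_subspace]])
    fix p :: int assume "p \<in> {..-2}"
    then have "\<iota> ` M p \<subseteq> ng"
      using p.image[of p] p.g.G_subset_graded_sum[of p "{..-2}"] by (simp add: n_part_def)
    then show "M p \<subseteq> {y \<in> carrier m. \<iota> y \<in> ng}" using p.m.G_closed by blast
  qed
  then show "\<iota> ` n \<subseteq> ng" by blast
  show "ng \<subseteq> \<iota> ` n" unfolding n_part_def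
  proof (rule p.g.graded_sum_subset[OF p.\<iota>.image_subspace[OF p.m.subspace_graded_sum]])
    fix p :: int assume "p \<in> {..-2}"
    then show "G p \<subseteq> \<iota> ` n"
      using p.image[of p] p.m.G_subset_graded_sum[of p "{..-2}"] by auto
  qed
qed

lemma negative_image:
  assumes "x \<in> G p" "p < 0" obtains u where "u \<in> M p" "x = \<iota> u"
  using assms p.image by blast

lemma negative_bracket_ng: "\<lbrakk>x \<in> G p; p < 0; z \<in> ng\<rbrakk> \<Longrightarrow> x \<otimes>\<^bsub>g\<^esub> z \<in> ng"
proof -
  assume x: "x \<in> G p" "p < 0" and "z \<in> ng"
  then obtain y where y: "y \<in> n" "z = \<iota> y" using \<iota>_n by blast
  obtain u where u: "u \<in> M p" "x = \<iota> u" using x by (rule negative_image)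
  have "x \<otimes>\<^bsub>g\<^esub> z = \<iota> (u \<otimes>\<^bsub>m\<^esub> y)"
    using u y p.m.G_closed n_closed by (simp add: p.\<iota>_bracket)
  moreover have "u \<otimes>\<^bsub>m\<^esub> y \<in> n" using u y p.m.G_closed n_closed by (intro bracket_n) auto
  ultimately show ?thesis using \<iota>_n by blast
qed

lemma H_neg: "p < 0 \<Longrightarrow> H p = G p"
  by (simp add: pre_a_deg_def)

lemma H_nonneg: "p \<ge> 0 \<Longrightarrow> x \<in> H p \<longleftrightarrow> x \<in> G p \<and> (\<forall>y\<in>ng. x \<otimes>\<^bsub>g\<^esub> y = \<zero>\<^bsub>g\<^esub>)"
  by (simp add: pre_a_deg_def)

lemma H_G: "x \<in> H p \<Longrightarrow> x \<in> G p"
  by (auto simp: pre_a_deg_def split: if_splits)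

lemma H_closed: "x \<in> H p \<Longrightarrow> x \<in> carrier g"
  using H_G p.g.G_closed by blast

lemma H_subspace: "subspace K (H p) g"
proof (cases "p < 0")
  case True then show ?thesis by (simp add: H_neg p.g.G_subspace)
next
  case False
  then show ?thesis
    by (intro p.g.subspaceI)
      (auto simp: H_nonneg p.g.G_closed ng_closed p.g.bracket_add_left p.g.bracket_smult_left
        p.g.subspace_add[OF p.g.G_subspace] p.g.subspace_smult[OF p.g.G_subspace])
qed

text \<open>x annihilates the lower part and y maps it into itself, so by the Leibniz rule their
  bracket annihilates it too.\<close>

lemma H_bracket_right:
  assumes x: "x \<in> H p" and y: "y \<in> H s" and p: "p \<ge> 0"
  shows "x \<otimes>\<^bsub>g\<^esub> y \<in> H (p + s)"
proof -
  note xG = H_G[OF x] and yG = H_G[OF y] and xc = H_closed[OF x] and yc = H_closed[OF y]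
  have kill: "x \<otimes>\<^bsub>g\<^esub> z = \<zero>\<^bsub>g\<^esub>" if "z \<in> ng" for z using x p that by (simp add: H_nonneg)
  have xyG: "x \<otimes>\<^bsub>g\<^esub> y \<in> G (p + s)" by (rule p.g.G_bracket[OF xG yG HOL.refl])
  have xy: "x \<otimes>\<^bsub>g\<^esub> y \<in> H (p + s)" if "\<And>z. z \<in> ng \<Longrightarrow> y \<otimes>\<^bsub>g\<^esub> z \<in> ng"
  proof (cases "p + s < 0")
    case True then show ?thesis using xyG by (simp add: H_neg)
  next
    case False
    have "(x \<otimes>\<^bsub>g\<^esub> y) \<otimes>\<^bsub>g\<^esub> z = \<zero>\<^bsub>g\<^esub>" if z: "z \<in> ng" for z
      using p.g.jacobi_right[OF xc yc ng_closed[OF z]] kill[OF z] kill[OF \<open>\<And>z. z \<in> ng \<Longrightarrow> y \<otimes>\<^bsub>g\<^esub> z \<in> ng\<close>[OF z]] yc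
      by simp
    then show ?thesis using xyG False by (simp add: H_nonneg)
  qed
  show ?thesis
  proof (rule xy)
    fix z assume z: "z \<in> ng"
    show "y \<otimes>\<^bsub>g\<^esub> z \<in> ng"
    proof (cases "s < 0")
      case True then show ?thesis using negative_bracket_ng[OF yG _ z] by simp
    next
      case False
      then have "y \<otimes>\<^bsub>g\<^esub> z = \<zero>\<^bsub>g\<^esub>" using y z by (simp add: H_nonneg)
      then show ?thesis using p.g.subspace_zero[OF ng_subspace] by simp
    qed
  qed
qed

lemma H_bracket: assumes x: "x \<in> H p" and y: "y \<in> H s" shows "x \<otimes>\<^bsub>g\<^esub> y \<in> H (p + s)"
proof -
  consider "p \<ge> 0" | "s \<ge> 0" | "p < 0" "s < 0" by linarith
  then show ?thesis
  proof cases
    case 1 then show ?thesis using H_bracket_right[OF x y] by simp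
  next
    case 2
    have "y \<otimes>\<^bsub>g\<^esub> x \<in> H (p + s)" using H_bracket_right[OF y x 2] by (simp add: add.commute)
    then show ?thesis using p.g.bracket_antisym[OF H_closed[OF x] H_closed[OF y]]
        p.g.subspace_neg[OF H_subspace] by simp
  next
    case 3
    then show ?thesis using p.g.G_bracket[OF H_G[OF x] H_G[OF y] HOL.refl] by (simp add: H_neg)
  qed
qed

abbreviation P where "P \<equiv> graded_sum g H UNIV"

lemma P_subspace: "subspace K P g"
  by (rule p.g.subspace_graded_sum_general[OF H_subspace])

lemma P_closed: "x \<in> P \<Longrightarrow> x \<in> carrier g"
  by (rule p.g.subspace_carrier[OF P_subspace])

lemma H_P: "x \<in> H p \<Longrightarrow> x \<in> P"
  using p.g.subset_graded_sum[of H p UNIV] H_closed by blast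

lemma P_iff: "x \<in> P \<longleftrightarrow> x \<in> carrier g \<and> (\<forall>p. p.g.component p x \<in> H p)"
  using p.g.mem_graded_sum_iff[of UNIV H x] H_G p.g.subspace_zero[OF H_subspace] by auto

lemma P_induct:
  assumes x: "x \<in> P" and S: "subspace K S g" and c: "\<And>p x. x \<in> H p \<Longrightarrow> x \<in> S"
  shows "x \<in> S"
  using p.g.graded_sum_subset[OF S, of UNIV H] c x by blast

lemma left_subspace:
  "\<lbrakk>subspace K S g; B \<subseteq> carrier g\<rbrakk> \<Longrightarrow> subspace K {x \<in> carrier g. \<forall>y\<in>B. x \<otimes>\<^bsub>g\<^esub> y \<in> S} g"
  by (rule p.g.subspaceI)
    (auto simp: subset_eq p.g.bracket_add_left p.g.bracket_smult_left p.g.subspace_zero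
      p.g.subspace_add p.g.subspace_smult)

lemma right_subspace:
  "\<lbrakk>subspace K S g; x \<in> carrier g\<rbrakk> \<Longrightarrow> subspace K {y \<in> carrier g. x \<otimes>\<^bsub>g\<^esub> y \<in> S} g"
  by (rule p.g.subspaceI)
    (auto simp: p.g.bracket_add_right p.g.bracket_smult_right p.g.subspace_zero
      p.g.subspace_add p.g.subspace_smult)

lemma P_bracket: assumes x: "x \<in> P" and y: "y \<in> P" shows "x \<otimes>\<^bsub>g\<^esub> y \<in> P"
proof -
  have "x \<in> {x \<in> carrier g. \<forall>y\<in>P. x \<otimes>\<^bsub>g\<^esub> y \<in> P}"
  proof (rule P_induct[OF x left_subspace[OF P_subspace]])
    show "P \<subseteq> carrier g" using P_closed by blast
    fix p x assume x: "x \<in> H p"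
    have "y \<in> {y \<in> carrier g. x \<otimes>\<^bsub>g\<^esub> y \<in> P}" if "y \<in> P" for y
      by (rule P_induct[OF that right_subspace[OF P_subspace H_closed[OF x]]])
        (use H_closed H_P[OF H_bracket[OF x]] in blast)
    then show "x \<in> {x \<in> carrier g. \<forall>y\<in>P. x \<otimes>\<^bsub>g\<^esub> y \<in> P}" using H_closed[OF x] by blast
  qed
  then show ?thesis using y by blast
qed

text \<open>Negative degrees preserve the lower part, since brackets in \<open>m\<close> fall into
  degrees \<le> -2; the degrees \<ge> 0 annihilate it.\<close>

lemma P_bracket_ng: assumes x: "x \<in> P" and z: "z \<in> ng" shows "x \<otimes>\<^bsub>g\<^esub> z \<in> ng"
proof -
  have "x \<in> {x \<in> carrier g. \<forall>y\<in>ng. x \<otimes>\<^bsub>g\<^esub> y \<in> ng}"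
  proof (rule P_induct[OF x left_subspace[OF ng_subspace]])
    show "ng \<subseteq> carrier g" using ng_closed by blast
    fix p x assume x: "x \<in> H p"
    have "x \<otimes>\<^bsub>g\<^esub> y \<in> ng" if y: "y \<in> ng" for y
    proof (cases "p < 0")
      case True then show ?thesis using negative_bracket_ng[OF H_G[OF x] _ y] by simp
    next
      case False
      then have "x \<otimes>\<^bsub>g\<^esub> y = \<zero>\<^bsub>g\<^esub>" using x y by (simp add: H_nonneg)
      then show ?thesis using p.g.subspace_zero[OF ng_subspace] by simp
    qed
    then show "x \<in> {x \<in> carrier g. \<forall>y\<in>ng. x \<otimes>\<^bsub>g\<^esub> y \<in> ng}" using H_closed[OF x] by blast
  qed
  then show ?thesis using z by blast
qed

lemma ng_P: "ng \<subseteq> P"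
  unfolding n_part_def
proof (rule p.g.graded_sum_subset[OF P_subspace])
  fix p :: int assume "p \<in> {..-2}"
  then show "G p \<subseteq> P" using H_P[of _ p] by (auto simp: H_neg)
qed

lemma pre_simps: "carrier pre = P" "x \<otimes>\<^bsub>pre\<^esub> y = x \<otimes>\<^bsub>g\<^esub> y" "x \<oplus>\<^bsub>pre\<^esub> y = x \<oplus>\<^bsub>g\<^esub> y"
  "c \<odot>\<^bsub>pre\<^esub> x = c \<odot>\<^bsub>g\<^esub> x" "\<zero>\<^bsub>pre\<^esub> = \<zero>\<^bsub>g\<^esub>"
  by (simp_all add: pre_a_def)

lemma lie_algebra_pre: "lie_algebra K pre"
  unfolding pre_a_def by (rule p.g.subalgebra[OF P_subspace P_bracket])

interpretation pre: lie_algebra K pre by (rule lie_algebra_pre)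

lemma subspace_pre: "\<lbrakk>subspace K S g; S \<subseteq> P\<rbrakk> \<Longrightarrow> subspace K S pre"
  by (rule pre.subspaceI) (auto simp: pre_simps p.g.subspace_zero p.g.subspace_add p.g.subspace_smult)

lemma graded_pre: "graded_lie_algebra K pre H"
proof (rule graded_lie_algebraI[where cp = p.g.component], goal_cases)
  case 1 then show ?case by (rule lie_algebra_pre)
next
  case (2 p) then show ?case by (rule subspace_pre[OF H_subspace]) (use H_P in blast)
next
  case (3 p s x y) then show ?case by (simp add: pre_simps H_bracket)
next
  case (4 p x) then show ?case by (simp add: pre_simps P_iff)
next
  case (5 x) then show ?case by (simp add: pre_simps p.g.component_finite P_closed)
next
  case (6 p x y) then show ?case by (simp add: pre_simps p.g.component_add P_closed)
next
  case (7 p x) then show ?case using p.g.component_same H_G by blast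
next
  case (8 p s x) then show ?case by (simp add: pre_simps p.g.component_other[OF H_G])
next
  case (9 x) then show ?case by (simp add: pre_simps p.g.eq_zero_if_components P_closed)
qed

interpretation pre: graded_lie K pre H by (rule graded_lieI[OF graded_pre])

lemma ng_ideal: "lie_ideal K ng pre"
  unfolding lie_ideal_def using subspace_pre[OF ng_subspace ng_P] P_bracket_ng by (simp add: pre_simps)

text \<open>Additive inverses are defined through the carrier, so they have to be compared again
  after the carrier is restricted.\<close>

lemma pre_minus: "\<lbrakk>x \<in> P; y \<in> P\<rbrakk> \<Longrightarrow> x \<ominus>\<^bsub>pre\<^esub> y = x \<ominus>\<^bsub>g\<^esub> y"
proof -
  assume xy: "x \<in> P" "y \<in> P"
  have "\<ominus>\<^bsub>pre\<^esub> y = \<ominus>\<^bsub>g\<^esub> y"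
    by (rule pre.M.minus_equality)
      (use xy P_closed p.g.subspace_neg[OF P_subspace] in \<open>auto simp: pre_simps p.g.M.l_neg\<close>)
  then show ?thesis by (simp add: a_minus_def pre_simps)
qed

interpretation q: lie_surjection K pre \<aa> q
  unfolding a_lie_def by (rule pre.lie_quot_surjection(1)[OF ng_ideal])

lemma lie_surjection_q: "lie_surjection K pre \<aa> q" by (rule q.lie_surjection_axioms)

lemma q_eq_iff: "\<lbrakk>x \<in> P; y \<in> P\<rbrakk> \<Longrightarrow> q x = q y \<longleftrightarrow> x \<ominus>\<^bsub>g\<^esub> y \<in> ng"
  using pre.lie_quot_surjection(2)[OF ng_ideal, of x y] by (simp add: pre_simps pre_minus)

lemma q_zero_iff: "x \<in> P \<Longrightarrow> q x = \<zero>\<^bsub>\<aa>\<^esub> \<longleftrightarrow> x \<in> ng"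
  using q_eq_iff[of x "\<zero>\<^bsub>g\<^esub>"] q.map_zero p.g.subspace_zero[OF P_subspace] P_closed
  by (simp add: pre_simps a_minus_def)

lemma pre_component: "x \<in> P \<Longrightarrow> pre.component p x = p.g.component p x"
proof -
  assume "x \<in> P"
  then have "x \<in> carrier pre" by (simp add: pre_simps)
  then show ?thesis
  proof (induction rule: pre.graded_induct)
    case (homogeneous s x)
    then show ?case
      using pre.component_same[OF homogeneous] p.g.component_same[OF H_G[OF homogeneous]]
        pre.component_other[OF homogeneous] p.g.component_other[OF H_G[OF homogeneous]]
      by (cases "p = s") (auto simp: pre_simps)
  next
    case (add x y)
    have "pre.component p (x \<oplus>\<^bsub>pre\<^esub> y) = pre.component p x \<oplus>\<^bsub>g\<^esub> pre.component p y"
      using pre.component_add[OF add(1,2)] by (simp add: pre_simps)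
    then show ?case using add P_closed by (simp add: pre_simps p.g.component_add)
  qed
qed

interpretation q: graded_lie_surjection K pre H \<aa> q
proof unfold_locales
  fix x p assume x: "x \<in> carrier pre" "q x = \<zero>\<^bsub>\<aa>\<^esub>"
  then have xP: "x \<in> P" "x \<in> ng" by (auto simp: pre_simps q_zero_iff)
  have c: "p.g.component p x \<in> P" using xP H_P P_iff by blast
  have "p.g.component p x \<in> ng"
  proof (cases "p \<in> {..-2}")
    case True
    then show ?thesis using p.g.component_in[OF P_closed[OF xP(1)], of p]
        p.g.G_subset_graded_sum[of p "{..-2}"] by (auto simp: n_part_def)
  next
    case False
    then have "p.g.component p x = \<zero>\<^bsub>g\<^esub>" using xP(2) by (simp add: n_part_def p.g.graded_sum_iff)
    then show ?thesis using p.g.subspace_zero[OF ng_subspace] by simp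
  qed
  then show "q (pre.component p x) = \<zero>\<^bsub>\<aa>\<^esub>" using c by (simp add: pre_component[OF xP(1)] q_zero_iff)
qed

lemma a_deg_eq: "a_deg g G p = q ` H p"
  by (simp add: a_deg_def quot_grading_def)

lemma graded_\<aa>: "graded_lie_algebra K \<aa> (a_deg g G)"
  using q.graded_image by (simp add: a_deg_eq[abs_def])

lemma ng_G_zero: "\<lbrakk>x \<in> ng; x \<in> G p; p > -2\<rbrakk> \<Longrightarrow> x = \<zero>\<^bsub>g\<^esub>"
  using p.g.component_same[of x p] by (auto simp: n_part_def p.g.graded_sum_iff)

section \<open>Comparison of a with the prolongations of the abelian algebra V\<close>

subsection \<open>The abelian quotient\<close>

abbreviation m' where "m' \<equiv> quot_lie K V F2"
abbreviation M' where "M' \<equiv> quot_lie_deg K V F2"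
abbreviation e' where "e' \<equiv> quot_gen K V F2"
abbreviation incl where "incl \<equiv> a_incl K V \<K> g G \<iota>"

lemma e'_surj: "e' ` carrier V = carrier m'"
proof
  show "e' ` carrier V \<subseteq> carrier m'" using ab.e.T_im by blast
  show "carrier m' \<subseteq> e' ` carrier V"
  proof
    fix X assume "X \<in> carrier m'"
    then obtain Y where Y: "Y \<in> carrier F" "X = ab.\<pi> Y" by (rule ab.\<pi>.image_cases)
    then have "ab.\<pi> Y = ab.\<pi> (free_gen K V (\<rho> Y))"
      using F_decompose[OF Y(1)] by (simp add: ab.\<pi>_eq_iff gen_closed \<rho>_closed)
    then show "X \<in> e' ` carrier V" using Y \<rho>_closed by (simp add: ab.e_eq)
  qed
qed

lemma m'_cases: assumes "X \<in> carrier m'" obtains v where "v \<in> carrier V" "X = e' v"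
  using assms e'_surj by blast

lemma m'_abelian: "\<lbrakk>X \<in> carrier m'; Y \<in> carrier m'\<rbrakk> \<Longrightarrow> X \<otimes>\<^bsub>m'\<^esub> Y = \<zero>\<^bsub>m'\<^esub>"
proof -
  assume "X \<in> carrier m'" "Y \<in> carrier m'"
  then obtain x y where xy: "x \<in> carrier F" "y \<in> carrier F" "X = ab.\<pi> x" "Y = ab.\<pi> y"
    by (elim ab.\<pi>.image_cases) blast
  then have "X \<otimes>\<^bsub>m'\<^esub> Y = ab.\<pi> (x \<otimes>\<^bsub>F\<^esub> y)" by (simp add: ab.\<pi>.map_mult)
  then show ?thesis using xy ab.\<pi>_zero_iff[OF F.bracket_closed[OF xy(1,2)]] bracket_in_F2 by simp
qed

lemma M'_other: "p \<noteq> -1 \<Longrightarrow> M' p = {\<zero>\<^bsub>m'\<^esub>}"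
proof (cases "p \<ge> 0")
  case False
  assume "p \<noteq> -1"
  then have "D p \<subseteq> F2" using False by (intro D_subset_F2) simp
  then have "ab.\<pi> X = \<zero>\<^bsub>m'\<^esub>" if "X \<in> D p" for X
    using that ab.\<pi>_zero_iff[OF D_closed[OF that]] by blast
  then show ?thesis unfolding ab.M_eq using F.subspace_zero[OF D_subspace] by blast
qed (simp add: ab.M_nonneg)

lemma M'_minus_one: "M' (-1) = carrier m'"
  using ab.e_onto e'_surj by simp

lemma fgla_m': "fgla K m' M'"
proof -
  have gr: "graded_lie_algebra K m' M'"
  proof (rule graded_lie_algebraI[where cp = "\<lambda>p X. if p = -1 then X else \<zero>\<^bsub>m'\<^esub>"], goal_cases)
    case 1 then show ?case by (rule ab.\<pi>.lie_algebra_image)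
  next
    case (2 p) then show ?case by (rule ab.M_subspace)
  next
    case (3 p s x y)
    then have "x \<otimes>\<^bsub>m'\<^esub> y = \<zero>\<^bsub>m'\<^esub>" by (intro m'_abelian) (use ab.\<pi>.N.subspace_carrier[OF ab.M_subspace] in auto)
    then show ?case using ab.\<pi>.N.subspace_zero[OF ab.M_subspace] by simp
  next
    case (4 p x) then show ?case using ab.\<pi>.N.subspace_zero[OF ab.M_subspace] by (simp add: M'_minus_one)
  next
    case (5 x)
    have "{p. (if p = -1 then x else \<zero>\<^bsub>m'\<^esub>) \<noteq> \<zero>\<^bsub>m'\<^esub>} \<subseteq> {-1}" by auto
    then show ?case using finite_subset by blast
  next
    case (6 p x y) then show ?case by simp
  next
    case (7 p x) then show ?case using M'_other[of p] by auto
  next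
    case (8 p q x) then show ?case using M'_other[of q] by auto
  next
    case (9 x) from 9(2)[of "-1"] show ?case by simp
  qed
  have "vectorspace.fin_dim K m'" by (rule ab.e.surj_fin_dim[OF V_fin_dim e'_surj])
  moreover have "m'\<lparr>carrier := M' (-1)\<rparr> = m'" by (simp add: M'_minus_one)
  moreover have "S = carrier m'" if "lie_subalgebra K S m'" "M' (-1) \<subseteq> S" for S
    using that by (auto simp: M'_minus_one lie_subalgebra_def dest: ab.\<pi>.N.subspace_carrier)
  ultimately show ?thesis using gr ab.M_nonneg by (simp add: fgla_def)
qed

text \<open>The union in \<open>a_incl\<close> collapses: representatives of one class differ by an
  element of \<open>F2\<close>, which \<pi> and \<iota> send into the lower part of
  \<open>g\<close>.\<close>

lemma incl_e': assumes v: "v \<in> carrier V" shows "incl (e' v) = q (\<iota> (e v))"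
proof -
  have gc: "free_gen K V v \<in> carrier F" by (rule gen_closed[OF v])
  have "q (\<iota> (\<pi> x)) = q (\<iota> (e v))" if "x \<in> e' v" for x
  proof -
    have x: "x \<in> carrier F" "x \<ominus>\<^bsub>F\<^esub> free_gen K V v \<in> F2"
      using that F.coset_subset[OF F2_ideal gc] F.mem_coset_iff[OF F2_ideal gc, of x]
      by (auto simp: quot_gen_def)
    have "\<pi> (x \<ominus>\<^bsub>F\<^esub> free_gen K V v) \<in> n" using x(2) \<pi>_F2 by blast
    then have "\<iota> (\<pi> (x \<ominus>\<^bsub>F\<^esub> free_gen K V v)) \<in> ng" using \<iota>_n by blast
    moreover have "\<iota> (\<pi> (x \<ominus>\<^bsub>F\<^esub> free_gen K V v)) = \<iota> (\<pi> x) \<ominus>\<^bsub>g\<^esub> \<iota> (e v)"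
      using x gc by (simp add: \<pi>.map.T_minus e_eq \<pi>_closed p.\<iota>.T_minus)
    moreover have \<iota>P: "\<iota> u \<in> P" if "u \<in> carrier m" for u
    proof -
      have "subspace K {u \<in> carrier m. \<iota> u \<in> P} m" by (rule p.\<iota>.vimage_subspace[OF P_subspace])
      note s = this
      show ?thesis using that
      proof (induction rule: p.m.graded_induct)
        case (homogeneous r x)
        show ?case
        proof (cases "r < 0")
          case True
          then show ?thesis using homogeneous p.image[OF True] H_P[of "\<iota> x" r] H_neg by blast
        next
          case False
          then have "x = \<zero>\<^bsub>m\<^esub>" using homogeneous p.M_nonneg[of r] by auto
          then show ?thesis using p.g.subspace_zero[OF P_subspace] by simp
        qed
      next
        case (add x y)
        then show ?case by (simp add: p.\<iota>.T_add p.g.subspace_add[OF P_subspace])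
      qed
    qed
    ultimately show ?thesis
      using q_eq_iff[OF \<iota>P[OF \<pi>_closed[OF x(1)]] \<iota>P[OF e.T_im[OF v]]] by simp
  qed
  moreover have "free_gen K V v \<in> e' v"
    using F.mem_coset_iff[OF F2_ideal gc gc] gc F.subspace_zero[OF F2_subspace]
    by (simp add: quot_gen_def a_minus_def F.M.r_neg)
  ultimately have "(\<Union>x\<in>e' v. q (\<iota> (\<pi> x))) = q (\<iota> (e v))" by blast
  then show ?thesis by (simp add: a_incl_def \<pi>_def)
qed

lemma \<iota>e_in: "v \<in> carrier V \<Longrightarrow> \<iota> (e v) \<in> G (-1)"
  using e_onto p.image[of "-1"] by auto

lemma \<iota>e_P: "v \<in> carrier V \<Longrightarrow> \<iota> (e v) \<in> P"
  using \<iota>e_in[of v] H_P[of "\<iota> (e v)" "-1"] by (simp add: H_neg)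

lemma G_minus_one: "G (-1) = (\<lambda>v. \<iota> (e v)) ` carrier V"
proof -
  have "\<iota> ` e ` carrier V = G (-1)" unfolding e_onto by (rule p.image) simp
  then show ?thesis by (simp add: image_image)
qed

text \<open>\<xi> kills the elements [v, w] and [v, y] of the lower part, where y is itself in the
  lower part. Expanded by the Leibniz rule, these are the two equations of
  \<open>a0_iff\<close>.\<close>

lemma type_a0:
  assumes \<xi>: "\<xi> \<in> H 0"
  shows "\<exists>A\<in>a0 K V \<K> \<L>. \<forall>v\<in>carrier V. \<xi> \<otimes>\<^bsub>g\<^esub> \<iota> (e v) = \<iota> (e (A v))"
proof -
  obtain A where A: "A \<in> \<L>" "\<And>v. v \<in> carrier V \<Longrightarrow> \<xi> \<otimes>\<^bsub>g\<^esub> \<iota> (e v) = \<iota> (e (A v))"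
    using type[OF H_G[OF \<xi>]] by blast
  note \<xi>c = H_closed[OF \<xi>] and Ac = \<L>_closed[OF A(1)]
  have kill: "\<xi> \<otimes>\<^bsub>g\<^esub> \<iota> y = \<zero>\<^bsub>g\<^esub>" if "y \<in> n" for y
    using \<xi> that \<iota>_n by (auto simp: H_nonneg)
  have "e (A v) \<otimes>\<^bsub>m\<^esub> e w \<oplus>\<^bsub>m\<^esub> e v \<otimes>\<^bsub>m\<^esub> e (A w) = \<zero>\<^bsub>m\<^esub>" if vw: "v \<in> carrier V" "w \<in> carrier V" for v w
  proof (rule p.\<iota>_zeroD)
    note c = vw[THEN e.T_im] vw[THEN Ac, THEN e.T_im]
    show "e (A v) \<otimes>\<^bsub>m\<^esub> e w \<oplus>\<^bsub>m\<^esub> e v \<otimes>\<^bsub>m\<^esub> e (A w) \<in> carrier m"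
      using c by (simp add: \<pi>.N.bracket_closed)
    have "\<iota> (e (A v) \<otimes>\<^bsub>m\<^esub> e w \<oplus>\<^bsub>m\<^esub> e v \<otimes>\<^bsub>m\<^esub> e (A w)) =
        (\<xi> \<otimes>\<^bsub>g\<^esub> \<iota> (e v)) \<otimes>\<^bsub>g\<^esub> \<iota> (e w) \<oplus>\<^bsub>g\<^esub> \<iota> (e v) \<otimes>\<^bsub>g\<^esub> (\<xi> \<otimes>\<^bsub>g\<^esub> \<iota> (e w))"
      using c vw A(2) by (simp add: p.\<iota>.T_add \<pi>.N.bracket_closed p.\<iota>_bracket)
    also have "\<dots> = \<xi> \<otimes>\<^bsub>g\<^esub> \<iota> (e v \<otimes>\<^bsub>m\<^esub> e w)"
      using p.g.jacobi_left[OF \<xi>c p.\<iota>.T_im[OF c(1)] p.\<iota>.T_im[OF c(2)]] c by (simp add: p.\<iota>_bracket)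
    also have "\<dots> = \<zero>\<^bsub>g\<^esub>" by (rule kill[OF bracket_n[OF c(1,2)]])
    finally show "\<iota> (e (A v) \<otimes>\<^bsub>m\<^esub> e w \<oplus>\<^bsub>m\<^esub> e v \<otimes>\<^bsub>m\<^esub> e (A w)) = \<zero>\<^bsub>g\<^esub>" .
  qed
  moreover have "e (A v) \<otimes>\<^bsub>m\<^esub> y = \<zero>\<^bsub>m\<^esub>" if v: "v \<in> carrier V" and y: "y \<in> n" for v y
  proof (rule p.\<iota>_zeroD)
    note c = e.T_im[OF v] e.T_im[OF Ac[OF v]] n_closed[OF y]
    show "e (A v) \<otimes>\<^bsub>m\<^esub> y \<in> carrier m" using c by (simp add: \<pi>.N.bracket_closed)
    have "\<zero>\<^bsub>g\<^esub> = \<xi> \<otimes>\<^bsub>g\<^esub> \<iota> (e v \<otimes>\<^bsub>m\<^esub> y)" using kill[OF bracket_n[OF c(1,3)]] by simp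
    also have "\<dots> = (\<xi> \<otimes>\<^bsub>g\<^esub> \<iota> (e v)) \<otimes>\<^bsub>g\<^esub> \<iota> y \<oplus>\<^bsub>g\<^esub> \<iota> (e v) \<otimes>\<^bsub>g\<^esub> (\<xi> \<otimes>\<^bsub>g\<^esub> \<iota> y)"
      using p.g.jacobi_left[OF \<xi>c p.\<iota>.T_im[OF c(1)] p.\<iota>.T_im[OF c(3)]] c by (simp add: p.\<iota>_bracket)
    also have "\<dots> = \<iota> (e (A v) \<otimes>\<^bsub>m\<^esub> y)" using c kill[OF y] A(2)[OF v]
      by (simp add: p.\<iota>_bracket p.g.bracket_closed)
    finally show "\<iota> (e (A v) \<otimes>\<^bsub>m\<^esub> y) = \<zero>\<^bsub>g\<^esub>" by simp
  qed
  ultimately have "A \<in> a0 K V \<K> \<L>" using A(1) by (simp add: a0_iff)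
  then show ?thesis using A(2) by blast
qed

lemma q_closed: "x \<in> P \<Longrightarrow> q x \<in> carrier \<aa>"
  using q.image_closed by (simp add: pre_simps)

lemma q_add: "\<lbrakk>x \<in> P; y \<in> P\<rbrakk> \<Longrightarrow> q (x \<oplus>\<^bsub>g\<^esub> y) = q x \<oplus>\<^bsub>\<aa>\<^esub> q y"
  using q.map_add[of x y] by (simp add: pre_simps)

lemma q_smult: "\<lbrakk>c \<in> carrier K; x \<in> P\<rbrakk> \<Longrightarrow> q (c \<odot>\<^bsub>g\<^esub> x) = c \<odot>\<^bsub>\<aa>\<^esub> q x"
  using q.map_smult[of c x] by (simp add: pre_simps)

lemma q_mult: "\<lbrakk>x \<in> P; y \<in> P\<rbrakk> \<Longrightarrow> q (x \<otimes>\<^bsub>g\<^esub> y) = q x \<otimes>\<^bsub>\<aa>\<^esub> q y"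
  using q.map_mult[of x y] by (simp add: pre_simps)

lemma bracket_degree_shift:
  assumes x: "x \<in> graded_sum g G {0..}" and v: "v \<in> G (-1)" shows "x \<otimes>\<^bsub>g\<^esub> v \<in> graded_sum g G {-1..}"
proof -
  have "graded_sum g G {0..} \<subseteq> {x \<in> carrier g. \<forall>y\<in>{v}. x \<otimes>\<^bsub>g\<^esub> y \<in> graded_sum g G {-1..}}"
  proof (rule p.g.graded_sum_subset[OF left_subspace[OF p.g.subspace_graded_sum]])
    show "{v} \<subseteq> carrier g" using p.g.G_closed[OF v] by simp
    fix r :: int assume r: "r \<in> {0..}"
    show "G r \<subseteq> {x \<in> carrier g. \<forall>y\<in>{v}. x \<otimes>\<^bsub>g\<^esub> y \<in> graded_sum g G {-1..}}"
    proof
      fix x assume x: "x \<in> G r"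
      have "x \<otimes>\<^bsub>g\<^esub> v \<in> G (r - 1)" by (rule p.g.G_bracket[OF x v]) simp
      then show "x \<in> {x \<in> carrier g. \<forall>y\<in>{v}. x \<otimes>\<^bsub>g\<^esub> y \<in> graded_sum g G {-1..}}"
        using p.g.G_subset_graded_sum[of "r - 1" "{-1..}"] r p.g.G_closed[OF x] by auto
    qed
  qed
  then show ?thesis using x by blast
qed

text \<open>The danger is that the quotient creates new annihilators of degree -1: for x of degree
  \<ge> 0 only [x, v] \<in> n is known. But [x, v] has components in degrees \<ge> -1 only, so it is
  zero, and effectivity of \<open>g\<close> applies.\<close>

lemma effective_\<aa>: "effective_prolongation K m' M' \<aa> (a_deg g G) incl"
proof -
  interpret \<aa>: graded_lie K \<aa> "a_deg g G" by (rule graded_lieI[OF graded_\<aa>])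
  have hom: "incl \<in> lie_hom K m' \<aa>"
    unfolding lie_hom_def module_hom_def
  proof (intro CollectI conjI allI impI ballI Pi_I)
    fix X assume "X \<in> carrier m'"
    then show "incl X \<in> carrier \<aa>" by (elim m'_cases) (simp add: incl_e' q_closed \<iota>e_P)
  next
    fix X Y assume "X \<in> carrier m' \<and> Y \<in> carrier m'"
    then obtain v w where vw: "v \<in> carrier V" "w \<in> carrier V" "X = e' v" "Y = e' w"
      by (meson m'_cases)
    have "incl (e' (v \<oplus>\<^bsub>V\<^esub> w)) = q (\<iota> (e (v \<oplus>\<^bsub>V\<^esub> w)))" by (rule incl_e') (use vw in simp)
    then have "incl (X \<oplus>\<^bsub>m'\<^esub> Y) = q (\<iota> (e v) \<oplus>\<^bsub>g\<^esub> \<iota> (e w))" using vw by simp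
    then show "incl (X \<oplus>\<^bsub>m'\<^esub> Y) = incl X \<oplus>\<^bsub>\<aa>\<^esub> incl Y"
      using vw by (simp add: incl_e' q_add \<iota>e_P)
  next
    fix c X assume "c \<in> carrier K \<and> X \<in> carrier m'"
    then obtain v where v: "v \<in> carrier V" "c \<in> carrier K" "X = e' v"
      by (meson m'_cases)
    have "incl (e' (c \<odot>\<^bsub>V\<^esub> v)) = q (\<iota> (e (c \<odot>\<^bsub>V\<^esub> v)))" by (rule incl_e') (use v in simp)
    then have "incl (c \<odot>\<^bsub>m'\<^esub> X) = q (c \<odot>\<^bsub>g\<^esub> \<iota> (e v))" using v by simp
    then show "incl (c \<odot>\<^bsub>m'\<^esub> X) = c \<odot>\<^bsub>\<aa>\<^esub> incl X"
      using v by (simp add: incl_e' q_smult \<iota>e_P)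
  next
    fix X Y assume XY: "X \<in> carrier m'" "Y \<in> carrier m'"
    then obtain v w where vw: "v \<in> carrier V" "w \<in> carrier V" "X = e' v" "Y = e' w"
      by (meson m'_cases)
    have "incl X \<otimes>\<^bsub>\<aa>\<^esub> incl Y = q (\<iota> (e v) \<otimes>\<^bsub>g\<^esub> \<iota> (e w))"
      using vw by (simp add: incl_e' q_mult \<iota>e_P)
    also have "\<iota> (e v) \<otimes>\<^bsub>g\<^esub> \<iota> (e w) = \<iota> (e v \<otimes>\<^bsub>m\<^esub> e w)" using vw by (simp add: p.\<iota>_bracket)
    also have "\<iota> (e v \<otimes>\<^bsub>m\<^esub> e w) \<in> ng" using \<iota>_n bracket_n vw e.T_im by blast
    then have "q (\<iota> (e v \<otimes>\<^bsub>m\<^esub> e w)) = \<zero>\<^bsub>\<aa>\<^esub>" using q_zero_iff ng_P by blast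
    finally have 1: "incl X \<otimes>\<^bsub>\<aa>\<^esub> incl Y = \<zero>\<^bsub>\<aa>\<^esub>" .
    have "incl (e' \<zero>\<^bsub>V\<^esub>) = q (\<iota> (e \<zero>\<^bsub>V\<^esub>))" by (rule incl_e') simp
    moreover have "q \<zero>\<^bsub>g\<^esub> = \<zero>\<^bsub>\<aa>\<^esub>" using q.map_zero by (simp add: pre_simps)
    moreover have "e' \<zero>\<^bsub>V\<^esub> = \<zero>\<^bsub>m'\<^esub>" "\<iota> (e \<zero>\<^bsub>V\<^esub>) = \<zero>\<^bsub>g\<^esub>" by simp_all
    ultimately have "incl \<zero>\<^bsub>m'\<^esub> = \<zero>\<^bsub>\<aa>\<^esub>" by simp
    then show "incl (X \<otimes>\<^bsub>m'\<^esub> Y) = incl X \<otimes>\<^bsub>\<aa>\<^esub> incl Y" using 1 m'_abelian[OF XY] by simp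
  qed
  have inj: "inj_on incl (carrier m')"
  proof -
    interpret i: linear_map K m' \<aa> incl
      by (rule lie_hom_linear_map[OF ab.\<pi>.lie_algebra_image q.lie_algebra_image hom])
    show ?thesis unfolding i.inj_on_iff
    proof (intro ballI impI)
      fix X assume X: "X \<in> carrier m'" "incl X = \<zero>\<^bsub>\<aa>\<^esub>"
      then obtain v where v: "v \<in> carrier V" "X = e' v" by (elim m'_cases)
      then have "\<iota> (e v) \<in> ng" using X(2) by (simp add: incl_e' q_zero_iff \<iota>e_P)
      then have "\<iota> (e v) = \<zero>\<^bsub>g\<^esub>" using ng_G_zero[OF _ \<iota>e_in[OF v(1)]] by simp
      then have "e v = \<zero>\<^bsub>m\<^esub>" using p.\<iota>_zeroD v(1) e.T_im by blast
      then have "v = \<zero>\<^bsub>V\<^esub>" using iffD1[OF e.inj_on_iff e_inj] v(1) by blast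
      then show "X = \<zero>\<^bsub>m'\<^esub>" using v(2) by simp
    qed
  qed
  have image: "incl ` M' r = a_deg g G r" if r: "r < 0" for r
  proof (cases "r = -1")
    case True
    have "incl ` M' (-1) = incl ` e' ` carrier V" by (simp add: M'_minus_one e'_surj)
    also have "\<dots> = q ` G (-1)" unfolding G_minus_one image_image by (rule image_cong) (auto simp: incl_e')
    finally show ?thesis using True by (simp add: a_deg_eq H_neg)
  next
    case False
    then have "G r \<subseteq> ng" using r p.g.G_subset_graded_sum[of r "{..-2}"] by (simp add: n_part_def)
    then have "q x = \<zero>\<^bsub>\<aa>\<^esub>" if "x \<in> G r" for x using that q_zero_iff ng_P by blast
    then have "q ` G r = (\<lambda>_. \<zero>\<^bsub>\<aa>\<^esub>) ` G r" by (rule image_cong[OF HOL.refl])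
    then have "a_deg g G r = {\<zero>\<^bsub>\<aa>\<^esub>}" using r by (simp add: a_deg_eq H_neg image_constant[OF p.g.G_zero])
    moreover have "incl \<zero>\<^bsub>m'\<^esub> = \<zero>\<^bsub>\<aa>\<^esub>"
      using linear_map.T0_is_0[OF lie_hom_linear_map[OF ab.\<pi>.lie_algebra_image q.lie_algebra_image hom]] .
    ultimately show ?thesis using M'_other[OF False] by simp
  qed
  have eff: "X = \<zero>\<^bsub>\<aa>\<^esub>" if X: "X \<in> graded_sum \<aa> (a_deg g G) {0..}"
    and 0: "\<forall>v\<in>a_deg g G (-1). X \<otimes>\<^bsub>\<aa>\<^esub> v = \<zero>\<^bsub>\<aa>\<^esub>" for X
  proof -
    let ?H0 = "graded_sum pre H {0..}"
    have "graded_sum \<aa> (a_deg g G) {0..} \<subseteq> q ` ?H0"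
    proof (rule q.N.graded_sum_subset[OF q.map.image_subspace[OF pre.subspace_graded_sum]])
      fix r :: int assume "r \<in> {0..}"
      then show "a_deg g G r \<subseteq> q ` ?H0" unfolding a_deg_eq
        by (intro image_mono pre.G_subset_graded_sum)
    qed
    then obtain x where x: "x \<in> ?H0" "X = q x" using X by blast
    then have xP: "x \<in> P" by (simp add: pre.graded_sum_iff pre_simps)
    have xG: "x \<in> graded_sum g G {0..}"
      using x(1) by (simp add: pre.graded_sum_iff pre_component[OF xP] pre_simps p.g.graded_sum_iff P_closed)
    have "x \<otimes>\<^bsub>g\<^esub> v = \<zero>\<^bsub>g\<^esub>" if v: "v \<in> G (-1)" for v
    proof -
      have vP: "v \<in> P" using v H_P[of v "-1"] by (simp add: H_neg)
      have "q v \<in> a_deg g G (-1)" using v by (simp add: a_deg_eq H_neg)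
      then have "q (x \<otimes>\<^bsub>g\<^esub> v) = \<zero>\<^bsub>\<aa>\<^esub>" using 0 x(2) xP vP by (simp add: q_mult)
      then have "x \<otimes>\<^bsub>g\<^esub> v \<in> ng" using q_zero_iff[OF P_bracket[OF xP vP]] by simp
      then have c: "x \<otimes>\<^bsub>g\<^esub> v \<in> carrier g" "\<And>r. r \<notin> {..-2} \<Longrightarrow> p.g.component r (x \<otimes>\<^bsub>g\<^esub> v) = \<zero>\<^bsub>g\<^esub>"
        by (auto simp: n_part_def p.g.graded_sum_iff)
      have d: "r \<notin> {-1..} \<Longrightarrow> p.g.component r (x \<otimes>\<^bsub>g\<^esub> v) = \<zero>\<^bsub>g\<^esub>" for r
        using bracket_degree_shift[OF xG v] by (simp add: p.g.graded_sum_iff)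
      show ?thesis
      proof (rule p.g.eq_zero_if_components[OF c(1)])
        fix r :: int
        show "p.g.component r (x \<otimes>\<^bsub>g\<^esub> v) = \<zero>\<^bsub>g\<^esub>" by (cases "r \<le> -2") (use c(2) d in auto)
      qed
    qed
    then have "x = \<zero>\<^bsub>g\<^esub>" using p.effectivity_sum[OF xG] by blast
    then show ?thesis using x(2) q.map_zero by (simp add: pre_simps)
  qed
  have "\<zero>\<^bsub>\<aa>\<^esub> \<in> graded_sum \<aa> (a_deg g G) {0..}" by (simp add: \<aa>.graded_sum_iff)
  moreover have "\<zero>\<^bsub>\<aa>\<^esub> \<otimes>\<^bsub>\<aa>\<^esub> v = \<zero>\<^bsub>\<aa>\<^esub>" if "v \<in> a_deg g G (-1)" for v
    using lie_algebra.zero_bracket[OF q.lie_algebra_image \<aa>.G_closed[OF that]] .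
  ultimately show ?thesis
    unfolding effective_prolongation_def using fgla_m' graded_\<aa> hom inj image eff by blast
qed

lemma a0_closed: "\<lbrakk>A \<in> a0 K V \<K> \<L>; v \<in> carrier V\<rbrakk> \<Longrightarrow> A v \<in> carrier V"
  using \<L>_closed by (simp add: a0_def)

lemma type_\<aa>: "prolongation_of_type (transport_gl V e' (a0 K V \<K> \<L>)) M' \<aa> (a_deg g G) incl"
  unfolding ab.type_iff
proof
  fix X assume "X \<in> a_deg g G 0"
  then obtain \<xi> where \<xi>: "\<xi> \<in> H 0" "X = q \<xi>" by (auto simp: a_deg_eq)
  obtain A where A: "A \<in> a0 K V \<K> \<L>" "\<forall>v\<in>carrier V. \<xi> \<otimes>\<^bsub>g\<^esub> \<iota> (e v) = \<iota> (e (A v))"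
    using type_a0[OF \<xi>(1)] by blast
  have "X \<otimes>\<^bsub>\<aa>\<^esub> incl (e' v) = incl (e' (A v))" if v: "v \<in> carrier V" for v
  proof -
    have "X \<otimes>\<^bsub>\<aa>\<^esub> incl (e' v) = q (\<xi> \<otimes>\<^bsub>g\<^esub> \<iota> (e v))"
      using v \<xi> H_P by (simp add: incl_e' q_mult \<iota>e_P)
    then show ?thesis using v A a0_closed by (simp add: incl_e')
  qed
  then show "\<exists>A\<in>a0 K V \<K> \<L>. \<forall>v\<in>carrier V. X \<otimes>\<^bsub>\<aa>\<^esub> incl (e' v) = incl (e' (A v))"
    using A(1) by blast
qed

lemma abelian_extensionI:
  assumes eff: "effective_prolongation K m' M' h Hh \<kappa>"
    and ty: "prolongation_of_type (transport_gl V e' (a0 K V \<K> \<L>)) M' h Hh \<kappa>"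
  shows "abelian_extension K V m M h Hh e (\<lambda>v. \<kappa> (e' v)) (a0 K V \<K> \<L>)"
proof -
  interpret h: effective K m' M' h Hh \<kappa> by (rule effective.intro[OF eff])
  have im: "\<kappa> ` M' r = Hh r" if "r < 0" for r by (rule h.image[OF that])
  have onto: "(\<lambda>v. \<kappa> (e' v)) ` carrier V = Hh (-1)"
  proof -
    have "\<kappa> ` e' ` carrier V = Hh (-1)" unfolding e'_surj M'_minus_one[symmetric] by (rule im) simp
    then show ?thesis by (simp add: image_image)
  qed
  show ?thesis
  proof (intro abelian_extension.intro abelian_extension_axioms.intro, goal_cases)
    case 1 show ?case by (rule vectorspace_axioms)
  next
    case 2 show ?case by (rule p.m.graded_lie_axioms)
  next
    case 3 show ?case by (rule h.g.graded_lie_axioms)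
  next
    case 4 show ?case by (rule p.fgla_m)
  next
    case 5 show ?case by (rule e_hom)
  next
    case 6 show ?case by (rule e_inj)
  next
    case 7 show ?case by (rule e_onto)
  next
    case 8 show ?case
      by (auto simp: module_hom_def ab.e.T_add ab.e.T_smult h.\<iota>.T_add h.\<iota>.T_smult h.\<iota>.T_im)
  next
    case 9 show ?case
      by (rule inj_onI) (metis inj_onD[OF h.inj] inj_onD[OF ab.e_inj] ab.e.T_im)
  next
    case 10 show ?case by (rule onto)
  next
    case (11 v w)
    then have "\<kappa> (e' v) \<otimes>\<^bsub>h\<^esub> \<kappa> (e' w) = \<kappa> (e' v \<otimes>\<^bsub>m'\<^esub> e' w)" by (simp add: h.\<iota>_bracket)
    then show ?case using 11 m'_abelian[of "e' v" "e' w"] h.\<iota>.T0_is_0 by simp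
  next
    case (12 r) then show ?case using im[of r] M'_other[of r] h.\<iota>.T0_is_0 by simp
  next
    case (13 x) then show ?case using h.effectivity_sum by blast
  next
    case (14 X) then show ?case using ty unfolding ab.type_iff by blast
  next
    case (15 A v) then show ?case by (rule a0_closed)
  next
    case (16 A v w) then show ?case by (simp add: a0_iff)
  next
    case (17 A v y) then show ?case by (simp add: a0_iff)
  qed
qed

text \<open>\<open>h\<close> is placed in \<open>ext\<close>, \<open>ext\<close> embeds into
  \<open>g\<close> by maximality, and the result is projected to the quotient. The map \<theta> from
  \<open>h\<close> to \<open>g\<close> need not be a homomorphism, since the bracket of
  \<open>ext\<close> contributes an element of the lower part; the projection kills it.\<close>

lemma embeds_into_\<aa>:
  fixes h :: "('k, 'h) module"
  assumes max: "maximal_effective_prolongation TYPE(nat \<Rightarrow> 'k) K m M (transport_gl V e \<L>) g G \<iota>"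
    and eff: "effective_prolongation K m' M' h Hh \<kappa>"
    and ty: "prolongation_of_type (transport_gl V e' (a0 K V \<K> \<L>)) M' h Hh \<kappa>"
  shows "\<exists>\<psi>\<in>lie_hom K h \<aa>. inj_on \<psi> (carrier h) \<and> (\<forall>p. \<psi> ` Hh p \<subseteq> a_deg g G p) \<and>
    (\<forall>X\<in>carrier m'. \<psi> (\<kappa> X) = incl X)"
proof -
  interpret x: abelian_extension K V m M h Hh e "\<lambda>v. \<kappa> (e' v)" "a0 K V \<K> \<L>"
    by (rule abelian_extensionI[OF eff ty])
  have tyx: "prolongation_of_type (transport_gl V e \<L>) M x.ext x.ext_deg x.ext_incl"
    unfolding type_iff using x.ext_type a0_subset by blast
  obtain \<phi> where \<phi>: "\<phi> \<in> lie_hom K x.ext g" "inj_on \<phi> (carrier x.ext)" "\<And>p. \<phi> ` x.ext_deg p \<subseteq> G p"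
    "\<And>u. u \<in> carrier m \<Longrightarrow> \<phi> (x.ext_incl u) = \<iota> u"
    using maximal_embedding[OF max x.effective_ext tyx seq_embeddable_quotient[OF V_fin_dim]] by blast
  interpret \<phi>: linear_map K x.ext g \<phi>
    by (rule lie_hom_linear_map[OF x.lie_algebra_ext p.g.lie_algebra_axioms \<phi>(1)])
  have 0: "\<zero>\<^bsub>m\<^esub> \<in> n" by (rule \<pi>.N.subspace_zero[OF p.m.subspace_graded_sum])
  have c: "(\<zero>\<^bsub>m\<^esub>, x) \<in> carrier x.ext" if "x \<in> carrier h" for x using that 0 by (simp add: x.ext_simps)
  have cn: "(y, \<zero>\<^bsub>h\<^esub>) \<in> carrier x.ext" if "y \<in> n" for y using that by (simp add: x.ext_simps)
  have \<phi>n: "\<phi> (y, \<zero>\<^bsub>h\<^esub>) = \<iota> y" if "y \<in> n" for y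
    using \<phi>(4)[OF n_closed[OF that]] x.ext_incl_n[OF that] by simp
  have \<phi>br: "\<phi> A \<otimes>\<^bsub>g\<^esub> \<phi> B = \<phi> (A \<otimes>\<^bsub>x.ext\<^esub> B)" if "A \<in> carrier x.ext" "B \<in> carrier x.ext" for A B
    using lie_hom_bracket[OF \<phi>(1) that] by simp
  define \<theta> where "\<theta> x = \<phi> (\<zero>\<^bsub>m\<^esub>, x)" for x
  have \<theta>_add: "\<theta> (x \<oplus>\<^bsub>h\<^esub> y) = \<theta> x \<oplus>\<^bsub>g\<^esub> \<theta> y" if "x \<in> carrier h" "y \<in> carrier h" for x y
    using \<phi>.T_add[OF c[OF that(1)] c[OF that(2)]] by (simp add: \<theta>_def x.ext_simps)
  have \<theta>_smult: "\<theta> (a \<odot>\<^bsub>h\<^esub> x) = a \<odot>\<^bsub>g\<^esub> \<theta> x" if "a \<in> carrier K" "x \<in> carrier h" for a x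
    using \<phi>.T_smult[OF that(1) c[OF that(2)]] that by (simp add: \<theta>_def x.ext_simps)
  have \<theta>_H: "\<theta> x \<in> H r" if x: "x \<in> Hh r" for x r
  proof -
    have xc: "x \<in> carrier h" by (rule x.h.G_closed[OF x])
    have "(\<zero>\<^bsub>m\<^esub>, x) \<in> x.ext_deg r" using x by (simp add: x.ext_deg_iff)
    then have xG: "\<theta> x \<in> G r" using \<phi>(3) by (auto simp: \<theta>_def)
    show ?thesis
    proof (cases "r < 0")
      case True then show ?thesis using xG by (simp add: H_neg)
    next
      case False
      have "\<theta> x \<otimes>\<^bsub>g\<^esub> z = \<zero>\<^bsub>g\<^esub>" if z: "z \<in> ng" for z
      proof -
        have "z \<in> \<iota> ` n" using z \<iota>_n by simp
        then obtain y where y: "y \<in> n" "z = \<iota> y" by (rule imageE)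
        have "\<theta> x \<otimes>\<^bsub>g\<^esub> z = \<phi> ((\<zero>\<^bsub>m\<^esub>, x) \<otimes>\<^bsub>x.ext\<^esub> (y, \<zero>\<^bsub>h\<^esub>))"
          using \<phi>br[OF c[OF xc] cn[OF y(1)]] y \<phi>n by (simp add: \<theta>_def)
        also have "(\<zero>\<^bsub>m\<^esub>, x) \<otimes>\<^bsub>x.ext\<^esub> (y, \<zero>\<^bsub>h\<^esub>) = \<zero>\<^bsub>x.ext\<^esub>"
          using False x.\<alpha>_other[OF x] n_closed[OF y(1)] xc by (simp add: x.ext_simps)
        finally show ?thesis by simp
      qed
      then show ?thesis using xG False by (simp add: H_nonneg)
    qed
  qed
  have \<theta>_P: "\<theta> x \<in> P" if "x \<in> carrier h" for x
    using that
  proof (induction rule: x.h.graded_induct)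
    case (homogeneous r x) then show ?case using \<theta>_H H_P by blast
  next
    case (add x y) then show ?case by (simp add: \<theta>_add p.g.subspace_add[OF P_subspace])
  qed
  define \<psi> where "\<psi> x = q (\<theta> x)" for x
  have \<psi>_mult: "\<psi> (x \<otimes>\<^bsub>h\<^esub> y) = \<psi> x \<otimes>\<^bsub>\<aa>\<^esub> \<psi> y" if xy: "x \<in> carrier h" "y \<in> carrier h" for x y
  proof -
    \<comment> \<open>The first component of the bracket of (0, x) and (0, y) in \<open>ext\<close>:
      the defect of \<theta> as a homomorphism.\<close>
    let ?z = "x.\<alpha> x \<otimes>\<^bsub>m\<^esub> x.\<alpha> y"
    have z: "?z \<in> n" using xy by (intro bracket_n) simp_all
    have hc: "x \<otimes>\<^bsub>h\<^esub> y \<in> carrier h" by (rule x.h.bracket_closed[OF xy])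
    have "\<theta> x \<otimes>\<^bsub>g\<^esub> \<theta> y = \<phi> ((?z, \<zero>\<^bsub>h\<^esub>) \<oplus>\<^bsub>x.ext\<^esub> (\<zero>\<^bsub>m\<^esub>, x \<otimes>\<^bsub>h\<^esub> y))"
      using \<phi>br[OF c[OF xy(1)] c[OF xy(2)]] xy z hc n_closed[OF z] by (simp add: \<theta>_def x.ext_simps)
    also have "\<dots> = \<iota> ?z \<oplus>\<^bsub>g\<^esub> \<theta> (x \<otimes>\<^bsub>h\<^esub> y)"
      using \<phi>.T_add[OF cn[OF z] c[OF hc]] \<phi>n[OF z] by (simp add: \<theta>_def)
    finally have eq: "\<theta> x \<otimes>\<^bsub>g\<^esub> \<theta> y = \<iota> ?z \<oplus>\<^bsub>g\<^esub> \<theta> (x \<otimes>\<^bsub>h\<^esub> y)" .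
    have \<iota>z: "\<iota> ?z \<in> ng" using z \<iota>_n by blast
    then have qz: "q (\<iota> ?z) = \<zero>\<^bsub>\<aa>\<^esub>" "\<iota> ?z \<in> P" using q_zero_iff ng_P by blast+
    have "\<psi> x \<otimes>\<^bsub>\<aa>\<^esub> \<psi> y = q (\<theta> x \<otimes>\<^bsub>g\<^esub> \<theta> y)"
      unfolding \<psi>_def by (rule q_mult[OF \<theta>_P[OF xy(1)] \<theta>_P[OF xy(2)], symmetric])
    also have "\<dots> = q (\<iota> ?z) \<oplus>\<^bsub>\<aa>\<^esub> q (\<theta> (x \<otimes>\<^bsub>h\<^esub> y))" unfolding eq by (rule q_add[OF qz(2) \<theta>_P[OF hc]])
    also have "\<dots> = \<psi> (x \<otimes>\<^bsub>h\<^esub> y)"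
      using qz(1) q_closed[OF \<theta>_P[OF hc]] q.N.M.l_zero by (simp add: \<psi>_def)
    finally show ?thesis by simp
  qed
  have hom: "\<psi> \<in> lie_hom K h \<aa>"
    unfolding lie_hom_def module_hom_def
    using \<psi>_mult \<theta>_P by (auto simp: \<psi>_def q_closed \<theta>_add \<theta>_smult q_add q_smult)
  have inj: "inj_on \<psi> (carrier h)"
  proof -
    interpret \<psi>: linear_map K h \<aa> \<psi>
      by (rule lie_hom_linear_map[OF x.h.lie_algebra_axioms q.lie_algebra_image hom])
    show ?thesis unfolding \<psi>.inj_on_iff
    proof (intro ballI impI)
      fix x assume x: "x \<in> carrier h" "\<psi> x = \<zero>\<^bsub>\<aa>\<^esub>"
      then have "\<theta> x \<in> ng" using q_zero_iff[OF \<theta>_P] by (simp add: \<psi>_def)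
      \<comment> \<open>Elements of the lower part of \<open>g\<close> are themselves values of
        \<phi>, at pairs (y, 0), so injectivity of \<phi> compares (0, x) with (y, 0).\<close>
      then obtain y where y: "y \<in> n" "\<theta> x = \<iota> y" using \<iota>_n by blast
      then have "\<phi> (\<zero>\<^bsub>m\<^esub>, x) = \<phi> (y, \<zero>\<^bsub>h\<^esub>)" using \<phi>n by (simp add: \<theta>_def)
      then have "(\<zero>\<^bsub>m\<^esub>, x) = (y, \<zero>\<^bsub>h\<^esub>)" by (rule inj_onD[OF \<phi>(2) _ c[OF x(1)] cn[OF y(1)]])
      then show "x = \<zero>\<^bsub>h\<^esub>" by simp
    qed
  qed
  have "\<psi> ` Hh r \<subseteq> a_deg g G r" for r using \<theta>_H by (auto simp: \<psi>_def a_deg_eq)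
  moreover have "\<psi> (\<kappa> X) = incl X" if X: "X \<in> carrier m'" for X
  proof -
    obtain v where v: "v \<in> carrier V" "X = e' v" by (rule m'_cases[OF X])
    have "\<theta> (\<kappa> (e' v)) = \<iota> (e v)"
      using \<phi>(4)[OF e.T_im[OF v(1)]] x.ext_incl_e[OF v(1)] by (simp add: \<theta>_def)
    then show ?thesis using v by (simp add: \<psi>_def incl_e')
  qed
  ultimately show ?thesis using hom inj by blast
qed

end

section \<open>Finiteness criteria and the equivalence\<close>

section \<open>Finite dimensionality\<close>

lemma (in linear_map) fin_dim_if_injective:
  assumes inj: "inj_on T (carrier V)" and W: "W.fin_dim" shows "V.fin_dim"
proof -
  have "W.separated (carrier W)" using W W.fin_dim_iff_separated by simp
  then obtain \<Phi> where \<Phi>: "finite \<Phi>" "\<forall>\<phi>\<in>\<Phi>. W.functional \<phi>"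
    "\<forall>x\<in>carrier W. (\<forall>\<phi>\<in>\<Phi>. \<phi> x = \<zero>\<^bsub>K\<^esub>) \<longrightarrow> x = \<zero>\<^bsub>W\<^esub>"
    unfolding W.separated_def by auto
  have "V.separated (carrier V)" unfolding V.separated_def
  proof (intro exI conjI)
    show "finite ((\<lambda>\<phi> x. \<phi> (T x)) ` \<Phi>)" using \<Phi>(1) by simp
    show "\<forall>\<psi>\<in>(\<lambda>\<phi> x. \<phi> (T x)) ` \<Phi>. V.functional \<psi>"
      using \<Phi>(2) by (auto simp: V.functional_def W.functional_def)
    show "\<forall>x\<in>carrier V. (\<forall>\<psi>\<in>(\<lambda>\<phi> x. \<phi> (T x)) ` \<Phi>. \<psi> x = \<zero>\<^bsub>K\<^esub>) \<longrightarrow> x = \<zero>\<^bsub>V\<^esub>"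
      using \<Phi>(3) iffD1[OF inj_on_iff inj] by simp
  qed
  then show ?thesis using V.fin_dim_iff_separated by simp
qed

context effective
begin

text \<open>In negative degrees functionals are taken over from \<open>m\<close>; effectivity
  carries finiteness up to the other degrees.\<close>

lemma separated_degree:
  assumes "vectorspace.fin_dim K m" shows "g.separated (G p)"
proof -
  have neg: "g.separated (G p)" if p: "p < 0" for p
  proof -
    have "m.separated (carrier m)" using assms m.fin_dim_iff_separated by simp
    then obtain \<Phi> where \<Phi>: "finite \<Phi>" "\<forall>\<phi>\<in>\<Phi>. m.functional \<phi>"
      "\<forall>x\<in>carrier m. (\<forall>\<phi>\<in>\<Phi>. \<phi> x = \<zero>\<^bsub>K\<^esub>) \<longrightarrow> x = \<zero>\<^bsub>m\<^esub>"
      unfolding m.separated_def by auto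
    \<comment> \<open>A linear map from \<open>g\<close> to \<open>m\<close> that inverts \<iota> on
      degree p, so that functionals of \<open>m\<close> can be evaluated on all of
      \<open>g\<close>.\<close>
    define s where "s x = inv_into (carrier m) \<iota> (g.component p x)" for x
    have "g.component p x \<in> \<iota> ` carrier m" if "x \<in> carrier g" for x
      using g.component_in[OF that, of p] image[OF p] m.G_closed by blast
    then have s: "s x \<in> carrier m" "\<iota> (s x) = g.component p x" if "x \<in> carrier g" for x
      using that inv_into_into f_inv_into_f unfolding s_def by metis+
    have sI: "s x = u" if "u \<in> carrier m" "\<iota> u = g.component p x" "x \<in> carrier g" for x u
      using that s inj_onD[OF inj] by metis
    have add: "s (x \<oplus>\<^bsub>g\<^esub> y) = s x \<oplus>\<^bsub>m\<^esub> s y" if "x \<in> carrier g" "y \<in> carrier g" for x y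
      by (rule sI) (use that s in \<open>simp_all add: g.component_add\<close>)
    have smult: "s (c \<odot>\<^bsub>g\<^esub> x) = c \<odot>\<^bsub>m\<^esub> s x" if "c \<in> carrier K" "x \<in> carrier g" for c x
      by (rule sI) (use that s in \<open>simp_all add: g.component_smult\<close>)
    show ?thesis unfolding g.separated_def
    proof (intro exI conjI)
      show "finite ((\<lambda>\<phi> x. \<phi> (s x)) ` \<Phi>)" using \<Phi>(1) by simp
      show "\<forall>\<psi>\<in>(\<lambda>\<phi> x. \<phi> (s x)) ` \<Phi>. g.functional \<psi>"
        using \<Phi>(2) s(1) by (auto simp: m.functional_def g.functional_def add smult)
      show "\<forall>x\<in>G p. (\<forall>\<psi>\<in>(\<lambda>\<phi> x. \<phi> (s x)) ` \<Phi>. \<psi> x = \<zero>\<^bsub>K\<^esub>) \<longrightarrow> x = \<zero>\<^bsub>g\<^esub>"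
      proof (intro ballI impI)
        fix x assume x: "x \<in> G p" "\<forall>\<psi>\<in>(\<lambda>\<phi> x. \<phi> (s x)) ` \<Phi>. \<psi> x = \<zero>\<^bsub>K\<^esub>"
        have "\<forall>\<phi>\<in>\<Phi>. \<phi> (s x) = \<zero>\<^bsub>K\<^esub>" using x(2) by simp
        then have "s x = \<zero>\<^bsub>m\<^esub>" using \<Phi>(3) s(1)[OF g.G_closed[OF x(1)]] by simp
        then show "x = \<zero>\<^bsub>g\<^esub>" using s(2)[OF g.G_closed[OF x(1)]] g.component_same[OF x(1)] \<iota>.T0_is_0 by simp
      qed
    qed
  qed
  obtain B where B: "finite B" "B \<subseteq> M (-1)" "M (-1) \<subseteq> m.span B" by (rule finite_spanning)
  show ?thesis
  proof (cases "p < 0")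
    case False
    show ?thesis
      by (rule g.separated_effective[OF neg _ finite_spanning_image[OF B(2,3)]])
        (use B(1) effectivity False in auto)
  qed (rule neg)
qed

text \<open>Nested brackets of n + 1 factors have degree - n - 1, so those with n < nat \<mu>
  exhaust the degrees from -1 down to - \<mu>.\<close>

lemma fin_dim_of_bounded:
  assumes bot: "\<And>p. p < - \<mu> \<Longrightarrow> M p = {\<zero>\<^bsub>m\<^esub>}" shows "vectorspace.fin_dim K m"
proof -
  obtain B where B: "finite B" "B \<subseteq> M (-1)" "M (-1) \<subseteq> m.span B" by (rule finite_spanning)
  let ?U = "\<Union>n<nat \<mu>. m.brackets B n"
  have Uc: "?U \<subseteq> carrier m" using m.brackets_degree[OF B(2)] m.G_closed by blast
  have U: "subspace K (m.span ?U) m" by (rule m.span_is_subspace[OF Uc])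
  have "x \<in> m.span ?U" if "x \<in> carrier m" for x
    using that
  proof (induction rule: m.graded_induct)
    case (homogeneous p x)
    show ?case
    proof (cases "p \<ge> 0 \<or> p < - \<mu>")
      case True
      then have "x = \<zero>\<^bsub>m\<^esub>" using homogeneous bot M_nonneg by blast
      then show ?thesis using m.subspace_zero[OF U] by simp
    next
      case False
      define n where "n = nat (- p - 1)"
      have n: "n < nat \<mu>" "p = - int n - 1" using False by (auto simp: n_def)
      have "x \<in> m.span (m.brackets B n)"
        using m.generated_component_span[OF B generated] homogeneous n(2) by blast
      moreover have "m.span (m.brackets B n) \<subseteq> m.span ?U"
        by (rule m.span_is_monotone) (use n(1) in blast)
      ultimately show ?thesis by blast
    qed
  next
    case (add x y) then show ?case by (simp add: m.subspace_add[OF U])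
  qed
  then have "m.span ?U = carrier m" using m.subspace_carrier[OF U] by blast
  moreover have "finite ?U" using m.brackets_finite[OF B(1)] by blast
  ultimately show ?thesis unfolding m.fin_dim_def using Uc by blast
qed

end

context quotient_prolongation
begin

text \<open>The lower part meets the degrees \<ge> 0 only in zero, so the projection loses nothing
  there.\<close>

lemma a_deg_zero_iff: "r \<ge> 0 \<Longrightarrow> a_deg g G r = {\<zero>\<^bsub>\<aa>\<^esub>} \<longleftrightarrow> H r = {\<zero>\<^bsub>g\<^esub>}"
proof
  assume r: "r \<ge> 0" and a: "a_deg g G r = {\<zero>\<^bsub>\<aa>\<^esub>}"
  have "x = \<zero>\<^bsub>g\<^esub>" if x: "x \<in> H r" for x
  proof -
    have "q x = \<zero>\<^bsub>\<aa>\<^esub>" using a x by (auto simp: a_deg_eq)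
    then have "x \<in> ng" using q_zero_iff[OF H_P[OF x]] by simp
    then show ?thesis using ng_G_zero[OF _ H_G[OF x]] r by simp
  qed
  then show "H r = {\<zero>\<^bsub>g\<^esub>}" using p.g.subspace_zero[OF H_subspace] by blast
next
  assume "H r = {\<zero>\<^bsub>g\<^esub>}"
  moreover have "q \<zero>\<^bsub>g\<^esub> = \<zero>\<^bsub>\<aa>\<^esub>"
    using q_zero_iff[of "\<zero>\<^bsub>g\<^esub>"] p.g.subspace_zero[OF P_subspace] p.g.subspace_zero[OF ng_subspace] by simp
  ultimately show "a_deg g G r = {\<zero>\<^bsub>\<aa>\<^esub>}" by (simp add: a_deg_eq)
qed

text \<open>Every single degree is finite dimensional on both sides, so only the set of nonzero
  degrees matters. One direction is the inclusion of a_p in g_p. For the other, a_p with p \<ge> 0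
  is the first of the annihilators, and its vanishing in large degrees starts the induction of
  \<open>vanishing_of_abelian_part\<close>.\<close>

lemma fin_dim_\<aa>_iff:
  assumes ch: "char_zero K" and bot: "\<And>r. r < - \<mu> \<Longrightarrow> M r = {\<zero>\<^bsub>m\<^esub>}"
  shows "vectorspace.fin_dim K g \<longleftrightarrow> vectorspace.fin_dim K \<aa>"
proof -
  interpret a: effective K m' M' \<aa> "a_deg g G" incl by (rule effective.intro[OF effective_\<aa>])
  have "vectorspace.fin_dim K m" by (rule p.fin_dim_of_bounded[OF bot])
  then have sep: "p.g.separated (G r)" for r by (rule p.separated_degree)
  have "vectorspace.fin_dim K m'" by (rule ab.e.surj_fin_dim[OF V_fin_dim e'_surj])
  then have sepa: "a.g.separated (a_deg g G r)" for r by (rule a.separated_degree)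
  have Gbot: "G r = {\<zero>\<^bsub>g\<^esub>}" if "r < - \<mu>" "r < 0" for r
    using p.image[OF that(2)] bot[OF that(1)] p.\<iota>.T0_is_0 by simp
  have abot: "a_deg g G r = {\<zero>\<^bsub>\<aa>\<^esub>}" if "r \<le> -2" for r
    using a.image[of r] M'_other[of r] a.\<iota>.T0_is_0 that by simp
  show ?thesis unfolding p.g.fin_dim_iff a.g.fin_dim_iff
  proof (intro iffI conjI allI)
    show "a.g.separated (a_deg g G r)" "p.g.separated (G r)" for r by (rule sepa, rule sep)
  next
    assume *: "(\<forall>r. p.g.separated (G r)) \<and> finite {r. G r \<noteq> {\<zero>\<^bsub>g\<^esub>}}"
    have "{r. a_deg g G r \<noteq> {\<zero>\<^bsub>\<aa>\<^esub>}} \<subseteq> insert (-1) {r. G r \<noteq> {\<zero>\<^bsub>g\<^esub>}}"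
    proof
      fix r assume r: "r \<in> {r. a_deg g G r \<noteq> {\<zero>\<^bsub>\<aa>\<^esub>}}"
      then have "r \<ge> -1" using abot[of r] by force
      show "r \<in> insert (-1) {r. G r \<noteq> {\<zero>\<^bsub>g\<^esub>}}"
      proof (cases "r = -1")
        case False
        then have "r \<ge> 0" using \<open>r \<ge> -1\<close> by simp
        then have "H r \<noteq> {\<zero>\<^bsub>g\<^esub>}" using a_deg_zero_iff r by simp
        then have "G r \<noteq> {\<zero>\<^bsub>g\<^esub>}" using H_G p.g.subspace_zero[OF H_subspace] by blast
        then show ?thesis by simp
      qed simp
    qed
    then show "finite {r. a_deg g G r \<noteq> {\<zero>\<^bsub>\<aa>\<^esub>}}" using * finite_subset by blast
  next
    assume *: "(\<forall>r. a.g.separated (a_deg g G r)) \<and> finite {r. a_deg g G r \<noteq> {\<zero>\<^bsub>\<aa>\<^esub>}}"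
    then obtain N where bd: "\<forall>r\<in>{r. a_deg g G r \<noteq> {\<zero>\<^bsub>\<aa>\<^esub>}}. r \<le> N"
      using bdd_above_finite unfolding bdd_above_def by blast
    have N: "a_deg g G r = {\<zero>\<^bsub>\<aa>\<^esub>}" if "r > N" for r
    proof (rule ccontr)
      assume "a_deg g G r \<noteq> {\<zero>\<^bsub>\<aa>\<^esub>}"
      then have "r \<le> N" using bspec[OF bd, of r] by simp
      then show False using \<open>r > N\<close> by simp
    qed
    have ann: "p.g.annihilator 1 {} r = H r" if "r \<ge> 0" for r
    proof -
      have sum: "(\<forall>y\<in>ng. x \<otimes>\<^bsub>g\<^esub> y = \<zero>\<^bsub>g\<^esub>) \<longleftrightarrow> (\<forall>s\<le>-2. \<forall>y\<in>G s. x \<otimes>\<^bsub>g\<^esub> y = \<zero>\<^bsub>g\<^esub>)" if x: "x \<in> G r" for x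
      proof
        assume "\<forall>y\<in>ng. x \<otimes>\<^bsub>g\<^esub> y = \<zero>\<^bsub>g\<^esub>"
        then show "\<forall>s\<le>-2. \<forall>y\<in>G s. x \<otimes>\<^bsub>g\<^esub> y = \<zero>\<^bsub>g\<^esub>"
          using p.g.G_subset_graded_sum[of _ "{..-2}"] by (auto simp: n_part_def)
      next
        assume *: "\<forall>s\<le>-2. \<forall>y\<in>G s. x \<otimes>\<^bsub>g\<^esub> y = \<zero>\<^bsub>g\<^esub>"
        have "ng \<subseteq> {y \<in> carrier g. x \<otimes>\<^bsub>g\<^esub> y = \<zero>\<^bsub>g\<^esub>}" unfolding n_part_def
          by (rule p.g.graded_sum_subset[OF p.g.annihilator_subspace[OF p.g.G_closed[OF x]]])
            (use * p.g.G_closed in auto)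
        then show "\<forall>y\<in>ng. x \<otimes>\<^bsub>g\<^esub> y = \<zero>\<^bsub>g\<^esub>" by blast
      qed
      then show ?thesis using that by (auto simp: p.g.annihilator_def H_nonneg)
    qed
    have base: "\<exists>N. \<forall>r\<ge>N. p.g.annihilator 1 {} r = {\<zero>\<^bsub>g\<^esub>}"
    proof (intro exI allI impI)
      fix r assume r: "r \<ge> max (N + 1) 0"
      then have "a_deg g G r = {\<zero>\<^bsub>\<aa>\<^esub>}" by (intro N) simp
      then show "p.g.annihilator 1 {} r = {\<zero>\<^bsub>g\<^esub>}" using r ann a_deg_zero_iff by simp
    qed
    obtain B where B: "finite B" "B \<subseteq> M (-1)" "M (-1) \<subseteq> \<pi>.N.span B" by (rule p.finite_spanning)
    \<comment> \<open>The spanning brackets are found in \<open>m\<close>, which degree -1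
      generates, and carried over by \<iota>. At index s the nested brackets have degree - s -
      1.\<close>
    have gen: "\<exists>C. finite C \<and> C \<subseteq> {v \<otimes>\<^bsub>g\<^esub> y | v y. v \<in> G (-1) \<and> y \<in> G (- int s)} \<and>
        G (- int s - 1) \<subseteq> p.g.span C" if s: "s \<ge> 1" for s
    proof -
      obtain k where k: "s = Suc k" using s by (cases s) auto
      let ?C = "p.m.brackets B s"
      have Cc: "?C \<subseteq> carrier m" using p.m.brackets_degree[OF B(2)] p.m.G_closed by blast
      have "G (- int s - 1) = \<iota> ` M (- int s - 1)" by (rule p.image[symmetric]) simp
      also have "\<dots> \<subseteq> \<iota> ` \<pi>.N.span ?C"
        by (rule image_mono) (rule p.m.generated_component_span[OF B p.generated])
      also have "\<dots> \<subseteq> p.g.span (\<iota> ` ?C)" by (rule p.\<iota>.image_span_subset[OF Cc])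
      finally have 1: "G (- int s - 1) \<subseteq> p.g.span (\<iota> ` ?C)" .
      have 2: "\<iota> ` ?C \<subseteq> {v \<otimes>\<^bsub>g\<^esub> y | v y. v \<in> G (-1) \<and> y \<in> G (- int s)}"
      proof
        fix z assume "z \<in> \<iota> ` ?C"
        then obtain v y where vy: "v \<in> B" "y \<in> p.m.brackets B k" "z = \<iota> (v \<otimes>\<^bsub>m\<^esub> y)" unfolding k by auto
        have v: "v \<in> M (-1)" using vy(1) B(2) by blast
        have "y \<in> M (- int k - 1)" using vy(2) p.m.brackets_degree[OF B(2)] by blast
        moreover have "- int k - 1 = - int s" by (simp add: k)
        ultimately have y: "y \<in> M (- int s)" by simp
        have "\<iota> v \<in> G (-1)" "\<iota> y \<in> G (- int s)" using v y p.image[of "-1"] p.image[of "- int s"] s by auto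
        moreover have "z = \<iota> v \<otimes>\<^bsub>g\<^esub> \<iota> y"
          unfolding vy(3) by (rule p.\<iota>_bracket) (use v y p.m.G_closed in auto)
        ultimately show "z \<in> {v \<otimes>\<^bsub>g\<^esub> y | v y. v \<in> G (-1) \<and> y \<in> G (- int s)}" by blast
      qed
      have "finite (\<iota> ` ?C)" by (rule finite_imageI[OF p.m.brackets_finite[OF B(1)]])
      then show ?thesis using 1 2 by blast
    qed
    \<comment> \<open>The maximum with 1 ensures that every degree below the bound is negative,
      where G is the image of M.\<close>
    have bot': "G r = {\<zero>\<^bsub>g\<^esub>}" if "r < - max \<mu> 1" for r by (rule Gbot) (use that in auto)
    obtain N' where N': "\<And>r. r \<ge> N' \<Longrightarrow> G r = {\<zero>\<^bsub>g\<^esub>}"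
      using p.g.vanishing_of_abelian_part[OF ch sep bot' gen base] by blast
    have "{r. G r \<noteq> {\<zero>\<^bsub>g\<^esub>}} \<subseteq> {- max \<mu> 1..N'}"
    proof
      fix r assume r: "r \<in> {r. G r \<noteq> {\<zero>\<^bsub>g\<^esub>}}"
      then have "\<not> r < - max \<mu> 1" "\<not> r \<ge> N'" using bot'[of r] N'[of r] by blast+
      then show "r \<in> {- max \<mu> 1..N'}" by simp
    qed
    then show "finite {r. G r \<noteq> {\<zero>\<^bsub>g\<^esub>}}" using finite_subset by blast
  qed
qed

text \<open>Each algebra embeds into the other by the maximality of the other, and two injective
  linear maps suffice to compare finite dimension.\<close>

lemma fin_dim_maximal_iff:
  fixes h :: "('k, 'h) module"
  assumes max: "maximal_effective_prolongation TYPE(nat \<Rightarrow> 'k) K m M (transport_gl V e \<L>) g G \<iota>"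
    and maxh: "maximal_effective_prolongation TYPE(nat \<Rightarrow> 'k) K m' M'
      (transport_gl V e' (a0 K V \<K> \<L>)) h Hh \<kappa>"
  shows "vectorspace.fin_dim K \<aa> \<longleftrightarrow> vectorspace.fin_dim K h"
proof -
  have eff: "effective_prolongation K m' M' h Hh \<kappa>"
    and ty: "prolongation_of_type (transport_gl V e' (a0 K V \<K> \<L>)) M' h Hh \<kappa>"
    using maxh by (auto simp: maximal_effective_prolongation_def)
  interpret a: effective K m' M' \<aa> "a_deg g G" incl by (rule effective.intro[OF effective_\<aa>])
  interpret h: effective K m' M' h Hh \<kappa> by (rule effective.intro[OF eff])
  note la = lie_surjection.lie_algebra_image[OF lie_surjection_q]
  obtain \<psi> where "\<psi> \<in> lie_hom K h \<aa>" and \<psi>: "inj_on \<psi> (carrier h)"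
    using embeds_into_\<aa>[OF max eff ty] by blast
  then interpret \<psi>: linear_map K h \<aa> \<psi> by (intro lie_hom_linear_map[OF h.g.lie_algebra_axioms la])
  obtain \<phi> where "\<phi> \<in> lie_hom K \<aa> h" and \<phi>: "inj_on \<phi> (carrier \<aa>)"
    by (rule maximal_embedding[OF maxh effective_\<aa> type_\<aa> ab.seq_embeddable_quotient[OF V_fin_dim]]) (rule that)
  then interpret \<phi>: linear_map K \<aa> h \<phi> by (intro lie_hom_linear_map[OF la h.g.lie_algebra_axioms])
  show ?thesis using \<psi>.fin_dim_if_injective[OF \<psi>] \<phi>.fin_dim_if_injective[OF \<phi>] by blast
qed

end

text \<open>The type variable 't is arbitrary, so maximality of a is established against
  prolongations with elements of any type. The quantifier over \<open>h\<close> makes the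
  equivalence independent of the representative of the maximal prolongation in (ii).\<close>

theorem theorem2p11:
  fixes K :: "('k, 'r) ring_scheme"
    and V :: "('k, 'v) module"
    and \<L> :: "('v \<Rightarrow> 'v) set"
    and \<K> :: "('k, 'v) lie_term set set"
    and \<mu> :: int
    and g :: "('k, 'g) module"
    and G :: "int \<Rightarrow> 'g set"
    and \<iota> :: "('k, 'v) lie_term set set \<Rightarrow> 'g"
  assumes "field K" and "char_zero K"
    and "vectorspace K V" and "vectorspace.fin_dim K V" and "vectorspace.dim K V \<ge> 2"
    and "lie_subalgebra K \<L> (gl K V)"
    and "graded_ideal K \<K> (free_lie K V) (free_lie_deg K V)"
    and "\<mu> \<ge> 1"
    and "free_lie_from K V (\<mu> + 1) \<subseteq> \<K>" and "\<K> \<subseteq> free_lie_from K V 2"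
    and "is_prolongation TYPE(nat \<Rightarrow> 'k) K V \<K> \<L> g G \<iota>"
  shows "linear_map K V (quot_lie K V (free_lie_from K V 2)) (quot_gen K V (free_lie_from K V 2)) \<and>
    bij_betw (quot_gen K V (free_lie_from K V 2))
      (carrier V) (carrier (quot_lie K V (free_lie_from K V 2))) \<and>
    abelian_lie (quot_lie K V (free_lie_from K V 2)) \<and>
    is_prolongation TYPE('t) K V (free_lie_from K V 2) (a0 K V \<K> \<L>)
      (a_lie g G) (a_deg g G) (a_incl K V \<K> g G \<iota>) \<and>
    (\<forall>(h :: ('k, 'h) module) H \<kappa>.
      is_prolongation TYPE(nat \<Rightarrow> 'k) K V (free_lie_from K V 2) (a0 K V \<K> \<L>) h H \<kappa> \<longrightarrow>
      (vectorspace.fin_dim K g \<longleftrightarrow> vectorspace.fin_dim K h))"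
proof -
  interpret V: vectorspace K V by fact
  interpret f: free_lie_on K V by (rule free_lie_on.intro) fact
  have ideal: "lie_ideal K \<K> (free_lie K V)" using assms by (simp add: graded_ideal_def)
  have max: "maximal_effective_prolongation TYPE(nat \<Rightarrow> 'k) K (quot_lie K V \<K>) (quot_lie_deg K V \<K>)
      (transport_gl V (quot_gen K V \<K>) \<L>) g G \<iota>"
    using assms by (simp add: is_prolongation_def)
  then have eff: "effective_prolongation K (quot_lie K V \<K>) (quot_lie_deg K V \<K>) g G \<iota>"
    and ty: "prolongation_of_type (transport_gl V (quot_gen K V \<K>) \<L>) (quot_lie_deg K V \<K>) g G \<iota>"
    by (auto simp: maximal_effective_prolongation_def)
  interpret k: free_lie_quotient K V \<K>
    by (intro free_lie_quotient.intro free_lie_quotient_axioms.intro f.free_lie_on_axioms ideal) fact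
  have \<L>: "\<L> \<subseteq> carrier (gl K V)"
    using assms by (auto simp: lie_subalgebra_def subspace_def submodule_def)
  interpret quotient_prolongation K V \<K> g G \<iota> \<L>
  proof (intro quotient_prolongation.intro quotient_prolongation_axioms.intro)
    show "free_lie_quotient K V \<K>" by (rule k.free_lie_quotient_axioms)
    show "free_lie_quotient K V (free_lie_from K V 2)"
      by (intro free_lie_quotient.intro free_lie_quotient_axioms.intro f.free_lie_on_axioms f.F2_ideal) simp
    show "effective K (quot_lie K V \<K>) (quot_lie_deg K V \<K>) g G \<iota>" by (rule effective.intro[OF eff])
    show "V.fin_dim" by fact
    show "A \<in> module_hom K V V" if "A \<in> \<L>" for A using \<L> that by (auto simp: gl_def)
    show "\<exists>A\<in>\<L>. \<forall>v\<in>carrier V. X \<otimes>\<^bsub>g\<^esub> \<iota> (quot_gen K V \<K> v) = \<iota> (quot_gen K V \<K> (A v))" if "X \<in> G 0" for X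
      using ty that unfolding k.type_iff by blast
  qed
  have bij: "bij_betw (quot_gen K V (free_lie_from K V 2)) (carrier V) (carrier (quot_lie K V (free_lie_from K V 2)))"
    using ab.e_inj e'_surj by (simp add: bij_betw_def)
  have prol: "is_prolongation TYPE('t) K V (free_lie_from K V 2) (a0 K V \<K> \<L>)
      (a_lie g G) (a_deg g G) (a_incl K V \<K> g G \<iota>)"
    unfolding is_prolongation_def maximal_effective_prolongation_def
    using effective_\<aa> type_\<aa> embeds_into_\<aa>[OF max] by blast
  have bot: "quot_lie_deg K V \<K> r = {\<zero>\<^bsub>quot_lie K V \<K>\<^esub>}" if "r < - \<mu>" for r
    by (rule k.M_below[OF _ that]) fact
  have "vectorspace.fin_dim K g \<longleftrightarrow> vectorspace.fin_dim K h"
    if "is_prolongation TYPE(nat \<Rightarrow> 'k) K V (free_lie_from K V 2) (a0 K V \<K> \<L>) h H \<kappa>"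
    for h :: "('k, 'h) module" and H \<kappa>
    using fin_dim_\<aa>_iff[OF \<open>char_zero K\<close> bot] fin_dim_maximal_iff[OF max that[unfolded is_prolongation_def]]
    by simp
  then show ?thesis using ab.e.linear_map_axioms bij m'_abelian prol by (auto simp: abelian_lie_def)
qed

end
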